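(* Let $G$ be a Carnot group of step $r$ with Carnot-Carathéodory metric $d_{cc}$ and a fixed system $\Delta$ of Christ cubes. Let $H$ be a Carnot group of step $s$ endowed with a homogeneous semimetric $d_H$ such that $|x_1-y_1|\le d_H(x,y)$ for all $x,y\in H$ and such that, for some $K>0$ and $p>1$, $$\frac{d_H(x,y)^p+d_H(y,z)^p}2\ge\left(\frac{d_H(x,z)}2\right)^p+\frac1K\left(\left|\frac{x_1+z_1}2-y_1\right|^p+NH(x^{-1}z)^p\right)\qquad\forall x,y,z\in H.$$ There exist constants $\alpha,\beta,\zeta>0$ depending only on $G$ and $H$ (with $d_H$) such that if $\epsilon\in(0,1/2)$, $m\in\mathbb N$, $\psi\ge0$, $h:G\to H$ is $\psi$-LLD, and $S\in\Delta$ satisfies $$\ell(S)\ge e^{\epsilon^{-\alpha}}\tau^{-m}\psi,$$ then $$\sum_{k=0}^m\ \sum_{\substack{Q\in\Delta_k(S)\\ cd_h^{C}(Q,\zeta\epsilon^\beta)>\epsilon\,\mathrm{Lip}_h(\psi)}}|Q|\ \le\ e^{\epsilon^{-\alpha}}|S|.$$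
   Context: A Carnot group of step $r$ is a simply connected Lie group $G$ whose Lie algebra is stratified nilpotent: $\mathfrak g=\bigoplus_{j=1}^r\mathcal V_j$ with $[\mathcal V_i,\mathcal V_j]\subset\mathcal V_{i+j}$, $\mathcal V_r\neq0$, and $\mathcal V_1$ (the horizontal layer, with an inner product) generating $\mathfrak g$. $d_{cc}$ is the infimum of lengths of curves tangent to the left-invariant subbundle generated by $\mathcal V_1$, measured with the left-invariant extension of the inner product. Carnot groups are identified with their Lie algebras via the exponential map; elements are written $g=(g_1,g_2,\dots)$ with $g_j\in\mathcal V_j$, each layer having a Euclidean norm $|\cdot|$, and dilations are $\delta_\lambda(g)=(\lambda g_1,\lambda^2g_2,\dots)$. $|\cdot|$ of a subset of $G$ denotes Lebesgue measure. A homogeneous norm is a continuous $N:H\to[0,\infty)$ with $N(g)=N(g^{-1})$, $N(\delta_\lambda(g))=\lambda N(g)$, $N(g)=0$ iff $g=0$; the associated homogeneous semimetric is $d_H(g,h)=N(g^{-1}h)$ (it satisfies the triangle inequality up to a multiplicative constant). $\tilde\pi(g)=(g_1,0,\dots,0)$ and $NH(g)=d_H(\tilde\pi(g),g)$. Christ cubes: $\Delta=\{Q_\omega^k\subset G:k\in\mathbb Z,\omega\in I_k\}$ with constants $a_0,a_1>0$, $\tau\in(0,1)$ such that (a) $|G\setminus\bigcup_\omega Q_\omega^k|=0$ for all $k$; (b) if $j\ge k$ then $Q_\alpha^j\subset Q_\omega^k$ or $Q_\alpha^j\cap Q_\omega^k=\emptyset$; (c) for each $(j,\alpha)$ and $k<j$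 there is a unique $\omega$ with $Q_\alpha^j\subset Q_\omega^k$; (d) $\mathrm{diam}(Q_\omega^k)\le a_1\tau^k$; (e) each $Q_\omega^k$ contains a ball $B_{cc}(z,a_0\tau^k)$. Such a system exists by a theorem of Christ and is fixed once and for all for $G$. Put $\ell(Q_\omega^k)=\tau^k$, $\Delta_k=\{Q_\omega^k:\omega\in I_k\}$, and for $S\in\Delta_j$, $\Delta_k(S)=\{Q\in\Delta_{j+k}:Q\subseteq S\}$. For $Q\in\Delta$, $B_Q$ is the ball of radius $a_0\ell(Q)$ from (e); $\eta B_Q$ is the concentric ball with radius multiplied by $\eta$. For $h:(G,d_{cc})\to(H,d_H)$ and $t\ge0$, $\mathrm{Lip}_h(t)=\sup_{d_{cc}(x,y)>t}\frac{d_H(h(x),h(y))}{d_{cc}(x,y)}$; $h$ is $\psi$-LLD ($\psi$-Lipschitz at large distances) if $\mathrm{Lip}_h(\psi)<\infty$ and $\sup_{d_{cc}(x,y)\le\psi}d_H(h(x),h(y))\le\mathrm{Lip}_h(\psi)\,\psi$. For $Q\in\Delta$, $\eta>0$, $$cd_h^{C}(Q,\eta)=\frac1{\eta a_0\ell(Q)}\inf_{T,g}\ \sup\{d_H(h(x),g\cdot T(x)):x\in\eta B_Q\},$$ the infimum being over all Lipschitz group homomorphisms $T:G\to H$ and all $g\in H$. *)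

theory Defs
  imports "HOL-Analysis.Analysis" "HOL-Algebra.Group"
begin

text \<open>
  A Carnot group is identified with its Lie algebra via the exponential map.  The carrier is thus a
  finite-dimensional real vector space, the group law is given by the Baker--Campbell--Hausdorff
  formula in Dynkin's form, and Lebesgue measure is that of the vector space.
\<close>

text \<open>Right-nested brackets \<open>[z\<^sub>1, [z\<^sub>2, \<dots> [z\<^sub>n\<^sub>-\<^sub>1, z\<^sub>n] \<dots>]]\<close>.\<close>

fun iterated_bracket :: "('a::real_vector \<Rightarrow> 'a \<Rightarrow> 'a) \<Rightarrow> 'a list \<Rightarrow> 'a" where
  "iterated_bracket br [] = 0"
| "iterated_bracket br [z] = z"
| "iterated_bracket br (z # w # ws) = br z (iterated_bracket br (w # ws))"

text \<open>
  A list \<open>[(p\<^sub>1, q\<^sub>1), \<dots>, (p\<^sub>n, q\<^sub>n)]\<close> encodes the word \<open>x\<^sup>p\<^sup>1 y\<^sup>q\<^sup>1 \<dots> x\<^sup>p\<^sup>n y\<^sup>q\<^sup>n\<close>.  Words of length greater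
  than the step have vanishing iterated bracket, so Dynkin's series is truncated there.
\<close>

definition dynkin_word :: "'a \<Rightarrow> 'a \<Rightarrow> (nat \<times> nat) list \<Rightarrow> 'a list" where
  "dynkin_word x y ps = concat (map (\<lambda>(p, q). replicate p x @ replicate q y) ps)"

definition dynkin_index :: "nat \<Rightarrow> (nat \<times> nat) list set" where
  "dynkin_index r =
     {ps. ps \<noteq> [] \<and> (\<forall>(p, q) \<in> set ps. p + q > 0) \<and> (\<Sum>(p, q)\<leftarrow>ps. p + q) \<le> r}"

definition dynkin_coeff :: "(nat \<times> nat) list \<Rightarrow> real" where
  "dynkin_coeff ps =
     (-1) ^ (length ps - 1) /
       (real (length ps) * real (\<Sum>(p, q)\<leftarrow>ps. p + q) * (\<Prod>(p, q)\<leftarrow>ps. fact p * fact q))"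

definition bch :: "nat \<Rightarrow> ('a::real_vector \<Rightarrow> 'a \<Rightarrow> 'a) \<Rightarrow> 'a \<Rightarrow> 'a \<Rightarrow> 'a" where
  "bch r br x y =
     (\<Sum>ps \<in> dynkin_index r. dynkin_coeff ps *\<^sub>R iterated_bracket br (dynkin_word x y ps))"

record 'a carnot = "'a monoid" +
  bracket :: "'a \<Rightarrow> 'a \<Rightarrow> 'a"
  layer :: "nat \<Rightarrow> 'a set"
  step :: nat

text \<open>
  The layers with index outside \<open>{1..step G}\<close> are \<open>{0}\<close>, so \<open>layer_bracket\<close> also says that brackets
  of total degree greater than the step vanish.  The Euclidean norm of each layer is the restriction
  of the norm of the ambient space; as the layers are independent, no choice of norms on the layers is
  excluded.  The bracket is that of the Lie algebra of the group because of \<open>mult_bch\<close>, which also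
  forces the unit to be \<open>0\<close> and the inverse of \<open>x\<close> to be \<open>-x\<close>.
\<close>

locale carnot_group = group G for G :: "'a::euclidean_space carnot" (structure) +
  assumes carrier_UNIV: "carrier G = UNIV"
    and bracket_bilinear: "bilinear (bracket G)"
    and bracket_alternating: "bracket G x x = 0"
    and bracket_jacobi:
      "bracket G x (bracket G y z) + bracket G y (bracket G z x) + bracket G z (bracket G x y) = 0"
    and layer_subspace: "subspace (layer G j)"
    and layer_outside: "j \<notin> {1..step G} \<Longrightarrow> layer G j = {0}"
    and layer_direct_sum:
      "\<exists>!f. (\<forall>j. f j \<in> layer G j) \<and> x = (\<Sum>j = 1..step G. f j)"
    and layer_bracket:
      "x \<in> layer G i \<Longrightarrow> y \<in> layer G j \<Longrightarrow> bracket G x y \<in> layer G (i + j)"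
    and layer_top: "layer G (step G) \<noteq> {0}"
    and layer_generating:
      "subspace W \<Longrightarrow> layer G 1 \<subseteq> W \<Longrightarrow> (\<And>u v. u \<in> W \<Longrightarrow> v \<in> W \<Longrightarrow> bracket G u v \<in> W) \<Longrightarrow> W = UNIV"
    and mult_bch: "x \<otimes> y = bch (step G) (bracket G) x y"

definition component :: "'a::euclidean_space carnot \<Rightarrow> nat \<Rightarrow> 'a \<Rightarrow> 'a" where
  "component G j x =
     (THE f. (\<forall>i. f i \<in> layer G i) \<and> x = (\<Sum>i = 1..step G. f i)) j"

definition dilation :: "'a::euclidean_space carnot \<Rightarrow> real \<Rightarrow> 'a \<Rightarrow> 'a" where
  "dilation G c x = (\<Sum>j = 1..step G. c ^ j *\<^sub>R component G j x)"

subsection \<open>Carnot-Carath\'eodory distance\<close>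

definition left_translation_deriv :: "'a::euclidean_space carnot \<Rightarrow> 'a \<Rightarrow> 'a \<Rightarrow> 'a \<Rightarrow> 'a" where
  "left_translation_deriv G g x = frechet_derivative (\<lambda>y. g \<otimes>\<^bsub>G\<^esub> y) (at x)"

definition horizontal_space :: "'a::euclidean_space carnot \<Rightarrow> 'a \<Rightarrow> 'a set" where
  "horizontal_space G g = left_translation_deriv G g \<one>\<^bsub>G\<^esub> ` layer G 1"

definition horizontal_norm :: "'a::euclidean_space carnot \<Rightarrow> 'a \<Rightarrow> 'a \<Rightarrow> real" where
  "horizontal_norm G g v = norm (left_translation_deriv G (inv\<^bsub>G\<^esub> g) g v)"

definition horizontal_path :: "'a::euclidean_space carnot \<Rightarrow> (real \<Rightarrow> 'a) \<Rightarrow> bool" where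
  "horizontal_path G \<gamma> \<longleftrightarrow>
     \<gamma> piecewise_C1_differentiable_on {0..1} \<and>
     (\<exists>F. finite F \<and>
       (\<forall>t \<in> {0..1} - F. vector_derivative \<gamma> (at t) \<in> horizontal_space G (\<gamma> t)))"

text \<open>
  \<open>piecewise_C1_differentiable_on\<close> does not bound the derivative near the exceptional points, so the
  length need not be finite; \<open>has_integral\<close> excludes the paths of infinite length.
\<close>

definition cc_dist :: "'a::euclidean_space carnot \<Rightarrow> 'a \<Rightarrow> 'a \<Rightarrow> real" where
  "cc_dist G x y =
     Inf {L. \<exists>\<gamma>. horizontal_path G \<gamma> \<and> \<gamma> 0 = x \<and> \<gamma> 1 = y \<and>
       ((\<lambda>t. horizontal_norm G (\<gamma> t) (vector_derivative \<gamma> (at t))) has_integral L) {0..1}}"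

definition cc_ball :: "'a::euclidean_space carnot \<Rightarrow> 'a \<Rightarrow> real \<Rightarrow> 'a set" where
  "cc_ball G z \<rho> = {x. cc_dist G z x < \<rho>}"

subsection \<open>Homogeneous semimetrics\<close>

definition homogeneous_norm :: "'a::euclidean_space carnot \<Rightarrow> ('a \<Rightarrow> real) \<Rightarrow> bool" where
  "homogeneous_norm G N \<longleftrightarrow>
     continuous_on UNIV N \<and> (\<forall>g. 0 \<le> N g) \<and> (\<forall>g. N (inv\<^bsub>G\<^esub> g) = N g) \<and>
     (\<forall>c > 0. \<forall>g. N (dilation G c g) = c * N g) \<and> (\<forall>g. N g = 0 \<longleftrightarrow> g = 0)"

definition hom_dist :: "'a::euclidean_space carnot \<Rightarrow> ('a \<Rightarrow> real) \<Rightarrow> 'a \<Rightarrow> 'a \<Rightarrow> real" where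
  "hom_dist G N g h = N (inv\<^bsub>G\<^esub> g \<otimes>\<^bsub>G\<^esub> h)"

text \<open>The quantity \<open>NH(g) = d\<^sub>H(\<pi>(g), g)\<close>, where \<open>\<pi>(g) = (g\<^sub>1, 0, \<dots>, 0)\<close>.\<close>

definition nonhorizontality :: "'a::euclidean_space carnot \<Rightarrow> ('a \<Rightarrow> real) \<Rightarrow> 'a \<Rightarrow> real" where
  "nonhorizontality G N g = hom_dist G N (component G 1 g) g"

subsection \<open>Christ cubes\<close>

text \<open>
  A cube is addressed by its generation \<open>k\<close> and its index \<open>\<omega>\<close>, since one set may be a cube of several
  generations (in one generation distinct indices give distinct sets).  The centre of the ball
  contained in the cube is part of the data.
\<close>

record ('a, 'i) cube_system =
  cube_index :: "int \<Rightarrow> 'i set"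
  cube :: "int \<Rightarrow> 'i \<Rightarrow> 'a set"
  cube_centre :: "int \<Rightarrow> 'i \<Rightarrow> 'a"
  inner_const :: real
  outer_const :: real
  cube_ratio :: real

definition cube_length :: "('a, 'i) cube_system \<Rightarrow> int \<Rightarrow> real" where
  "cube_length \<Delta> k = cube_ratio \<Delta> powi k"

locale christ_cubes =
  fixes G :: "'a::euclidean_space carnot" and \<Delta> :: "('a, 'i) cube_system"
  assumes inner_const_pos: "inner_const \<Delta> > 0"
    and outer_const_pos: "outer_const \<Delta> > 0"
    and cube_ratio: "cube_ratio \<Delta> \<in> {0<..<1}"
    and cube_measurable: "\<omega> \<in> cube_index \<Delta> k \<Longrightarrow> cube \<Delta> k \<omega> \<in> sets lebesgue"
    and cube_cover: "negligible (UNIV - (\<Union>\<omega> \<in> cube_index \<Delta> k. cube \<Delta> k \<omega>))"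
    and cube_nested:
      "k \<le> j \<Longrightarrow> \<alpha> \<in> cube_index \<Delta> j \<Longrightarrow> \<omega> \<in> cube_index \<Delta> k \<Longrightarrow>
        cube \<Delta> j \<alpha> \<subseteq> cube \<Delta> k \<omega> \<or> cube \<Delta> j \<alpha> \<inter> cube \<Delta> k \<omega> = {}"
    and cube_ancestor:
      "k < j \<Longrightarrow> \<alpha> \<in> cube_index \<Delta> j \<Longrightarrow> \<exists>!\<omega>. \<omega> \<in> cube_index \<Delta> k \<and> cube \<Delta> j \<alpha> \<subseteq> cube \<Delta> k \<omega>"
    and cube_diameter:
      "\<omega> \<in> cube_index \<Delta> k \<Longrightarrow> x \<in> cube \<Delta> k \<omega> \<Longrightarrow> y \<in> cube \<Delta> k \<omega> \<Longrightarrow>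
        cc_dist G x y \<le> outer_const \<Delta> * cube_length \<Delta> k"
    and cube_inner_ball:
      "\<omega> \<in> cube_index \<Delta> k \<Longrightarrow>
        cc_ball G (cube_centre \<Delta> k \<omega>) (inner_const \<Delta> * cube_length \<Delta> k) \<subseteq> cube \<Delta> k \<omega>"

text \<open>The ball \<open>\<eta>B\<^sub>Q\<close> for the cube \<open>Q\<close> of generation \<open>k\<close> and index \<open>\<omega>\<close>.\<close>

definition cube_ball ::
  "'a::euclidean_space carnot \<Rightarrow> ('a, 'i) cube_system \<Rightarrow> real \<Rightarrow> int \<Rightarrow> 'i \<Rightarrow> 'a set" where
  "cube_ball G \<Delta> \<eta> k \<omega> = cc_ball G (cube_centre \<Delta> k \<omega>) (\<eta> * (inner_const \<Delta> * cube_length \<Delta> k))"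

text \<open>The indices of the cubes in \<open>\<Delta>\<^sub>k(S)\<close>, where \<open>S\<close> has generation \<open>j\<close> and index \<open>\<sigma>\<close>.  For a
  Christ system this set is finite, since the cubes are disjoint and contain balls of equal measure.\<close>

definition subcubes :: "('a, 'i) cube_system \<Rightarrow> int \<Rightarrow> 'i \<Rightarrow> nat \<Rightarrow> 'i set" where
  "subcubes \<Delta> j \<sigma> k =
     {\<omega> \<in> cube_index \<Delta> (j + int k). cube \<Delta> (j + int k) \<omega> \<subseteq> cube \<Delta> j \<sigma>}"

subsection \<open>Large-scale Lipschitz maps and deviation from homomorphisms\<close>

definition lip_at ::
  "'a::euclidean_space carnot \<Rightarrow> 'b::euclidean_space carnot \<Rightarrow> ('b \<Rightarrow> real) \<Rightarrow> ('a \<Rightarrow> 'b) \<Rightarrow> real \<Rightarrow> ereal"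
  where
  "lip_at G H N h t =
     (SUP (x, y) \<in> {(x, y). cc_dist G x y > t}. ereal (hom_dist H N (h x) (h y) / cc_dist G x y))"

definition lipschitz_large_dist ::
  "'a::euclidean_space carnot \<Rightarrow> 'b::euclidean_space carnot \<Rightarrow> ('b \<Rightarrow> real) \<Rightarrow> real \<Rightarrow> ('a \<Rightarrow> 'b) \<Rightarrow> bool"
  where
  "lipschitz_large_dist G H N \<psi> h \<longleftrightarrow>
     lip_at G H N h \<psi> < \<infinity> \<and>
     (SUP (x, y) \<in> {(x, y). cc_dist G x y \<le> \<psi>}. ereal (hom_dist H N (h x) (h y)))
       \<le> lip_at G H N h \<psi> * ereal \<psi>"

definition lipschitz_homs ::
  "'a::euclidean_space carnot \<Rightarrow> 'b::euclidean_space carnot \<Rightarrow> ('b \<Rightarrow> real) \<Rightarrow> ('a \<Rightarrow> 'b) set" where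
  "lipschitz_homs G H N =
     {T \<in> hom G H. \<exists>L. \<forall>x y. hom_dist H N (T x) (T y) \<le> L * cc_dist G x y}"

definition carnot_deviation ::
  "'a::euclidean_space carnot \<Rightarrow> 'b::euclidean_space carnot \<Rightarrow> ('b \<Rightarrow> real) \<Rightarrow> ('a, 'i) cube_system \<Rightarrow>
    ('a \<Rightarrow> 'b) \<Rightarrow> int \<Rightarrow> 'i \<Rightarrow> real \<Rightarrow> ereal" where
  "carnot_deviation G H N \<Delta> h k \<omega> \<eta> =
     ereal (1 / (\<eta> * inner_const \<Delta> * cube_length \<Delta> k)) *
     (INF (T, g) \<in> lipschitz_homs G H N \<times> carrier H.
        SUP x \<in> cube_ball G \<Delta> \<eta> k \<omega>. ereal (hom_dist H N (h x) (g \<otimes>\<^bsub>H\<^esub> T x)))"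

end

theory Submission
  imports Defs
begin

text \<open>
  The hypothesis on \<open>d\<^sub>H\<close> is a quantitative uniform convexity, and the theorem is a quantitative differentiation
  theorem in the sense of Jones and of Dorronsoro.  The proof has an analytic half, which finds scales at which
  the map is almost affine along every horizontal line, and an algebraic half, which shows that such a map is
  close to a homomorphism.

  For the analytic half, apply the convexity inequality to the three points \<open>h(x)\<close>, \<open>h(x w)\<close>, \<open>h(x w\<^sup>2)\<close>, where \<open>w\<close> is
  horizontal.  It says that the \<open>p\<close>-th power of the difference quotient at the scale of \<open>w\<^sup>2\<close> is at most the average of
  the two quotients at the scale of \<open>w\<close>, minus a defect that measures how far \<open>h\<^sub>1\<close> is from being midpoint affine and
  how far \<open>h(x)\<^sup>-\<^sup>1 h(x w\<^sup>2)\<close> is from the first layer.  Right translations preserve Lebesgue measure, so after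
  integration over \<open>x\<close> the two quotients have the same mean and the inequality telescopes over dyadic scales
  (\<open>telescoping_defect\<close>).  As the quotients are bounded by the Lipschitz constant, the defects of all the dyadic
  scales between \<open>\<psi>\<close> and \<open>\<ell>(S)\<close> add up to at most a constant multiple of \<open>|S|\<close>, however many scales there are
  (\<open>total_grid_defect\<close>).  A cube on which \<open>h\<close> is not close to a homomorphism carries a defect of at least a power of
  \<open>\<epsilon>\<close> times its measure, at one of about \<open>log(1/\<epsilon>)\<close> scales near its own
  (\<open>approximable_or_large_defect\<close>).  Cubes of one generation are disjoint and each scale is used by boundedly
  many generations, so the bad cubes have total measure at most \<open>C \<epsilon>\<^sup>-\<^sup>E |S|\<close>, which is below the bound claimed.

  For the algebraic half, suppose that the defects at the scales \<open>\<rho>, 2\<rho>, \<dots>, 2\<^sup>k\<rho>\<close> are tiny near a point.  Along each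
  horizontal ray of length \<open>2\<^sup>k\<rho>\<close> the component \<open>h\<^sub>1\<close> then has a slope.  Two parallel rays that start at distance \<open>\<rho>\<close>
  remain much closer to each other than their length, so their slopes agree (\<open>slope_compare\<close>).  Since the
  increments are nearly horizontal, \<open>h(x v)\<close> is close to \<open>h(x) s(v)\<close> with an element \<open>s(v)\<close> that does not depend
  on \<open>x\<close> (\<open>one_step\<close>).  Every point is the value of a word of bounded length in a basis of the first layer
  (\<open>horizontal_words_reach\<close>), so \<open>h\<close> is nearly the map that reads such words in the target group.  A word with
  trivial value in \<open>G\<close> returns to its start, hence its value in \<open>H\<close> is nearly trivial: the finitely many real
  parameters of the assignment almost solve a finite system of polynomial equations.  By an inequality of
  Lojasiewicz type (\<open>lojasiewicz\<close>) an exact solution lies nearby (\<open>approximate_relations\<close>), and an exact solution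
  is a homomorphism, which is Lipschitz because it is homogeneous (\<open>exact_relations_hom\<close>).  This gives \<open>rigidity\<close>.

  No step loses more than a power of \<open>\<epsilon>\<close>.  Hence a power \<open>\<epsilon>\<^sup>\<beta>\<close> suffices for the radius, while \<open>exp(\<epsilon>\<^sup>-\<^sup>\<alpha>)\<close> dominates all
  the powers of \<open>1/\<epsilon>\<close> that accumulate.  The Lojasiewicz inequality is obtained without semialgebraic geometry: a
  sequence of counterexamples is a point over a valuation ring of sequences modulo an ultrafilter, and solutions
  modulo the maximal ideal lift, since the ring contains a field of representatives of its residue field.
\<close>

section \<open>The filtration of a stratified Lie algebra and the Baker--Campbell--Hausdorff product\<close>

context carnot_group
begin

lemma component_decomp:
  "(\<forall>i. component G i x \<in> layer G i) \<and> x = (\<Sum>i = 1..step G. component G i x)"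
proof -
  have "(\<lambda>j. component G j x) = (THE f. (\<forall>j. f j \<in> layer G j) \<and> x = (\<Sum>j = 1..step G. f j))"
    by (simp add: component_def)
  with theI'[OF layer_direct_sum[of x]] show ?thesis by (simp add: fun_eq_iff)
qed

lemma component_in_layer: "component G i x \<in> layer G i"
  and sum_component: "(\<Sum>i = 1..step G. component G i x) = x"
  using component_decomp[of x] by auto

lemma sum_component_Suc: "(\<Sum>i = Suc 0..step G. component G i x) = x"
  using sum_component[of x] by simp

lemma component_unique:
  assumes "\<And>j. f j \<in> layer G j" "x = (\<Sum>j = 1..step G. f j)"
  shows "component G j x = f j"
  using layer_direct_sum[of x] component_decomp[of x] assms by (metis (no_types, lifting))

lemma linear_component: "linear (component G j)"
proof (rule linearI)
  fix x y
  show "component G j (x + y) = component G j x + component G j y"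
    by (rule component_unique)
       (auto simp: sum.distrib sum_component_Suc intro!: subspace_add[OF layer_subspace] component_in_layer)
next
  fix c x
  show "component G j (c *\<^sub>R x) = c *\<^sub>R component G j x"
    by (rule component_unique)
       (auto simp: scaleR_sum_right[symmetric] sum_component_Suc
             intro!: subspace_scale[OF layer_subspace] component_in_layer)
qed

lemmas component_add = linear_add[OF linear_component]
  and component_diff = linear_diff[OF linear_component]
  and component_neg = linear_neg[OF linear_component]
  and component_scaleR = linear_scale[OF linear_component]
  and component_zero [simp] = linear_0[OF linear_component]
  and component_sum = linear_sum[OF linear_component]

lemma component_layer:
  assumes "x \<in> layer G j"
  shows "component G i x = (if i = j then x else 0)"
proof (rule component_unique)
  show "(if i = j then x else 0) \<in> layer G i" for i
    using assms subspace_0[OF layer_subspace] by auto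
  show "x = (\<Sum>i = 1..step G. if i = j then x else 0)"
    using assms layer_outside[of j] by (cases "j \<in> {1..step G}") auto
qed

lemma component_outside: "i \<notin> {1..step G} \<Longrightarrow> component G i x = 0"
  using component_in_layer[of i x] layer_outside[of i] by auto

lemma component_component: "component G i (component G j x) = (if i = j then component G j x else 0)"
  by (rule component_layer) (rule component_in_layer)

lemma component_eqI: "(\<And>i. i \<in> {1..step G} \<Longrightarrow> component G i x = component G i y) \<Longrightarrow> x = y"
  by (metis (no_types, lifting) sum.cong sum_component)

lemma step_pos: "1 \<le> step G"
  using layer_top layer_outside[of "step G"] by (cases "step G") auto

text \<open>The group product agrees with vector addition to leading order along this filtration.  Estimates
  on the product take the form of congruences modulo the next step of the filtration.\<close>

definition filt :: "nat \<Rightarrow> 'a set" where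
  "filt m = {x. \<forall>i<m. component G i x = 0}"

lemma subspace_filt: "subspace (filt m)"
  by (auto simp: subspace_def filt_def component_add component_scaleR)

lemmas filt_add = subspace_add[OF subspace_filt]
  and filt_diff = subspace_diff[OF subspace_filt]
  and filt_scaleR = subspace_scale[OF subspace_filt]
  and filt_zero [simp] = subspace_0[OF subspace_filt]
  and filt_sum = subspace_sum[OF subspace_filt]
  and filt_neg = subspace_neg[OF subspace_filt]

lemma filt_mono: "x \<in> filt m \<Longrightarrow> k \<le> m \<Longrightarrow> x \<in> filt k"
  by (auto simp: filt_def)

lemma filt_1 [simp]: "x \<in> filt (Suc 0)" "x \<in> filt 0"
  by (auto simp: filt_def component_outside)

lemma filt_top: "x \<in> filt m \<Longrightarrow> step G < m \<Longrightarrow> x = 0"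
  by (rule component_eqI) (auto simp: filt_def)

lemma layer_filt: "x \<in> layer G j \<Longrightarrow> x \<in> filt j"
  by (auto simp: filt_def component_layer)

lemma filt_component: "x \<in> filt m \<Longrightarrow> component G i x = 0 \<or> m \<le> i"
  by (auto simp: filt_def not_less)

lemma filt_SucI: "x \<in> filt m \<Longrightarrow> component G m x = 0 \<Longrightarrow> x \<in> filt (Suc m)"
  by (auto simp: filt_def less_Suc_eq)

abbreviation br :: "'a \<Rightarrow> 'a \<Rightarrow> 'a" where "br \<equiv> bracket G"

lemma br_add_left: "br (x + y) z = br x z + br y z"
  and br_add_right: "br x (y + z) = br x y + br x z"
  and br_scale_left: "br (c *\<^sub>R x) z = c *\<^sub>R br x z"
  and br_scale_right: "br x (c *\<^sub>R y) = c *\<^sub>R br x y"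
  and br_zero_left [simp]: "br 0 z = 0"
  and br_zero_right [simp]: "br z 0 = 0"
  and br_diff_left: "br (x - y) z = br x z - br y z"
  and br_diff_right: "br x (y - z) = br x y - br x z"
  using bracket_bilinear
  by (auto simp: bilinear_ladd bilinear_radd bilinear_lmul bilinear_rmul bilinear_lzero bilinear_rzero
        bilinear_lsub bilinear_rsub bilinear_lneg bilinear_rneg)

lemma br_anti: "br y x = - br x y"
proof -
  have "br (x + y) (x + y) = br x y + br y x"
    by (simp only: br_add_left br_add_right) (simp add: bracket_alternating)
  then show ?thesis by (simp add: bracket_alternating eq_neg_iff_add_eq_0 add.commute)
qed

lemma br_sum: "finite A \<Longrightarrow> finite B \<Longrightarrow> br (sum f A) (sum g B) = (\<Sum>a\<in>A. \<Sum>b\<in>B. br (f a) (g b))"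
  using bilinear_sum[OF bracket_bilinear, of f A g B] by (simp add: sum.cartesian_product)

lemma br_components:
  "br x y = (\<Sum>a = 1..step G. \<Sum>b = 1..step G. br (component G a x) (component G b y))"
  by (subst br_sum[symmetric]) (simp_all add: sum_component_Suc)

lemma br_filt:
  assumes "x \<in> filt i" "y \<in> filt j"
  shows "br x y \<in> filt (i + j)"
proof -
  have "br (component G a x) (component G b y) \<in> filt (i + j)" for a b
  proof (cases "i \<le> a \<and> j \<le> b")
    case True
    then show ?thesis
      using layer_filt[OF layer_bracket[OF component_in_layer component_in_layer], of a x b y]
      by (auto intro: filt_mono)
  next
    case False
    then have "component G a x = 0 \<or> component G b y = 0" using assms filt_component by blast
    then show ?thesis by auto
  qed
  then show ?thesis by (subst br_components) (intro filt_sum)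
qed

lemma iterated_bracket_filt:
  assumes "list_all2 (\<lambda>z w. z \<in> filt w) zs ws" "zs \<noteq> []"
  shows "iterated_bracket br zs \<in> filt (sum_list ws)"
  using assms
proof (induction zs arbitrary: ws rule: induct_list012)
  case (3 z w zs)
  then obtain a ws' where ws: "ws = a # ws'" "z \<in> filt a" "list_all2 (\<lambda>z w. z \<in> filt w) (w # zs) ws'"
    by (auto simp: list_all2_Cons1)
  then show ?case using 3 by (auto intro: br_filt)
qed (auto simp: list_all2_Cons1)

lemma iterated_bracket_length_filt: "zs \<noteq> [] \<Longrightarrow> iterated_bracket br zs \<in> filt (length zs)"
  using iterated_bracket_filt[of zs "replicate (length zs) 1"]
  by (auto simp: list_all2_conv_all_nth sum_list_replicate)

lemma iterated_bracket_diff: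
  assumes "list_all2 (\<lambda>z z'. z' - z \<in> filt m) zs zs'" "zs \<noteq> []"
  shows "iterated_bracket br zs' - iterated_bracket br zs \<in> filt (m + length zs - 1)"
  using assms
proof (induction zs arbitrary: zs' rule: induct_list012)
  case (3 z w zs)
  then obtain z' w' zs'' where zs': "zs' = z' # w' # zs''" and z: "z' - z \<in> filt m"
    and la: "list_all2 (\<lambda>z z'. z' - z \<in> filt m) (w # zs) (w' # zs'')"
    by (auto simp: list_all2_Cons1)
  let ?I = "iterated_bracket br (w # zs)" and ?I' = "iterated_bracket br (w' # zs'')"
  have len: "length zs'' = length zs" using la by (auto dest: list_all2_lengthD)
  have 1: "?I' - ?I \<in> filt (m + length zs)"
    using "3.IH"(2)[OF la] "3.prems" by auto
  have 2: "?I' \<in> filt (Suc (length zs))"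
    using iterated_bracket_length_filt[of "w' # zs''"] len by simp
  have "br z' ?I' - br z ?I = br (z' - z) ?I' + br z (?I' - ?I)"
    by (simp add: br_diff_left br_diff_right)
  moreover have "br (z' - z) ?I' \<in> filt (m + Suc (length zs))"
    by (rule br_filt[OF z 2])
  moreover have "br z (?I' - ?I) \<in> filt (1 + (m + length zs))"
    by (rule br_filt[OF _ 1]) simp
  ultimately show ?case by (auto simp: zs' intro!: filt_add)
qed (auto simp: list_all2_Cons1)

lemma iterated_bracket_multiples:
  assumes "set zs \<subseteq> range (\<lambda>c. c *\<^sub>R x)" "2 \<le> length zs"
  shows "iterated_bracket br zs = 0"
  using assms
proof (induction zs rule: induct_list012)
  case (3 z w zs)
  show ?case
  proof (cases zs)
    case Nil
    with 3 show ?thesis by (auto simp: br_scale_left br_scale_right bracket_alternating)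
  next
    case (Cons a zs')
    with 3 show ?thesis by auto
  qed
qed auto

text \<open>Both arguments occur in a bracket that does not vanish: a bracket of multiples of one vector is zero.  A third
  entry then raises the degree beyond \<open>i + j\<close>.\<close>

lemma iterated_bracket_mixed:
  assumes "x \<in> filt i" "y \<in> filt j" "1 \<le> i" "1 \<le> j" "set zs \<subseteq> {x, y}" "3 \<le> length zs"
  shows "iterated_bracket br zs \<in> filt (Suc (i + j))"
proof (cases "x \<in> set zs \<and> y \<in> set zs \<and> x \<noteq> y")
  case True
  let ?w = "\<lambda>z. if z = x then i else j"
  have *: "list_all2 (\<lambda>z w. z \<in> filt w) zs (map ?w zs)"
    using assms by (auto simp: list_all2_conv_all_nth dest!: nth_mem)
  have "length zs = length (filter ((=) x) zs) + length (filter (\<lambda>z. x \<noteq> z) zs)"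
    by (simp add: sum_length_filter_compl)
  moreover have "sum_list (map ?w zs) = i * length (filter ((=) x) zs) + j * length (filter (\<lambda>z. x \<noteq> z) zs)"
    by (induction zs) auto
  moreover have "filter ((=) x) zs \<noteq> []" "filter (\<lambda>z. x \<noteq> z) zs \<noteq> []"
    using True by (auto simp: filter_empty_conv)
  then have "length (filter ((=) x) zs) \<ge> 1" "length (filter (\<lambda>z. x \<noteq> z) zs) \<ge> 1"
    by (auto simp: Suc_le_eq simp del: filter_empty_conv)
  moreover have "Suc (i + j) \<le> i * a + j * b" if "a \<ge> 1" "b \<ge> 1" "3 \<le> a + b" for a b :: nat
  proof -
    have "i * a + j * b = i + j + (i * (a - 1) + j * (b - 1))"
      using that by (cases a; cases b) simp_all
    moreover have "i * (a - 1) + j * (b - 1) \<ge> 1"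
    proof (cases "a \<ge> 2")
      case True
      then have "1 * 1 \<le> i * (a - 1)" using assms(3) by (intro mult_le_mono) auto
      then show ?thesis by linarith
    next
      case False
      then have "1 * 1 \<le> j * (b - 1)" using assms(4) that by (intro mult_le_mono) auto
      then show ?thesis by linarith
    qed
    ultimately show ?thesis by linarith
  qed
  ultimately have "Suc (i + j) \<le> sum_list (map ?w zs)" using assms(6) by metis
  moreover have "zs \<noteq> []" using assms(6) by auto
  ultimately show ?thesis using iterated_bracket_filt[OF *] filt_mono by blast
next
  case False
  then have "set zs \<subseteq> {x} \<or> set zs \<subseteq> {y}" using assms(5) by auto
  then have "\<exists>z. set zs \<subseteq> range (\<lambda>c. c *\<^sub>R z)"
    using rangeI[of "\<lambda>c. c *\<^sub>R x" 1] rangeI[of "\<lambda>c. c *\<^sub>R y" 1]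
    by (metis (no_types, lifting) empty_subsetI insert_subset scaleR_one subset_trans)
  then have "iterated_bracket br zs = 0" using iterated_bracket_multiples assms(6) by force
  then show ?thesis by simp
qed

end

subsection \<open>The low-order terms of Dynkin's series\<close>

abbreviation dynkin_weight :: "(nat \<times> nat) list \<Rightarrow> nat" where
  "dynkin_weight ps \<equiv> (\<Sum>(p, q)\<leftarrow>ps. p + q)"

lemma length_dynkin_word: "length (dynkin_word x y ps) = dynkin_weight ps"
  by (induction ps) (auto simp: dynkin_word_def)

lemma in_set_dynkin_word:
  assumes "z \<in> set (dynkin_word x y ps)"
  shows "z = x \<or> z = y"
proof -
  obtain p q where "z \<in> set (replicate p x @ replicate q y)"
    using assms [[simproc del: list_to_set_comprehension]] by (auto simp: dynkin_word_def)
  then show ?thesis by auto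
qed

lemma length_le_dynkin_weight: "\<forall>(p, q)\<in>set ps. p + q > 0 \<Longrightarrow> length ps \<le> dynkin_weight ps"
proof (induction ps)
  case (Cons a ps)
  then have "length ps \<le> dynkin_weight ps" "fst a + snd a > 0" by (auto split: prod.splits)
  then show ?case by (cases a) (simp, linarith)
qed simp

lemma dynkin_index_weight_ge:
  assumes "ps \<in> dynkin_index R"
  shows "length ps \<le> dynkin_weight ps" "1 \<le> length ps" "dynkin_weight ps \<le> R"
proof -
  show "length ps \<le> dynkin_weight ps" using assms by (intro length_le_dynkin_weight) (simp add: dynkin_index_def)
  show "1 \<le> length ps" using assms by (cases ps) (auto simp: dynkin_index_def)
  show "dynkin_weight ps \<le> R" using assms by (simp add: dynkin_index_def)
qed

lemma finite_dynkin_index: "finite (dynkin_index R)"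
proof (rule finite_subset)
  show "dynkin_index R \<subseteq> {ps. set ps \<subseteq> {0..R} \<times> {0..R} \<and> length ps \<le> R}"
  proof safe
    fix ps assume ps: "ps \<in> dynkin_index R"
    then show "length ps \<le> R" using dynkin_index_weight_ge[OF ps] by linarith
    fix p q assume "(p, q) \<in> set ps"
    then have "p + q \<in> set (map (\<lambda>(p, q). p + q) ps)" by force
    then have "p + q \<le> dynkin_weight ps" by (intro member_le_sum_list) simp_all
    then show "p \<in> {0..R}" "q \<in> {0..R}" using dynkin_index_weight_ge(3)[OF ps] by auto
  qed
  show "finite {ps. set ps \<subseteq> {0..R} \<times> {0..R} \<and> length ps \<le> R}"
    by (rule finite_lists_length_le) auto
qed

lemma dynkin_weight_1:
  "{ps \<in> dynkin_index (max R 2). dynkin_weight ps = 1} = {[(1, 0)], [(0, 1)]}"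
proof -
  have "ps = [(1, 0)] \<or> ps = [(0, 1)]" if "ps \<in> dynkin_index k" "dynkin_weight ps = 1" for ps k
  proof -
    have "length ps = 1" using that dynkin_index_weight_ge[OF that(1)] by linarith
    then obtain p q where *: "ps = [(p, q)]" by (auto simp: length_Suc_conv)
    with that have "p + q = 1" by simp
    then have "p = 1 \<and> q = 0 \<or> p = 0 \<and> q = 1" by linarith
    with * show ?thesis by auto
  qed
  then show ?thesis by (auto simp: dynkin_index_def)
qed

text \<open>The seven words of weight two; those with a repeated letter contribute nothing, and the others add up
  to half the bracket.\<close>

lemma dynkin_weight_2:
  "{ps \<in> dynkin_index (max R 2). dynkin_weight ps = 2} =
    {[(2, 0)], [(0, 2)], [(1, 1)], [(1, 0), (1, 0)], [(0, 1), (0, 1)], [(1, 0), (0, 1)], [(0, 1), (1, 0)]}"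
    (is "?L = ?S")
proof
  show "?L \<subseteq> ?S"
  proof
    fix ps assume "ps \<in> ?L"
    then have ps: "ps \<in> dynkin_index (max R 2)" "dynkin_weight ps = 2" by auto
    then have "length ps = 1 \<or> length ps = 2"
      using dynkin_index_weight_ge[OF ps(1)] by linarith
    then show "ps \<in> ?S"
    proof
      assume "length ps = 1"
      then obtain p q where *: "ps = [(p, q)]" by (auto simp: length_Suc_conv)
      with ps(2) have "p + q = 2" by simp
      then have "p = 2 \<and> q = 0 \<or> p = 0 \<and> q = 2 \<or> p = 1 \<and> q = 1" by linarith
      with * show ?thesis by auto
    next
      assume "length ps = 2"
      then obtain p q p' q' where *: "ps = [(p, q), (p', q')]"
        by (auto simp: length_Suc_conv numeral_2_eq_2)
      with ps have "p + q > 0" "p' + q' > 0" "p + q + (p' + q') = 2" by (auto simp: dynkin_index_def)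
      then have "p + q = 1" "p' + q' = 1" by auto
      then have "(p, q) = (1, 0) \<or> (p, q) = (0, 1)" "(p', q') = (1, 0) \<or> (p', q') = (0, 1)" by auto
      with * show ?thesis by auto
    qed
  qed
  show "?S \<subseteq> ?L" by (auto simp: dynkin_index_def)
qed


context carnot_group
begin

text \<open>With a truncation at weight two or more, the terms of low weight can be read off in step one as well.\<close>

lemma bch_extend:
  assumes "step G \<le> R"
  shows "x \<otimes> y = bch R br x y"
proof -
  have "dynkin_index (step G) \<subseteq> dynkin_index R" using assms by (auto simp: dynkin_index_def)
  moreover have "iterated_bracket br (dynkin_word x y ps) = 0"
    if "ps \<in> dynkin_index R - dynkin_index (step G)" for ps
  proof -
    have "step G < dynkin_weight ps" using that by (auto simp: dynkin_index_def)
    moreover from this have "dynkin_word x y ps \<noteq> []"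
      by (metis length_dynkin_word list.size(3) not_less_zero)
    ultimately show ?thesis
      using iterated_bracket_length_filt[of "dynkin_word x y ps"]
      by (intro filt_top[of _ "dynkin_weight ps"]) (simp_all add: length_dynkin_word)
  qed
  ultimately show ?thesis
    by (auto simp: mult_bch bch_def finite_dynkin_index intro!: sum.mono_neutral_left)
qed

definition bch_rest :: "'a \<Rightarrow> 'a \<Rightarrow> 'a" where
  "bch_rest x y = (\<Sum>ps | ps \<in> dynkin_index (max (step G) 2) \<and> 3 \<le> dynkin_weight ps.
     dynkin_coeff ps *\<^sub>R iterated_bracket br (dynkin_word x y ps))"

lemma mult_low_order: "x \<otimes> y = x + y + (1 / 2) *\<^sub>R br x y + bch_rest x y"
proof -
  let ?R = "max (step G) 2"
  let ?t = "\<lambda>ps. dynkin_coeff ps *\<^sub>R iterated_bracket br (dynkin_word x y ps)"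
  let ?I1 = "{ps \<in> dynkin_index ?R. dynkin_weight ps = 1}"
  let ?I2 = "{ps \<in> dynkin_index ?R. dynkin_weight ps = 2}"
  let ?I3 = "{ps \<in> dynkin_index ?R. 3 \<le> dynkin_weight ps}"
  have un: "dynkin_index ?R = (?I1 \<union> ?I2) \<union> ?I3"
    using dynkin_index_weight_ge by fastforce
  have "x \<otimes> y = bch ?R br x y" by (rule bch_extend) simp
  also have "\<dots> = sum ?t (?I1 \<union> ?I2) + sum ?t ?I3"
    unfolding bch_def by (subst un, rule sum.union_disjoint) (auto simp: finite_dynkin_index)
  also have "sum ?t (?I1 \<union> ?I2) = sum ?t ?I1 + sum ?t ?I2"
    by (rule sum.union_disjoint) (auto simp: finite_dynkin_index)
  also have "sum ?t ?I1 = x + y"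
    unfolding dynkin_weight_1 by (simp add: dynkin_word_def dynkin_coeff_def)
  also have "sum ?t ?I2 = (1 / 2) *\<^sub>R br x y"
    unfolding dynkin_weight_2
    by (simp add: dynkin_word_def dynkin_coeff_def numeral_2_eq_2 bracket_alternating br_anti[of x y]
        flip: scaleR_add_left scaleR_left_diff_distrib)
  finally show ?thesis by (simp add: bch_rest_def)
qed

lemma bch_rest_diff:
  assumes "x' - x \<in> filt m" "y' - y \<in> filt m"
  shows "bch_rest x' y' - bch_rest x y \<in> filt (Suc m)"
proof -
  have la: "list_all2 (\<lambda>z z'. z' - z \<in> filt m) (dynkin_word x y ps) (dynkin_word x' y' ps)" for ps
  proof (induction ps)
    case (Cons a ps)
    have "list_all2 (\<lambda>z z'. z' - z \<in> filt m) (replicate k z) (replicate k z')" if "z' - z \<in> filt m" for k z z'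
      using that by (simp add: list_all2_conv_all_nth)
    with assms Cons show ?case
      by (cases a) (auto simp: dynkin_word_def intro!: list_all2_appendI)
  qed (simp add: dynkin_word_def)
  have "iterated_bracket br (dynkin_word x' y' ps) - iterated_bracket br (dynkin_word x y ps) \<in> filt (Suc m)"
    if "3 \<le> dynkin_weight ps" for ps
  proof -
    have "dynkin_word x y ps \<noteq> []" using that
      by (metis length_dynkin_word list.size(3) not_numeral_le_zero)
    from iterated_bracket_diff[OF la this] show ?thesis
      by (rule filt_mono) (use that in \<open>simp add: length_dynkin_word\<close>)
  qed
  then show ?thesis
    unfolding bch_rest_def sum_subtractf[symmetric] scaleR_right_diff_distrib[symmetric]
    by (intro filt_sum filt_scaleR) auto
qed

lemma bch_rest_mixed:
  assumes "x \<in> filt i" "y \<in> filt j" "1 \<le> i" "1 \<le> j"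
  shows "bch_rest x y \<in> filt (Suc (i + j))"
proof -
  have "iterated_bracket br (dynkin_word x y ps) \<in> filt (Suc (i + j))" if "3 \<le> dynkin_weight ps" for ps
    using that in_set_dynkin_word[of _ x y ps]
    by (intro iterated_bracket_mixed[OF assms]) (auto simp: length_dynkin_word)
  then show ?thesis unfolding bch_rest_def by (intro filt_sum filt_scaleR) auto
qed

text \<open>In every bracket that contains the increment there is another entry, which raises the degree.\<close>

lemma mult_increment_right:
  assumes "d \<in> filt m"
  shows "x \<otimes> (y + d) - x \<otimes> y - d \<in> filt (Suc m)"
proof -
  have "x \<otimes> (y + d) - x \<otimes> y - d = (1 / 2) *\<^sub>R br x d + (bch_rest x (y + d) - bch_rest x y)"
    by (simp add: mult_low_order br_add_right scaleR_add_right)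
  moreover have "br x d \<in> filt (1 + m)" by (rule br_filt) (simp_all add: assms)
  moreover have "bch_rest x (y + d) - bch_rest x y \<in> filt (Suc m)"
    by (rule bch_rest_diff) (simp_all add: assms)
  ultimately show ?thesis by (auto intro!: filt_add filt_scaleR)
qed

lemma mult_increment_left:
  assumes "d \<in> filt m"
  shows "(x + d) \<otimes> y - x \<otimes> y - d \<in> filt (Suc m)"
proof -
  have "(x + d) \<otimes> y - x \<otimes> y - d = (1 / 2) *\<^sub>R br d y + (bch_rest (x + d) y - bch_rest x y)"
    by (simp add: mult_low_order br_add_left scaleR_add_right)
  moreover have "br d y \<in> filt (m + 1)" by (rule br_filt) (simp_all add: assms)
  moreover have "bch_rest (x + d) y - bch_rest x y \<in> filt (Suc m)"
    by (rule bch_rest_diff) (simp_all add: assms)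
  ultimately show ?thesis by (auto intro!: filt_add filt_scaleR)
qed

text \<open>The two products differ in the sign of the bracket only; all other terms have higher degree.\<close>

lemma mult_commutator:
  assumes "x \<in> filt i" "y \<in> filt j" "1 \<le> i" "1 \<le> j"
  shows "x \<otimes> y - y \<otimes> x - br x y \<in> filt (Suc (i + j))"
proof -
  have "(1 / 2) *\<^sub>R br x y - (1 / 2) *\<^sub>R br y x = br x y"
    unfolding br_anti[of y x] by (simp flip: scaleR_add_left)
  then have "x \<otimes> y - y \<otimes> x - br x y = bch_rest x y - bch_rest y x"
    unfolding mult_low_order by (simp add: algebra_simps)
  moreover have "bch_rest y x \<in> filt (Suc (i + j))" using bch_rest_mixed[of y j x i] assms by (simp add: add.commute)
  ultimately show ?thesis using bch_rest_mixed[OF assms] by (simp add: filt_diff)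
qed

lemma mult_multiples: "(c *\<^sub>R x) \<otimes> (d *\<^sub>R x) = (c + d) *\<^sub>R x"
proof -
  have "iterated_bracket br (dynkin_word (c *\<^sub>R x) (d *\<^sub>R x) ps) = 0" if "3 \<le> dynkin_weight ps" for ps
    using that in_set_dynkin_word[of _ "c *\<^sub>R x" "d *\<^sub>R x" ps]
    by (intro iterated_bracket_multiples[where x = x]) (auto simp: length_dynkin_word)
  then have "bch_rest (c *\<^sub>R x) (d *\<^sub>R x) = 0" unfolding bch_rest_def by simp
  then show ?thesis
    by (simp add: mult_low_order br_scale_left br_scale_right bracket_alternating scaleR_add_left)
qed

lemma mult_zero_right [simp]: "x \<otimes> 0 = x"
  using mult_multiples[of 1 x 0] by simp

lemma mult_zero_left [simp]: "0 \<otimes> x = x"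
  using mult_multiples[of 0 x 1] by simp

lemma one_eq_zero: "\<one> = 0"
  using l_one[of 0] by (simp add: carrier_UNIV)

lemma mult_neg_right [simp]: "x \<otimes> (- x) = 0"
  using mult_multiples[of 1 x "-1"] by simp

lemma mult_neg_left [simp]: "(- x) \<otimes> x = 0"
  using mult_multiples[of "-1" x 1] by simp

lemma inv_eq_neg: "inv x = - x"
  by (rule inv_equality) (simp_all add: carrier_UNIV one_eq_zero)

lemma mult_assoc: "x \<otimes> y \<otimes> z = x \<otimes> (y \<otimes> z)"
  by (rule m_assoc) (simp_all add: carrier_UNIV)

lemma mult_cancel_neg [simp]: "(- x) \<otimes> (x \<otimes> y) = y" "x \<otimes> ((- x) \<otimes> y) = y"
  by (simp_all flip: mult_assoc)

lemma neg_mult: "- (x \<otimes> y) = (- y) \<otimes> (- x)"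
  using inv_mult_group[of x y] by (simp add: carrier_UNIV inv_eq_neg)

lemma component1_mult: "component G 1 (x \<otimes> y) = component G 1 x + component G 1 y"
proof -
  have "x \<otimes> (0 + y) - x \<otimes> 0 - y \<in> filt (Suc 1)" by (rule mult_increment_right) simp
  then have "component G 1 (x \<otimes> y - x - y) = 0" by (simp add: filt_def)
  then have "component G 1 (x \<otimes> y) - component G 1 x - component G 1 y = 0" by (simp only: component_diff)
  then show ?thesis by (simp add: diff_diff_eq)
qed

end

subsection \<open>Dilations\<close>

context carnot_group
begin

lemma linear_dilation: "linear (dilation G c)"
  by (rule linearI)
     (simp_all add: dilation_def component_add component_scaleR scaleR_add_right sum.distrib
        scaleR_sum_right mult.commute)

lemmas dilation_add = linear_add[OF linear_dilation]
  and dilation_diff = linear_diff[OF linear_dilation]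
  and dilation_neg = linear_neg[OF linear_dilation]
  and dilation_scaleR = linear_scale[OF linear_dilation]
  and dilation_zero [simp] = linear_0[OF linear_dilation]
  and dilation_sum = linear_sum[OF linear_dilation]

lemma component_dilation: "component G j (dilation G c x) = c ^ j *\<^sub>R component G j x"
proof (rule component_unique[where f = "\<lambda>j. c ^ j *\<^sub>R component G j x"])
  show "c ^ i *\<^sub>R component G i x \<in> layer G i" for i
    by (intro subspace_scale[OF layer_subspace] component_in_layer)
qed (rule dilation_def)

lemma dilation_layer:
  assumes "x \<in> layer G j"
  shows "dilation G c x = c ^ j *\<^sub>R x"
  by (rule component_eqI) (simp add: component_dilation component_scaleR component_layer[OF assms])

lemma dilation_dilation: "dilation G c (dilation G d x) = dilation G (c * d) x"
  by (rule component_eqI) (simp add: component_dilation power_mult_distrib)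

lemma dilation_1 [simp]: "dilation G 1 x = x"
  by (rule component_eqI) (simp add: component_dilation)

lemma dilation_0 [simp]: "dilation G 0 x = 0"
  by (rule component_eqI) (simp add: component_dilation)

lemma dilation_br: "dilation G c (br x y) = br (dilation G c x) (dilation G c y)"
proof -
  have "dilation G c (br x y) =
    (\<Sum>a = 1..step G. \<Sum>b = 1..step G. dilation G c (br (component G a x) (component G b y)))"
    by (subst br_components) (simp add: dilation_sum)
  also have "\<dots> = (\<Sum>a = 1..step G. \<Sum>b = 1..step G.
      br (c ^ a *\<^sub>R component G a x) (c ^ b *\<^sub>R component G b y))"
    by (simp add: br_scale_left br_scale_right power_add mult.commute
        dilation_layer[OF layer_bracket[OF component_in_layer component_in_layer]])
  also have "\<dots> = br (dilation G c x) (dilation G c y)"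
    unfolding dilation_def by (rule br_sum[symmetric]) auto
  finally show ?thesis .
qed

lemma dilation_iterated_bracket:
  "dilation G c (iterated_bracket br zs) = iterated_bracket br (map (dilation G c) zs)"
  by (induction zs rule: induct_list012) (simp_all add: dilation_br)

lemma dilation_mult: "dilation G c (x \<otimes> y) = dilation G c x \<otimes> dilation G c y"
proof -
  have "map (dilation G c) (dynkin_word x y ps) = dynkin_word (dilation G c x) (dilation G c y) ps" for ps
    by (induction ps) (auto simp: dynkin_word_def)
  then show ?thesis
    by (simp add: mult_bch bch_def dilation_sum dilation_scaleR dilation_iterated_bracket)
qed

end

subsection \<open>The product is polynomial in coordinates\<close>

text \<open>Lipschitz estimates, differentiability, continuity and the algebraic dependence on parameters are
  all inherited by the group product from its coordinates for the same reason: the functions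
  with the property in question form an algebra, and the product is polynomial in coordinates.\<close>

definition function_algebra :: "('z \<Rightarrow> real) set \<Rightarrow> bool" where
  "function_algebra A \<longleftrightarrow> (\<forall>c. (\<lambda>_. c) \<in> A) \<and>
     (\<forall>u\<in>A. \<forall>v\<in>A. (\<lambda>z. u z + v z) \<in> A \<and> (\<lambda>z. u z * v z) \<in> A)"

lemma function_algebra_const: "function_algebra A \<Longrightarrow> (\<lambda>_. c) \<in> A"
  and function_algebra_add: "function_algebra A \<Longrightarrow> u \<in> A \<Longrightarrow> v \<in> A \<Longrightarrow> (\<lambda>z. u z + v z) \<in> A"
  and function_algebra_mult: "function_algebra A \<Longrightarrow> u \<in> A \<Longrightarrow> v \<in> A \<Longrightarrow> (\<lambda>z. u z * v z) \<in> A"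
  by (simp_all add: function_algebra_def)

lemma function_algebra_sum:
  assumes "function_algebra A" "finite I" "\<And>i. i \<in> I \<Longrightarrow> u i \<in> A"
  shows "(\<lambda>z. \<Sum>i\<in>I. u i z) \<in> A"
  using assms(2,3)
  by (induction I rule: finite_induct)
     (simp_all add: function_algebra_const[OF assms(1)] function_algebra_add[OF assms(1)])

lemma function_algebra_cmult: "function_algebra A \<Longrightarrow> u \<in> A \<Longrightarrow> (\<lambda>z. c * u z) \<in> A"
  by (rule function_algebra_mult) (auto intro: function_algebra_const)

context carnot_group
begin

lemma br_inner:
  "br u v \<bullet> c = (\<Sum>d\<in>Basis. \<Sum>e\<in>Basis. (br d e \<bullet> c) * ((u \<bullet> d) * (v \<bullet> e)))"
proof -
  have "br u v = br (\<Sum>d\<in>Basis. (u \<bullet> d) *\<^sub>R d) (\<Sum>e\<in>Basis. (v \<bullet> e) *\<^sub>R e)"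
    by (simp only: euclidean_representation)
  also have "\<dots> = (\<Sum>d\<in>Basis. \<Sum>e\<in>Basis. ((u \<bullet> d) * (v \<bullet> e)) *\<^sub>R br d e)"
    by (subst br_sum) (simp_all add: br_scale_left br_scale_right mult.commute)
  finally show ?thesis by (simp add: inner_sum_left mult.commute)
qed

lemma mult_coordinates_closed:
  fixes f g :: "'z \<Rightarrow> 'a" and A :: "('z \<Rightarrow> real) set"
  assumes A: "function_algebra A"
    and f: "\<And>b. b \<in> Basis \<Longrightarrow> (\<lambda>z. f z \<bullet> b) \<in> A"
    and g: "\<And>b. b \<in> Basis \<Longrightarrow> (\<lambda>z. g z \<bullet> b) \<in> A"
    and "b \<in> Basis"
  shows "(\<lambda>z. (f z \<otimes> g z) \<bullet> b) \<in> A"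
proof -
  define P where "P u \<longleftrightarrow> (\<forall>b\<in>Basis. (\<lambda>z. u z \<bullet> b) \<in> A)" for u :: "'z \<Rightarrow> 'a"
  have br: "P (\<lambda>z. br (u z) (v z))" if "P u" "P v" for u v
    unfolding P_def
  proof
    fix b :: 'a assume "b \<in> Basis"
    have "(\<lambda>z. br (u z) (v z) \<bullet> b) =
        (\<lambda>z. \<Sum>d\<in>Basis. \<Sum>e\<in>Basis. (br d e \<bullet> b) * ((u z \<bullet> d) * (v z \<bullet> e)))"
      by (rule ext) (rule br_inner)
    also have "\<dots> \<in> A"
      by (rule function_algebra_sum[OF A], simp, rule function_algebra_sum[OF A], simp,
          rule function_algebra_cmult[OF A], rule function_algebra_mult[OF A])
         (use that in \<open>auto simp: P_def\<close>)
    finally show "(\<lambda>z. br (u z) (v z) \<bullet> b) \<in> A" .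
  qed
  have it: "P (\<lambda>z. iterated_bracket br (map (\<lambda>u. u z) us))" if "\<And>u. u \<in> set us \<Longrightarrow> P u" for us
    using that
  proof (induction us rule: induct_list012)
    case 1
    show ?case by (simp add: P_def function_algebra_const[OF A])
  next
    case (3 u v us)
    have "P u" "P (\<lambda>z. iterated_bracket br (map (\<lambda>u. u z) (v # us)))" using 3 by auto
    from br[OF this] show ?case by simp
  qed auto
  have w: "dynkin_word (f z) (g z) ps = map (\<lambda>u. u z) (dynkin_word f g ps)" for z ps
    by (induction ps) (auto simp: dynkin_word_def)
  have "P (\<lambda>z. iterated_bracket br (dynkin_word (f z) (g z) ps))" for ps
    unfolding w by (rule it) (use f g in \<open>auto simp: P_def dest!: in_set_dynkin_word\<close>)
  then have "(\<lambda>z. dynkin_coeff ps * (iterated_bracket br (dynkin_word (f z) (g z) ps) \<bullet> b)) \<in> A" for ps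
    using \<open>b \<in> Basis\<close> by (intro function_algebra_cmult[OF A]) (simp add: P_def)
  then have "(\<lambda>z. \<Sum>ps\<in>dynkin_index (step G).
      dynkin_coeff ps * (iterated_bracket br (dynkin_word (f z) (g z) ps) \<bullet> b)) \<in> A"
    by (rule function_algebra_sum[OF A finite_dynkin_index])
  then show ?thesis
    by (simp add: mult_bch bch_def inner_sum_left)
qed

end

section \<open>Analysis on a Carnot group\<close>

subsection \<open>Powers of a small parameter\<close>

text \<open>All quantitative statements below have the form "if the data are \<open>d ^ q\<close>-close, then the conclusion
  holds up to \<open>d\<close>", uniformly in \<open>0 < d \<le> 1/2\<close>.  Multiplicative constants are absorbed by raising
  the exponent, so only the existence of an exponent has to be recorded.\<close>

lemma absorb_constant:
  fixes C :: real
  shows "\<exists>q\<ge>m. \<forall>d. 0 < d \<and> d \<le> 1/2 \<longrightarrow> C * d ^ q \<le> d ^ m"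
proof -
  obtain k where k: "C < 2 ^ k" using real_arch_pow[of 2 C] by auto
  have "C * d ^ (m + k) \<le> d ^ m" if d: "0 < d" "d \<le> 1/2" for d :: real
  proof -
    have "C * d ^ k \<le> 2 ^ k * (1/2) ^ k"
      using d k by (intro mult_mono power_mono) auto
    also have "\<dots> = 1" by (simp flip: power_mult_distrib)
    finally have "d ^ m * (C * d ^ k) \<le> d ^ m * 1" using d by (intro mult_left_mono) auto
    then show ?thesis by (simp add: power_add algebra_simps)
  qed
  then show ?thesis by (intro exI[of _ "m + k"]) auto
qed

lemma power_small_mono:
  fixes d :: real
  shows "0 < d \<Longrightarrow> d \<le> 1/2 \<Longrightarrow> p \<le> q \<Longrightarrow> d ^ q \<le> d ^ p"
  by (rule power_decreasing) auto

lemma power_small_range: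
  fixes d :: real
  assumes "0 < d" "d \<le> 1/2" "1 \<le> q"
  shows "0 < d ^ q" "d ^ q \<le> 1/2"
  using assms power_small_mono[of d 1 q] by auto

subsection \<open>Local estimates for the product\<close>

lemma function_algebra_bounded_lipschitz:
  fixes Z :: "'z::metric_space set"
  shows "function_algebra {u. \<exists>M\<ge>0. \<forall>z\<in>Z. \<forall>z'\<in>Z. \<bar>u z\<bar> \<le> M \<and> \<bar>u z - u z'\<bar> \<le> M * dist z z'}"
    (is "function_algebra ?A")
  unfolding function_algebra_def
proof (intro conjI allI ballI)
  fix c :: real
  show "(\<lambda>_. c) \<in> ?A" by (auto intro!: exI[of _ "\<bar>c\<bar>"])
next
  fix u v assume "u \<in> ?A" "v \<in> ?A"
  then obtain M M' where M: "M \<ge> 0" "\<And>z z'. z \<in> Z \<Longrightarrow> z' \<in> Z \<Longrightarrow> \<bar>u z\<bar> \<le> M \<and> \<bar>u z - u z'\<bar> \<le> M * dist z z'"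
    and M': "M' \<ge> 0" "\<And>z z'. z \<in> Z \<Longrightarrow> z' \<in> Z \<Longrightarrow> \<bar>v z\<bar> \<le> M' \<and> \<bar>v z - v z'\<bar> \<le> M' * dist z z'"
    by auto
  have "\<bar>u z + v z\<bar> \<le> M + M' \<and> \<bar>u z + v z - (u z' + v z')\<bar> \<le> (M + M') * dist z z'"
    if "z \<in> Z" "z' \<in> Z" for z z'
    using M(2)[OF that] M'(2)[OF that] by (simp add: distrib_right) linarith
  then show "(\<lambda>z. u z + v z) \<in> ?A" using M(1) M'(1) by (auto intro!: exI[of _ "M + M'"])
  have "\<bar>u z * v z\<bar> \<le> 2 * M * M' \<and> \<bar>u z * v z - u z' * v z'\<bar> \<le> 2 * M * M' * dist z z'"
    if "z \<in> Z" "z' \<in> Z" for z z'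
  proof
    have "\<bar>u z * v z\<bar> \<le> M * M'"
      using M(2)[OF that] M'(2)[OF that] M(1) M'(1) by (auto simp: abs_mult intro!: mult_mono)
    also have "\<dots> \<le> 2 * M * M'" using M(1) M'(1) by simp
    finally show "\<bar>u z * v z\<bar> \<le> 2 * M * M'" .
    have "\<bar>u z * v z - u z' * v z'\<bar> = \<bar>u z * (v z - v z') + (u z - u z') * v z'\<bar>"
      by (simp add: algebra_simps)
    also have "\<dots> \<le> \<bar>u z\<bar> * \<bar>v z - v z'\<bar> + \<bar>u z - u z'\<bar> * \<bar>v z'\<bar>"
      by (metis abs_mult abs_triangle_ineq)
    also have "\<dots> \<le> M * (M' * dist z z') + M * dist z z' * M'"
      using M(2)[OF that] M'(2)[OF that] M'(2)[OF that(2,1)] M(1) M'(1)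
      by (intro add_mono mult_mono) auto
    finally show "\<bar>u z * v z - u z' * v z'\<bar> \<le> 2 * M * M' * dist z z'" by (simp add: algebra_simps)
  qed
  then show "(\<lambda>z. u z * v z) \<in> ?A"
    using M(1) M'(1) by (auto intro!: exI[of _ "2 * M * M'"])
qed

context carnot_group
begin

lemma mult_lipschitz:
  "\<exists>C\<ge>0. \<forall>x y x' y'. norm x \<le> B \<and> norm y \<le> B \<and> norm x' \<le> B \<and> norm y' \<le> B \<longrightarrow>
     norm (x \<otimes> y - x' \<otimes> y') \<le> C * (norm (x - x') + norm (y - y'))"
proof -
  define Z where "Z = (cball 0 B :: 'a set) \<times> (cball 0 B :: 'a set)"
  let ?A = "{u. \<exists>M\<ge>0. \<forall>z\<in>Z. \<forall>z'\<in>Z. \<bar>u z\<bar> \<le> M \<and> \<bar>u z - u z'\<bar> \<le> M * dist z z'}"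
  have coord: "(\<lambda>z. fst z \<bullet> b) \<in> ?A" "(\<lambda>z. snd z \<bullet> b) \<in> ?A" if "b \<in> Basis" for b
  proof -
    have 1: "\<bar>x \<bullet> b\<bar> \<le> norm x" for x :: 'a using that by (rule Basis_le_norm)
    have 2: "\<bar>x \<bullet> b\<bar> \<le> max B 1 \<and> \<bar>x \<bullet> b - y \<bullet> b\<bar> \<le> max B 1 * e"
      if "norm x \<le> B" "dist x y \<le> e" "0 \<le> e" for x y :: 'a and e
    proof
      show "\<bar>x \<bullet> b\<bar> \<le> max B 1" using 1[of x] that(1) by linarith
      have "\<bar>x \<bullet> b - y \<bullet> b\<bar> \<le> e" using 1[of "x - y"] that(2) by (simp add: dist_norm inner_diff_left)
      also have "\<dots> \<le> max B 1 * e" using that(3) mult_right_mono[of 1 "max B 1" e] by simp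
      finally show "\<bar>x \<bullet> b - y \<bullet> b\<bar> \<le> max B 1 * e" .
    qed
    show "(\<lambda>z. fst z \<bullet> b) \<in> ?A"
      unfolding mem_Collect_eq Z_def
      by (intro exI[of _ "max B 1"] conjI[OF _ ballI[OF ballI[OF 2]]]) (auto simp: dist_fst_le)
    show "(\<lambda>z. snd z \<bullet> b) \<in> ?A"
      unfolding mem_Collect_eq Z_def
      by (intro exI[of _ "max B 1"] conjI[OF _ ballI[OF ballI[OF 2]]]) (auto simp: dist_snd_le)
  qed
  have "(\<lambda>z. (fst z \<otimes> snd z) \<bullet> b) \<in> ?A" if "b \<in> Basis" for b
    by (rule mult_coordinates_closed[OF function_algebra_bounded_lipschitz]) (use coord that in auto)
  then have "\<forall>b\<in>Basis. \<exists>M\<ge>0. \<forall>z\<in>Z. \<forall>z'\<in>Z.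
      \<bar>(fst z \<otimes> snd z) \<bullet> b - (fst z' \<otimes> snd z') \<bullet> b\<bar> \<le> M * dist z z'"
    by blast
  then obtain M where M: "\<And>b. b \<in> Basis \<Longrightarrow> M b \<ge> 0"
    "\<And>b z z'. b \<in> Basis \<Longrightarrow> z \<in> Z \<Longrightarrow> z' \<in> Z \<Longrightarrow>
      \<bar>(fst z \<otimes> snd z) \<bullet> b - (fst z' \<otimes> snd z') \<bullet> b\<bar> \<le> M b * dist z z'"
    by (metis (no_types, lifting))
  have "norm (x \<otimes> y - x' \<otimes> y') \<le> sum M Basis * (norm (x - x') + norm (y - y'))"
    if "norm x \<le> B" "norm y \<le> B" "norm x' \<le> B" "norm y' \<le> B" for x y x' y'
  proof -
    have d: "dist (x, y) (x', y') \<le> norm (x - x') + norm (y - y')"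
      using norm_Pair_le[of "x - x'" "y - y'"] by (simp add: dist_norm)
    have "norm (x \<otimes> y - x' \<otimes> y') \<le> (\<Sum>b\<in>Basis. \<bar>(x \<otimes> y - x' \<otimes> y') \<bullet> b\<bar>)" by (rule norm_le_l1)
    also have "\<dots> \<le> (\<Sum>b\<in>Basis. M b * (norm (x - x') + norm (y - y')))"
    proof (rule sum_mono)
      fix b :: 'a assume b: "b \<in> Basis"
      have "\<bar>(x \<otimes> y - x' \<otimes> y') \<bullet> b\<bar> \<le> M b * dist (x, y) (x', y')"
        using M(2)[OF b, of "(x, y)" "(x', y')"] that by (simp add: Z_def inner_diff_left)
      also have "\<dots> \<le> M b * (norm (x - x') + norm (y - y'))"
        using d M(1)[OF b] by (rule mult_left_mono)
      finally show "\<bar>(x \<otimes> y - x' \<otimes> y') \<bullet> b\<bar> \<le> M b * (norm (x - x') + norm (y - y'))" .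
    qed
    finally show ?thesis by (simp add: sum_distrib_right)
  qed
  then show ?thesis using M(1) by (intro exI[of _ "sum M Basis"]) (auto intro: sum_nonneg)
qed

lemma mult_bounded: "\<exists>C\<ge>0. \<forall>x y. norm x \<le> B \<and> norm y \<le> B \<longrightarrow> norm (x \<otimes> y) \<le> C"
proof -
  obtain C where C: "C \<ge> 0" "\<And>x y x' y'. norm x \<le> B \<and> norm y \<le> B \<and> norm x' \<le> B \<and> norm y' \<le> B \<Longrightarrow>
     norm (x \<otimes> y - x' \<otimes> y') \<le> C * (norm (x - x') + norm (y - y'))"
    using mult_lipschitz[of B] by blast
  have "norm (x \<otimes> y) \<le> C * (B + B)" if "norm x \<le> B" "norm y \<le> B" for x y
  proof -
    have "0 \<le> B" using that norm_ge_zero order_trans by blast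
    with C(2)[of x y 0 0] that have "norm (x \<otimes> y) \<le> C * (norm x + norm y)" by simp
    also have "\<dots> \<le> C * (B + B)" using that C(1) by (intro mult_left_mono add_mono) auto
    finally show ?thesis .
  qed
  then show ?thesis by (intro exI[of _ "\<bar>C * (B + B)\<bar>"]) (auto intro: order_trans[OF _ abs_ge_self])
qed

lemma continuous_on_mult [continuous_intros]:
  fixes S :: "'z::t2_space set"
  assumes "continuous_on S f" "continuous_on S g"
  shows "continuous_on S (\<lambda>z. f z \<otimes> g z)"
proof -
  have A: "function_algebra {u. continuous_on S u}"
    by (auto simp: function_algebra_def intro!: continuous_intros)
  have "(\<lambda>z. (f z \<otimes> g z) \<bullet> b) \<in> {u. continuous_on S u}" if "b \<in> Basis" for b
    using assms that by (intro mult_coordinates_closed[OF A]) (auto intro!: continuous_intros)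
  then have "continuous_on S (\<lambda>z. (f z \<otimes> g z) \<bullet> b)" if "b \<in> Basis" for b using that by simp
  then show ?thesis using continuous_on_componentwise[of S "\<lambda>z. f z \<otimes> g z"] by blast
qed

lemma differentiable_mult:
  assumes "f differentiable at z" "g differentiable at z"
  shows "(\<lambda>z. f z \<otimes> g z) differentiable at z"
proof -
  have A: "function_algebra {u. u differentiable at z}"
    by (auto simp: function_algebra_def intro!: differentiable_add differentiable_mult)
  have "(\<lambda>z. (f z \<otimes> g z) \<bullet> b) \<in> {u. u differentiable at z}" if "b \<in> Basis" for b
    using assms that
    by (intro mult_coordinates_closed[OF A]) (auto simp: differentiable_componentwise_within[where f = f]
        differentiable_componentwise_within[where f = g])
  then show ?thesis by (subst differentiable_componentwise_within) auto
qed

lemma bounded_linear_component: "bounded_linear (component G j)"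
  using linear_component linear_conv_bounded_linear by blast

lemma bounded_linear_dilation: "bounded_linear (dilation G c)"
  using linear_dilation linear_conv_bounded_linear by blast

lemmas continuous_on_component [continuous_intros] =
    bounded_linear.continuous_on[OF bounded_linear_component]
  and continuous_on_dilation [continuous_intros] =
    bounded_linear.continuous_on[OF bounded_linear_dilation]

lemma component_bound: "\<exists>K\<ge>0. \<forall>j x. norm (component G j x) \<le> K * norm x"
proof -
  have "\<forall>j. \<exists>K. \<forall>x. norm (component G j x) \<le> norm x * K"
    using bounded_linear.bounded[OF bounded_linear_component] by blast
  then obtain K where K: "\<And>j x. norm (component G j x) \<le> norm x * K j" by metis
  let ?K = "\<Sum>j = 1..step G. \<bar>K j\<bar>"
  have "norm (component G j x) \<le> ?K * norm x" for j x
  proof (cases "j \<in> {1..step G}")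
    case True
    then have "\<bar>K j\<bar> \<le> ?K" by (intro member_le_sum) auto
    then have "K j \<le> ?K" by linarith
    then have "norm x * K j \<le> norm x * ?K" by (intro mult_left_mono) auto
    then show ?thesis using K[of j x] by (simp add: mult.commute)
  next
    case False
    then show ?thesis by (simp add: component_outside sum_nonneg)
  qed
  then show ?thesis by (intro exI[of _ ?K]) (auto intro: sum_nonneg)
qed

subsection \<open>Homogeneous norms\<close>

text \<open>A concrete homogeneous norm, with which the given one and the Carnot--Caratheodory distance are compared.\<close>

definition hnorm :: "'a \<Rightarrow> real" where
  "hnorm x = (\<Sum>j = 1..step G. root j (norm (component G j x)))"

abbreviation hdist :: "'a \<Rightarrow> 'a \<Rightarrow> real" where "hdist x y \<equiv> hnorm (- x \<otimes> y)"

lemma hnorm_nonneg: "0 \<le> hnorm x"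
  unfolding hnorm_def by (intro sum_nonneg real_root_ge_zero norm_ge_zero)

lemma hnorm_ge: "j \<in> {1..step G} \<Longrightarrow> root j (norm (component G j x)) \<le> hnorm x"
  unfolding hnorm_def by (rule member_le_sum[of j]) (assumption, rule real_root_ge_zero, simp_all)

lemma norm_component_le_hnorm:
  assumes "j \<in> {1..step G}"
  shows "norm (component G j x) \<le> hnorm x ^ j"
proof -
  have "norm (component G j x) = root j (norm (component G j x)) ^ j" using assms by simp
  also have "\<dots> \<le> hnorm x ^ j" by (intro power_mono hnorm_ge assms real_root_ge_zero norm_ge_zero)
  finally show ?thesis .
qed

lemma norm_le_hnorm: "norm x \<le> (\<Sum>j = 1..step G. hnorm x ^ j)"
proof -
  have "norm x \<le> (\<Sum>j = 1..step G. norm (component G j x))"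
    by (subst sum_component[of x, symmetric]) (rule norm_sum)
  also have "\<dots> \<le> (\<Sum>j = 1..step G. hnorm x ^ j)" by (intro sum_mono norm_component_le_hnorm)
  finally show ?thesis .
qed

lemma hnorm_dilation: "0 \<le> c \<Longrightarrow> hnorm (dilation G c x) = c * hnorm x"
  unfolding hnorm_def sum_distrib_left
  by (intro sum.cong) (auto simp: component_dilation real_root_mult real_root_power_cancel abs_mult)

lemma hnorm_neg [simp]: "hnorm (- x) = hnorm x"
  by (simp add: hnorm_def component_neg)

lemma hnorm_zero [simp]: "hnorm 0 = 0"
  by (simp add: hnorm_def)

lemma hnorm_eq_zero: "hnorm x = 0 \<longleftrightarrow> x = 0"
proof
  assume "hnorm x = 0"
  then show "x = 0" using norm_le_hnorm[of x] by (simp add: power_0_left)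
qed simp

lemma continuous_on_hnorm [continuous_intros]: "continuous_on S f \<Longrightarrow> continuous_on S (\<lambda>z. hnorm (f z))"
  unfolding hnorm_def by (intro continuous_intros) auto

lemma homogeneous_norm_hnorm: "homogeneous_norm G hnorm"
  by (auto simp: homogeneous_norm_def hnorm_nonneg inv_eq_neg hnorm_dilation hnorm_eq_zero
      intro!: continuous_intros)

lemma hnorm_layer1: "x \<in> layer G 1 \<Longrightarrow> hnorm x = norm x"
proof -
  assume x: "x \<in> layer G 1"
  have "hnorm x = (\<Sum>j = 1..step G. if j = 1 then norm x else 0)"
    unfolding hnorm_def by (intro sum.cong) (auto simp: component_layer[OF x])
  then show ?thesis using step_pos by simp
qed

lemma norm_bounded_if_hnorm: "\<exists>C\<ge>0. \<forall>x. hnorm x \<le> B \<longrightarrow> norm x \<le> C"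
proof -
  have "norm x \<le> (\<Sum>j = 1..step G. \<bar>B\<bar> ^ j)" if "hnorm x \<le> B" for x
    using norm_le_hnorm[of x] that hnorm_nonneg[of x]
    by (elim order_trans) (intro sum_mono power_mono, auto)
  then show ?thesis by (intro exI[of _ "\<Sum>j = 1..step G. \<bar>B\<bar> ^ j"]) (auto intro: sum_nonneg)
qed

lemma hnorm_bounded_if_norm: "\<exists>C\<ge>0. \<forall>x. norm x \<le> B \<longrightarrow> hnorm x \<le> C"
proof -
  obtain K where K: "K \<ge> 0" "\<And>j x. norm (component G j x) \<le> K * norm x"
    using component_bound by blast
  have "hnorm x \<le> (\<Sum>j = 1..step G. root j (K * \<bar>B\<bar>))" if "norm x \<le> B" for x
    unfolding hnorm_def
  proof (intro sum_mono real_root_le_mono)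
    show "norm (component G j x) \<le> K * \<bar>B\<bar>" for j
      using K(2)[of j x] that K(1) by (elim order_trans) (intro mult_left_mono, auto)
  qed auto
  then show ?thesis using K(1)
    by (intro exI[of _ "\<Sum>j = 1..step G. root j (K * \<bar>B\<bar>)"]) (auto intro: sum_nonneg)
qed

lemma hnorm_small_if_norm: "\<exists>q\<ge>1. \<forall>d x. 0 < d \<and> d \<le> 1/2 \<and> norm x \<le> d ^ q \<longrightarrow> hnorm x \<le> d"
proof -
  obtain K where K: "K \<ge> 0" "\<And>j x. norm (component G j x) \<le> K * norm x"
    using component_bound by blast
  let ?r = "real (step G)"
  obtain q where q: "q \<ge> step G" "\<And>d. 0 < d \<and> d \<le> 1/2 \<Longrightarrow> (K * ?r ^ step G) * d ^ q \<le> d ^ step G"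
    using absorb_constant[of "step G" "K * ?r ^ step G"] by blast
  have r: "?r \<ge> 1" using step_pos by simp
  have "hnorm x \<le> d" if d: "0 < d" "d \<le> 1/2" and x: "norm x \<le> d ^ q" for d x
  proof -
    have "root j (norm (component G j x)) \<le> d / ?r" if j: "j \<in> {1..step G}" for j
    proof -
      have "norm (component G j x) \<le> K * d ^ q"
        using K(2)[of j x] x K(1) by (elim order_trans) (intro mult_left_mono, auto)
      also have "\<dots> \<le> (d / ?r) ^ step G"
        using q(2)[of d] d r by (simp add: power_divide field_simps)
      also have "\<dots> \<le> (d / ?r) ^ j"
        using j d r by (intro power_decreasing) (auto simp: divide_le_eq)
      finally have "root j (norm (component G j x)) \<le> root j ((d / ?r) ^ j)"
        using j by (intro real_root_le_mono) auto
      then show ?thesis using j d by (simp add: real_root_power_cancel)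
    qed
    then have "hnorm x \<le> (\<Sum>j = 1..step G. d / ?r)" unfolding hnorm_def by (intro sum_mono)
    then show ?thesis using r by simp
  qed
  then show ?thesis using q(1) step_pos by (intro exI[of _ q]) auto
qed

lemma norm_small_if_hnorm: "\<exists>q\<ge>1. \<forall>d x. 0 < d \<and> d \<le> 1/2 \<and> hnorm x \<le> d ^ q \<longrightarrow> norm x \<le> d"
proof -
  let ?r = "real (step G)"
  obtain q where q: "q \<ge> 1" "\<And>d. 0 < d \<and> d \<le> 1/2 \<Longrightarrow> ?r * d ^ q \<le> d ^ 1"
    using absorb_constant[of 1 "?r"] by blast
  have "norm x \<le> d" if d: "0 < d" "d \<le> 1/2" and x: "hnorm x \<le> d ^ q" for d x
  proof -
    have "hnorm x \<le> 1" using x power_small_range[OF d q(1)] by linarith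
    then have "hnorm x ^ j \<le> d ^ q" if "j \<in> {1..step G}" for j
      using that x hnorm_nonneg[of x] power_decreasing[of 1 j "hnorm x"] by simp
    then have "norm x \<le> (\<Sum>j = 1..step G. d ^ q)"
      using norm_le_hnorm[of x] by (elim order_trans) (intro sum_mono)
    then show ?thesis using q(2)[of d] d by simp
  qed
  then show ?thesis using q(1) by blast
qed

end

text \<open>A homogeneous norm is comparable to \<open>hnorm\<close>, because the unit sphere of \<open>hnorm\<close> is compact.\<close>

locale normed_carnot_group = carnot_group +
  fixes N :: "'a \<Rightarrow> real"
  assumes homogeneous_norm: "homogeneous_norm G N"
begin

lemma N_nonneg: "0 \<le> N x"
  and N_neg [simp]: "N (- x) = N x"
  and N_eq_zero: "N x = 0 \<longleftrightarrow> x = 0"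
  using homogeneous_norm by (auto simp: homogeneous_norm_def inv_eq_neg)

lemma N_zero [simp]: "N 0 = 0" by (simp add: N_eq_zero)

lemma N_dilation: "0 \<le> c \<Longrightarrow> N (dilation G c x) = c * N x"
  using homogeneous_norm by (cases "c = 0") (auto simp: homogeneous_norm_def)

lemma continuous_on_N [continuous_intros]: "continuous_on S f \<Longrightarrow> continuous_on S (\<lambda>z. N (f z))"
  using homogeneous_norm continuous_on_compose2[of UNIV N S f] by (auto simp: homogeneous_norm_def)

lemma hom_dist_eq: "hom_dist G N x y = N (- x \<otimes> y)"
  by (simp add: hom_dist_def inv_eq_neg)

lemma N_comparable: "\<exists>c>0. \<exists>C>0. \<forall>x. c * hnorm x \<le> N x \<and> N x \<le> C * hnorm x"
proof -
  let ?S = "{x. hnorm x = 1}"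
  obtain B where "\<And>x. hnorm x \<le> 1 \<Longrightarrow> norm x \<le> B" using norm_bounded_if_hnorm[of 1] by blast
  then have "\<forall>x\<in>?S. norm x \<le> B" by simp
  then have "bounded ?S" unfolding bounded_iff by blast
  moreover have "closed ?S" by (intro closed_Collect_eq continuous_intros)
  ultimately have S: "compact ?S" by (simp add: compact_eq_bounded_closed)
  have scale: "dilation G (1 / hnorm x) x \<in> ?S" "N x = hnorm x * N (dilation G (1 / hnorm x) x)" if "x \<noteq> 0" for x
  proof -
    have "hnorm x > 0" using that hnorm_nonneg[of x] hnorm_eq_zero[of x] by linarith
    then show "dilation G (1 / hnorm x) x \<in> ?S" "N x = hnorm x * N (dilation G (1 / hnorm x) x)"
      by (simp_all add: hnorm_dilation N_dilation)
  qed
  obtain x0 where "x0 \<in> layer G (step G)" "x0 \<noteq> 0"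
    using layer_top subspace_0[OF layer_subspace] by blast
  then have ne: "?S \<noteq> {}" using scale(1)[of x0] by blast
  obtain u where u: "u \<in> ?S" "\<And>x. x \<in> ?S \<Longrightarrow> N u \<le> N x"
    using continuous_attains_inf[OF S ne continuous_on_N[OF continuous_on_id]] by auto
  obtain v where v: "v \<in> ?S" "\<And>x. x \<in> ?S \<Longrightarrow> N x \<le> N v"
    using continuous_attains_sup[OF S ne continuous_on_N[OF continuous_on_id]] by auto
  have pos: "0 < N u" using u(1) N_nonneg[of u] N_eq_zero[of u] by (auto simp: less_le)
  have "N u * hnorm x \<le> N x \<and> N x \<le> N v * hnorm x" for x
  proof (cases "x = 0")
    case False
    have "hnorm x * N u \<le> hnorm x * N (dilation G (1 / hnorm x) x)"
      "hnorm x * N (dilation G (1 / hnorm x) x) \<le> hnorm x * N v"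
      using u(2) v(2) scale(1)[OF False] by (auto intro!: mult_left_mono hnorm_nonneg)
    then show ?thesis using scale(2)[OF False] by (simp add: mult.commute)
  qed simp
  moreover have "0 < N v" using pos u(1) v(2) by fastforce
  ultimately show ?thesis using pos by blast
qed

lemma norm_bounded_if_N: "\<exists>C\<ge>0. \<forall>x. N x \<le> B \<longrightarrow> norm x \<le> C"
proof -
  obtain c C where c: "c > 0" "\<And>x. c * hnorm x \<le> N x" using N_comparable by blast
  obtain C where C: "C \<ge> 0" "\<And>x. hnorm x \<le> B / c \<Longrightarrow> norm x \<le> C" using norm_bounded_if_hnorm by blast
  have "hnorm x \<le> B / c" if "N x \<le> B" for x
    using c(2)[of x] that c(1) by (simp add: field_simps)
  then show ?thesis using C by blast
qed

lemma N_bounded_if_norm: "\<exists>C\<ge>0. \<forall>x. norm x \<le> B \<longrightarrow> N x \<le> C"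
proof -
  obtain c where c: "c > 0" "\<And>x. N x \<le> c * hnorm x" using N_comparable by blast
  obtain C where C: "C \<ge> 0" "\<And>x. norm x \<le> B \<Longrightarrow> hnorm x \<le> C" using hnorm_bounded_if_norm by blast
  have "N x \<le> c * C" if "norm x \<le> B" for x
    using c(2)[of x] C(2)[OF that] c(1) by (meson mult_left_mono order_trans less_imp_le)
  then show ?thesis using C c(1) by (intro exI[of _ "c * C"]) auto
qed

lemma N_small_if_norm: "\<exists>q\<ge>1. \<forall>d x. 0 < d \<and> d \<le> 1/2 \<and> norm x \<le> d ^ q \<longrightarrow> N x \<le> d"
proof -
  obtain c where c: "c > 0" "\<And>x. N x \<le> c * hnorm x" using N_comparable by blast
  obtain q where q: "q \<ge> 1" "\<And>d. 0 < d \<and> d \<le> 1/2 \<Longrightarrow> c * d ^ q \<le> d ^ 1"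
    using absorb_constant[of 1 c] by blast
  obtain q' where q': "q' \<ge> 1" "\<And>d x. 0 < d \<and> d \<le> 1/2 \<and> norm x \<le> d ^ q' \<Longrightarrow> hnorm x \<le> d"
    using hnorm_small_if_norm by blast
  have "N x \<le> d" if d: "0 < d" "d \<le> 1/2" and x: "norm x \<le> d ^ (q * q')" for d x
  proof -
    have "hnorm x \<le> d ^ q" using x power_small_range[OF d q(1)] by (intro q'(2)) (simp add: power_mult)
    then have "c * hnorm x \<le> c * d ^ q" using c(1) by simp
    then show ?thesis using c(2)[of x] q(2)[of d] d by simp
  qed
  then show ?thesis using q(1) q'(1) by (intro exI[of _ "q * q'"]) auto
qed

lemma norm_small_if_N: "\<exists>q\<ge>1. \<forall>d x. 0 < d \<and> d \<le> 1/2 \<and> N x \<le> d ^ q \<longrightarrow> norm x \<le> d"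
proof -
  obtain c where c: "c > 0" "\<And>x. c * hnorm x \<le> N x" using N_comparable by blast
  obtain q' where q': "q' \<ge> 1" "\<And>d x. 0 < d \<and> d \<le> 1/2 \<and> hnorm x \<le> d ^ q' \<Longrightarrow> norm x \<le> d"
    using norm_small_if_hnorm by blast
  obtain q where q: "q \<ge> q'" "\<And>d. 0 < d \<and> d \<le> 1/2 \<Longrightarrow> 1 / c * d ^ q \<le> d ^ q'"
    using absorb_constant[of q' "1 / c"] by blast
  have "norm x \<le> d" if d: "0 < d" "d \<le> 1/2" and x: "N x \<le> d ^ q" for d x
  proof -
    have "hnorm x \<le> 1 / c * N x" using c(2)[of x] c(1) by (simp add: field_simps)
    also have "\<dots> \<le> 1 / c * d ^ q" using x c(1) by (intro mult_left_mono) auto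
    also have "\<dots> \<le> d ^ q'" using q(2) d by blast
    finally show ?thesis using q'(2) d by blast
  qed
  then show ?thesis using q(1) q'(1) by (intro exI[of _ q]) auto
qed

text \<open>By homogeneity it is enough to bound \<open>N\<close> on products of two elements of its unit ball, which is bounded.\<close>

lemma N_quasi_triangle: "\<exists>C\<ge>1. \<forall>x y. N (x \<otimes> y) \<le> C * (N x + N y)"
proof -
  obtain B where B: "B \<ge> 0" "\<And>x. N x \<le> 1 \<Longrightarrow> norm x \<le> B" using norm_bounded_if_N[of 1] by blast
  obtain B' where B': "\<And>x y. norm x \<le> B \<and> norm y \<le> B \<Longrightarrow> norm (x \<otimes> y) \<le> B'"
    using mult_bounded[of B] by blast
  obtain C where C: "C \<ge> 0" "\<And>x. norm x \<le> B' \<Longrightarrow> N x \<le> C" using N_bounded_if_norm[of B'] by blast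
  have "N (x \<otimes> y) \<le> (C + 1) * (N x + N y)" for x y
  proof (cases "x = 0 \<and> y = 0")
    case False
    define s where "s = N x + N y"
    have s: "s > 0" using False N_nonneg[of x] N_nonneg[of y] N_eq_zero[of x] N_eq_zero[of y]
      unfolding s_def by (metis add_nonneg_eq_0_iff add_nonneg_nonneg less_eq_real_def)
    have "N (dilation G (1 / s) x) \<le> 1" "N (dilation G (1 / s) y) \<le> 1"
      using s N_nonneg[of x] N_nonneg[of y] by (simp_all add: N_dilation s_def)
    then have "N (dilation G (1 / s) x \<otimes> dilation G (1 / s) y) \<le> C"
      using B(2) B' C(2) by blast
    then have "1 / s * N (x \<otimes> y) \<le> C" using s by (simp add: dilation_mult[symmetric] N_dilation)
    then have "N (x \<otimes> y) \<le> C * s" using s by (simp add: field_simps)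
    also have "\<dots> \<le> (C + 1) * s" using s by simp
    finally show ?thesis by (simp add: s_def)
  qed simp
  then show ?thesis using C(1) by (intro exI[of _ "C + 1"]) auto
qed

text \<open>Euclidean and homogeneous distance are comparable on bounded sets up to a power; this lemma and the next
  translate smallness from one to the other.\<close>

lemma N_dist_small_if_norm:
  "\<exists>q\<ge>1. \<forall>d x y. 0 < d \<and> d \<le> 1/2 \<and> norm x \<le> B \<and> norm y \<le> B \<and> norm (x - y) \<le> d ^ q \<longrightarrow>
     N (- x \<otimes> y) \<le> d"
proof -
  obtain C where C: "C \<ge> 0" "\<And>x y x' y'. norm x \<le> B \<and> norm y \<le> B \<and> norm x' \<le> B \<and> norm y' \<le> B \<Longrightarrow>
     norm (x \<otimes> y - x' \<otimes> y') \<le> C * (norm (x - x') + norm (y - y'))"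
    using mult_lipschitz[of B] by blast
  obtain q' where q': "q' \<ge> 1" "\<And>d x. 0 < d \<and> d \<le> 1/2 \<and> norm x \<le> d ^ q' \<Longrightarrow> N x \<le> d"
    using N_small_if_norm by blast
  obtain q where q: "q \<ge> q'" "\<And>d. 0 < d \<and> d \<le> 1/2 \<Longrightarrow> C * d ^ q \<le> d ^ q'"
    using absorb_constant[of q' C] by blast
  have "N (- x \<otimes> y) \<le> d"
    if d: "0 < d" "d \<le> 1/2" and xy: "norm x \<le> B" "norm y \<le> B" "norm (x - y) \<le> d ^ q" for d x y
  proof -
    have "norm (- x \<otimes> y) \<le> C * norm (x - y)"
      using C(2)[of "- x" y "- x" x] xy by (simp add: norm_minus_commute)
    also have "\<dots> \<le> C * d ^ q" using xy C(1) by (intro mult_left_mono)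
    also have "\<dots> \<le> d ^ q'" using q(2) d by blast
    finally show ?thesis using q'(2) d by blast
  qed
  then show ?thesis using q(1) q'(1) by (intro exI[of _ q]) auto
qed

lemma norm_dist_small_if_N:
  "\<exists>q\<ge>1. \<forall>d x y. 0 < d \<and> d \<le> 1/2 \<and> norm x \<le> B \<and> N (- x \<otimes> y) \<le> d ^ q \<longrightarrow> norm (x - y) \<le> d"
proof -
  obtain C where C: "C \<ge> 0" "\<And>x y x' y'. norm x \<le> max B 1 \<and> norm y \<le> max B 1 \<and> norm x' \<le> max B 1 \<and> norm y' \<le> max B 1 \<Longrightarrow>
     norm (x \<otimes> y - x' \<otimes> y') \<le> C * (norm (x - x') + norm (y - y'))"
    using mult_lipschitz[of "max B 1"] by blast
  obtain q1 where q1: "q1 \<ge> 1" "\<And>d x. 0 < d \<and> d \<le> 1/2 \<and> N x \<le> d ^ q1 \<Longrightarrow> norm x \<le> d"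
    using norm_small_if_N by blast
  obtain q where q: "q \<ge> 1" "\<And>d. 0 < d \<and> d \<le> 1/2 \<Longrightarrow> C * d ^ q \<le> d ^ 1"
    using absorb_constant[of 1 C] by blast
  have "norm (x - y) \<le> d"
    if d: "0 < d" "d \<le> 1/2" and xy: "norm x \<le> B" "N (- x \<otimes> y) \<le> d ^ (q * q1)" for d x y
  proof -
    have u: "norm (- x \<otimes> y) \<le> d ^ q"
      using xy(2) power_small_range[OF d q(1)] by (intro q1(2)) (simp add: power_mult)
    then have "norm (- x \<otimes> y) \<le> 1" using power_small_range[OF d q(1)] by linarith
    then have "norm (x \<otimes> 0 - x \<otimes> (- x \<otimes> y)) \<le> C * (norm (x - x) + norm (0 - (- x \<otimes> y)))"
      using xy by (intro C(2)) auto
    then have "norm (x - y) \<le> C * norm (- x \<otimes> y)" by simp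
    also have "\<dots> \<le> C * d ^ q" using u C(1) by (intro mult_left_mono)
    also have "\<dots> \<le> d" using q(2)[of d] d by simp
    finally show ?thesis .
  qed
  then show ?thesis using q(1) q1(1) by (intro exI[of _ "q * q1"]) auto
qed

end

section \<open>Horizontal words reach every point\<close>

context carnot_group
begin

lemma normed_hnorm: "normed_carnot_group G hnorm"
  by unfold_locales (rule homogeneous_norm_hnorm)

lemmas hnorm_quasi_triangle = normed_carnot_group.N_quasi_triangle[OF normed_hnorm]

text \<open>The letters are kept apart from the vectors \<open>a e\<close> assigned to them, because the same word is read in two groups:
  this is how a map is compared with a homomorphism.\<close>

fun wprod :: "('e \<Rightarrow> 'a) \<Rightarrow> (real \<times> 'e) list \<Rightarrow> 'a" where
  "wprod a [] = 0"
| "wprod a ((t, e) # ws) = (t *\<^sub>R a e) \<otimes> wprod a ws"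

abbreviation hword :: "(real \<times> 'a) list \<Rightarrow> 'a" where "hword \<equiv> wprod (\<lambda>b. b)"

lemma wprod_append: "wprod a (ws @ vs) = wprod a ws \<otimes> wprod a vs"
  by (induction ws) (auto simp: mult_assoc)

end

definition word_inverse :: "(real \<times> 'e) list \<Rightarrow> (real \<times> 'e) list" where
  "word_inverse ws = rev (map (\<lambda>(t, e). (- t, e)) ws)"

definition word_scale :: "real \<Rightarrow> (real \<times> 'e) list \<Rightarrow> (real \<times> 'e) list" where
  "word_scale c ws = map (\<lambda>(t, e). (c * t, e)) ws"

definition words :: "'e set \<Rightarrow> nat \<Rightarrow> real \<Rightarrow> (real \<times> 'e) list set" where
  "words E n \<tau> = {ws. length ws \<le> n \<and> set ws \<subseteq> {-\<tau>..\<tau>} \<times> E}"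

lemma word_inverse_words: "ws \<in> words E n \<tau> \<Longrightarrow> word_inverse ws \<in> words E n \<tau>"
  by (fastforce simp: words_def word_inverse_def)

lemma word_scale_words: "ws \<in> words E n \<tau> \<Longrightarrow> 0 \<le> c \<Longrightarrow> word_scale c ws \<in> words E n (c * \<tau>)"
proof -
  assume ws: "ws \<in> words E n \<tau>" and c: "0 \<le> c"
  have "- (c * \<tau>) \<le> c * t \<and> c * t \<le> c * \<tau>" if "- \<tau> \<le> t" "t \<le> \<tau>" for t
    using mult_left_mono[OF that(1) c] mult_left_mono[OF that(2) c] by simp
  with ws show ?thesis by (fastforce simp: words_def word_scale_def)
qed

lemma append_words: "ws \<in> words E n \<tau> \<Longrightarrow> vs \<in> words E m \<tau> \<Longrightarrow> ws @ vs \<in> words E (n + m) \<tau>"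
  by (auto simp: words_def)

lemma words_mono: "ws \<in> words E n \<tau> \<Longrightarrow> n \<le> m \<Longrightarrow> \<tau> \<le> \<tau>' \<Longrightarrow> ws \<in> words E m \<tau>'"
  by (fastforce simp: words_def)

lemma in_some_words: "set ws \<subseteq> UNIV \<times> E \<Longrightarrow> \<exists>\<tau>. ws \<in> words E (length ws) \<tau>"
proof (induction ws)
  case (Cons w ws)
  then obtain \<tau> where "ws \<in> words E (length ws) \<tau>" by auto
  then have "ws \<in> words E (length ws) (max \<tau> \<bar>fst w\<bar>)" by (rule words_mono) auto
  with Cons.prems have "w # ws \<in> words E (length (w # ws)) (max \<tau> \<bar>fst w\<bar>)"
    by (cases w) (auto simp: words_def max_def abs_le_iff)
  then show ?case by blast
qed (auto simp: words_def)

context carnot_group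
begin

lemma wprod_inverse: "wprod a (word_inverse ws) = - wprod a ws"
  by (induction ws) (auto simp: word_inverse_def wprod_append neg_mult)

lemma wprod_scale:
  assumes "\<And>t e. (t, e) \<in> set ws \<Longrightarrow> a e \<in> layer G 1"
  shows "wprod a (word_scale c ws) = dilation G c (wprod a ws)"
  using assms
proof (induction ws)
  case (Cons w ws)
  obtain t e where w: "w = (t, e)" by (cases w)
  have "a e \<in> layer G 1" using Cons.prems[of t e] by (simp add: w)
  then have 1: "dilation G c (t *\<^sub>R a e) = (c * t) *\<^sub>R a e"
    by (simp add: dilation_scaleR dilation_layer[of "a e" 1] mult.commute)
  have 2: "wprod a (word_scale c ws) = dilation G c (wprod a ws)"
    using Cons.IH Cons.prems by (metis list.set_intros(2))
  have "word_scale c (w # ws) = (c * t, e) # word_scale c ws" by (simp add: w word_scale_def)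
  then show ?case by (simp only: w wprod.simps 1 2 dilation_mult)
qed (simp add: word_scale_def)

definition hbasis :: "'a set" where
  "hbasis = (SOME B. finite B \<and> B \<subseteq> layer G 1 \<and> span B = layer G 1)"

lemma hbasis: "finite hbasis" "hbasis \<subseteq> layer G 1" "span hbasis = layer G 1"
proof -
  obtain B where B: "B \<subseteq> layer G 1" "independent B" "layer G 1 \<subseteq> span B"
    by (rule basis_exists)
  moreover have "span B \<subseteq> layer G 1" using B(1) layer_subspace by (rule span_minimal)
  ultimately have "finite B \<and> B \<subseteq> layer G 1 \<and> span B = layer G 1"
    using layer_subspace independent_imp_finite by blast
  then have "finite hbasis \<and> hbasis \<subseteq> layer G 1 \<and> span hbasis = layer G 1"
    unfolding hbasis_def by (rule someI)
  then show "finite hbasis" "hbasis \<subseteq> layer G 1" "span hbasis = layer G 1" by auto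
qed

lemma dilation_filt: "x \<in> filt m \<Longrightarrow> dilation G c x \<in> filt m"
  by (simp add: filt_def component_dilation)

lemma mult_leading:
  assumes "u - x \<in> filt (Suc j)" "v - y \<in> filt (Suc j)" "y \<in> filt j"
  shows "u \<otimes> v - (x + y) \<in> filt (Suc j)"
proof -
  have "v \<in> filt j"
    using filt_add[OF filt_mono[OF assms(2), of j] assms(3)] by simp
  then have "u \<otimes> (0 + v) - u \<otimes> 0 - v \<in> filt (Suc j)" by (rule mult_increment_right)
  from filt_add[OF this filt_add[OF assms(1,2)]] show ?thesis by (simp add: algebra_simps)
qed

text \<open>\<open>lead j\<close> consists of the vectors of layer \<open>j\<close> that are leading terms of values of words.  Products,
  dilations and group commutators of words add, scale and bracket the leading terms; so the \<open>lead j\<close>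
  span a subalgebra, which is everything because it contains the generating layer.\<close>

definition lead :: "nat \<Rightarrow> 'a set" where
  "lead j = {x \<in> layer G j. \<exists>ws. set ws \<subseteq> UNIV \<times> hbasis \<and> hword ws - x \<in> filt (Suc j)}"

lemma set_word_inverse: "set ws \<subseteq> UNIV \<times> E \<Longrightarrow> set (word_inverse ws) \<subseteq> UNIV \<times> E"
  and set_word_scale: "set ws \<subseteq> UNIV \<times> E \<Longrightarrow> set (word_scale c ws) \<subseteq> UNIV \<times> E"
  by (auto simp: word_inverse_def word_scale_def)

lemma wprod_id_scale:
  "set ws \<subseteq> UNIV \<times> hbasis \<Longrightarrow> hword (word_scale c ws) = dilation G c (hword ws)"
  using hbasis(2) by (intro wprod_scale) auto

text \<open>The leading term in layer \<open>j\<close> is multiplied by \<open>c\<close>: a dilation by a root gives the modulus, inversion the sign.\<close>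

definition word_multiple :: "nat \<Rightarrow> real \<Rightarrow> (real \<times> 'e) list \<Rightarrow> (real \<times> 'e) list" where
  "word_multiple j c ws =
     (if 0 \<le> c then word_scale (root j c) ws else word_inverse (word_scale (root j (- c)) ws))"

lemma word_multiple_leading:
  assumes "1 \<le> j" "set ws \<subseteq> UNIV \<times> hbasis" "x \<in> layer G j" "hword ws - x \<in> filt (Suc j)"
  shows "hword (word_multiple j c ws) - c *\<^sub>R x \<in> filt (Suc j)"
proof -
  have *: "hword (word_scale (root j s) ws) - s *\<^sub>R x \<in> filt (Suc j)" if "0 \<le> s" for s
  proof -
    have "dilation G (root j s) x = s *\<^sub>R x" using assms(1) that by (simp add: dilation_layer[OF assms(3)])
    then show ?thesis
      using dilation_filt[OF assms(4), of "root j s"] by (simp add: wprod_id_scale[OF assms(2)] dilation_diff)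
  qed
  show ?thesis
  proof (cases "0 \<le> c")
    case False
    then show ?thesis
      using filt_neg[OF *[of "- c"]] by (simp add: word_multiple_def wprod_inverse minus_diff_commute)
  qed (simp add: word_multiple_def *)
qed

lemma word_multiple_words:
  assumes "ws \<in> words E n \<tau>"
  shows "word_multiple j c ws \<in> words E n (root j \<bar>c\<bar> * \<tau>)"
proof -
  have "0 \<le> root j \<bar>c\<bar>" by (rule real_root_ge_zero) simp
  from word_scale_words[OF assms this] show ?thesis
    using word_inverse_words by (auto simp: word_multiple_def)
qed

lemma subspace_lead:
  assumes "1 \<le> j"
  shows "subspace (lead j)"
  unfolding subspace_def
proof (intro conjI ballI allI)
  show "0 \<in> lead j"
    by (auto simp: lead_def subspace_0[OF layer_subspace] intro!: exI[of _ "[]"])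
next
  fix x y assume "x \<in> lead j" "y \<in> lead j"
  then obtain ws vs where *: "x \<in> layer G j" "y \<in> layer G j" "set ws \<subseteq> UNIV \<times> hbasis" "set vs \<subseteq> UNIV \<times> hbasis"
    "hword ws - x \<in> filt (Suc j)" "hword vs - y \<in> filt (Suc j)"
    by (auto simp: lead_def)
  then have "hword (ws @ vs) - (x + y) \<in> filt (Suc j)"
    unfolding wprod_append by (intro mult_leading layer_filt[OF *(2)])
  with * show "x + y \<in> lead j"
    unfolding lead_def mem_Collect_eq
    by (intro conjI exI[of _ "ws @ vs"] subspace_add[OF layer_subspace]) auto
next
  fix c x assume "x \<in> lead j"
  then obtain ws where *: "x \<in> layer G j" "set ws \<subseteq> UNIV \<times> hbasis" "hword ws - x \<in> filt (Suc j)"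
    by (auto simp: lead_def)
  have "set (word_multiple j c ws) \<subseteq> UNIV \<times> hbasis"
    using *(2) by (simp add: word_multiple_def set_word_inverse set_word_scale)
  with * word_multiple_leading[OF assms *(2,1,3)] show "c *\<^sub>R x \<in> lead j"
    unfolding lead_def by (auto intro: subspace_scale[OF layer_subspace])
qed

lemma br_lead:
  assumes "x \<in> lead i" "y \<in> lead j" "1 \<le> i" "1 \<le> j"
  shows "br x y \<in> lead (i + j)"
proof -
  obtain ws vs where *: "x \<in> layer G i" "y \<in> layer G j" "set ws \<subseteq> UNIV \<times> hbasis" "set vs \<subseteq> UNIV \<times> hbasis"
    "hword ws - x \<in> filt (Suc i)" "hword vs - y \<in> filt (Suc j)"
    using assms by (auto simp: lead_def)
  define u v where "u = hword ws" and "v = hword vs"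
  have x: "x \<in> filt i" and y: "y \<in> filt j" using * layer_filt by auto
  have u: "u \<in> filt i" and v: "v \<in> filt j"
    using filt_add[OF filt_mono[OF *(5), of i] x] filt_add[OF filt_mono[OF *(6), of j] y]
    by (simp_all add: u_def v_def)
  have 1: "u \<otimes> v - v \<otimes> u - br u v \<in> filt (Suc (i + j))"
    by (rule mult_commutator[OF u v assms(3,4)])
  have "br (u - x) v \<in> filt (Suc i + j)" "br x (v - y) \<in> filt (i + Suc j)"
    using br_filt[OF *(5) v] br_filt[OF x *(6)] by (simp_all only: u_def v_def)
  then have "br (u - x) v + br x (v - y) \<in> filt (Suc (i + j))" by (intro filt_add) simp_all
  then have "br u v - br x y \<in> filt (Suc (i + j))" by (simp add: br_diff_left br_diff_right)
  from filt_add[OF 1 this] have 2: "u \<otimes> v - v \<otimes> u - br x y \<in> filt (Suc (i + j))" by simp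
  have d: "u \<otimes> v - v \<otimes> u \<in> filt (i + j)"
    using filt_add[OF filt_mono[OF 2, of "i + j"] br_filt[OF x y]] by simp
  have "(v \<otimes> u + (u \<otimes> v - v \<otimes> u)) \<otimes> (- (v \<otimes> u)) - (v \<otimes> u) \<otimes> (- (v \<otimes> u)) - (u \<otimes> v - v \<otimes> u)
      \<in> filt (Suc (i + j))"
    by (rule mult_increment_left[OF d])
  from filt_add[OF this 2] have "(u \<otimes> v) \<otimes> (- (v \<otimes> u)) - br x y \<in> filt (Suc (i + j))"
    by simp
  moreover have "hword (ws @ vs @ word_inverse ws @ word_inverse vs) = (u \<otimes> v) \<otimes> (- (v \<otimes> u))"
    by (simp add: wprod_append wprod_inverse neg_mult mult_assoc u_def v_def)
  ultimately show ?thesis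
    unfolding lead_def mem_Collect_eq using *
    by (intro conjI exI[of _ "ws @ vs @ word_inverse ws @ word_inverse vs"] layer_bracket)
       (simp_all add: set_word_inverse)
qed

lemma lead_eq_layer:
  assumes "1 \<le> j"
  shows "lead j = layer G j"
proof -
  define W where "W = {x. \<forall>j\<in>{1..step G}. component G j x \<in> lead j}"
  have W: "subspace W"
    using subspace_lead
    by (auto simp: W_def subspace_def component_add component_scaleR)
  have "layer G 1 \<subseteq> lead 1"
  proof -
    have "hbasis \<subseteq> lead 1"
    proof
      fix b assume b: "b \<in> hbasis"
      then show "b \<in> lead 1"
        using hbasis(2) by (auto simp: lead_def intro!: exI[of _ "[(1, b)]"])
    qed
    then show ?thesis using span_minimal[OF _ subspace_lead[OF order_refl]] unfolding hbasis(3)[symmetric] by blast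
  qed
  then have l1: "layer G 1 \<subseteq> W"
    using subspace_0[OF subspace_lead]
    by (auto simp: W_def component_layer)
  have "br x y \<in> W" if "x \<in> W" "y \<in> W" for x y
  proof -
    have "component G k (br x y) \<in> lead k" if k: "k \<in> {1..step G}" for k
    proof -
      have "component G k (br (component G a x) (component G b y)) \<in> lead k"
        if "a \<in> {1..step G}" "b \<in> {1..step G}" for a b
      proof (cases "k = a + b")
        case True
        have "br (component G a x) (component G b y) \<in> lead (a + b)"
          using \<open>x \<in> W\<close> \<open>y \<in> W\<close> that by (intro br_lead) (auto simp: W_def)
        then show ?thesis
          using component_layer[OF layer_bracket[OF component_in_layer component_in_layer], of k a x b y] True
          by simp
      next
        case False
        then show ?thesis
          using component_layer[OF layer_bracket[OF component_in_layer component_in_layer], of k a x b y]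
            subspace_0[OF subspace_lead] k by simp
      qed
      then show ?thesis
        using k by (subst br_components) (auto simp: component_sum intro!: subspace_sum[OF subspace_lead])
    qed
    then show ?thesis by (simp add: W_def)
  qed
  then have "W = UNIV" using layer_generating[OF W l1] by blast
  have "x \<in> lead j" if "x \<in> layer G j" for x
  proof (cases "j \<in> {1..step G}")
    case True
    have "x \<in> W" using \<open>W = UNIV\<close> by simp
    then have "component G j x \<in> lead j" using True unfolding W_def by blast
    then show ?thesis using component_layer[OF that, of j] by simp
  next
    case False
    then show ?thesis using layer_outside[OF False] that subspace_0[OF subspace_lead[OF assms]] by simp
  qed
  then show ?thesis by (auto simp: lead_def)
qed

text \<open>The length and the exponents of the words can be bounded, because finitely many words, one for each
  basis vector, suffice: expand the given vector and multiply rescaled words.\<close>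

lemma lead_uniform:
  assumes "1 \<le> j"
  shows "\<exists>n C. 0 \<le> C \<and> (\<forall>x\<in>layer G j. \<exists>ws\<in>words hbasis n (C * root j (norm x)).
      hword ws - x \<in> filt (Suc j))"
proof -
  have "\<forall>d. \<exists>ws. set ws \<subseteq> UNIV \<times> hbasis \<and> hword ws - component G j d \<in> filt (Suc j)"
    using lead_eq_layer[OF assms] component_in_layer[of j] by (auto simp: lead_def)
  then obtain w where w: "\<And>d. set (w d) \<subseteq> UNIV \<times> hbasis"
    "\<And>d. hword (w d) - component G j d \<in> filt (Suc j)" by metis
  then have "\<forall>d. \<exists>\<tau>. w d \<in> words hbasis (length (w d)) \<tau>" by (intro allI in_some_words)
  then obtain \<tau> where \<tau>: "\<And>d. w d \<in> words hbasis (length (w d)) (\<tau> d)" by metis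
  obtain ds where ds: "set ds = (Basis :: 'a set)" "distinct ds"
    using finite_distinct_list[OF finite_Basis] by blast
  define C where "C = (\<Sum>d\<in>Basis. \<bar>\<tau> d\<bar>)"
  have C: "0 \<le> C" by (simp add: C_def sum_nonneg)
  have \<tau>C: "w d \<in> words hbasis (length (w d)) C" if "d \<in> Basis" for d
  proof (rule words_mono[OF \<tau>])
    have "\<bar>\<tau> d\<bar> \<le> C" unfolding C_def using that by (intro member_le_sum) auto
    then show "\<tau> d \<le> C" by linarith
  qed simp
  have main: "\<exists>ws\<in>words hbasis (\<Sum>d\<leftarrow>es. length (w d)) (C * root j (norm x)).
      hword ws - (\<Sum>d\<leftarrow>es. (x \<bullet> d) *\<^sub>R component G j d) \<in> filt (Suc j)"
    if "set es \<subseteq> Basis" for x es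
    using that
  proof (induction es)
    case Nil
    show ?case by (auto simp: words_def intro!: bexI[of _ "[]"])
  next
    case (Cons d es)
    then obtain ws where ws: "ws \<in> words hbasis (\<Sum>d\<leftarrow>es. length (w d)) (C * root j (norm x))"
      "hword ws - (\<Sum>d\<leftarrow>es. (x \<bullet> d) *\<^sub>R component G j d) \<in> filt (Suc j)" by auto
    have d: "d \<in> Basis" using Cons.prems by simp
    have "word_multiple j (x \<bullet> d) (w d) \<in> words hbasis (length (w d)) (root j \<bar>x \<bullet> d\<bar> * C)"
      by (rule word_multiple_words[OF \<tau>C[OF d]])
    moreover have "root j \<bar>x \<bullet> d\<bar> * C \<le> C * root j (norm x)"
      using assms C Basis_le_norm[OF d, of x] by (subst mult.commute) (intro mult_left_mono real_root_le_mono, auto)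
    ultimately have "word_multiple j (x \<bullet> d) (w d) \<in> words hbasis (length (w d)) (C * root j (norm x))"
      using words_mono by blast
    from append_words[OF this ws(1)]
    have "word_multiple j (x \<bullet> d) (w d) @ ws \<in> words hbasis (\<Sum>d\<leftarrow>d # es. length (w d)) (C * root j (norm x))"
      by simp
    moreover have "hword (word_multiple j (x \<bullet> d) (w d) @ ws) -
        ((x \<bullet> d) *\<^sub>R component G j d + (\<Sum>d\<leftarrow>es. (x \<bullet> d) *\<^sub>R component G j d)) \<in> filt (Suc j)"
      unfolding wprod_append
    proof (rule mult_leading[OF word_multiple_leading[OF assms w(1) component_in_layer w(2)] ws(2)])
      show "(\<Sum>d\<leftarrow>es. (x \<bullet> d) *\<^sub>R component G j d) \<in> filt j"
        by (induction es) (auto intro!: filt_add filt_scaleR layer_filt[OF component_in_layer])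
    qed
    ultimately show ?case by auto
  qed
  have "\<exists>ws\<in>words hbasis (\<Sum>d\<leftarrow>ds. length (w d)) (C * root j (norm x)).
      hword ws - x \<in> filt (Suc j)" if x: "x \<in> layer G j" for x
  proof -
    have "x = component G j (\<Sum>d\<in>Basis. (x \<bullet> d) *\<^sub>R d)"
      using component_layer[OF x, of j] by (simp add: euclidean_representation)
    also have "\<dots> = (\<Sum>d\<leftarrow>ds. (x \<bullet> d) *\<^sub>R component G j d)"
      using ds by (simp add: component_sum component_scaleR sum.distinct_set_conv_list[symmetric])
    finally show ?thesis using main[of ds x] ds by simp
  qed
  then show ?thesis using C by blast
qed

lemma hnorm_wprod_bound:
  "\<exists>C\<ge>0. \<forall>\<tau>\<ge>0. \<forall>ws\<in>words hbasis n \<tau>. hnorm (hword ws) \<le> C * \<tau>"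
proof (induction n)
  case 0
  show ?case by (auto simp: words_def intro!: exI[of _ 0])
next
  case (Suc n)
  then obtain C where C: "C \<ge> 0" "\<And>\<tau> ws. \<tau> \<ge> 0 \<Longrightarrow> ws \<in> words hbasis n \<tau> \<Longrightarrow> hnorm (hword ws) \<le> C * \<tau>"
    by blast
  obtain D where D: "D \<ge> 1" "\<And>x y. hnorm (x \<otimes> y) \<le> D * (hnorm x + hnorm y)"
    using hnorm_quasi_triangle by blast
  define M where "M = (\<Sum>b\<in>hbasis. norm b)"
  have M: "norm b \<le> M" if "b \<in> hbasis" for b
    unfolding M_def using that hbasis(1) by (intro member_le_sum) auto
  have M0: "0 \<le> M" by (simp add: M_def sum_nonneg)
  have "hnorm (hword ws) \<le> D * (M + C) * \<tau>" if \<tau>: "\<tau> \<ge> 0" and ws: "ws \<in> words hbasis (Suc n) \<tau>" for \<tau> ws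
  proof (cases ws)
    case Nil
    then show ?thesis using D C M0 \<tau> by simp
  next
    case (Cons w vs)
    obtain t b where w: "w = (t, b)" by (cases w)
    have t: "\<bar>t\<bar> \<le> \<tau>" "b \<in> hbasis" and vs: "vs \<in> words hbasis n \<tau>"
      using ws by (auto simp: Cons w words_def)
    have "t *\<^sub>R b \<in> layer G 1" using t(2) hbasis(2) by (auto intro: subspace_scale[OF layer_subspace])
    then have "hnorm (t *\<^sub>R b) = \<bar>t\<bar> * norm b" by (simp add: hnorm_layer1)
    also have "\<dots> \<le> \<tau> * M" using t M \<tau> by (intro mult_mono) auto
    finally have "hnorm (t *\<^sub>R b) + hnorm (hword vs) \<le> \<tau> * M + C * \<tau>" using C(2)[OF \<tau> vs] by simp
    then have "D * (hnorm (t *\<^sub>R b) + hnorm (hword vs)) \<le> D * (\<tau> * M + C * \<tau>)"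
      using D(1) by (intro mult_left_mono) auto
    then show ?thesis using D(2)[of "t *\<^sub>R b" "hword vs"] by (simp add: Cons w algebra_simps)
  qed
  then show ?case using C D M0 by (intro exI[of _ "D * (M + C)"]) auto
qed

text \<open>The components are corrected from the lowest layer upwards: a word with the right leading term in one layer
  changes only the layers from there on.\<close>

theorem horizontal_words_reach:
  "\<exists>n C. 0 \<le> C \<and> (\<forall>x. \<exists>ws\<in>words hbasis n (C * hnorm x). hword ws = x)"
proof -
  have "\<exists>n C. 0 \<le> C \<and> (\<forall>x. \<exists>ws\<in>words hbasis n (C * hnorm x). - hword ws \<otimes> x \<in> filt (Suc k))" for k
  proof (induction k)
    case 0
    show ?case by (rule exI[of _ 0], rule exI[of _ 0]) (auto simp: words_def)
  next
    case (Suc k)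
    then obtain n C where C: "0 \<le> C"
      and nC: "\<And>x. \<exists>ws\<in>words hbasis n (C * hnorm x). - hword ws \<otimes> x \<in> filt (Suc k)" by blast
    obtain n' C' where C': "0 \<le> C'" and nC': "\<And>x. x \<in> layer G (Suc k) \<Longrightarrow>
        \<exists>ws\<in>words hbasis n' (C' * root (Suc k) (norm x)). hword ws - x \<in> filt (Suc (Suc k))"
      using lead_uniform[of "Suc k"] by auto
    obtain D where D: "D \<ge> 1" "\<And>x y. hnorm (x \<otimes> y) \<le> D * (hnorm x + hnorm y)"
      using hnorm_quasi_triangle by blast
    obtain A where A: "A \<ge> 0" "\<And>\<tau> ws. \<tau> \<ge> 0 \<Longrightarrow> ws \<in> words hbasis n \<tau> \<Longrightarrow> hnorm (hword ws) \<le> A * \<tau>"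
      using hnorm_wprod_bound[of n] by blast
    define C1 where "C1 = C + C' * (D * (A * C + 1))"
    have C1: "0 \<le> C1" "C \<le> C1" "C' * (D * (A * C + 1)) \<le> C1"
      using C C' D(1) A(1) by (auto simp: C1_def)
    have "\<exists>us\<in>words hbasis (n + n') (C1 * hnorm x). - hword us \<otimes> x \<in> filt (Suc (Suc k))" for x
    proof -
      obtain ws where ws: "ws \<in> words hbasis n (C * hnorm x)" "- hword ws \<otimes> x \<in> filt (Suc k)"
        using nC by blast
      define y z where "y = - hword ws \<otimes> x" and "z = component G (Suc k) y"
      have hx: "0 \<le> hnorm x" by (rule hnorm_nonneg)
      have "hnorm (hword ws) \<le> A * (C * hnorm x)" using ws(1) C hx by (intro A(2)) auto
      then have "D * (hnorm (- hword ws) + hnorm x) \<le> D * (A * (C * hnorm x) + hnorm x)"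
        using D(1) by (intro mult_left_mono) auto
      then have y: "hnorm y \<le> D * (A * C + 1) * hnorm x"
        using D(2)[of "- hword ws" x] by (simp add: y_def algebra_simps)
      have z: "root (Suc k) (norm z) \<le> hnorm y"
      proof (cases "Suc k \<in> {1..step G}")
        case True
        then show ?thesis unfolding z_def by (rule hnorm_ge)
      next
        case False
        then show ?thesis by (simp add: z_def component_outside hnorm_nonneg)
      qed
      obtain vs where vs: "vs \<in> words hbasis n' (C' * root (Suc k) (norm z))"
        "hword vs - z \<in> filt (Suc (Suc k))"
        using nC'[of z] component_in_layer by (auto simp: z_def)
      define v where "v = hword vs"
      have "C' * root (Suc k) (norm z) \<le> C' * (D * (A * C + 1) * hnorm x)"
        using z y C' by (intro mult_left_mono) auto
      also have "\<dots> \<le> C1 * hnorm x"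
        using mult_right_mono[OF C1(3) hx] by (simp add: mult.assoc)
      finally have "vs \<in> words hbasis n' (C1 * hnorm x)" using vs(1) words_mono by blast
      moreover have "ws \<in> words hbasis n (C1 * hnorm x)"
        using ws(1) mult_right_mono[OF C1(2) hx] words_mono by blast
      ultimately have us: "ws @ vs \<in> words hbasis (n + n') (C1 * hnorm x)" by (intro append_words)
      have "y - z \<in> filt (Suc (Suc k))"
        by (rule filt_SucI)
           (auto simp: z_def component_diff component_component y_def
             intro!: filt_diff[OF ws(2) layer_filt] component_in_layer)
      from filt_diff[OF this vs(2)] have e: "y - v \<in> filt (Suc (Suc k))" by (simp add: v_def)
      have "- v \<otimes> (v + (y - v)) - - v \<otimes> v - (y - v) \<in> filt (Suc (Suc (Suc k)))"
        by (rule mult_increment_right[OF e])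
      then have "- v \<otimes> (v + (y - v)) - - v \<otimes> v - (y - v) \<in> filt (Suc (Suc k))"
        by (rule filt_mono) simp
      from filt_add[OF this e] have "- v \<otimes> y \<in> filt (Suc (Suc k))" by simp
      then have "- hword (ws @ vs) \<otimes> x \<in> filt (Suc (Suc k))"
        by (simp add: wprod_append neg_mult v_def y_def mult_assoc)
      then show ?thesis using us by blast
    qed
    then show ?case using C1(1) by blast
  qed
  from this[of "step G"] obtain n C where C: "0 \<le> C"
    and nC: "\<And>x. \<exists>ws\<in>words hbasis n (C * hnorm x). - hword ws \<otimes> x \<in> filt (Suc (step G))" by blast
  have "\<exists>ws\<in>words hbasis n (C * hnorm x). hword ws = x" for x
  proof -
    obtain ws where ws: "ws \<in> words hbasis n (C * hnorm x)" "- hword ws \<otimes> x \<in> filt (Suc (step G))"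
      using nC by blast
    then have "- hword ws \<otimes> x = 0" by (intro filt_top) auto
    then have "hword ws \<otimes> (- hword ws \<otimes> x) = hword ws" by simp
    then show ?thesis using ws(1) by auto
  qed
  then show ?thesis using C by blast
qed

end

section \<open>The Carnot--Caratheodory distance is comparable to the homogeneous norm\<close>

context carnot_group
begin

abbreviation dtrans :: "'a \<Rightarrow> 'a \<Rightarrow> 'a \<Rightarrow> 'a" where
  "dtrans g x \<equiv> left_translation_deriv G g x"

lemma translation_has_derivative: "((\<lambda>y. g \<otimes> y) has_derivative dtrans g x) (at x)"
proof -
  have "(\<lambda>y. g \<otimes> y) differentiable at x" by (intro differentiable_mult) simp_all
  then show ?thesis by (simp add: left_translation_deriv_def frechet_derivative_works)
qed

lemma linear_dtrans: "linear (dtrans g x)"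
  using translation_has_derivative has_derivative_linear by blast

lemma exponential_curve_derivative:
  "((\<lambda>s. y \<otimes> (s *\<^sub>R u)) has_vector_derivative dtrans y 0 u) (at 0)"
proof -
  have "((\<lambda>s::real. s *\<^sub>R u) has_derivative (\<lambda>s. s *\<^sub>R u)) (at 0)"
    by (auto intro!: derivative_eq_intros)
  moreover have "((\<lambda>v. y \<otimes> v) has_derivative dtrans y 0) (at (0 *\<^sub>R u))"
    using translation_has_derivative[of y 0] by simp
  ultimately have "((\<lambda>s. y \<otimes> (s *\<^sub>R u)) has_derivative (\<lambda>s. dtrans y 0 (s *\<^sub>R u))) (at 0)"
    by (rule has_derivative_compose)
  then show ?thesis
    by (simp add: has_vector_derivative_def linear_scale[OF linear_dtrans])
qed

text \<open>A left translation preserves the horizontal coordinate of a velocity, and a dilation multiplies it by \<open>c\<close>.\<close>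

lemma dtrans_similarity:
  assumes u: "u \<in> layer G 1"
  shows "dilation G c (dtrans x y (dtrans y 0 u)) = dtrans (dilation G c (x \<otimes> y)) 0 (c *\<^sub>R u)"
proof -
  have "dilation G c (x \<otimes> (y \<otimes> (s *\<^sub>R u))) = dilation G c (x \<otimes> y) \<otimes> (s *\<^sub>R (c *\<^sub>R u))" for s
    using dilation_layer[OF u, of c]
    by (simp add: dilation_mult mult_assoc dilation_scaleR)
  then have 1: "((\<lambda>s. dilation G c (x \<otimes> (y \<otimes> (s *\<^sub>R u)))) has_vector_derivative
      dtrans (dilation G c (x \<otimes> y)) 0 (c *\<^sub>R u)) (at 0)"
    using exponential_curve_derivative[of "dilation G c (x \<otimes> y)" "c *\<^sub>R u"] by presburger
  have "((\<lambda>s. y \<otimes> (s *\<^sub>R u)) has_derivative (\<lambda>s. s *\<^sub>R dtrans y 0 u)) (at 0)"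
    using exponential_curve_derivative by (simp add: has_vector_derivative_def)
  moreover have "((\<lambda>z. x \<otimes> z) has_derivative dtrans x y) (at (y \<otimes> (0 *\<^sub>R u)))"
    using translation_has_derivative[of x y] by simp
  ultimately have "((\<lambda>s. x \<otimes> (y \<otimes> (s *\<^sub>R u))) has_derivative (\<lambda>s. dtrans x y (s *\<^sub>R dtrans y 0 u))) (at 0)"
    by (rule has_derivative_compose)
  from bounded_linear.has_derivative[OF bounded_linear_dilation this, of c]
  have 2: "((\<lambda>s. dilation G c (x \<otimes> (y \<otimes> (s *\<^sub>R u)))) has_vector_derivative
      dilation G c (dtrans x y (dtrans y 0 u))) (at 0)"
    by (simp add: has_vector_derivative_def linear_scale[OF linear_dtrans] dilation_scaleR)
  show ?thesis using vector_derivative_unique_at[OF 2 1] .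
qed

lemma dtrans_zero [simp]: "dtrans 0 x v = v"
proof -
  have "((\<lambda>y. 0 \<otimes> y) has_derivative (\<lambda>v. v)) (at x)" by simp
  from has_derivative_unique[OF translation_has_derivative this] show ?thesis by simp
qed

lemma horizontal_norm_dtrans:
  assumes "u \<in> layer G 1"
  shows "horizontal_norm G y (dtrans y 0 u) = norm u"
  using dtrans_similarity[OF assms, of 1 "- y" y] by (simp add: horizontal_norm_def inv_eq_neg)

lemma dtrans_bound: "\<exists>C>0. \<forall>y u. norm y \<le> 1 \<longrightarrow> norm (dtrans y 0 u) \<le> C * norm u"
proof -
  obtain C where C: "C \<ge> 0" "\<And>x y x' y'. norm x \<le> 1 \<and> norm y \<le> 1 \<and> norm x' \<le> 1 \<and> norm y' \<le> 1 \<Longrightarrow>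
     norm (x \<otimes> y - x' \<otimes> y') \<le> C * (norm (x - x') + norm (y - y'))"
    using mult_lipschitz[of 1] by blast
  have "norm (dtrans y 0 u) \<le> (C + 1) * norm u" if y: "norm y \<le> 1" for y u
  proof -
    have "norm (dtrans y 0 u) \<le> C * norm u + e" if e: "e > 0" for e
    proof -
      have "((\<lambda>s. y \<otimes> (s *\<^sub>R u)) has_derivative (\<lambda>s. s *\<^sub>R dtrans y 0 u)) (at 0)"
        using exponential_curve_derivative by (simp add: has_vector_derivative_def)
      then obtain \<delta> where \<delta>: "\<delta> > 0"
        "\<And>s. \<bar>s\<bar> < \<delta> \<Longrightarrow> norm (y \<otimes> (s *\<^sub>R u) - y - s *\<^sub>R dtrans y 0 u) \<le> e * \<bar>s\<bar>"
        using e unfolding has_derivative_at_alt by fastforce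
      define s where "s = min (\<delta> / 2) (1 / (norm u + 1))"
      have nu: "norm u + 1 > 0" by (simp add: add_nonneg_pos)
      have s: "s > 0" "s < \<delta>" "s \<le> 1 / (norm u + 1)"
        using \<delta>(1) nu by (auto simp: s_def)
      have "s * norm u \<le> 1 / (norm u + 1) * norm u" using s by (intro mult_right_mono) auto
      also have "\<dots> \<le> 1" using nu by (simp add: divide_le_eq)
      finally have "norm (y \<otimes> (s *\<^sub>R u) - y \<otimes> 0) \<le> C * (norm (y - y) + norm (s *\<^sub>R u - 0))"
        using y s by (intro C(2)) auto
      then have 1: "norm (y \<otimes> (s *\<^sub>R u) - y) \<le> s * (C * norm u)" using s by (simp add: algebra_simps)
      have "s * norm (dtrans y 0 u) = norm (s *\<^sub>R dtrans y 0 u)" using s by simp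
      also have "\<dots> \<le> norm (y \<otimes> (s *\<^sub>R u) - y) + norm (y \<otimes> (s *\<^sub>R u) - y - s *\<^sub>R dtrans y 0 u)"
        using norm_triangle_ineq4[of "y \<otimes> (s *\<^sub>R u) - y" "y \<otimes> (s *\<^sub>R u) - y - s *\<^sub>R dtrans y 0 u"] by simp
      also have "\<dots> \<le> s * (C * norm u + e)" using 1 \<delta>(2)[of s] s by (simp add: algebra_simps)
      finally show ?thesis using s by simp
    qed
    then have "norm (dtrans y 0 u) \<le> C * norm u" by (rule field_le_epsilon)
    also have "\<dots> \<le> (C + 1) * norm u" by (simp add: distrib_right)
    finally show ?thesis .
  qed
  then show ?thesis using C(1) by (intro exI[of _ "C + 1"]) auto
qed

text \<open>A relation rather than a function, since the length of a horizontal path may be infinite.\<close>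

definition path_length :: "(real \<Rightarrow> 'a) \<Rightarrow> real \<Rightarrow> bool" where
  "path_length \<gamma> L \<longleftrightarrow> horizontal_path G \<gamma> \<and>
     ((\<lambda>t. horizontal_norm G (\<gamma> t) (vector_derivative \<gamma> (at t))) has_integral L) {0..1}"

lemma cc_dist_eq: "cc_dist G x y = Inf {L. \<exists>\<gamma>. path_length \<gamma> L \<and> \<gamma> 0 = x \<and> \<gamma> 1 = y}"
  unfolding cc_dist_def path_length_def by (rule arg_cong[where f = Inf]) auto

lemma horizontal_velocity:
  assumes "horizontal_path G \<gamma>"
  obtains F u where "finite F" "\<And>t. t \<in> {0..1} - F \<Longrightarrow> u t \<in> layer G 1"
    "\<And>t. t \<in> {0..1} - F \<Longrightarrow> (\<gamma> has_vector_derivative dtrans (\<gamma> t) 0 (u t)) (at t)"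
    "\<And>t. t \<in> {0..1} - F \<Longrightarrow> horizontal_norm G (\<gamma> t) (vector_derivative \<gamma> (at t)) = norm (u t)"
    "continuous_on {0..1} \<gamma>"
proof -
  obtain S where S: "finite S" "\<gamma> C1_differentiable_on ({0..1} - S)" "continuous_on {0..1} \<gamma>"
    using assms by (auto simp: horizontal_path_def piecewise_C1_differentiable_on_def)
  obtain F where F: "finite F" "\<And>t. t \<in> {0..1} - F \<Longrightarrow> vector_derivative \<gamma> (at t) \<in> horizontal_space G (\<gamma> t)"
    using assms by (auto simp: horizontal_path_def)
  have "\<forall>t\<in>{0..1} - (S \<union> F). \<exists>u\<in>layer G 1. vector_derivative \<gamma> (at t) = dtrans (\<gamma> t) 0 u"
    using F(2) unfolding horizontal_space_def one_eq_zero by blast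
  then obtain u where u: "\<And>t. t \<in> {0..1} - (S \<union> F) \<Longrightarrow> u t \<in> layer G 1"
    "\<And>t. t \<in> {0..1} - (S \<union> F) \<Longrightarrow> vector_derivative \<gamma> (at t) = dtrans (\<gamma> t) 0 (u t)"
    by metis
  have "(\<gamma> has_vector_derivative vector_derivative \<gamma> (at t)) (at t)" if "t \<in> {0..1} - (S \<union> F)" for t
    using S(2) that by (auto simp: C1_differentiable_on_eq vector_derivative_works)
  with u S(1,3) F(1) show thesis
    by (intro that[of "S \<union> F" u]) (auto simp: horizontal_norm_dtrans)
qed

lemma path_length_nonneg: "path_length \<gamma> L \<Longrightarrow> 0 \<le> L"
  by (auto simp: path_length_def horizontal_norm_def intro: has_integral_nonneg)

text \<open>A path that is short after dilation stays in the unit ball, where its Euclidean speed is controlled.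
  Scaling turns this into a lower bound for the length.\<close>

lemma dilated_path_in_unit_ball:
  "\<exists>C>0. \<forall>\<gamma> L c. path_length \<gamma> L \<and> 0 \<le> c \<and> C * c * L < 1 \<longrightarrow>
     norm (dilation G c (- \<gamma> 0 \<otimes> \<gamma> 1)) \<le> 1"
proof -
  obtain C where C: "C > 0" "\<And>y u. norm y \<le> 1 \<Longrightarrow> norm (dtrans y 0 u) \<le> C * norm u"
    using dtrans_bound by blast
  have "norm (dilation G c (- \<gamma> 0 \<otimes> \<gamma> 1)) \<le> 1"
    if \<gamma>: "path_length \<gamma> L" and c: "0 \<le> c" "C * c * L < 1" for \<gamma> L c
  proof (rule ccontr)
    assume contra: "\<not> norm (dilation G c (- \<gamma> 0 \<otimes> \<gamma> 1)) \<le> 1"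
    define \<sigma> where "\<sigma> t = dilation G c (- \<gamma> 0 \<otimes> \<gamma> t)" for t
    define g where "g t = horizontal_norm G (\<gamma> t) (vector_derivative \<gamma> (at t))" for t
    have gint: "(g has_integral L) {0..1}" and hp: "horizontal_path G \<gamma>"
      using \<gamma> by (auto simp: path_length_def g_def[abs_def])
    have g0: "0 \<le> g t" for t by (simp add: g_def horizontal_norm_def)
    obtain F u where F: "finite F" and u: "\<And>t. t \<in> {0..1} - F \<Longrightarrow> u t \<in> layer G 1"
      and vd: "\<And>t. t \<in> {0..1} - F \<Longrightarrow> (\<gamma> has_vector_derivative dtrans (\<gamma> t) 0 (u t)) (at t)"
      and gu: "\<And>t. t \<in> {0..1} - F \<Longrightarrow> g t = norm (u t)" and cont: "continuous_on {0..1} \<gamma>"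
      using horizontal_velocity[OF hp] unfolding g_def by blast
    have cont\<sigma>: "continuous_on {0..1} \<sigma>"
      unfolding \<sigma>_def[abs_def] by (intro continuous_intros cont)
    have vd\<sigma>: "(\<sigma> has_vector_derivative dtrans (\<sigma> t) 0 (c *\<^sub>R u t)) (at t)" if t: "t \<in> {0..1} - F" for t
    proof -
      have "(\<gamma> has_derivative (\<lambda>s. s *\<^sub>R dtrans (\<gamma> t) 0 (u t))) (at t)"
        using vd[OF t] by (simp add: has_vector_derivative_def)
      from has_derivative_compose[OF this translation_has_derivative]
      have "((\<lambda>t. - \<gamma> 0 \<otimes> \<gamma> t) has_derivative
          (\<lambda>s. dtrans (- \<gamma> 0) (\<gamma> t) (s *\<^sub>R dtrans (\<gamma> t) 0 (u t)))) (at t)" .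
      from bounded_linear.has_derivative[OF bounded_linear_dilation this, of c] show ?thesis
        using dtrans_similarity[OF u[OF t], of c "- \<gamma> 0" "\<gamma> t"]
        by (simp add: has_vector_derivative_def \<sigma>_def[abs_def] linear_scale[OF linear_dtrans] dilation_scaleR)
    qed
    define T where "T = {t \<in> {0..1}. 1 \<le> norm (\<sigma> t)}"
    have "closed T" unfolding T_def
      using continuous_closed_preimage[of "{0..1}" "\<lambda>t. norm (\<sigma> t)" "{1..}"] continuous_on_norm[OF cont\<sigma>]
      by (auto simp: vimage_def Int_def)
    moreover have "bounded T" by (rule bounded_subset[of "{0..1}"]) (auto simp: T_def)
    ultimately have "compact T" by (simp add: compact_eq_bounded_closed)
    moreover have "1 \<in> T" using contra by (simp add: T_def \<sigma>_def)
    ultimately obtain t0 where t0: "t0 \<in> T" "\<And>t. t \<in> T \<Longrightarrow> t0 \<le> t"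
      using compact_attains_inf[of T] by auto
    have t01: "0 \<le> t0" "t0 \<le> 1" "1 \<le> norm (\<sigma> t0)" using t0(1) by (auto simp: T_def)
    have small: "norm (\<sigma> t) \<le> 1" if "t \<in> {0..<t0}" for t
      using t0(2)[of t] that t01 by (force simp: T_def)
    define f' where "f' t = (if t \<in> F \<union> {t0} then 0 else dtrans (\<sigma> t) 0 (c *\<^sub>R u t))" for t
    have "(f' has_integral (\<sigma> t0 - \<sigma> 0)) {0..t0}"
    proof (rule fundamental_theorem_of_calculus_interior_strong)
      show "finite (F \<union> {t0})" using F by simp
      show "continuous_on {0..t0} \<sigma>" using cont\<sigma> t01 by (auto elim: continuous_on_subset)
      show "(\<sigma> has_vector_derivative f' t) (at t)" if "t \<in> {0<..<t0} - (F \<union> {t0})" for t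
        using vd\<sigma>[of t] that t01 by (auto simp: f'_def)
    qed (use t01 in auto)
    moreover have "norm (f' t) \<le> C * c * g t" if "t \<in> {0..t0}" for t
    proof (cases "t \<in> F \<union> {t0}")
      case True
      then show ?thesis using g0[of t] C(1) c(1) by (auto simp: f'_def)
    next
      case False
      then have "norm (dtrans (\<sigma> t) 0 (c *\<^sub>R u t)) \<le> C * norm (c *\<^sub>R u t)"
        using that by (intro C(2) small) auto
      then show ?thesis using False gu[of t] that t01 c(1) by (auto simp: f'_def)
    qed
    moreover have gi: "g integrable_on {0..t0}"
      by (rule integrable_on_subinterval[OF has_integral_integrable[OF gint]]) (use t01 in auto)
    ultimately have "norm (integral {0..t0} f') \<le> integral {0..t0} (\<lambda>t. C * c * g t)"
      by (intro integral_norm_bound_integral integrable_on_mult_right) (auto simp: has_integral_integrable)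
    also have "integral {0..t0} f' = \<sigma> t0"
      using \<open>(f' has_integral _) _\<close> by (simp add: integral_unique \<sigma>_def)
    also have "integral {0..t0} (\<lambda>t. C * c * g t) = C * c * integral {0..t0} g" by simp
    also have "\<dots> \<le> C * c * integral {0..1} g"
      using C(1) c(1) gi gint t01 g0
      by (intro mult_left_mono integral_subset_le) (auto simp: has_integral_integrable)
    also have "integral {0..1} g = L" using gint by (rule integral_unique)
    finally show False using c(2) t01(3) by linarith
  qed
  then show ?thesis using C(1) by blast
qed

lemma path_length_ge_hnorm: "\<exists>C>0. \<forall>\<gamma> L. path_length \<gamma> L \<longrightarrow> hnorm (- \<gamma> 0 \<otimes> \<gamma> 1) \<le> C * L"
proof -
  obtain C where C: "C > 0" "\<And>\<gamma> L c. path_length \<gamma> L \<and> 0 \<le> c \<and> C * c * L < 1 \<Longrightarrow>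
     norm (dilation G c (- \<gamma> 0 \<otimes> \<gamma> 1)) \<le> 1"
    using dilated_path_in_unit_ball by blast
  obtain D where D: "D \<ge> 0" "\<And>x. norm x \<le> 1 \<Longrightarrow> hnorm x \<le> D" using hnorm_bounded_if_norm[of 1] by blast
  have "hnorm (- \<gamma> 0 \<otimes> \<gamma> 1) \<le> (2 * C * (D + 1)) * L" if \<gamma>: "path_length \<gamma> L" for \<gamma> L
  proof -
    let ?h = "hnorm (- \<gamma> 0 \<otimes> \<gamma> 1)"
    have *: "c * ?h \<le> D" if "0 \<le> c" "C * c * L < 1" for c
      using D(2)[OF C(2)[of \<gamma> L c]] \<gamma> that by (simp add: hnorm_dilation)
    show ?thesis
    proof (cases "L = 0")
      case True
      have "?h \<le> 0"
      proof (rule ccontr)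
        assume h: "\<not> ?h \<le> 0"
        have "(D + 1) / ?h * ?h \<le> D" using h D(1) True by (intro *) auto
        then show False using h by simp
      qed
      then show ?thesis using True by simp
    next
      case False
      then have L: "L > 0" using path_length_nonneg[OF \<gamma>] by simp
      then have "1 / (2 * C * L) * ?h \<le> D" using C(1) by (intro *) (auto simp: field_simps)
      then have "?h \<le> 2 * C * D * L" using L C(1) by (simp add: field_simps)
      also have "\<dots> \<le> 2 * C * (D + 1) * L" using L C(1) by (simp add: field_simps)
      finally show ?thesis .
    qed
  qed
  then show ?thesis using C(1) D(1) by (intro exI[of _ "2 * C * (D + 1)"]) auto
qed

subsection \<open>Horizontal polygons\<close>

lemma path_length_segment:
  assumes v: "v \<in> layer G 1"
  shows "path_length (\<lambda>s. x \<otimes> (s *\<^sub>R v)) (norm v)"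
proof -
  let ?\<gamma> = "\<lambda>s. x \<otimes> (s *\<^sub>R v)"
  have A: "function_algebra {u::real \<Rightarrow> real. real_polynomial_function u}"
    by (auto simp: function_algebra_def)
  have lin: "real_polynomial_function (\<lambda>s::real. s * c)" for c
    by (rule real_polynomial_function.intros(1)) (rule bounded_linear_mult_left)
  have "(\<lambda>z. ?\<gamma> z \<bullet> b) \<in> {u. real_polynomial_function u}" if "b \<in> Basis" for b
    using that by (intro mult_coordinates_closed[OF A]) (auto simp: lin)
  then have "polynomial_function ?\<gamma>" by (simp add: polynomial_function_iff_Basis_inner)
  then obtain p where p: "polynomial_function p" "\<And>t. (?\<gamma> has_vector_derivative p t) (at t)"
    by (rule has_vector_derivative_polynomial_function) blast
  from p(1) have "continuous_on {0..1} p" by (rule continuous_on_polymonial_function)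
  with p(2) have "?\<gamma> C1_differentiable_on {0..1}"
    unfolding C1_differentiable_on_def by blast
  then have pc: "?\<gamma> piecewise_C1_differentiable_on {0..1}" by (rule C1_differentiable_imp_piecewise)
  have vd: "(?\<gamma> has_vector_derivative dtrans (?\<gamma> t) 0 v) (at t)" for t
  proof -
    have "((\<lambda>s. s - t) has_vector_derivative 1) (at t)" by (auto intro!: derivative_eq_intros)
    moreover have "((\<lambda>s. ?\<gamma> t \<otimes> (s *\<^sub>R v)) has_vector_derivative dtrans (?\<gamma> t) 0 v) (at (t - t))"
      using exponential_curve_derivative[of "?\<gamma> t" v] by simp
    ultimately have "(((\<lambda>s. ?\<gamma> t \<otimes> (s *\<^sub>R v)) \<circ> (\<lambda>s. s - t)) has_vector_derivative 1 *\<^sub>R dtrans (?\<gamma> t) 0 v) (at t)"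
      by (rule vector_diff_chain_at)
    then show ?thesis by (simp add: o_def mult_assoc mult_multiples)
  qed
  then have vd': "vector_derivative ?\<gamma> (at t) = dtrans (?\<gamma> t) 0 v" for t
    by (rule vector_derivative_at)
  have "dtrans (?\<gamma> t) 0 v \<in> horizontal_space G (?\<gamma> t)" for t
    unfolding horizontal_space_def one_eq_zero using v by (rule imageI)
  then have "horizontal_path G ?\<gamma>"
    unfolding horizontal_path_def vd' using pc by blast
  moreover have "((\<lambda>t::real. norm v) has_integral norm v) {0..1}"
    using has_integral_const_real[of "norm v" 0 1] by simp
  ultimately show ?thesis
    unfolding path_length_def vd' horizontal_norm_dtrans[OF v] by blast
qed

lemma has_integral_double_speed:
  fixes f :: "real \<Rightarrow> real"
  assumes "(f has_integral L) {0..1}"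
  shows "((\<lambda>t. 2 * f (2 * t - c)) has_integral L) {c / 2..(1 + c) / 2}"
proof -
  have "(f has_integral L) (cbox 0 1)" using assms by simp
  from has_integral_mult_right[OF has_integral_affinity'[OF this, of 2 "- c"], of 2]
  have "((\<lambda>t. 2 * f (2 * t - c)) has_integral L) (cbox (c / 2) ((1 + c) / 2))" by (simp add: field_simps)
  then show ?thesis by simp
qed

lemma path_length_join:
  assumes 1: "path_length \<gamma>1 L1" and 2: "path_length \<gamma>2 L2" and eq: "\<gamma>1 1 = \<gamma>2 0"
  shows "path_length (\<gamma>1 +++ \<gamma>2) (L1 + L2)"
proof -
  let ?\<gamma> = "\<gamma>1 +++ \<gamma>2"
  let ?g = "\<lambda>t. horizontal_norm G (?\<gamma> t) (vector_derivative ?\<gamma> (at t))"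
  have int1: "((\<lambda>t. horizontal_norm G (\<gamma>1 t) (vector_derivative \<gamma>1 (at t))) has_integral L1) {0..1}"
    using 1 by (simp add: path_length_def)
  have hp1: "horizontal_path G \<gamma>1" using 1 by (simp add: path_length_def)
  obtain F1 u1 where F1: "finite F1" and u1: "\<And>t. t \<in> {0..1} - F1 \<Longrightarrow> u1 t \<in> layer G 1"
    and vd1: "\<And>t. t \<in> {0..1} - F1 \<Longrightarrow> (\<gamma>1 has_vector_derivative dtrans (\<gamma>1 t) 0 (u1 t)) (at t)"
    and g1: "\<And>t. t \<in> {0..1} - F1 \<Longrightarrow> horizontal_norm G (\<gamma>1 t) (vector_derivative \<gamma>1 (at t)) = norm (u1 t)"
    by (rule horizontal_velocity[OF hp1]) blast
  have int2: "((\<lambda>t. horizontal_norm G (\<gamma>2 t) (vector_derivative \<gamma>2 (at t))) has_integral L2) {0..1}"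
    using 2 by (simp add: path_length_def)
  have hp2: "horizontal_path G \<gamma>2" using 2 by (simp add: path_length_def)
  obtain F2 u2 where F2: "finite F2" and u2: "\<And>t. t \<in> {0..1} - F2 \<Longrightarrow> u2 t \<in> layer G 1"
    and vd2: "\<And>t. t \<in> {0..1} - F2 \<Longrightarrow> (\<gamma>2 has_vector_derivative dtrans (\<gamma>2 t) 0 (u2 t)) (at t)"
    and g2: "\<And>t. t \<in> {0..1} - F2 \<Longrightarrow> horizontal_norm G (\<gamma>2 t) (vector_derivative \<gamma>2 (at t)) = norm (u2 t)"
    by (rule horizontal_velocity[OF hp2]) blast
  define F where "F = {1/2} \<union> (\<lambda>t. t / 2) ` F1 \<union> (\<lambda>t. (t + 1) / 2) ` F2"
  have F: "finite F" using F1 F2 by (simp add: F_def)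
  have A: "vector_derivative ?\<gamma> (at t) = dtrans (?\<gamma> t) 0 (2 *\<^sub>R u1 (2 * t))" "2 * t \<in> {0..1} - F1"
    if t: "t \<in> {0..1/2} - F" for t
  proof -
    have "2 * t \<notin> F1"
    proof
      assume "2 * t \<in> F1"
      then have "2 * t / 2 \<in> F" unfolding F_def by blast
      then show False using t by simp
    qed
    then show t': "2 * t \<in> {0..1} - F1" using t by auto
    have "t < 1/2" using t by (auto simp: F_def less_le)
    have "((\<lambda>s::real. 2 * s) has_vector_derivative 2) (at t)" by (auto intro!: derivative_eq_intros)
    from vector_diff_chain_at[OF this, of \<gamma>1] vd1[OF t']
    have "((\<lambda>s. \<gamma>1 (2 * s)) has_vector_derivative 2 *\<^sub>R dtrans (\<gamma>1 (2 * t)) 0 (u1 (2 * t))) (at t)"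
      by (simp add: o_def)
    then have "(?\<gamma> has_vector_derivative 2 *\<^sub>R dtrans (\<gamma>1 (2 * t)) 0 (u1 (2 * t))) (at t)"
      by (rule has_vector_derivative_transform_within_open[where S = "{..<1/2}"])
         (use \<open>t < 1/2\<close> in \<open>auto simp: joinpaths_def\<close>)
    then have "vector_derivative ?\<gamma> (at t) = 2 *\<^sub>R dtrans (\<gamma>1 (2 * t)) 0 (u1 (2 * t))"
      by (rule vector_derivative_at)
    then show "vector_derivative ?\<gamma> (at t) = dtrans (?\<gamma> t) 0 (2 *\<^sub>R u1 (2 * t))"
      using \<open>t < 1/2\<close> by (simp add: joinpaths_def linear_scale[OF linear_dtrans])
  qed
  have B: "vector_derivative ?\<gamma> (at t) = dtrans (?\<gamma> t) 0 (2 *\<^sub>R u2 (2 * t - 1))" "2 * t - 1 \<in> {0..1} - F2"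
    if t: "t \<in> {1/2..1} - F" for t
  proof -
    have "2 * t - 1 \<notin> F2"
    proof
      assume "2 * t - 1 \<in> F2"
      then have "(2 * t - 1 + 1) / 2 \<in> F" unfolding F_def by blast
      then show False using t by simp
    qed
    then show t': "2 * t - 1 \<in> {0..1} - F2" using t by auto
    have "t > 1/2" using t by (auto simp: F_def less_le)
    have "((\<lambda>s::real. 2 * s - 1) has_vector_derivative 2) (at t)" by (auto intro!: derivative_eq_intros)
    from vector_diff_chain_at[OF this, of \<gamma>2] vd2[OF t']
    have "((\<lambda>s. \<gamma>2 (2 * s - 1)) has_vector_derivative 2 *\<^sub>R dtrans (\<gamma>2 (2 * t - 1)) 0 (u2 (2 * t - 1))) (at t)"
      by (simp add: o_def)
    then have "(?\<gamma> has_vector_derivative 2 *\<^sub>R dtrans (\<gamma>2 (2 * t - 1)) 0 (u2 (2 * t - 1))) (at t)"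
      by (rule has_vector_derivative_transform_within_open[where S = "{1/2<..}"])
         (use \<open>t > 1/2\<close> in \<open>auto simp: joinpaths_def\<close>)
    then have "vector_derivative ?\<gamma> (at t) = 2 *\<^sub>R dtrans (\<gamma>2 (2 * t - 1)) 0 (u2 (2 * t - 1))"
      by (rule vector_derivative_at)
    then show "vector_derivative ?\<gamma> (at t) = dtrans (?\<gamma> t) 0 (2 *\<^sub>R u2 (2 * t - 1))"
      using \<open>t > 1/2\<close> by (simp add: joinpaths_def linear_scale[OF linear_dtrans])
  qed
  have i1: "(?g has_integral L1) {0..1/2}"
  proof (rule has_integral_spike_finite[OF F])
    show "((\<lambda>t. 2 * horizontal_norm G (\<gamma>1 (2 * t)) (vector_derivative \<gamma>1 (at (2 * t)))) has_integral L1) {0..1/2}"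
      using has_integral_double_speed[OF int1, of 0] by simp
    show "?g t = 2 * horizontal_norm G (\<gamma>1 (2 * t)) (vector_derivative \<gamma>1 (at (2 * t)))" if "t \<in> {0..1/2} - F" for t
      using A[OF that] u1 g1
      by (simp add: horizontal_norm_dtrans subspace_scale[OF layer_subspace])
  qed
  have i2: "(?g has_integral L2) {1/2..1}"
  proof (rule has_integral_spike_finite[OF F])
    show "((\<lambda>t. 2 * horizontal_norm G (\<gamma>2 (2 * t - 1)) (vector_derivative \<gamma>2 (at (2 * t - 1)))) has_integral L2) {1/2..1}"
      using has_integral_double_speed[OF int2, of 1] by simp
    show "?g t = 2 * horizontal_norm G (\<gamma>2 (2 * t - 1)) (vector_derivative \<gamma>2 (at (2 * t - 1)))" if "t \<in> {1/2..1} - F" for t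
      using B[OF that] u2 g2
      by (simp add: horizontal_norm_dtrans subspace_scale[OF layer_subspace])
  qed
  have "(?g has_integral (L1 + L2)) {0..1}"
    by (rule has_integral_combine[OF _ _ i1 i2]) auto
  moreover have "vector_derivative ?\<gamma> (at t) \<in> horizontal_space G (?\<gamma> t)" if "t \<in> {0..1} - F" for t
  proof (cases "t \<le> 1/2")
    case True
    with A[of t] u1 that show ?thesis
      by (auto simp: horizontal_space_def one_eq_zero intro!: imageI subspace_scale[OF layer_subspace])
  next
    case False
    with B[of t] u2 that show ?thesis
      by (auto simp: horizontal_space_def one_eq_zero intro!: imageI subspace_scale[OF layer_subspace])
  qed
  moreover have "valid_path ?\<gamma>"
    using 1 2 eq by (intro valid_path_join)
      (auto simp: path_length_def horizontal_path_def valid_path_def pathfinish_def pathstart_def)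
  ultimately show ?thesis
    using F by (auto simp: path_length_def horizontal_path_def valid_path_def)
qed

lemma path_length_word:
  assumes "set ws \<subseteq> UNIV \<times> hbasis"
  shows "\<exists>\<gamma>. path_length \<gamma> (\<Sum>(t, b)\<leftarrow>ws. \<bar>t\<bar> * norm b) \<and> \<gamma> 0 = x \<and> \<gamma> 1 = x \<otimes> hword ws"
  using assms
proof (induction ws arbitrary: x)
  case Nil
  show ?case
    using path_length_segment[OF subspace_0[OF layer_subspace], of x]
    by (intro exI[of _ "\<lambda>s. x \<otimes> (s *\<^sub>R 0)"]) simp
next
  case (Cons w ws)
  obtain t b where w: "w = (t, b)" by (cases w)
  have "t *\<^sub>R b \<in> layer G 1"
    using Cons.prems hbasis(2) by (auto simp: w intro: subspace_scale[OF layer_subspace])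
  from path_length_segment[OF this] have 1: "path_length (\<lambda>s. x \<otimes> (s *\<^sub>R (t *\<^sub>R b))) (\<bar>t\<bar> * norm b)" by simp
  obtain \<gamma> where 2: "path_length \<gamma> (\<Sum>(t, b)\<leftarrow>ws. \<bar>t\<bar> * norm b)" "\<gamma> 0 = x \<otimes> (t *\<^sub>R b)"
    "\<gamma> 1 = x \<otimes> (t *\<^sub>R b) \<otimes> hword ws"
    using Cons.IH[of "x \<otimes> (t *\<^sub>R b)"] Cons.prems by auto
  show ?case
    using path_length_join[OF 1 2(1)] 2(2,3)
    by (intro exI[of _ "(\<lambda>s. x \<otimes> (s *\<^sub>R (t *\<^sub>R b))) +++ \<gamma>"]) (simp add: w mult_assoc joinpaths_def)
qed

text \<open>A word in horizontal vectors is a concatenation of segments, which bounds the distance from above; the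
  lower bound is that for the length of a single path.\<close>

theorem cc_dist_comparable:
  "\<exists>c>0. \<exists>C>0. \<forall>x y. c * hdist x y \<le> cc_dist G x y \<and> cc_dist G x y \<le> C * hdist x y"
proof -
  obtain A where A: "A > 0" "\<And>\<gamma> L. path_length \<gamma> L \<Longrightarrow> hnorm (- \<gamma> 0 \<otimes> \<gamma> 1) \<le> A * L"
    using path_length_ge_hnorm by blast
  obtain n C where C: "0 \<le> C" "\<And>x. \<exists>ws\<in>words hbasis n (C * hnorm x). hword ws = x"
    using horizontal_words_reach by blast
  define M where "M = (\<Sum>b\<in>hbasis. norm b)"
  have M: "norm b \<le> M" if "b \<in> hbasis" for b
    unfolding M_def using that hbasis(1) by (intro member_le_sum) auto
  have M0: "0 \<le> M" by (simp add: M_def sum_nonneg)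
  have len: "(\<Sum>(t, b)\<leftarrow>ws. \<bar>t\<bar> * norm b) \<le> real (length ws) * (\<tau> * M)"
    if "set ws \<subseteq> {-\<tau>..\<tau>} \<times> hbasis" for ws \<tau>
    using that
  proof (induction ws)
    case (Cons w ws)
    obtain t b where w: "w = (t, b)" by (cases w)
    have "\<bar>t\<bar> * norm b \<le> \<tau> * M" using Cons.prems M[of b] by (intro mult_mono) (auto simp: w)
    with Cons show ?case by (simp add: w distrib_right)
  qed simp
  define U where "U x y = {L. \<exists>\<gamma>. path_length \<gamma> L \<and> \<gamma> 0 = x \<and> \<gamma> 1 = y}" for x y
  have upper: "\<exists>L\<in>U x y. L \<le> (real n * C * M + 1) * hdist x y" for x y
  proof -
    obtain ws where ws: "ws \<in> words hbasis n (C * hdist x y)" "hword ws = - x \<otimes> y"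
      using C(2) by blast
    obtain \<gamma> where \<gamma>: "path_length \<gamma> (\<Sum>(t, b)\<leftarrow>ws. \<bar>t\<bar> * norm b)" "\<gamma> 0 = x" "\<gamma> 1 = x \<otimes> (- x \<otimes> y)"
      using path_length_word[of ws x] ws by (auto simp: words_def)
    have h: "0 \<le> hdist x y" by (rule hnorm_nonneg)
    have "(\<Sum>(t, b)\<leftarrow>ws. \<bar>t\<bar> * norm b) \<le> real (length ws) * (C * hdist x y * M)"
      using ws(1) by (intro len) (auto simp: words_def)
    also have "\<dots> \<le> real n * (C * hdist x y * M)"
      using ws(1) C(1) h M0 by (intro mult_right_mono) (auto simp: words_def)
    also have "\<dots> \<le> (real n * C * M + 1) * hdist x y" using h by (simp add: algebra_simps)
    finally show ?thesis using \<gamma> by (auto simp: U_def)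
  qed
  have bdd: "bdd_below (U x y)" for x y
    by (rule bdd_belowI[of _ 0]) (auto simp: U_def path_length_nonneg)
  have "cc_dist G x y \<le> (real n * C * M + 1) * hdist x y" for x y
  proof -
    obtain L where "L \<in> U x y" "L \<le> (real n * C * M + 1) * hdist x y" using upper by blast
    then show ?thesis using cInf_lower[OF _ bdd, of L x y] by (simp add: cc_dist_eq U_def)
  qed
  moreover have "1 / A * hdist x y \<le> cc_dist G x y" for x y
    unfolding cc_dist_eq U_def[symmetric]
  proof (rule cInf_greatest)
    show "U x y \<noteq> {}" using upper[of x y] by auto
    fix L assume "L \<in> U x y"
    then show "1 / A * hdist x y \<le> L" using A(2)[of _ L] A(1) by (auto simp: U_def field_simps)
  qed
  moreover have "real n * C * M + 1 > 0" using C(1) M0 by (simp add: add_nonneg_pos)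
  ultimately show ?thesis using A(1) by (intro exI[of _ "1 / A"] conjI exI[of _ "real n * C * M + 1"]) auto
qed

end

section \<open>Translations preserve Lebesgue measure\<close>

text \<open>A shear by a countably-valued function is piecewise a translation, and each piece is invariant under
  the translations that occur.\<close>

lemma emeasure_discrete_shear:
  fixes c :: "'a::euclidean_space \<Rightarrow> 'a"
  assumes c: "c \<in> borel_measurable borel" "countable (range c)"
    and inv: "\<And>y v. v \<in> range c \<Longrightarrow> c (y + v) = c y"
    and A: "A \<in> sets borel"
  shows "emeasure lborel {y. y + c y \<in> A} = emeasure lborel A"
proof -
  define P where "P v = c -` {v}" for v
  have P: "P v \<in> sets borel" for v
    using measurable_sets[OF c(1), of "{v}"] by (simp add: P_def)
  have tr: "(\<lambda>y. v + y) -` (P v \<inter> A) \<in> sets borel" for v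
    using measurable_sets[of "\<lambda>y. v + y" borel borel "P v \<inter> A"] P A by simp
  have eq: "emeasure lborel ((\<lambda>y. v + y) -` (P v \<inter> A)) = emeasure lborel (P v \<inter> A)" for v
  proof -
    have "emeasure lborel (P v \<inter> A) = emeasure (distr lborel borel ((+) v)) (P v \<inter> A)"
      by (simp add: lborel_distr_plus)
    also have "\<dots> = emeasure lborel ((\<lambda>y. v + y) -` (P v \<inter> A))"
      using P A by (subst emeasure_distr) auto
    finally show ?thesis by simp
  qed
  have inv': "c (v + y) = c y" if "v \<in> range c" for y v
    using inv[OF that, of y] by (simp add: add.commute)
  have "{y. y + c y \<in> A} = (\<Union>v\<in>range c. (\<lambda>y. v + y) -` (P v \<inter> A))"
  proof (intro equalityI subsetI)
    fix y assume "y \<in> {y. y + c y \<in> A}"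
    then have "y \<in> (\<lambda>z. c y + z) -` (P (c y) \<inter> A)"
      using inv'[of "c y" y] by (simp add: P_def add.commute)
    then show "y \<in> (\<Union>v\<in>range c. (\<lambda>y. v + y) -` (P v \<inter> A))" by blast
  next
    fix y assume "y \<in> (\<Union>v\<in>range c. (\<lambda>y. v + y) -` (P v \<inter> A))"
    then obtain v where "v \<in> range c" "c (v + y) = v" "v + y \<in> A" by (auto simp: P_def)
    then show "y \<in> {y. y + c y \<in> A}" using inv'[of v y] by (simp add: add.commute)
  qed
  moreover have "A = (\<Union>v\<in>range c. P v \<inter> A)" by (auto simp: P_def)
  moreover have "emeasure lborel (\<Union>v\<in>range c. (\<lambda>y. v + y) -` (P v \<inter> A)) =
      (\<integral>\<^sup>+v. emeasure lborel ((\<lambda>y. v + y) -` (P v \<inter> A)) \<partial>count_space (range c))"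
  proof (rule emeasure_UN_countable)
    show "disjoint_family_on (\<lambda>v. (\<lambda>y. v + y) -` (P v \<inter> A)) (range c)"
      using inv' by (auto simp: disjoint_family_on_def P_def)
  qed (use c(2) tr in auto)
  moreover have "emeasure lborel (\<Union>v\<in>range c. P v \<inter> A) =
      (\<integral>\<^sup>+v. emeasure lborel (P v \<inter> A) \<partial>count_space (range c))"
    using c(2) P A by (intro emeasure_UN_countable) (auto simp: disjoint_family_on_def P_def)
  ultimately show ?thesis using eq by simp
qed

text \<open>The displacement \<open>q\<close> is constant along the directions in which it displaces.\<close>

locale shear =
  fixes q :: "'a::euclidean_space \<Rightarrow> 'a"
  assumes continuous: "continuous_on UNIV q"
    and invariant: "\<And>y z. q (y + q z) = q y" "\<And>y z. q (y - q z) = q y"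
begin

text \<open>Approximate the displacement by countably-valued ones.  A point that is moved into the open set is eventually
  moved there by the approximations, so Fatou's lemma applies.\<close>

lemma emeasure_open_le:
  assumes A: "open A"
  shows "emeasure lborel {y. y + q y \<in> A} \<le> emeasure lborel A"
proof -
  obtain R where R: "countable R" "R \<subseteq> range q" "range q \<subseteq> closure R"
    using separable[of "range q"] by blast
  then have "R \<noteq> {}" by auto
  define e where "e = from_nat_into R"
  have e: "range e = R" unfolding e_def using R(1) \<open>R \<noteq> {}\<close> by (simp add: range_from_nat_into)
  define i where "i n y = (LEAST k. dist (e k) (q y) < 1 / real (Suc n))" for n y
  define c where "c n y = e (i n y)" for n y
  have close: "dist (c n y) (q y) < 1 / real (Suc n)" for n y
  proof -
    have "q y \<in> closure R" using R(3) by auto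
    then obtain v where "v \<in> R" "dist v (q y) < 1 / real (Suc n)"
      unfolding closure_approachable by (metis divide_pos_pos of_nat_0_less_iff zero_less_Suc zero_less_one)
    then obtain k where "dist (e k) (q y) < 1 / real (Suc n)" using e by auto
    then show ?thesis unfolding c_def i_def by (rule LeastI)
  qed
  have qm [measurable]: "q \<in> borel_measurable borel"
    using continuous by (rule borel_measurable_continuous_onI)
  have im: "i n \<in> measurable borel (count_space UNIV)" for n
  proof -
    have "open {y. dist (e k) (q y) < 1 / real (Suc n)}" for k
      by (intro open_Collect_less continuous_intros continuous)
    then have "Measurable.pred borel (\<lambda>y. dist (e k) (q y) < 1 / real (Suc n))" for k
      by (simp add: pred_def)
    then show ?thesis unfolding i_def by (rule measurable_Least)
  qed
  have cm: "c n \<in> borel_measurable borel" for n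
    unfolding c_def[abs_def] by (rule measurable_compose[OF im]) simp
  have cr: "range (c n) \<subseteq> R" for n
    unfolding c_def e[symmetric] by blast
  have cinv: "c n (y + v) = c n y" if "v \<in> range (c n)" for n y v
  proof -
    have "v \<in> range q" by (rule subsetD[OF R(2) subsetD[OF cr that]])
    then obtain z where "v = q z" by (rule imageE)
    then have "q (y + v) = q y" by (simp add: invariant)
    then show ?thesis by (simp add: c_def i_def)
  qed
  have disc: "emeasure lborel {y. y + c n y \<in> A} = emeasure lborel A" for n
    by (rule emeasure_discrete_shear[OF cm countable_subset[OF cr R(1)] cinv borel_open[OF A]])
  have Sm: "{y. y + c n y \<in> A} \<in> sets borel" for n
  proof -
    have "(\<lambda>y. y + c n y) \<in> borel_measurable borel" using cm[of n] by simp
    from measurable_sets[OF this borel_open[OF A]] show ?thesis by (simp add: vimage_def)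
  qed
  have Sq: "{y. y + q y \<in> A} \<in> sets borel"
  proof -
    have "(\<lambda>y. y + q y) \<in> borel_measurable borel" by simp
    from measurable_sets[OF this borel_open[OF A]] show ?thesis by (simp add: vimage_def)
  qed
  have lim: "indicator {y. y + q y \<in> A} y \<le> liminf (\<lambda>n. indicator {y. y + c n y \<in> A} y :: ennreal)" for y
  proof (cases "y + q y \<in> A")
    case True
    have "(\<lambda>n. c n y) \<longlonglongrightarrow> q y"
    proof (rule tendstoI)
      fix r :: real assume "r > 0"
      then have "eventually (\<lambda>n. 1 / real (Suc n) < r) sequentially"
        using LIMSEQ_inverse_real_of_nat[THEN order_tendstoD(2), of r] by (simp add: inverse_eq_divide)
      then show "eventually (\<lambda>n. dist (c n y) (q y) < r) sequentially"
        by (rule eventually_mono) (use close less_trans in blast)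
    qed
    then have "(\<lambda>n. y + c n y) \<longlonglongrightarrow> y + q y" by (intro tendsto_intros)
    then have "eventually (\<lambda>n. y + c n y \<in> A) sequentially"
      using A True by (simp add: tendsto_def)
    then have "eventually (\<lambda>n. (1::ennreal) \<le> indicator {y. y + c n y \<in> A} y) sequentially"
      by (rule eventually_mono) simp
    then have "1 \<le> liminf (\<lambda>n. indicator {y. y + c n y \<in> A} y :: ennreal)"
      by (rule Liminf_bounded)
    then show ?thesis using True by simp
  qed simp
  have "emeasure lborel {y. y + q y \<in> A} = (\<integral>\<^sup>+y. indicator {y. y + q y \<in> A} y \<partial>lborel)"
    using Sq by simp
  also have "\<dots> \<le> (\<integral>\<^sup>+y. liminf (\<lambda>n. indicator {y. y + c n y \<in> A} y) \<partial>lborel)"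
    by (rule nn_integral_mono) (rule lim)
  also have "\<dots> \<le> liminf (\<lambda>n. \<integral>\<^sup>+y. indicator {y. y + c n y \<in> A} y \<partial>lborel)"
    using Sm by (intro nn_integral_liminf) auto
  also have "\<dots> = emeasure lborel A" using Sm disc by (simp add: Liminf_const)
  finally show ?thesis .
qed

end

text \<open>The inverse of a shear is a shear, so the inequality for open sets holds in both directions.\<close>

lemma distr_shear:
  assumes "shear q"
  shows "distr lborel borel (\<lambda>y. y + q y) = lborel"
proof -
  interpret shear q by fact
  interpret inverse: shear "\<lambda>y. - q y"
    using continuous invariant by unfold_locales (auto intro!: continuous_intros)
  have qm [measurable]: "q \<in> borel_measurable borel"
    using continuous by (rule borel_measurable_continuous_onI)
  have eq: "emeasure lborel {y. y + q y \<in> A} = emeasure lborel A" if A: "open A" for A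
  proof (rule antisym)
    show "emeasure lborel {y. y + q y \<in> A} \<le> emeasure lborel A" by (rule emeasure_open_le[OF A])
    have "open ((\<lambda>y. y + q y) -` A)"
      by (rule open_vimage[OF A]) (intro continuous_intros continuous)
    then have "open {y. y + q y \<in> A}" by (simp add: vimage_def)
    from inverse.emeasure_open_le[OF this]
    have "emeasure lborel {y. (y - q y) + q (y - q y) \<in> A} \<le> emeasure lborel {y. y + q y \<in> A}" by simp
    then show "emeasure lborel A \<le> emeasure lborel {y. y + q y \<in> A}" by (simp add: invariant)
  qed
  show ?thesis
  proof (rule lborel_eqI[symmetric])
    fix l u :: 'a assume lu: "\<And>b. b \<in> Basis \<Longrightarrow> l \<bullet> b \<le> u \<bullet> b"
    have "emeasure (distr lborel borel (\<lambda>y. y + q y)) (box l u) = emeasure lborel {y. y + q y \<in> box l u}"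
      by (subst emeasure_distr) (auto simp: vimage_def)
    also have "\<dots> = emeasure lborel (box l u)" by (rule eq) (rule open_box)
    also have "\<dots> = ennreal (\<Prod>b\<in>Basis. (u - l) \<bullet> b)" using lu by (simp add: emeasure_lborel_box)
    finally show "emeasure (distr lborel borel (\<lambda>y. y + q y)) (box l u) = (\<Prod>b\<in>Basis. (u - l) \<bullet> b)" .
  qed simp
qed

context carnot_group
begin

text \<open>A map that is the identity to leading order along the filtration is a composition of shears, one
  for each layer, performed from the top layer downwards.\<close>

lemma distr_triangular:
  assumes cont: "continuous_on UNIV f"
    and tri: "\<And>m y d. d \<in> filt m \<Longrightarrow> f (y + d) - f y - d \<in> filt (Suc m)"
  shows "distr lborel borel f = lborel"
proof -
  define q where "q j y = component G j (f y) - component G j y" for j y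
  have qinv: "q j (y + d) = q j y" if d: "d \<in> filt j" for j y d
  proof -
    have "component G j (f (y + d) - f y - d) = 0" using tri[OF d, of y] by (simp add: filt_def)
    then show ?thesis by (simp add: q_def component_diff component_add algebra_simps)
  qed
  have qfilt: "q j y \<in> filt i" if "i \<le> j" for i j y
    using that by (auto simp: q_def intro!: filt_diff filt_mono[OF layer_filt[OF component_in_layer]])
  have qcont: "continuous_on UNIV (q j)" for j
    unfolding q_def[abs_def] by (intro continuous_intros cont)
  have sh: "shear (q j)" for j
    using qinv[OF qfilt[OF order_refl]] qinv[OF filt_neg[OF qfilt[OF order_refl]]]
    by unfold_locales (auto simp: qcont)
  define g where "g k y = y + (\<Sum>j = 1..k. q j y)" for k y
  have gcont: "continuous_on UNIV (g k)" for k
    unfolding g_def[abs_def] by (intro continuous_intros qcont)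
  have gm: "g k \<in> borel_measurable borel" for k
    using gcont by (rule borel_measurable_continuous_onI)
  have sm: "(\<lambda>y. y + q k y) \<in> borel_measurable borel" for k
    by (rule borel_measurable_continuous_onI) (intro continuous_intros qcont)
  have "distr lborel borel (g k) = lborel" for k
  proof (induction k)
    case 0
    have "g 0 = (\<lambda>y. y)" by (simp add: g_def fun_eq_iff)
    then show ?case by (simp add: distr_id2)
  next
    case (Suc k)
    have "g (Suc k) y = g k (y + q (Suc k) y)" for y
    proof -
      have "q j (y + q (Suc k) y) = q j y" if "j \<in> {1..k}" for j
        using that by (intro qinv qfilt) auto
      then show ?thesis by (simp add: g_def add.commute add.left_commute)
    qed
    then have "g (Suc k) = g k \<circ> (\<lambda>y. y + q (Suc k) y)" by (simp add: fun_eq_iff)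
    then have "distr lborel borel (g (Suc k)) = distr (distr lborel borel (\<lambda>y. y + q (Suc k) y)) borel (g k)"
      using gm sm by (simp add: distr_distr)
    then show ?case by (simp add: distr_shear[OF sh] Suc.IH)
  qed
  moreover have "g (step G) = f"
  proof
    fix y
    have "(\<Sum>j = 1..step G. q j y) = f y - y"
      by (simp only: q_def sum_subtractf sum_component)
    then show "g (step G) y = f y" by (simp add: g_def)
  qed
  ultimately show ?thesis by metis
qed

lemma distr_left_translation: "distr lborel borel (\<lambda>y. x \<otimes> y) = lborel"
  by (rule distr_triangular) (auto intro!: continuous_intros mult_increment_right)

lemma distr_right_translation: "distr lborel borel (\<lambda>y. y \<otimes> x) = lborel"
  by (rule distr_triangular) (auto intro!: continuous_intros mult_increment_left)

lemma borel_measurable_translations [measurable]: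
  "(\<lambda>y. x \<otimes> y) \<in> borel_measurable borel" "(\<lambda>y. y \<otimes> x) \<in> borel_measurable borel"
  by (auto intro!: borel_measurable_continuous_onI continuous_intros)

lemma nn_integral_right_translation:
  assumes [measurable]: "f \<in> borel_measurable borel"
  shows "(\<integral>\<^sup>+y. f (y \<otimes> x) \<partial>lborel) = (\<integral>\<^sup>+y. f y \<partial>lborel)"
proof -
  have "(\<integral>\<^sup>+y. f y \<partial>lborel) = (\<integral>\<^sup>+y. f y \<partial>distr lborel borel (\<lambda>y. y \<otimes> x))"
    by (simp add: distr_right_translation)
  also have "\<dots> = (\<integral>\<^sup>+y. f (y \<otimes> x) \<partial>lborel)" by (rule nn_integral_distr) simp_all
  finally show ?thesis by simp
qed

subsection \<open>Balls of the homogeneous norm\<close>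

definition hball :: "'a \<Rightarrow> real \<Rightarrow> 'a set" where
  "hball x \<rho> = {y. hdist x y < \<rho>}"

lemma open_hball: "open (hball x \<rho>)"
  unfolding hball_def by (intro open_Collect_less continuous_intros)

lemma borel_hball [measurable]: "hball x \<rho> \<in> sets borel"
  using open_hball by simp

lemma hball_mono: "\<rho> \<le> \<rho>' \<Longrightarrow> hball x \<rho> \<subseteq> hball x \<rho>'"
  by (auto simp: hball_def)

lemma emeasure_hball_translate: "emeasure lborel (hball x \<rho>) = emeasure lborel (hball 0 \<rho>)"
proof -
  have "hball x \<rho> = (\<lambda>y. - x \<otimes> y) -` hball 0 \<rho>" by (auto simp: hball_def)
  then have "emeasure lborel (hball x \<rho>) = emeasure (distr lborel borel (\<lambda>y. - x \<otimes> y)) (hball 0 \<rho>)"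
    by (subst emeasure_distr) auto
  then show ?thesis by (simp add: distr_left_translation)
qed

lemma bounded_hball: "bounded (hball 0 \<rho>)"
proof -
  obtain C where "\<And>x. hnorm x \<le> \<rho> \<Longrightarrow> norm x \<le> C" using norm_bounded_if_hnorm by blast
  then have "\<forall>x\<in>hball 0 \<rho>. norm x \<le> C" by (simp add: hball_def)
  then show ?thesis unfolding bounded_iff by blast
qed

definition volume :: "real \<Rightarrow> real" where "volume \<rho> = measure lborel (hball 0 \<rho>)"

lemma emeasure_hball: "emeasure lborel (hball x \<rho>) = ennreal (volume \<rho>)"
  using emeasure_bounded_finite[OF bounded_hball, of \<rho>] emeasure_hball_translate[of x \<rho>]
  by (simp add: volume_def emeasure_eq_ennreal_measure)

lemma volume_nonneg: "0 \<le> volume \<rho>" by (simp add: volume_def)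

lemma volume_mono: "\<rho> \<le> \<rho>' \<Longrightarrow> volume \<rho> \<le> volume \<rho>'"
  using emeasure_mono[OF hball_mono[of \<rho> \<rho>' 0], of lborel] by (simp add: emeasure_hball volume_nonneg)

text \<open>Doubling needs only translation invariance: cover the ball of radius \<open>2\<close> by finitely many unit balls
  and dilate the cover.\<close>

lemma volume_doubling: "\<exists>D\<ge>1. \<forall>\<rho>>0. volume (2 * \<rho>) \<le> D * volume \<rho>"
proof -
  define S where "S = {x. hnorm x \<le> 2}"
  have "closed S" unfolding S_def by (intro closed_Collect_le continuous_intros)
  moreover obtain C where "\<And>x. hnorm x \<le> 2 \<Longrightarrow> norm x \<le> C" using norm_bounded_if_hnorm by blast
  then have "\<forall>x\<in>S. norm x \<le> C" by (simp add: S_def)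
  then have "bounded S" unfolding bounded_iff by blast
  ultimately have "compact S" by (simp add: compact_eq_bounded_closed)
  moreover have "x \<in> hball x 1" for x by (simp add: hball_def)
  then have "S \<subseteq> (\<Union>x\<in>UNIV. hball x 1)" by blast
  ultimately obtain Z where Z: "finite Z" "S \<subseteq> (\<Union>x\<in>Z. hball x 1)"
    using compactE_image[of S UNIV "\<lambda>x. hball x 1"] open_hball by metis
  have "volume (2 * \<rho>) \<le> (real (card Z) + 1) * volume \<rho>" if \<rho>: "0 < \<rho>" for \<rho>
  proof -
    have "hball 0 (2 * \<rho>) \<subseteq> (\<Union>x\<in>Z. hball (dilation G \<rho> x) \<rho>)"
    proof
      fix y assume "y \<in> hball 0 (2 * \<rho>)"
      then have "dilation G (1 / \<rho>) y \<in> S" using \<rho> by (simp add: hball_def S_def hnorm_dilation field_simps)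
      then obtain x where x: "x \<in> Z" "hnorm (- x \<otimes> dilation G (1 / \<rho>) y) < 1"
        using Z(2) by (auto simp: hball_def)
      have "- dilation G \<rho> x \<otimes> y = dilation G \<rho> (- x \<otimes> dilation G (1 / \<rho>) y)"
        using \<rho> by (simp add: dilation_mult dilation_neg dilation_dilation)
      then have "hnorm (- dilation G \<rho> x \<otimes> y) < \<rho>" using x(2) \<rho> by (simp add: hnorm_dilation)
      then show "y \<in> (\<Union>x\<in>Z. hball (dilation G \<rho> x) \<rho>)" using x(1) by (auto simp: hball_def)
    qed
    then have "ennreal (volume (2 * \<rho>)) \<le> emeasure lborel (\<Union>x\<in>Z. hball (dilation G \<rho> x) \<rho>)"
      unfolding emeasure_hball[of 0, symmetric] using Z(1) by (intro emeasure_mono) auto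
    also have "\<dots> \<le> (\<Sum>x\<in>Z. emeasure lborel (hball (dilation G \<rho> x) \<rho>))"
      using Z(1) by (intro emeasure_subadditive_finite) auto
    also have "\<dots> = ennreal (real (card Z) * volume \<rho>)"
      by (simp add: emeasure_hball ennreal_mult volume_nonneg ennreal_of_nat_eq_real_of_nat)
    finally have "volume (2 * \<rho>) \<le> real (card Z) * volume \<rho>"
      by (simp add: volume_nonneg)
    then show ?thesis using volume_nonneg[of \<rho>] by (simp add: distrib_right)
  qed
  then show ?thesis by (intro exI[of _ "real (card Z) + 1"]) auto
qed

lemma volume_scale_up: "\<exists>D\<ge>1. \<forall>\<rho>>0. volume (C * \<rho>) \<le> D * volume \<rho>"
proof -
  obtain D where D: "D \<ge> 1" "\<And>\<rho>. \<rho> > 0 \<Longrightarrow> volume (2 * \<rho>) \<le> D * volume \<rho>" using volume_doubling by blast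
  have *: "volume (2 ^ k * \<rho>) \<le> D ^ k * volume \<rho>" if "\<rho> > 0" for k \<rho>
  proof (induction k)
    case (Suc k)
    have "volume (2 * (2 ^ k * \<rho>)) \<le> D * volume (2 ^ k * \<rho>)" using that by (intro D(2)) auto
    also have "\<dots> \<le> D * (D ^ k * volume \<rho>)" using Suc D(1) by (intro mult_left_mono) auto
    finally show ?case by (simp add: mult.assoc)
  qed simp
  obtain k where k: "C < 2 ^ k" using real_arch_pow[of 2 C] by auto
  have "volume (C * \<rho>) \<le> D ^ k * volume \<rho>" if "\<rho> > 0" for \<rho>
    using volume_mono[of "C * \<rho>" "2 ^ k * \<rho>"] *[OF that, of k] that k by (simp add: mult_right_mono)
  then show ?thesis using D(1) by (intro exI[of _ "D ^ k"]) (auto simp: one_le_power)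
qed

text \<open>Iterated doubling, with the number of steps logarithmic in \<open>1 / d\<close>.\<close>

lemma volume_scale_down: "\<exists>q. \<forall>d \<rho>. 0 < d \<and> d \<le> 1/2 \<and> 0 < \<rho> \<longrightarrow> d ^ q * volume \<rho> \<le> volume (d * \<rho>)"
proof -
  obtain D where D: "D \<ge> 1" "\<And>\<rho>. \<rho> > 0 \<Longrightarrow> volume (2 * \<rho>) \<le> D * volume \<rho>" using volume_doubling by blast
  obtain a where a: "D < 2 ^ a" using real_arch_pow[of 2 D] by auto
  have *: "volume \<rho> \<le> D ^ k * volume (\<rho> / 2 ^ k)" if "\<rho> > 0" for k \<rho>
  proof (induction k)
    case (Suc k)
    have "volume (\<rho> / 2 ^ k) \<le> D * volume (\<rho> / 2 ^ Suc k)"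
      using D(2)[of "\<rho> / 2 ^ Suc k"] that by simp
    then have "D ^ k * volume (\<rho> / 2 ^ k) \<le> D ^ k * (D * volume (\<rho> / 2 ^ Suc k))"
      using D(1) by (intro mult_left_mono) auto
    with Suc show ?case by (simp add: mult.assoc mult.left_commute)
  qed simp
  have "d ^ (2 * a) * volume \<rho> \<le> volume (d * \<rho>)" if d: "0 < d" "d \<le> 1/2" and \<rho>: "0 < \<rho>" for d \<rho>
  proof -
    obtain k0 where "(1 / 2) ^ k0 < d" using real_arch_pow_inv[of d "1/2"] d by auto
    then have k0: "1 / 2 ^ k0 \<le> d" by (simp add: power_one_over)
    define k where "k = (LEAST k. 1 / 2 ^ k \<le> d)"
    have k: "1 / 2 ^ k \<le> d" unfolding k_def using k0 by (rule LeastI)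
    have k': "d < 1 / 2 ^ j" if "j < k" for j
      using not_less_Least[OF that[unfolded k_def]] by simp
    have "k > 0" using k d by (intro gr0I) auto
    then obtain j where j: "k = Suc j" by (cases k) auto
    have "d < 1 / 2 ^ j" using k' j by simp
    then have "d * 2 ^ k \<le> 2" by (simp add: j field_simps)
    then have "d * (d * 2 ^ k) \<le> 1/2 * 2" using d by (intro mult_mono) auto
    then have "(d ^ 2 * 2 ^ k) ^ a \<le> 1" using d by (intro power_le_one) (auto simp: power2_eq_square mult.assoc)
    then have 1: "d ^ (2 * a) * (2 ^ a) ^ k \<le> 1"
      by (simp add: power_mult_distrib power_mult[symmetric] mult.commute)
    have "D ^ k \<le> (2 ^ a) ^ k" using a D(1) by (intro power_mono) auto
    then have "d ^ (2 * a) * D ^ k \<le> d ^ (2 * a) * (2 ^ a) ^ k" using d by (intro mult_left_mono) auto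
    with 1 have 2: "d ^ (2 * a) * D ^ k \<le> 1" by linarith
    have "d ^ (2 * a) * volume \<rho> \<le> d ^ (2 * a) * (D ^ k * volume (\<rho> / 2 ^ k))"
      using *[OF \<rho>] d by (intro mult_left_mono) auto
    also have "\<dots> \<le> 1 * volume (\<rho> / 2 ^ k)"
      using mult_right_mono[OF 2 volume_nonneg[of "\<rho> / 2 ^ k"]] by (simp add: mult.assoc)
    also have "\<dots> \<le> volume (d * \<rho>)"
      using k \<rho> mult_right_mono[of "1 / 2 ^ k" d \<rho>] by (auto intro!: volume_mono)
    finally show ?thesis .
  qed
  then show ?thesis by blast
qed

end

section \<open>A Lojasiewicz inequality for polynomial systems\<close>

lemma ultrafilter_exists:
  "\<exists>U::nat filter. U \<noteq> bot \<and> U \<le> sequentially \<and> (\<forall>P. eventually P U \<or> eventually (\<lambda>n. \<not> P n) U)"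
proof -
  define A where "A = {F::nat filter. F \<noteq> bot \<and> F \<le> sequentially}"
  have "\<exists>M\<in>A. \<forall>F\<in>A. F \<le> M \<longrightarrow> F = M"
  proof (rule predicate_Zorn[where P = "\<lambda>F G. G \<le> F"])
    show "partial_order_on A (relation_of (\<lambda>F G. G \<le> F) A)"
      by (rule partial_order_on_relation_ofI) auto
    fix C assume C: "C \<in> Chains (relation_of (\<lambda>F G. G \<le> F) A)"
    show "\<exists>u\<in>A. \<forall>F\<in>C. u \<le> F"
    proof (cases "C = {}")
      case True
      moreover have "sequentially \<in> A" by (simp add: A_def)
      ultimately show ?thesis by blast
    next
      case False
      have CA: "C \<subseteq> A" using C by (auto simp: Chains_def relation_of_def)
      have "eventually P (Inf C) \<longleftrightarrow> (\<exists>F\<in>C. eventually P F)" for P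
      proof (rule eventually_Inf_base[OF False])
        fix F G assume "F \<in> C" "G \<in> C"
        then show "\<exists>x\<in>C. x \<le> inf F G" using C by (auto simp: Chains_def relation_of_def)
      qed
      then have "Inf C \<noteq> bot" using CA by (auto simp: trivial_limit_def A_def)
      moreover have "Inf C \<le> sequentially" using False CA by (auto simp: A_def intro: Inf_lower2)
      ultimately show ?thesis by (auto simp: A_def intro!: bexI[of _ "Inf C"] Inf_lower)
    qed
  qed
  then obtain U where U: "U \<noteq> bot" "U \<le> sequentially" "\<And>F. F \<in> A \<Longrightarrow> F \<le> U \<Longrightarrow> F = U"
    by (auto simp: A_def)
  have "eventually P U \<or> eventually (\<lambda>n. \<not> P n) U" for P
  proof (cases "eventually (\<lambda>n. \<not> P n) U")
    case False
    then have "inf U (principal {n. P n}) \<noteq> bot"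
      by (simp add: trivial_limit_def eventually_inf_principal)
    moreover have "inf U (principal {n. P n}) \<le> sequentially" using U(2) by (rule le_infI1)
    ultimately have "inf U (principal {n. P n}) = U" by (intro U(3)) (auto simp: A_def)
    moreover have "eventually P (inf U (principal {n. P n}))" by (simp add: eventually_inf_principal)
    ultimately show ?thesis by simp
  qed simp
  with U show ?thesis by blast
qed

text \<open>Fix an ultrafilter and a sequence \<open>\<epsilon>\<close> of small numbers.  Sequences bounded by a power of \<open>1/\<epsilon>\<close> form a
  valuation ring whose maximal ideal consists of the sequences below every power of \<open>\<epsilon>\<close>.  The locale
  develops the fact that this ring has a field of representatives.\<close>

locale asymptotic_scale =
  fixes U :: "nat filter" and \<epsilon> :: "nat \<Rightarrow> real"
  assumes proper: "U \<noteq> bot"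
    and ultra: "\<And>P. eventually P U \<or> eventually (\<lambda>n. \<not> P n) U"
    and scale_pos: "\<And>n. 0 < \<epsilon> n" and scale_le: "\<And>n. \<epsilon> n \<le> 1/2"
begin

definition negligible_seq :: "(nat \<Rightarrow> real) \<Rightarrow> bool" where
  "negligible_seq y \<longleftrightarrow> (\<forall>k. eventually (\<lambda>n. \<bar>y n\<bar> \<le> \<epsilon> n ^ k) U)"

definition moderate :: "(nat \<Rightarrow> real) \<Rightarrow> bool" where
  "moderate y \<longleftrightarrow> (\<exists>k. eventually (\<lambda>n. \<bar>y n\<bar> * \<epsilon> n ^ k \<le> 1) U)"

lemma scale_power: "0 < \<epsilon> n ^ k" "\<epsilon> n ^ k \<le> 1"
  using scale_pos[of n] scale_le[of n] by (auto intro: power_le_one)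

lemma negligible_add:
  assumes "negligible_seq y" "negligible_seq z"
  shows "negligible_seq (\<lambda>n. y n + z n)"
  unfolding negligible_seq_def
proof
  fix k
  have "eventually (\<lambda>n. \<bar>y n\<bar> \<le> \<epsilon> n ^ Suc k) U" "eventually (\<lambda>n. \<bar>z n\<bar> \<le> \<epsilon> n ^ Suc k) U"
    using assms unfolding negligible_seq_def by blast+
  then show "eventually (\<lambda>n. \<bar>y n + z n\<bar> \<le> \<epsilon> n ^ k) U"
  proof eventually_elim
    case (elim n)
    have "2 * \<epsilon> n ^ Suc k \<le> \<epsilon> n ^ k" using scale_le[of n] scale_power(1)[of n k] by simp
    with elim show ?case by linarith
  qed
qed

lemma moderate_mult:
  assumes "moderate y" "moderate z"
  shows "moderate (\<lambda>n. y n * z n)"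
proof -
  obtain k l where "eventually (\<lambda>n. \<bar>y n\<bar> * \<epsilon> n ^ k \<le> 1) U" "eventually (\<lambda>n. \<bar>z n\<bar> * \<epsilon> n ^ l \<le> 1) U"
    using assms unfolding moderate_def by blast
  then have "eventually (\<lambda>n. \<bar>y n * z n\<bar> * \<epsilon> n ^ (k + l) \<le> 1) U"
  proof eventually_elim
    case (elim n)
    have "(\<bar>y n\<bar> * \<epsilon> n ^ k) * (\<bar>z n\<bar> * \<epsilon> n ^ l) \<le> 1 * 1"
      using elim scale_power(1)[of n l] by (intro mult_mono) auto
    then show ?case by (simp add: abs_mult power_add mult_ac)
  qed
  then show ?thesis unfolding moderate_def by blast
qed

lemma moderate_add:
  assumes "moderate y" "moderate z"
  shows "moderate (\<lambda>n. y n + z n)"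
proof -
  obtain k l where "eventually (\<lambda>n. \<bar>y n\<bar> * \<epsilon> n ^ k \<le> 1) U" "eventually (\<lambda>n. \<bar>z n\<bar> * \<epsilon> n ^ l \<le> 1) U"
    using assms unfolding moderate_def by blast
  then have "eventually (\<lambda>n. \<bar>y n + z n\<bar> * \<epsilon> n ^ (k + l + 1) \<le> 1) U"
  proof eventually_elim
    case (elim n)
    have 1: "\<bar>y n\<bar> * \<epsilon> n ^ (k + l) \<le> 1"
      using mult_mono[OF elim(1) scale_power(2)[of n l]] scale_power(1)[of n l] by (simp add: power_add mult_ac)
    have 2: "\<bar>z n\<bar> * \<epsilon> n ^ (k + l) \<le> 1"
      using mult_mono[OF elim(2) scale_power(2)[of n k]] scale_power(1)[of n k] by (simp add: power_add mult_ac)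
    have "\<bar>y n + z n\<bar> * \<epsilon> n ^ (k + l) \<le> (\<bar>y n\<bar> + \<bar>z n\<bar>) * \<epsilon> n ^ (k + l)"
      using scale_power(1)[of n "k + l"] by (intro mult_right_mono abs_triangle_ineq) auto
    also have "\<dots> \<le> 2" using 1 2 by (simp add: distrib_right)
    finally have "(\<bar>y n + z n\<bar> * \<epsilon> n ^ (k + l)) * \<epsilon> n \<le> 2 * (1/2)"
      using scale_le[of n] scale_pos[of n] by (intro mult_mono) auto
    then show ?case by (simp add: mult_ac)
  qed
  then show ?thesis unfolding moderate_def by blast
qed

lemma negligible_mult:
  assumes "moderate y" "negligible_seq z"
  shows "negligible_seq (\<lambda>n. y n * z n)"
  unfolding negligible_seq_def
proof
  fix j
  obtain k where "eventually (\<lambda>n. \<bar>y n\<bar> * \<epsilon> n ^ k \<le> 1) U" using assms(1) unfolding moderate_def by blast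
  moreover have "eventually (\<lambda>n. \<bar>z n\<bar> \<le> \<epsilon> n ^ (k + j)) U" using assms(2) unfolding negligible_seq_def by blast
  ultimately show "eventually (\<lambda>n. \<bar>y n * z n\<bar> \<le> \<epsilon> n ^ j) U"
  proof eventually_elim
    case (elim n)
    have "\<bar>y n\<bar> * \<bar>z n\<bar> \<le> \<bar>y n\<bar> * \<epsilon> n ^ (k + j)" using elim by (intro mult_left_mono) auto
    also have "\<dots> = (\<bar>y n\<bar> * \<epsilon> n ^ k) * \<epsilon> n ^ j" by (simp add: power_add)
    also have "\<dots> \<le> 1 * \<epsilon> n ^ j" using elim scale_power(1)[of n j] by (intro mult_right_mono) auto
    finally show ?case by (simp add: abs_mult)
  qed
qed

lemma moderate_const: "moderate (\<lambda>_. c)"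
proof -
  obtain k where k: "\<bar>c\<bar> < 2 ^ k" using real_arch_pow[of 2 "\<bar>c\<bar>"] by auto
  have "\<bar>c\<bar> * \<epsilon> n ^ k \<le> 1" for n
  proof -
    have "\<bar>c\<bar> * \<epsilon> n ^ k \<le> 2 ^ k * (1/2) ^ k"
      using k scale_pos[of n] scale_le[of n] by (intro mult_mono power_mono) auto
    then show ?thesis by (simp flip: power_mult_distrib)
  qed
  then show ?thesis unfolding moderate_def by (auto intro!: exI[of _ k])
qed

lemma moderate_bounded: "(\<And>n. \<bar>y n\<bar> \<le> \<bar>z n\<bar>) \<Longrightarrow> moderate z \<Longrightarrow> moderate y"
  unfolding moderate_def
proof (elim exE)
  fix k assume le: "\<And>n. \<bar>y n\<bar> \<le> \<bar>z n\<bar>" and "eventually (\<lambda>n. \<bar>z n\<bar> * \<epsilon> n ^ k \<le> 1) U"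
  from this(2) have "eventually (\<lambda>n. \<bar>y n\<bar> * \<epsilon> n ^ k \<le> 1) U"
  proof (rule eventually_mono)
    fix n assume "\<bar>z n\<bar> * \<epsilon> n ^ k \<le> 1"
    moreover have "\<bar>y n\<bar> * \<epsilon> n ^ k \<le> \<bar>z n\<bar> * \<epsilon> n ^ k"
      using le scale_power(1)[of n k] by (intro mult_right_mono) auto
    ultimately show "\<bar>y n\<bar> * \<epsilon> n ^ k \<le> 1" by linarith
  qed
  then show "\<exists>k. eventually (\<lambda>n. \<bar>y n\<bar> * \<epsilon> n ^ k \<le> 1) U" by blast
qed

lemma moderate_abs: "moderate y \<Longrightarrow> moderate (\<lambda>n. \<bar>y n\<bar>)"
  by (rule moderate_bounded) auto

lemma moderate_power: "moderate y \<Longrightarrow> moderate (\<lambda>n. y n ^ i)"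
  by (induction i) (auto intro: moderate_const moderate_mult)

lemma moderate_sum: "finite I \<Longrightarrow> (\<And>i. i \<in> I \<Longrightarrow> moderate (y i)) \<Longrightarrow> moderate (\<lambda>n. \<Sum>i\<in>I. y i n)"
  by (induction I rule: finite_induct) (auto intro: moderate_const moderate_add)

lemma negligible_zero: "negligible_seq (\<lambda>_. 0)"
  using scale_power(1) by (auto simp: negligible_seq_def less_imp_le)

lemma negligible_sum:
  "finite I \<Longrightarrow> (\<And>i. i \<in> I \<Longrightarrow> negligible_seq (y i)) \<Longrightarrow> negligible_seq (\<lambda>n. \<Sum>i\<in>I. y i n)"
  by (induction I rule: finite_induct) (auto intro: negligible_zero negligible_add)

lemma negligible_moderate: "negligible_seq y \<Longrightarrow> moderate y"
  unfolding negligible_seq_def moderate_def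
  by (rule exI[of _ 0]) (auto dest: spec[of _ 0])

lemma negligible_cmult: "negligible_seq y \<Longrightarrow> negligible_seq (\<lambda>n. c * y n)"
  by (rule negligible_mult[OF moderate_const])

lemma negligible_diff: "negligible_seq y \<Longrightarrow> negligible_seq z \<Longrightarrow> negligible_seq (\<lambda>n. y n - z n)"
  using negligible_add[of y "\<lambda>n. -1 * z n"] negligible_cmult[of z "-1"] by simp

lemma negligible_cong:
  assumes "eventually (\<lambda>n. y n = z n) U" "negligible_seq y"
  shows "negligible_seq z"
  unfolding negligible_seq_def
proof
  fix k
  have "eventually (\<lambda>n. \<bar>y n\<bar> \<le> \<epsilon> n ^ k) U" using assms(2) unfolding negligible_seq_def by blast
  with assms(1) show "eventually (\<lambda>n. \<bar>z n\<bar> \<le> \<epsilon> n ^ k) U" by eventually_elim simp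
qed

lemma not_negligible:
  assumes "\<not> negligible_seq y"
  obtains k where "eventually (\<lambda>n. \<epsilon> n ^ k < \<bar>y n\<bar>) U"
proof -
  obtain k where "\<not> eventually (\<lambda>n. \<bar>y n\<bar> \<le> \<epsilon> n ^ k) U" using assms unfolding negligible_seq_def by blast
  then have "eventually (\<lambda>n. \<not> \<bar>y n\<bar> \<le> \<epsilon> n ^ k) U" using ultra by blast
  then show thesis by (intro that[of k]) (simp add: not_le)
qed

text \<open>A \<open>lifted\<close> algebra of sequences meets the maximal ideal only in zero, so that negligibility of an
  expression means that the expression vanishes.\<close>

definition lifted :: "(nat \<Rightarrow> real) set \<Rightarrow> bool" where
  "lifted S \<longleftrightarrow> function_algebra S \<and> (\<forall>y\<in>S. moderate y \<and> (negligible_seq y \<longrightarrow> eventually (\<lambda>n. y n = 0) U))"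

definition adjoin :: "(nat \<Rightarrow> real) set \<Rightarrow> (nat \<Rightarrow> real) \<Rightarrow> (nat \<Rightarrow> real) set" where
  "adjoin S y = {z. \<exists>d c. (\<forall>i. c i \<in> S) \<and> z = (\<lambda>n. \<Sum>i<d. c i n * y n ^ i)}"

lemma function_algebra_adjoin:
  fixes y :: "nat \<Rightarrow> real"
  assumes S: "function_algebra S"
  shows "function_algebra (adjoin S y)" "S \<subseteq> adjoin S y" "y \<in> adjoin S y"
proof -
  note const = function_algebra_const[OF S]
  have zero: "(\<lambda>_. 0) \<in> S" by (rule const)
  show sub: "S \<subseteq> adjoin S y"
  proof
    fix c assume "c \<in> S"
    then show "c \<in> adjoin S y"
      unfolding adjoin_def by (auto intro!: exI[of _ 1] exI[of _ "\<lambda>_. c"])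
  qed
  have add: "(\<lambda>n. u n + v n) \<in> adjoin S y" if uv: "u \<in> adjoin S y" "v \<in> adjoin S y" for u v
  proof -
    obtain d c d' c' where u: "\<And>i. c i \<in> S" "u = (\<lambda>n. \<Sum>i<d. c i n * y n ^ i)"
      and v: "\<And>i. c' i \<in> S" "v = (\<lambda>n. \<Sum>i<d'. c' i n * y n ^ i)"
      using uv unfolding adjoin_def by blast
    define e where "e i = (\<lambda>n. (if i < d then c i n else 0) + (if i < d' then c' i n else 0))" for i
    have pz: "(\<lambda>n. if b then w n else 0) \<in> S" if "w \<in> S" for b w using that zero by (cases b) auto
    have "e i \<in> S" for i
      unfolding e_def by (intro function_algebra_add[OF S] pz u(1) v(1))
    moreover have "(\<Sum>i<max d d'. (if i < k then f i else 0)) = (\<Sum>i<k. f i)" if "k \<le> max d d'" for k and f :: "nat \<Rightarrow> real"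
      by (rule sum.mono_neutral_cong_right) (use that in auto)
    note pad = this
    have "u n + v n = (\<Sum>i<max d d'. e i n * y n ^ i)" for n
    proof -
      have "(\<Sum>i<max d d'. e i n * y n ^ i) =
          (\<Sum>i<max d d'. (if i < d then c i n * y n ^ i else 0)) + (\<Sum>i<max d d'. (if i < d' then c' i n * y n ^ i else 0))"
        unfolding sum.distrib[symmetric] by (rule sum.cong) (auto simp: e_def distrib_right)
      then show ?thesis by (simp add: pad u v)
    qed
    ultimately show ?thesis unfolding adjoin_def by blast
  qed
  have smult: "(\<lambda>n. s n * u n) \<in> adjoin S y" if s: "s \<in> S" and uv: "u \<in> adjoin S y" for s u
  proof -
    obtain d c where u: "\<And>i. c i \<in> S" "u = (\<lambda>n. \<Sum>i<d. c i n * y n ^ i)"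
      using uv unfolding adjoin_def by blast
    have "(\<lambda>n. s n * c i n) \<in> S" for i by (rule function_algebra_mult[OF S s u(1)])
    moreover have "(\<lambda>n. s n * u n) = (\<lambda>n. \<Sum>i<d. (s n * c i n) * y n ^ i)"
      by (simp add: u sum_distrib_left mult.assoc)
    ultimately show ?thesis unfolding adjoin_def mem_Collect_eq
      by (intro exI[of _ d] exI[of _ "\<lambda>i n. s n * c i n"]) simp
  qed
  have ymult: "(\<lambda>n. y n * u n) \<in> adjoin S y" if uv: "u \<in> adjoin S y" for u
  proof -
    obtain d c where u: "\<And>i. c i \<in> S" "u = (\<lambda>n. \<Sum>i<d. c i n * y n ^ i)"
      using uv unfolding adjoin_def by blast
    define e where "e i = (case i of 0 \<Rightarrow> (\<lambda>_. 0) | Suc j \<Rightarrow> c j)" for i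
    have "e i \<in> S" for i by (cases i) (auto simp: e_def zero u(1))
    moreover have "(\<lambda>n. y n * u n) = (\<lambda>n. \<Sum>i<Suc d. e i n * y n ^ i)"
      by (simp add: u e_def sum.lessThan_Suc_shift sum_distrib_left mult_ac del: sum.lessThan_Suc)
    ultimately show ?thesis unfolding adjoin_def by blast
  qed
  have pmult: "(\<lambda>n. y n ^ i * u n) \<in> adjoin S y" if "u \<in> adjoin S y" for u i
  proof (induction i)
    case (Suc i)
    from ymult[OF this] show ?case by (simp add: mult.assoc)
  qed (simp add: that)
  have mult: "(\<lambda>n. u n * v n) \<in> adjoin S y" if uv: "u \<in> adjoin S y" "v \<in> adjoin S y" for u v
  proof -
    obtain d c where u: "\<And>i. c i \<in> S" "u = (\<lambda>n. \<Sum>i<d. c i n * y n ^ i)"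
      using uv unfolding adjoin_def by blast
    have "(\<lambda>n. \<Sum>i<k. c i n * (y n ^ i * v n)) \<in> adjoin S y" for k
    proof (induction k)
      case 0
      show ?case using subsetD[OF sub zero] by simp
    next
      case (Suc k)
      from add[OF this smult[OF u(1) pmult[OF uv(2)]]] show ?case by simp
    qed
    from this[of d] show ?thesis by (simp add: u sum_distrib_right mult.assoc)
  qed
  show "function_algebra (adjoin S y)"
    using sub const add mult by (auto simp: function_algebra_def)
  show "y \<in> adjoin S y"
    using ymult[OF subsetD[OF sub const[of 1]]] by simp
qed

text \<open>The error is explicit in \<open>x\<close>, since the approximate roots to which it is applied need not be bounded.\<close>

lemma power_taylor:
  fixes x t :: real
  assumes "\<bar>t\<bar> \<le> 1"
  shows "\<bar>(x + t) ^ Suc i - x ^ Suc i - real (Suc i) * x ^ i * t\<bar> \<le> (real (Suc i))\<^sup>2 * (\<bar>x\<bar> + 1) ^ Suc i * t\<^sup>2"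
proof (induction i)
  case (Suc i)
  let ?e = "\<lambda>i. (x + t) ^ Suc i - x ^ Suc i - real (Suc i) * x ^ i * t"
  have "?e (Suc i) = (x + t) * ?e i + real (Suc i) * x ^ i * t\<^sup>2"
    by (simp add: algebra_simps power2_eq_square)
  then have "\<bar>?e (Suc i)\<bar> \<le> \<bar>x + t\<bar> * \<bar>?e i\<bar> + real (Suc i) * \<bar>x\<bar> ^ i * t\<^sup>2"
    by (metis (no_types, opaque_lifting) abs_mult abs_of_nat abs_power2 abs_triangle_ineq power_abs)
  also have "\<dots> \<le> (\<bar>x\<bar> + 1) * ((real (Suc i))\<^sup>2 * (\<bar>x\<bar> + 1) ^ Suc i * t\<^sup>2) + real (Suc i) * (\<bar>x\<bar> + 1) ^ Suc (Suc i) * t\<^sup>2"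
  proof (intro add_mono mult_mono Suc.IH)
    show "\<bar>x + t\<bar> \<le> \<bar>x\<bar> + 1" using assms by linarith
    have "\<bar>x\<bar> ^ i \<le> (\<bar>x\<bar> + 1) ^ i" by (intro power_mono) auto
    also have "\<dots> \<le> (\<bar>x\<bar> + 1) ^ Suc (Suc i)" by (intro power_increasing) auto
    finally show "\<bar>x\<bar> ^ i \<le> (\<bar>x\<bar> + 1) ^ Suc (Suc i)" .
  qed auto
  also have "\<dots> = ((real (Suc i))\<^sup>2 + real (Suc i)) * (\<bar>x\<bar> + 1) ^ Suc (Suc i) * t\<^sup>2"
    by (simp add: algebra_simps)
  also have "\<dots> \<le> (real (Suc (Suc i)))\<^sup>2 * (\<bar>x\<bar> + 1) ^ Suc (Suc i) * t\<^sup>2"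
    by (intro mult_right_mono) (auto simp: power2_eq_square algebra_simps)
  finally show ?case .
qed simp

text \<open>Newton's argument at a simple approximate root: the linear term dominates on an interval of negligible
  length, and the polynomial changes sign there.\<close>

lemma lift_simple_root:
  assumes q: "\<And>i. moderate (q i)" and y: "moderate y"
    and root: "negligible_seq (\<lambda>n. \<Sum>i<Suc d. q i n * y n ^ i)"
    and simple: "\<not> negligible_seq (\<lambda>n. \<Sum>i<d. (real (Suc i) * q (Suc i) n) * y n ^ i)"
  obtains y' where "negligible_seq (\<lambda>n. y' n - y n)"
    "eventually (\<lambda>n. (\<Sum>i<Suc d. q i n * y' n ^ i) = 0) U"
proof -
  define Q where "Q n x = (\<Sum>i<Suc d. q i n * x ^ i)" for n x
  define D where "D n = (\<Sum>i<d. (real (Suc i) * q (Suc i) n) * y n ^ i)" for n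
  define B where "B n = (\<Sum>i<d. \<bar>q (Suc i) n\<bar> * ((real (Suc i))\<^sup>2 * (\<bar>y n\<bar> + 1) ^ Suc i))" for n
  have B: "moderate B"
    unfolding B_def
    by (intro moderate_sum moderate_mult moderate_abs q moderate_power moderate_add moderate_const y) auto
  have Q: "Q n x = q 0 n + (\<Sum>i<d. q (Suc i) n * x ^ Suc i)" for n x
    unfolding Q_def by (simp add: sum.lessThan_Suc_shift del: sum.lessThan_Suc)
  have taylor: "\<bar>Q n (y n + t) - Q n (y n) - D n * t\<bar> \<le> B n * t\<^sup>2" if t: "\<bar>t\<bar> \<le> 1" for n t
  proof -
    have "Q n (y n + t) - Q n (y n) - D n * t =
        (\<Sum>i<d. q (Suc i) n * ((y n + t) ^ Suc i - y n ^ Suc i - real (Suc i) * y n ^ i * t))"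
    proof -
      have "D n * t = (\<Sum>i<d. q (Suc i) n * (real (Suc i) * y n ^ i * t))"
        unfolding D_def sum_distrib_right by (rule sum.cong) (simp_all add: mult_ac)
      then show ?thesis unfolding Q by (simp add: sum_subtractf right_diff_distrib)
    qed
    also have "\<bar>\<dots>\<bar> \<le> (\<Sum>i<d. \<bar>q (Suc i) n\<bar> * ((real (Suc i))\<^sup>2 * (\<bar>y n\<bar> + 1) ^ Suc i * t\<^sup>2))"
      by (intro order_trans[OF sum_abs] sum_mono) (unfold abs_mult, intro mult_left_mono power_taylor t, simp)
    also have "\<dots> = B n * t\<^sup>2"
      unfolding B_def sum_distrib_right by (rule sum.cong) (simp_all add: mult_ac)
    finally show ?thesis .
  qed
  obtain k where k: "eventually (\<lambda>n. \<epsilon> n ^ k < \<bar>D n\<bar>) U"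
    using not_negligible[OF simple] unfolding D_def by blast
  define t where "t n = 2 * \<bar>Q n (y n)\<bar> / \<bar>D n\<bar>" for n
  have Qn: "eventually (\<lambda>n. \<bar>Q n (y n)\<bar> \<le> \<epsilon> n ^ j) U" for j
    using root unfolding negligible_seq_def Q_def by blast
  have t: "negligible_seq t"
    unfolding negligible_seq_def
  proof
    fix j
    from k Qn[of "k + j + 1"] show "eventually (\<lambda>n. \<bar>t n\<bar> \<le> \<epsilon> n ^ j) U"
    proof eventually_elim
      case (elim n)
      have Dp: "\<bar>D n\<bar> > 0" using elim(1) scale_power(1)[of n k] by linarith
      have "2 * \<bar>Q n (y n)\<bar> \<le> (2 * \<epsilon> n) * (\<epsilon> n ^ j * \<epsilon> n ^ k)" using elim(2) by (simp add: power_add mult_ac)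
      also have "\<dots> \<le> 1 * (\<epsilon> n ^ j * \<bar>D n\<bar>)"
        using elim(1) scale_le[of n] scale_pos[of n] scale_power(1)[of n j] scale_power(1)[of n k]
        by (intro mult_mono) auto
      finally show ?case using Dp by (simp add: t_def divide_le_eq)
    qed
  qed
  have "eventually (\<lambda>n. \<bar>B n * t n\<bar> \<le> \<epsilon> n ^ (k + 1)) U"
    using negligible_mult[OF B t] unfolding negligible_seq_def by blast
  moreover have "eventually (\<lambda>n. \<bar>t n\<bar> \<le> \<epsilon> n ^ 1) U" using t unfolding negligible_seq_def by blast
  ultimately have ev: "eventually (\<lambda>n. \<exists>x. \<bar>x - y n\<bar> \<le> t n \<and> Q n x = 0) U"
    using k
  proof eventually_elim
    case (elim n)
    have Dp: "\<bar>D n\<bar> > 0" using elim(3) scale_power(1)[of n k] by linarith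
    have t0: "0 \<le> t n" by (simp add: t_def)
    have t1: "\<bar>t n\<bar> \<le> 1" "\<bar>- t n\<bar> \<le> 1" using elim(2) scale_le[of n] by auto
    have Qt: "2 * \<bar>Q n (y n)\<bar> = t n * \<bar>D n\<bar>" using Dp by (simp add: t_def)
    have "\<epsilon> n * \<epsilon> n ^ k \<le> 1/2 * \<bar>D n\<bar>"
      by (rule mult_mono) (use elim(3) scale_le[of n] scale_power(1)[of n k] in auto)
    then have "\<epsilon> n ^ (k + 1) \<le> 1/2 * \<bar>D n\<bar>" by simp
    then have "B n * t n \<le> 1/2 * \<bar>D n\<bar>" using elim(1) by linarith
    from mult_left_mono[OF this t0] have Bt: "2 * (B n * (t n)\<^sup>2) \<le> t n * \<bar>D n\<bar>"
      by (simp add: power2_eq_square mult_ac)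
    have plus: "\<bar>Q n (y n + t n) - D n * t n\<bar> \<le> t n * \<bar>D n\<bar>"
      using taylor[OF t1(1), of n] Qt Bt by linarith
    have minus: "\<bar>Q n (y n - t n) + D n * t n\<bar> \<le> t n * \<bar>D n\<bar>"
      using taylor[OF t1(2), of n] Qt Bt by simp
    have cont: "continuous_on {y n - t n..y n + t n} (Q n)"
      unfolding Q_def[abs_def] by (intro continuous_intros)
    show ?case
    proof (cases "D n > 0")
      case True
      then have "Q n (y n - t n) \<le> 0" "0 \<le> Q n (y n + t n)"
        using plus minus by (auto simp: mult.commute abs_le_iff)
      then obtain x where "y n - t n \<le> x" "x \<le> y n + t n" "Q n x = 0"
        using IVT'[of "Q n" "y n - t n" 0 "y n + t n"] cont t0 by auto
      then show ?thesis by (intro exI[of _ x]) (auto simp: abs_le_iff)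
    next
      case False
      then have "0 \<le> Q n (y n - t n)" "Q n (y n + t n) \<le> 0"
        using plus minus Dp by (auto simp: mult.commute abs_le_iff)
      then obtain x where "y n - t n \<le> x" "x \<le> y n + t n" "Q n x = 0"
        using IVT2'[of "Q n" "y n + t n" 0 "y n - t n"] cont t0 by auto
      then show ?thesis by (intro exI[of _ x]) (auto simp: abs_le_iff)
    qed
  qed
  define y' where "y' n = (SOME x. \<bar>x - y n\<bar> \<le> t n \<and> Q n x = 0)" for n
  have y': "eventually (\<lambda>n. \<bar>y' n - y n\<bar> \<le> t n \<and> Q n (y' n) = 0) U"
    using ev by (rule eventually_mono) (unfold y'_def, rule someI_ex)
  show thesis
  proof
    show "negligible_seq (\<lambda>n. y' n - y n)"
      unfolding negligible_seq_def
    proof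
      fix j
      have "eventually (\<lambda>n. \<bar>t n\<bar> \<le> \<epsilon> n ^ j) U" using t unfolding negligible_seq_def by blast
      with y' show "eventually (\<lambda>n. \<bar>y' n - y n\<bar> \<le> \<epsilon> n ^ j) U" by eventually_elim auto
    qed
    show "eventually (\<lambda>n. (\<Sum>i<Suc d. q i n * y' n ^ i) = 0) U"
      using y' by (rule eventually_mono) (simp add: Q_def)
  qed
qed

lemma negligible_power_diff:
  assumes "moderate y" "negligible_seq (\<lambda>n. y' n - y n)"
  shows "negligible_seq (\<lambda>n. y' n ^ i - y n ^ i)"
proof (induction i)
  case (Suc i)
  have y': "moderate y'"
    using moderate_add[OF negligible_moderate[OF assms(2)] assms(1)] by simp
  have eq: "(\<lambda>n. y' n ^ Suc i - y n ^ Suc i) = (\<lambda>n. y' n * (y' n ^ i - y n ^ i) + y n ^ i * (y' n - y n))"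
    by (simp add: algebra_simps)
  show ?case
    unfolding eq by (intro negligible_add negligible_mult y' Suc moderate_power assms)
qed (simp add: negligible_zero)

lemma negligible_poly_diff:
  assumes "\<And>i. moderate (c i)" "moderate y" "negligible_seq (\<lambda>n. y' n - y n)"
  shows "negligible_seq (\<lambda>n. (\<Sum>i<d. c i n * y' n ^ i) - (\<Sum>i<d. c i n * y n ^ i))"
proof -
  have eq: "(\<lambda>n. (\<Sum>i<d. c i n * y' n ^ i) - (\<Sum>i<d. c i n * y n ^ i)) = (\<lambda>n. \<Sum>i<d. c i n * (y' n ^ i - y n ^ i))"
    by (simp add: sum_subtractf right_diff_distrib)
  show ?thesis
    unfolding eq by (intro negligible_sum negligible_mult assms negligible_power_diff finite_lessThan)
qed

text \<open>Adjoining one sequence: if it is transcendental modulo the maximal ideal, adjoin it as it is;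
  otherwise replace it by the exact root of its minimal polynomial that lies nearby.\<close>

lemma lifted_adjoin:
  assumes S: "lifted S" and y: "moderate y"
  obtains y' where "negligible_seq (\<lambda>n. y' n - y n)" "lifted (adjoin S y')"
proof -
  have alg: "function_algebra S" and mod: "\<And>c. c \<in> S \<Longrightarrow> moderate c"
    and zero: "\<And>c. c \<in> S \<Longrightarrow> negligible_seq c \<Longrightarrow> eventually (\<lambda>n. c n = 0) U"
    using S by (auto simp: lifted_def)
  note alg_rules = function_algebra_add[OF alg] function_algebra_mult[OF alg]
    function_algebra_const[OF alg] function_algebra_cmult[OF alg]
  have modadj: "moderate z" if z: "z \<in> adjoin S y'" and y': "moderate y'" for z y'
  proof -
    obtain d c where c: "\<And>i. c i \<in> S" "z = (\<lambda>n. \<Sum>i<d. c i n * y' n ^ i)" using z unfolding adjoin_def by blast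
    show ?thesis unfolding c(2)
      by (intro moderate_sum moderate_mult moderate_power y' mod c(1) finite_lessThan)
  qed
  define T where "T d \<longleftrightarrow> (\<forall>c. (\<forall>i. c i \<in> S) \<longrightarrow> negligible_seq (\<lambda>n. \<Sum>i<d. c i n * y n ^ i) \<longrightarrow>
      (\<forall>i<d. negligible_seq (c i)))" for d
  have vanish: "eventually (\<lambda>n. (\<Sum>i<d. c i n * z n ^ i) = 0) U"
    if "\<And>i. c i \<in> S" "\<And>i. i < d \<Longrightarrow> negligible_seq (c i)" for c d z
  proof -
    have "eventually (\<lambda>n. \<forall>i\<in>{..<d}. c i n = 0) U"
      using that zero by (intro eventually_ball_finite) auto
    then show ?thesis by (rule eventually_mono) simp
  qed
  show thesis
  proof (cases "\<forall>d. T d")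
    case True
    have "lifted (adjoin S y)"
      unfolding lifted_def
    proof (intro conjI ballI impI)
      fix z assume z: "z \<in> adjoin S y"
      show "moderate z" by (rule modadj[OF z y])
      assume neg: "negligible_seq z"
      obtain d c where c: "\<And>i. c i \<in> S" "z = (\<lambda>n. \<Sum>i<d. c i n * y n ^ i)" using z unfolding adjoin_def by blast
      then have "\<forall>i<d. negligible_seq (c i)" using True neg unfolding T_def by blast
      then show "eventually (\<lambda>n. z n = 0) U" using vanish[of c d y] c by simp
    qed (rule function_algebra_adjoin[OF alg])
    moreover have "negligible_seq (\<lambda>n. y n - y n)" by (simp add: negligible_zero)
    ultimately show thesis using that by blast
  next
    case False
    define e where "e = (LEAST d. \<not> T d)"
    have e: "\<not> T e" unfolding e_def using False by (metis LeastI_ex)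
    have Tless: "T j" if "j < e" for j using not_less_Least[OF that[unfolded e_def]] by simp
    have "T 0" by (simp add: T_def)
    moreover have "T 1" by (simp add: T_def)
    ultimately have "e \<noteq> 0" "e \<noteq> 1" using e by metis+
    then obtain d where d: "e = Suc d" "1 \<le> d" by (cases e) auto
    then have Td: "T d" using Tless by simp
    obtain q where q: "\<And>i. q i \<in> S" "negligible_seq (\<lambda>n. \<Sum>i<Suc d. q i n * y n ^ i)"
      "\<exists>i<Suc d. \<not> negligible_seq (q i)"
      using e unfolding d T_def by blast
    have lead: "\<not> negligible_seq (q d)"
    proof
      assume neg: "negligible_seq (q d)"
      have "negligible_seq (\<lambda>n. y n ^ d * q d n)" by (intro negligible_mult moderate_power y neg)
      from negligible_diff[OF q(2) this] have "negligible_seq (\<lambda>n. \<Sum>i<d. q i n * y n ^ i)"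
        by (simp add: mult.commute)
      then have "\<forall>i<d. negligible_seq (q i)" using Td q(1) unfolding T_def by blast
      then show False using q(3) neg by (auto simp: less_Suc_eq)
    qed
    have simple: "\<not> negligible_seq (\<lambda>n. \<Sum>i<d. (real (Suc i) * q (Suc i) n) * y n ^ i)"
    proof
      assume "negligible_seq (\<lambda>n. \<Sum>i<d. (real (Suc i) * q (Suc i) n) * y n ^ i)"
      moreover have "\<forall>i. (\<lambda>n. real (Suc i) * q (Suc i) n) \<in> S" by (intro allI alg_rules q)
      ultimately have "\<forall>i<d. negligible_seq (\<lambda>n. real (Suc i) * q (Suc i) n)" using Td unfolding T_def
        by (elim allE[of _ "\<lambda>i n. real (Suc i) * q (Suc i) n"]) simp
      then have "negligible_seq (\<lambda>n. real d * q d n)" using d(2) by (elim allE[of _ "d - 1"]) simp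
      from negligible_cmult[OF this, of "1 / real d"] show False using lead d(2) by simp
    qed
    obtain y' where near: "negligible_seq (\<lambda>n. y' n - y n)"
      and root: "eventually (\<lambda>n. (\<Sum>i<Suc d. q i n * y' n ^ i) = 0) U"
      using lift_simple_root[OF mod[OF q(1)] y q(2) simple] by blast
    have y': "moderate y'" using moderate_add[OF negligible_moderate[OF near] y] by simp
    \<comment> \<open>pseudo-division by the minimal polynomial, on the level of values at the root\<close>
    have reduce: "\<exists>a r. (\<forall>i. r i \<in> S) \<and>
        eventually (\<lambda>n. q d n ^ a * (\<Sum>i<m. c i n * y' n ^ i) = (\<Sum>i<d. r i n * y' n ^ i)) U"
      if "\<And>i. c i \<in> S" for m c
      using that
    proof (induction m arbitrary: c)
      case 0
      show ?case by (rule exI[of _ 0], rule exI[of _ "\<lambda>_ _. 0"]) (simp add: alg_rules)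
    next
      case (Suc m)
      show ?case
      proof (cases "m < d")
        case True
        have "(\<Sum>i<Suc m. c i n * y' n ^ i) = (\<Sum>i<d. (if i \<le> m then c i n else 0) * y' n ^ i)" for n
          by (rule sum.mono_neutral_cong_left) (use True in auto)
        moreover have "(\<lambda>n. if i \<le> m then c i n else 0) \<in> S" for i
          using Suc.prems[of i] alg_rules(3)[of 0] by (cases "i \<le> m") simp_all
        ultimately show ?thesis
          by (intro exI[of _ 0] exI[of _ "\<lambda>i n. if i \<le> m then c i n else 0"]) simp
      next
        case False
        define c' where "c' i = (\<lambda>n. q d n * c i n + (if m - d \<le> i then -1 else 0) * (c m n * q (i - (m - d)) n))" for i
        have c': "c' i \<in> S" for i unfolding c'_def by (intro alg_rules Suc.prems q)
        obtain a r where ar: "\<forall>i. r i \<in> S"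
          "eventually (\<lambda>n. q d n ^ a * (\<Sum>i<m. c' i n * y' n ^ i) = (\<Sum>i<d. r i n * y' n ^ i)) U"
          using Suc.IH[of c', OF c'] by blast
        have "eventually (\<lambda>n. q d n ^ Suc a * (\<Sum>i<Suc m. c i n * y' n ^ i) = (\<Sum>i<d. r i n * y' n ^ i)) U"
          using ar(2) root
        proof eventually_elim
          case (elim n)
          have "(\<Sum>i<m. (if m - d \<le> i then -1 else 0) * (c m n * q (i - (m - d)) n) * y' n ^ i)
              = - (\<Sum>i\<in>{m-d..<m}. c m n * q (i - (m - d)) n * y' n ^ i)"
            unfolding sum_negf[symmetric] by (rule sum.mono_neutral_cong_right) auto
          also have "(\<Sum>i\<in>{m-d..<m}. c m n * q (i - (m - d)) n * y' n ^ i)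
              = (\<Sum>i<d. c m n * q i n * y' n ^ (i + (m - d)))"
            by (rule sum.reindex_bij_witness[of _ "\<lambda>i. i + (m - d)" "\<lambda>i. i - (m - d)"]) (use False in auto)
          also have "\<dots> = c m n * y' n ^ (m - d) * (\<Sum>i<d. q i n * y' n ^ i)"
            by (simp add: sum_distrib_left power_add mult_ac)
          also have "(\<Sum>i<d. q i n * y' n ^ i) = - (q d n * y' n ^ d)" using elim(2) by simp
          also have "- (c m n * y' n ^ (m - d) * - (q d n * y' n ^ d)) = q d n * (c m n * y' n ^ m)"
            using False by (simp add: mult_ac flip: power_add)
          finally have "(\<Sum>i<m. c' i n * y' n ^ i) = q d n * (\<Sum>i<Suc m. c i n * y' n ^ i)"
            by (simp add: c'_def distrib_right sum.distrib sum_distrib_left mult.assoc distrib_left)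
          then show ?case using elim(1) by (simp add: mult_ac)
        qed
        with ar(1) show ?thesis by blast
      qed
    qed
    have "lifted (adjoin S y')"
      unfolding lifted_def
    proof (intro conjI ballI impI)
      fix z assume z: "z \<in> adjoin S y'"
      show "moderate z" by (rule modadj[OF z y'])
      assume neg: "negligible_seq z"
      obtain m c where c: "\<And>i. c i \<in> S" "z = (\<lambda>n. \<Sum>i<m. c i n * y' n ^ i)" using z unfolding adjoin_def by blast
      obtain a r where ar: "\<And>i. r i \<in> S"
          "eventually (\<lambda>n. q d n ^ a * z n = (\<Sum>i<d. r i n * y' n ^ i)) U"
        using reduce[where c = c and m = m, OF c(1)] unfolding c(2) by blast
      have "negligible_seq (\<lambda>n. q d n ^ a * z n)"
        by (intro negligible_mult moderate_power mod q neg)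
      then have "negligible_seq (\<lambda>n. \<Sum>i<d. r i n * y' n ^ i)" by (rule negligible_cong[OF ar(2)])
      from negligible_diff[OF this negligible_poly_diff[where c = r and d = d, OF mod[OF ar(1)] y near]]
      have "negligible_seq (\<lambda>n. \<Sum>i<d. r i n * y n ^ i)" by simp
      then have "\<forall>i<d. negligible_seq (r i)" using Td ar(1) unfolding T_def by blast
      then have "eventually (\<lambda>n. (\<Sum>i<d. r i n * y' n ^ i) = 0) U" using vanish[of r d y'] ar(1) by blast
      moreover obtain k where "eventually (\<lambda>n. \<epsilon> n ^ k < \<bar>q d n\<bar>) U" using not_negligible[OF lead] .
      ultimately show "eventually (\<lambda>n. z n = 0) U" using ar(2)
      proof eventually_elim
        case (elim n)
        have "q d n \<noteq> 0" using elim(2) scale_power(1)[of n k] by auto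
        with elim show ?case by simp
      qed
    qed (rule function_algebra_adjoin[OF alg])
    then show thesis using near that by blast
  qed
qed

lemma lifted_constants: "lifted (range (\<lambda>c _. c))"
  unfolding lifted_def
proof (intro conjI ballI impI)
  show "function_algebra (range (\<lambda>c (_::nat). c::real))" by (auto simp: function_algebra_def)
  fix y :: "nat \<Rightarrow> real" assume "y \<in> range (\<lambda>c _. c)"
  then obtain c where y: "y = (\<lambda>_. c)" by auto
  show "moderate y" unfolding y by (rule moderate_const)
  assume neg: "negligible_seq y"
  have "\<bar>c\<bar> \<le> (1/2) ^ k" for k
  proof -
    have "eventually (\<lambda>n. \<bar>c\<bar> \<le> \<epsilon> n ^ k) U" using neg unfolding negligible_seq_def y by blast
    then obtain n where "\<bar>c\<bar> \<le> \<epsilon> n ^ k" using eventually_happens'[OF proper] by blast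
    also have "\<dots> \<le> (1/2) ^ k" using scale_pos[of n] scale_le[of n] by (intro power_mono) auto
    finally show ?thesis .
  qed
  moreover have "\<exists>k. (1/2) ^ k < \<bar>c\<bar>" if "c \<noteq> 0" using real_arch_pow_inv[of "\<bar>c\<bar>" "1/2"] that by auto
  ultimately have "c = 0" using not_le by blast
  then show "eventually (\<lambda>n. y n = 0) U" by (simp add: y)
qed

text \<open>Adjoin the sequences one after the other, starting from the constants.\<close>

lemma lifted_family:
  assumes "finite I" "\<And>i. i \<in> I \<Longrightarrow> moderate (a i)"
  shows "\<exists>a' S. lifted S \<and> (\<forall>i\<in>I. a' i \<in> S \<and> negligible_seq (\<lambda>n. a' i n - a i n))"
  using assms
proof (induction I rule: finite_induct)
  case empty
  show ?case using lifted_constants by blast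
next
  case (insert j I)
  then obtain a' S where S: "lifted S" "\<And>i. i \<in> I \<Longrightarrow> a' i \<in> S \<and> negligible_seq (\<lambda>n. a' i n - a i n)"
    by auto
  obtain y' where y': "negligible_seq (\<lambda>n. y' n - a j n)" "lifted (adjoin S y')"
    using lifted_adjoin[OF S(1), of "a j"] insert.prems by auto
  have "function_algebra S" using S(1) by (simp add: lifted_def)
  note adj = function_algebra_adjoin[OF this, of y']
  show ?case
    using y' S(2) adj insert.hyps by (intro exI[of _ "a'(j := y')"] exI[of _ "adjoin S y'"]) auto
qed

end

text \<open>Polynomials in several variables enter only through evaluation and closure properties.\<close>

inductive_set polyfun :: "'i set \<Rightarrow> (('i \<Rightarrow> real) \<Rightarrow> real) set" for I where
  polyfun_const: "(\<lambda>_. c) \<in> polyfun I"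
| polyfun_coord: "i \<in> I \<Longrightarrow> (\<lambda>a. a i) \<in> polyfun I"
| polyfun_add: "P \<in> polyfun I \<Longrightarrow> Q \<in> polyfun I \<Longrightarrow> (\<lambda>a. P a + Q a) \<in> polyfun I"
| polyfun_mult: "P \<in> polyfun I \<Longrightarrow> Q \<in> polyfun I \<Longrightarrow> (\<lambda>a. P a * Q a) \<in> polyfun I"

lemma function_algebra_polyfun: "function_algebra (polyfun I)"
  by (auto simp: function_algebra_def intro: polyfun.intros)

context asymptotic_scale
begin

lemma polyfun_lifted:
  assumes S: "lifted S" and a: "\<And>i. i \<in> I \<Longrightarrow> a' i \<in> S \<and> negligible_seq (\<lambda>n. a' i n - a i n)"
    and P: "P \<in> polyfun I"
  shows "(\<lambda>n. P (\<lambda>i. a' i n)) \<in> S \<and> negligible_seq (\<lambda>n. P (\<lambda>i. a' i n) - P (\<lambda>i. a i n))"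
  using P
proof induction
  case (polyfun_const c)
  then show ?case using S by (simp add: lifted_def function_algebra_const negligible_zero)
next
  case (polyfun_coord i)
  then show ?case using a by simp
next
  case (polyfun_add P Q)
  have eq: "(\<lambda>n. P (\<lambda>i. a' i n) + Q (\<lambda>i. a' i n) - (P (\<lambda>i. a i n) + Q (\<lambda>i. a i n))) =
      (\<lambda>n. (P (\<lambda>i. a' i n) - P (\<lambda>i. a i n)) + (Q (\<lambda>i. a' i n) - Q (\<lambda>i. a i n)))" by (simp add: algebra_simps)
  have alg: "function_algebra S" using S by (simp add: lifted_def)
  show ?case
    unfolding eq using polyfun_add.IH by (intro conjI negligible_add function_algebra_add[OF alg]) blast+
next
  case (polyfun_mult P Q)
  define p p' r r' where "p n = P (\<lambda>i. a i n)" and "p' n = P (\<lambda>i. a' i n)"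
    and "r n = Q (\<lambda>i. a i n)" and "r' n = Q (\<lambda>i. a' i n)" for n
  have IH: "p' \<in> S" "r' \<in> S" "negligible_seq (\<lambda>n. p' n - p n)" "negligible_seq (\<lambda>n. r' n - r n)"
    using polyfun_mult.IH by (simp_all add: p_def[abs_def] p'_def[abs_def] r_def[abs_def] r'_def[abs_def])
  then have mod: "moderate p'" "moderate r'" using S by (auto simp: lifted_def)
  have "moderate (\<lambda>n. r' n + -1 * (r' n - r n))"
    by (intro moderate_add moderate_mult moderate_const mod negligible_moderate IH)
  then have "moderate r" by simp
  have "(\<lambda>n. p' n * r' n - p n * r n) = (\<lambda>n. p' n * (r' n - r n) + r n * (p' n - p n))"
    by (simp add: algebra_simps)
  moreover have "negligible_seq \<dots>"
    by (intro negligible_add negligible_mult mod IH \<open>moderate r\<close>)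
  ultimately have "negligible_seq (\<lambda>n. p' n * r' n - p n * r n)" by simp
  moreover have "(\<lambda>n. p' n * r' n) \<in> S" using S IH by (simp add: lifted_def function_algebra_mult)
  ultimately show ?case unfolding p_def p'_def r_def r'_def by (rule conjI[rotated])
qed

end

text \<open>If no exponent worked, a sequence of counterexamples would solve the system modulo the maximal ideal of
  the valuation ring attached to it, hence could be moved negligibly to exact solutions.\<close>

theorem lojasiewicz:
  fixes I :: "'i set" and PP :: "(('i \<Rightarrow> real) \<Rightarrow> real) set" and B :: real
  assumes I: "finite I" and PP: "finite PP" "PP \<subseteq> polyfun I"
  shows "\<exists>q. \<forall>d a. 0 < d \<and> d \<le> 1/2 \<and> (\<forall>i\<in>I. \<bar>a i\<bar> \<le> B) \<and> (\<forall>P\<in>PP. \<bar>P a\<bar> \<le> d ^ q) \<longrightarrow>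
    (\<exists>a'. (\<forall>P\<in>PP. P a' = 0) \<and> (\<forall>i\<in>I. \<bar>a i - a' i\<bar> \<le> d))"
proof (rule ccontr)
  assume "\<not> ?thesis"
  then have "\<forall>q. \<exists>d a. (0 < d \<and> d \<le> 1/2 \<and> (\<forall>i\<in>I. \<bar>a i\<bar> \<le> B) \<and> (\<forall>P\<in>PP. \<bar>P a\<bar> \<le> d ^ q)) \<and>
    \<not> (\<exists>a'. (\<forall>P\<in>PP. P a' = 0) \<and> (\<forall>i\<in>I. \<bar>a i - a' i\<bar> \<le> d))"
    by (simp only: not_ex not_all not_imp) simp
  from choice[OF this] obtain d where "\<forall>q. \<exists>a. (0 < d q \<and> d q \<le> 1/2 \<and> (\<forall>i\<in>I. \<bar>a i\<bar> \<le> B) \<and>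
    (\<forall>P\<in>PP. \<bar>P a\<bar> \<le> d q ^ q)) \<and> \<not> (\<exists>a'. (\<forall>P\<in>PP. P a' = 0) \<and> (\<forall>i\<in>I. \<bar>a i - a' i\<bar> \<le> d q))"
    by (rule exE)
  from choice[OF this] obtain a where *: "\<forall>q. (0 < d q \<and> d q \<le> 1/2 \<and> (\<forall>i\<in>I. \<bar>a q i\<bar> \<le> B) \<and>
    (\<forall>P\<in>PP. \<bar>P (a q)\<bar> \<le> d q ^ q)) \<and> \<not> (\<exists>a'. (\<forall>P\<in>PP. P a' = 0) \<and> (\<forall>i\<in>I. \<bar>a q i - a' i\<bar> \<le> d q))"
    by (rule exE)
  have da: "\<And>q. 0 < d q" "\<And>q. d q \<le> 1/2" "\<And>q i. i \<in> I \<Longrightarrow> \<bar>a q i\<bar> \<le> B"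
    "\<And>q P. P \<in> PP \<Longrightarrow> \<bar>P (a q)\<bar> \<le> d q ^ q"
    "\<And>q a'. \<forall>P\<in>PP. P a' = 0 \<Longrightarrow> \<not> (\<forall>i\<in>I. \<bar>a q i - a' i\<bar> \<le> d q)"
    using * by blast+
  obtain U :: "nat filter" where U: "U \<noteq> bot" "U \<le> sequentially"
    "\<And>P. eventually P U \<or> eventually (\<lambda>n. \<not> P n) U"
    using ultrafilter_exists by blast
  interpret asymptotic_scale U d
    by unfold_locales (use U da in auto)
  have "moderate (\<lambda>n. a n i)" if "i \<in> I" for i
    by (rule moderate_bounded[OF _ moderate_const[of "\<bar>B\<bar>"]]) (simp, rule order_trans[OF da(3)[OF that] abs_ge_self])
  then obtain a' S where S: "lifted S" "\<And>i. i \<in> I \<Longrightarrow> a' i \<in> S \<and> negligible_seq (\<lambda>n. a' i n - a n i)"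
    using lifted_family[OF I, of "\<lambda>i n. a n i"] by blast
  have "eventually (\<lambda>n. P (\<lambda>i. a' i n) = 0) U" if P: "P \<in> PP" for P
  proof -
    have "negligible_seq (\<lambda>n. P (a n))"
      unfolding negligible_seq_def
    proof
      fix k
      have "eventually (\<lambda>n. k \<le> n) U" using filter_leD[OF U(2) eventually_ge_at_top] .
      then show "eventually (\<lambda>n. \<bar>P (a n)\<bar> \<le> d n ^ k) U"
      proof (rule eventually_mono)
        fix n assume "k \<le> n"
        have "\<bar>P (a n)\<bar> \<le> d n ^ n" by (rule da(4)[OF P])
        also have "\<dots> \<le> d n ^ k" by (rule power_small_mono[OF da(1,2) \<open>k \<le> n\<close>])
        finally show "\<bar>P (a n)\<bar> \<le> d n ^ k" .
      qed
    qed
    moreover have "P \<in> polyfun I" using P PP by blast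
    note * = polyfun_lifted[where a' = a' and a = "\<lambda>i n. a n i" and I = I, OF S this]
    ultimately have "negligible_seq (\<lambda>n. P (\<lambda>i. a' i n))"
      using negligible_add[of "\<lambda>n. P (\<lambda>i. a' i n) - P (a n)" "\<lambda>n. P (a n)"] by simp
    with conjunct1[OF *] S(1) show ?thesis unfolding lifted_def by blast
  qed
  then have "eventually (\<lambda>n. \<forall>P\<in>PP. P (\<lambda>i. a' i n) = 0) U" using PP(1) by (intro eventually_ball_finite) auto
  moreover have "eventually (\<lambda>n. \<bar>a' i n - a n i\<bar> \<le> d n ^ 1) U" if "i \<in> I" for i
    using S(2)[OF that] unfolding negligible_seq_def by blast
  then have "eventually (\<lambda>n. \<forall>i\<in>I. \<bar>a' i n - a n i\<bar> \<le> d n ^ 1) U" using I by (intro eventually_ball_finite) auto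
  ultimately have "eventually (\<lambda>n. (\<forall>P\<in>PP. P (\<lambda>i. a' i n) = 0) \<and> (\<forall>i\<in>I. \<bar>a' i n - a n i\<bar> \<le> d n ^ 1)) U"
    by (rule eventually_conj)
  from eventually_happens'[OF U(1) this] obtain n where
    n: "(\<forall>P\<in>PP. P (\<lambda>i. a' i n) = 0) \<and> (\<forall>i\<in>I. \<bar>a' i n - a n i\<bar> \<le> d n ^ 1)" by (rule exE)
  have "\<forall>i\<in>I. \<bar>a n i - a' i n\<bar> \<le> d n" using conjunct2[OF n] by (simp add: abs_minus_commute)
  with da(5)[OF conjunct1[OF n]] show False by (rule notE)
qed

section \<open>Letter assignments and homomorphisms\<close>

text \<open>Words with the same letters whose exponents differ by at most \<open>\<eta>\<close>.  On words of bounded length the value depends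
  Lipschitz-continuously on the exponents and on the vectors assigned to the letters.\<close>

definition nearby_words :: "real \<Rightarrow> (real \<times> 'e) list \<Rightarrow> (real \<times> 'e) list \<Rightarrow> bool" where
  "nearby_words \<eta> = list_all2 (\<lambda>w w'. snd w = snd w' \<and> \<bar>fst w - fst w'\<bar> \<le> \<eta>)"

context carnot_group
begin

lemma wprod_lipschitz:
  fixes E :: "'e set"
  shows "\<exists>C\<ge>1. \<forall>a a' ws ws' \<eta>. ws \<in> words E n 1 \<and> ws' \<in> words E n 1 \<and> nearby_words \<eta> ws ws' \<and> 0 \<le> \<eta> \<and>
     (\<forall>e\<in>E. norm (a e) \<le> B \<and> norm (a' e) \<le> B \<and> norm (a e - a' e) \<le> \<eta>) \<longrightarrow>
     norm (wprod a ws) \<le> C \<and> norm (wprod a' ws') \<le> C \<and> norm (wprod a ws - wprod a' ws') \<le> C * \<eta>"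
proof (induction n)
  case 0
  show ?case by (rule exI[of _ 1]) (auto simp: words_def)
next
  case (Suc n)
  then obtain C where C: "C \<ge> 1" and IH: "\<And>a a' ws ws' \<eta>. ws \<in> words E n 1 \<and> ws' \<in> words E n 1 \<and>
     nearby_words \<eta> ws ws' \<and> 0 \<le> \<eta> \<and>
     (\<forall>e\<in>E. norm (a e) \<le> B \<and> norm (a' e) \<le> B \<and> norm (a e - a' e) \<le> \<eta>) \<Longrightarrow>
     norm (wprod a ws) \<le> C \<and> norm (wprod a' ws') \<le> C \<and> norm (wprod a ws - wprod a' ws') \<le> C * \<eta>"
    by blast
  define B' where "B' = max \<bar>B\<bar> C"
  obtain L where L: "L \<ge> 0" "\<And>x y x' y'. norm x \<le> B' \<and> norm y \<le> B' \<and> norm x' \<le> B' \<and> norm y' \<le> B' \<Longrightarrow>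
     norm (x \<otimes> y - x' \<otimes> y') \<le> L * (norm (x - x') + norm (y - y'))"
    using mult_lipschitz[of B'] by blast
  obtain K where K: "K \<ge> 0" "\<And>x y. norm x \<le> B' \<and> norm y \<le> B' \<Longrightarrow> norm (x \<otimes> y) \<le> K"
    using mult_bounded[of B'] by blast
  define C' where "C' = max (max 1 K) (L * (\<bar>B\<bar> + 1 + C))"
  have "norm (wprod a ws) \<le> C' \<and> norm (wprod a' ws') \<le> C' \<and> norm (wprod a ws - wprod a' ws') \<le> C' * \<eta>"
    if ws: "ws \<in> words E (Suc n) 1" "ws' \<in> words E (Suc n) 1" "nearby_words \<eta> ws ws'" and \<eta>: "0 \<le> \<eta>"
      and a: "\<forall>e\<in>E. norm (a e) \<le> B \<and> norm (a' e) \<le> B \<and> norm (a e - a' e) \<le> \<eta>" for a a' ws ws' \<eta>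
  proof (cases ws)
    case Nil
    then have "ws' = []" using ws(3) by (simp add: nearby_words_def)
    then show ?thesis using Nil \<eta> by (auto simp: C'_def)
  next
    case (Cons w vs)
    then obtain w' vs' where ws': "ws' = w' # vs'" "snd w = snd w'" "\<bar>fst w - fst w'\<bar> \<le> \<eta>" "nearby_words \<eta> vs vs'"
      using ws(3) by (auto simp: nearby_words_def list_all2_Cons1)
    obtain t t' e where w: "w = (t, e)" "w' = (t', e)" using ws'(2) by (metis prod.collapse)
    have e: "e \<in> E" "\<bar>t\<bar> \<le> 1" "\<bar>t'\<bar> \<le> 1" and vs: "vs \<in> words E n 1" "vs' \<in> words E n 1"
      using ws(1,2) by (auto simp: Cons ws'(1) w words_def)
    have ih: "norm (wprod a vs) \<le> C" "norm (wprod a' vs') \<le> C" "norm (wprod a vs - wprod a' vs') \<le> C * \<eta>"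
      using IH[of vs vs' \<eta> a a'] vs ws'(4) \<eta> a by blast+
    have ae: "norm (a e) \<le> B" "norm (a' e) \<le> B" "norm (a e - a' e) \<le> \<eta>" using a e(1) by blast+
    have n1: "norm (t *\<^sub>R a e) \<le> B'" "norm (t' *\<^sub>R a' e) \<le> B'"
      using mult_mono[OF e(2) ae(1)] mult_mono[OF e(3) ae(2)] ae by (auto simp: B'_def)
    have n2: "norm (wprod a vs) \<le> B'" "norm (wprod a' vs') \<le> B'" using ih by (auto simp: B'_def)
    have "norm (t *\<^sub>R a e - t' *\<^sub>R a' e) = norm ((t - t') *\<^sub>R a e + t' *\<^sub>R (a e - a' e))"
      by (simp add: algebra_simps)
    also have "\<dots> \<le> \<bar>t - t'\<bar> * norm (a e) + \<bar>t'\<bar> * norm (a e - a' e)"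
      using norm_triangle_ineq[of "(t - t') *\<^sub>R a e" "t' *\<^sub>R (a e - a' e)"] by simp
    also have "\<dots> \<le> \<eta> * \<bar>B\<bar> + 1 * \<eta>"
      using ws'(3) ae e by (intro add_mono mult_mono) (auto simp: w)
    finally have d: "norm (t *\<^sub>R a e - t' *\<^sub>R a' e) \<le> (\<bar>B\<bar> + 1) * \<eta>" by (simp add: algebra_simps)
    have "norm (wprod a ws - wprod a' ws') \<le> L * (norm (t *\<^sub>R a e - t' *\<^sub>R a' e) + norm (wprod a vs - wprod a' vs'))"
      using L(2) n1 n2 by (simp add: Cons ws'(1) w)
    also have "\<dots> \<le> L * ((\<bar>B\<bar> + 1) * \<eta> + C * \<eta>)" using L(1) d ih by (intro mult_left_mono add_mono)
    also have "\<dots> = (L * (\<bar>B\<bar> + 1 + C)) * \<eta>" by (simp add: algebra_simps)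
    also have "\<dots> \<le> C' * \<eta>" using \<eta> by (intro mult_right_mono) (simp_all add: C'_def)
    finally show ?thesis using K(2) n1 n2 by (simp add: Cons ws'(1) w C'_def le_max_iff_disj)
  qed
  moreover have "1 \<le> C'" by (simp add: C'_def)
  ultimately show ?case by blast
qed

lemma wprod_bounded:
  fixes E :: "'e set"
  obtains C where "C \<ge> 1" "\<And>(a :: 'e \<Rightarrow> 'a) ws. ws \<in> words E n 1 \<Longrightarrow> (\<And>e. e \<in> E \<Longrightarrow> norm (a e) \<le> B) \<Longrightarrow> norm (wprod a ws) \<le> C"
proof -
  obtain C where C: "C \<ge> 1" "\<And>(a :: 'e \<Rightarrow> 'a) a' ws ws' \<eta>. ws \<in> words E n 1 \<and> ws' \<in> words E n 1 \<and> nearby_words \<eta> ws ws' \<and> 0 \<le> \<eta> \<and>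
     (\<forall>e\<in>E. norm (a e) \<le> B \<and> norm (a' e) \<le> B \<and> norm (a e - a' e) \<le> \<eta>) \<Longrightarrow>
     norm (wprod a ws) \<le> C \<and> norm (wprod a' ws') \<le> C \<and> norm (wprod a ws - wprod a' ws') \<le> C * \<eta>"
    using wprod_lipschitz[of E n B] by blast
  have "nearby_words 0 ws ws" for ws :: "(real \<times> 'e) list"
    by (auto simp: nearby_words_def list_all2_same)
  then show thesis using that[OF C(1)] C(2)[of ws ws 0 a a for ws a] by simp
qed

end

text \<open>The map is controlled along finitely many vectors only, so exponents are rounded to multiples of \<open>1 / n\<close>.\<close>

definition grid_words :: "nat \<Rightarrow> 'e set \<Rightarrow> nat \<Rightarrow> (real \<times> 'e) list set" where
  "grid_words n E m = {ws. length ws \<le> m \<and> set ws \<subseteq> (\<lambda>l. of_int l / real n) ` {- int n..int n} \<times> E}"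

lemma grid_words_subset: "1 \<le> n \<Longrightarrow> grid_words n E m \<subseteq> words E m 1"
proof
  fix ws assume n: "1 \<le> n" and ws: "ws \<in> grid_words n E m"
  have "(\<lambda>l. of_int l / real n) ` {- int n..int n} \<subseteq> {-1..1}"
    using n by (auto simp: divide_le_eq le_divide_eq)
  with ws show "ws \<in> words E m 1" unfolding grid_words_def words_def by fast
qed

lemma round_to_grid:
  fixes E :: "'e set"
  assumes n: "1 \<le> n" and ws: "ws \<in> words E m 1"
  obtains ws' where "ws' \<in> grid_words n E m" "nearby_words (1 / real n) ws ws'"
proof -
  define r where "r w = (of_int \<lfloor>fst w * real n\<rfloor> / real n, snd w)" for w :: "real \<times> 'e"
  have "\<bar>fst w - fst (r w)\<bar> \<le> 1 / real n" for w
  proof -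
    have "\<bar>fst w * real n - of_int \<lfloor>fst w * real n\<rfloor>\<bar> \<le> 1" by linarith
    then have "\<bar>fst w * real n - of_int \<lfloor>fst w * real n\<rfloor>\<bar> / real n \<le> 1 / real n"
      by (rule divide_right_mono) simp
    moreover have "fst w - fst (r w) = (fst w * real n - of_int \<lfloor>fst w * real n\<rfloor>) / real n"
      using n by (simp add: r_def field_simps)
    ultimately show ?thesis by (simp add: abs_divide)
  qed
  then have 1: "nearby_words (1 / real n) ws (map r ws)"
    by (auto simp: nearby_words_def list_all2_conv_all_nth r_def)
  have "r w \<in> (\<lambda>l. of_int l / real n) ` {- int n..int n} \<times> E" if "w \<in> set ws" for w
  proof -
    have "- 1 \<le> fst w" "fst w \<le> 1" "snd w \<in> E" using ws that by (auto simp: words_def)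
    from this(1,2) have "- real n \<le> fst w * real n" "fst w * real n \<le> real n"
      using mult_right_mono[of "-1" "fst w" "real n"] mult_right_mono[of "fst w" 1 "real n"] by auto
    then have "\<lfloor>fst w * real n\<rfloor> \<in> {- int n..int n}" by (auto simp: le_floor_iff floor_le_iff)
    then show ?thesis using \<open>snd w \<in> E\<close> by (auto simp: r_def)
  qed
  then have "set (map r ws) \<subseteq> (\<lambda>l. of_int l / real n) ` {- int n..int n} \<times> E"
    unfolding set_map by (rule image_subsetI)
  then have "map r ws \<in> grid_words n E m" using ws by (simp add: grid_words_def words_def)
  then show thesis using 1 by (rule that)
qed

text \<open>The vectors \<open>(m k w)\<close>, \<open>k < K\<close>, lie in a space of dimension \<open>K\<close>, however large the index set \<open>R\<close> is.\<close>

lemma finite_spanning_subfamily: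
  fixes m :: "nat \<Rightarrow> 'w \<Rightarrow> real"
  shows "\<exists>R0. finite R0 \<and> R0 \<subseteq> R \<and> (\<forall>w\<in>R. \<exists>c. \<forall>k<K. m k w = (\<Sum>v\<in>R0. c v * m k v))"
proof (induction K)
  case 0
  show ?case by (auto intro!: exI[of _ "{}"])
next
  case (Suc K)
  then obtain R0 where R0: "finite R0" "R0 \<subseteq> R" "\<forall>w\<in>R. \<exists>c. \<forall>k<K. m k w = (\<Sum>v\<in>R0. c v * m k v)" by blast
  then obtain c where c: "\<And>w k. w \<in> R \<Longrightarrow> k < K \<Longrightarrow> m k w = (\<Sum>v\<in>R0. c w v * m k v)" by metis
  define r where "r w = m K w - (\<Sum>v\<in>R0. c w v * m K v)" for w
  show ?case
  proof (cases "\<forall>w\<in>R. r w = 0")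
    case True
    then have "\<forall>w\<in>R. \<forall>k<Suc K. m k w = (\<Sum>v\<in>R0. c w v * m k v)"
      using c by (auto simp: less_Suc_eq r_def)
    then show ?thesis using R0(1,2) by blast
  next
    case False
    then obtain u where u: "u \<in> R" "r u \<noteq> 0" by blast
    have "\<exists>c'. \<forall>k<Suc K. m k w = (\<Sum>v\<in>insert u R0. c' v * m k v)" if w: "w \<in> R" for w
    proof -
      define s where "s = r w / r u"
      define c' where "c' v = (if v \<in> R0 then c w v - s * c u v else 0) + (if v = u then s else 0)" for v
      have "(\<Sum>v\<in>insert u R0. c' v * m k v) = m k w" if "k < Suc K" for k
      proof -
        have "(\<Sum>v\<in>insert u R0. c' v * m k v) =
            (\<Sum>v\<in>insert u R0. if v \<in> R0 then (c w v - s * c u v) * m k v else 0) +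
            (\<Sum>v\<in>insert u R0. if v = u then s * m k v else 0)"
          unfolding sum.distrib[symmetric] by (rule sum.cong) (auto simp: c'_def distrib_right)
        also have "(\<Sum>v\<in>insert u R0. if v \<in> R0 then (c w v - s * c u v) * m k v else 0) =
            (\<Sum>v\<in>R0. (c w v - s * c u v) * m k v)"
          by (rule sum.mono_neutral_cong_right) (use R0(1) in auto)
        also have "\<dots> = (\<Sum>v\<in>R0. c w v * m k v) - s * (\<Sum>v\<in>R0. c u v * m k v)"
          by (simp add: left_diff_distrib sum_subtractf sum_distrib_left mult.assoc)
        also have "(\<Sum>v\<in>insert u R0. if v = u then s * m k v else 0) = s * m k u" using R0(1) by simp
        finally have eq: "(\<Sum>v\<in>insert u R0. c' v * m k v) =
            (\<Sum>v\<in>R0. c w v * m k v) + s * (m k u - (\<Sum>v\<in>R0. c u v * m k v))"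
          by (simp add: algebra_simps)
        show ?thesis
        proof (cases "k < K")
          case True
          then show ?thesis using c[OF w True] c[OF u(1) True] eq by simp
        next
          case False
          then have "k = K" using that by simp
          then show ?thesis using eq u(2) by (simp add: s_def r_def[symmetric]) (simp add: r_def)
        qed
      qed
      then show ?thesis by metis
    qed
    then show ?thesis using R0(1,2) u(1) by (intro exI[of _ "insert u R0"]) auto
  qed
qed

locale carnot_pair = G: carnot_group G + H: normed_carnot_group H N
  for G :: "'a::euclidean_space carnot" and H :: "'b::euclidean_space carnot" and N :: "'b \<Rightarrow> real"
begin

abbreviation mult_source (infixl "\<cdot>" 70) where "x \<cdot> y \<equiv> x \<otimes>\<^bsub>G\<^esub> y"

abbreviation mult_target (infixl "\<star>" 70) where "x \<star> y \<equiv> x \<otimes>\<^bsub>H\<^esub> y"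

text \<open>Assignments are parametrised by unconstrained reals: the projection to the first layer makes the assigned
  vectors horizontal for every value of the parameters.\<close>

definition letter :: "('a \<times> 'b \<Rightarrow> real) \<Rightarrow> 'a \<Rightarrow> 'b" where
  "letter s b = (\<Sum>e\<in>Basis. s (b, e) *\<^sub>R component H 1 e)"

abbreviation params :: "('a \<times> 'b) set" where "params \<equiv> G.hbasis \<times> Basis"

abbreviation gword :: "(real \<times> 'a) list \<Rightarrow> 'a" where "gword \<equiv> G.hword"

definition relators :: "nat \<Rightarrow> (real \<times> 'a) list set" where
  "relators m = {ws \<in> words G.hbasis m 1. gword ws = 0}"

lemma finite_params: "finite params" using G.hbasis(1) by simp

lemma letter_layer: "letter s b \<in> layer H 1"
  unfolding letter_def
  by (intro subspace_sum[OF H.layer_subspace] subspace_scale[OF H.layer_subspace] H.component_in_layer)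

lemma letter_coordinates:
  assumes "a b \<in> layer H 1"
  shows "letter (\<lambda>(b, e). a b \<bullet> e) b = a b"
proof -
  have "letter (\<lambda>(b, e). a b \<bullet> e) b = component H 1 (\<Sum>e\<in>Basis. (a b \<bullet> e) *\<^sub>R e)"
    by (simp add: letter_def H.component_sum H.component_scaleR)
  then show ?thesis using assms by (simp add: euclidean_representation H.component_layer)
qed

lemma letter_lipschitz:
  "\<exists>C\<ge>1. \<forall>s s' \<eta> b. b \<in> G.hbasis \<and> (\<forall>i\<in>params. \<bar>s i - s' i\<bar> \<le> \<eta>) \<longrightarrow> norm (letter s b - letter s' b) \<le> C * \<eta>"
proof -
  define C where "C = 1 + (\<Sum>e\<in>Basis. norm (component H 1 (e::'b)))"
  have "norm (letter s b - letter s' b) \<le> C * \<eta>"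
    if b: "b \<in> G.hbasis" and s: "\<forall>i\<in>params. \<bar>s i - s' i\<bar> \<le> \<eta>" for s s' \<eta> b
  proof -
    have \<eta>: "0 \<le> \<eta>"
      using s b nonempty_Basis by (meson SigmaI abs_ge_zero ex_in_conv order_trans)
    have "letter s b - letter s' b = (\<Sum>e\<in>Basis. (s (b, e) - s' (b, e)) *\<^sub>R component H 1 e)"
      by (simp add: letter_def sum_subtractf scaleR_left_diff_distrib)
    also have "norm \<dots> \<le> (\<Sum>e\<in>Basis. \<eta> * norm (component H 1 (e::'b)))"
      by (rule sum_norm_le) (use s b in \<open>auto intro!: mult_right_mono\<close>)
    also have "\<dots> \<le> C * \<eta>" using \<eta> by (simp add: C_def sum_distrib_left[symmetric] algebra_simps)
    finally show ?thesis .
  qed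
  then show ?thesis by (intro exI[of _ C]) (auto simp: C_def sum_nonneg)
qed

text \<open>The value of a word splits into functions of the word and polynomials in the assignment.\<close>

definition separated :: "((real \<times> 'a) list \<times> ('a \<times> 'b \<Rightarrow> real) \<Rightarrow> real) set" where
  "separated = {F. \<exists>(K::nat) m Q. (\<forall>k. Q k \<in> polyfun params) \<and> F = (\<lambda>(ws, s). \<Sum>k<K. m k ws * Q k s)}"

lemma separatedD:
  assumes "F \<in> separated"
  shows "\<exists>(K::nat) m Q. (\<forall>k. Q k \<in> polyfun params) \<and> (\<forall>ws s. F (ws, s) = (\<Sum>k<K. m k ws * Q k s))"
  using assms unfolding separated_def by auto

lemma in_separated:
  fixes K :: nat
  assumes "\<And>k. Q k \<in> polyfun params" "\<And>ws s. F (ws, s) = (\<Sum>k<K. m k ws * Q k s)"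
  shows "F \<in> separated"
proof -
  have "F = (\<lambda>(ws, s). \<Sum>k<K. m k ws * Q k s)" using assms(2) by (simp add: fun_eq_iff)
  then show ?thesis unfolding separated_def using assms(1) by blast
qed

lemma separatedI:
  assumes "Q \<in> polyfun params"
  shows "(\<lambda>(ws, s). m ws * Q s) \<in> separated"
  by (rule in_separated[where K = 1 and m = "\<lambda>_. m" and Q = "\<lambda>_. Q"]) (simp_all add: assms)

lemma separated_add:
  assumes "F \<in> separated" "F' \<in> separated"
  shows "(\<lambda>z. F z + F' z) \<in> separated"
proof -
  obtain K :: nat and m Q where F0: "(\<forall>k. Q k \<in> polyfun params) \<and> (\<forall>ws s. F (ws, s) = (\<Sum>k<K. m k ws * Q k s))"
    using separatedD[OF assms(1)] by blast
  note F = F0[THEN conjunct1, THEN spec] F0[THEN conjunct2, THEN spec, THEN spec]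
  obtain K' :: nat and m' Q' where F'0: "(\<forall>k. Q' k \<in> polyfun params) \<and> (\<forall>ws s. F' (ws, s) = (\<Sum>k<K'. m' k ws * Q' k s))"
    using separatedD[OF assms(2)] by blast
  note F' = F'0[THEN conjunct1, THEN spec] F'0[THEN conjunct2, THEN spec, THEN spec]
  have split: "(\<Sum>k<K + K'. f k) = (\<Sum>k<K. f k) + (\<Sum>k<K'. f (K + k))" for f :: "nat \<Rightarrow> real"
    by (induction K') (auto simp: add.assoc)
  show ?thesis
  proof (rule in_separated[where K = "K + K'" and m = "\<lambda>k. if k < K then m k else m' (k - K)" and
        Q = "\<lambda>k. if k < K then Q k else Q' (k - K)"])
    show "(if k < K then Q k else Q' (k - K)) \<in> polyfun params" for k using F(1) F'(1) by simp
    show "F (ws, s) + F' (ws, s) = (\<Sum>k<K + K'. (if k < K then m k else m' (k - K)) ws *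
      (if k < K then Q k else Q' (k - K)) s)" for ws s
      unfolding split by (simp add: F(2) F'(2))
  qed
qed

lemma function_algebra_separated: "function_algebra separated"
  unfolding function_algebra_def
proof (intro conjI allI ballI)
  show const: "(\<lambda>_. c) \<in> separated" for c
    by (rule in_separated[where K = 1 and m = "\<lambda>_ _. 1" and Q = "\<lambda>_ _. c"]) (simp_all add: polyfun_const)
  fix F F' assume F: "F \<in> separated" "F' \<in> separated"
  then show "(\<lambda>z. F z + F' z) \<in> separated" by (rule separated_add)
  obtain K :: nat and m Q where mQ0: "(\<forall>k. Q k \<in> polyfun params) \<and> (\<forall>ws s. F (ws, s) = (\<Sum>k<K. m k ws * Q k s))"
    using separatedD[OF F(1)] by blast
  note mQ = mQ0[THEN conjunct1, THEN spec] mQ0[THEN conjunct2, THEN spec, THEN spec]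
  obtain K' :: nat and m' Q' where mQ'0: "(\<forall>k. Q' k \<in> polyfun params) \<and> (\<forall>ws s. F' (ws, s) = (\<Sum>k<K'. m' k ws * Q' k s))"
    using separatedD[OF F(2)] by blast
  note mQ' = mQ'0[THEN conjunct1, THEN spec] mQ'0[THEN conjunct2, THEN spec, THEN spec]
  have sum: "(\<lambda>z. \<Sum>k<K. f k z) \<in> separated" if "\<And>k. f k \<in> separated" for f and K :: nat
    by (induction K) (auto intro: const separated_add that)
  have "(\<lambda>z. F z * F' z) = (\<lambda>z. \<Sum>k<K. \<Sum>j<K'. (\<lambda>(ws, s). (m k ws * m' j ws) * (Q k s * Q' j s)) z)"
    by (simp only: mQ(2) mQ'(2) fun_eq_iff split_paired_All prod.case sum_product)
       (intro allI sum.cong refl, simp add: mult_ac)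
  also have "\<dots> \<in> separated"
    by (intro sum separatedI polyfun_mult mQ(1) mQ'(1))
  finally show "(\<lambda>z. F z * F' z) \<in> separated" .
qed

lemma wprod_separated:
  "\<exists>F. (\<forall>e\<in>Basis. (\<lambda>z. F z \<bullet> e) \<in> separated) \<and>
    (\<forall>ws s. length ws \<le> m \<and> set ws \<subseteq> UNIV \<times> G.hbasis \<longrightarrow> F (ws, s) = H.wprod (letter s) ws)"
proof (induction m)
  case 0
  show ?case
    by (rule exI[of _ "\<lambda>_. 0"]) (simp add: function_algebra_const[OF function_algebra_separated])
next
  case (Suc m)
  then obtain F where F: "\<forall>e\<in>Basis. (\<lambda>z. F z \<bullet> e) \<in> separated"
    "\<And>ws s. length ws \<le> m \<and> set ws \<subseteq> UNIV \<times> G.hbasis \<Longrightarrow> F (ws, s) = H.wprod (letter s) ws" by blast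
  define T where "T = (\<lambda>(ws, s :: 'a \<times> 'b \<Rightarrow> real). F (tl ws, s))"
  have T: "(\<lambda>z. T z \<bullet> e) \<in> separated" if "e \<in> Basis" for e
  proof -
    have "(\<lambda>z. F z \<bullet> e) \<in> separated" using F(1) that by blast
    obtain K :: nat and m Q where sep0: "(\<forall>k. Q k \<in> polyfun params) \<and> (\<forall>ws s. F (ws, s) \<bullet> e = (\<Sum>k<K. m k ws * Q k s))"
      using separatedD[OF \<open>(\<lambda>z. F z \<bullet> e) \<in> separated\<close>] by blast
    note sep = sep0[THEN conjunct1, THEN spec] sep0[THEN conjunct2, THEN spec, THEN spec]
    then show ?thesis
      by (intro in_separated[where K = K and m = "\<lambda>k ws. m k (tl ws)" and Q = Q]) (simp_all add: T_def sep)
  qed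
  define t where "t ws b = (if ws \<noteq> [] \<and> snd (hd ws) = b then fst (hd ws) else 0)" for ws :: "(real \<times> 'a) list" and b
  define L where "L = (\<lambda>(ws, s). \<Sum>b\<in>G.hbasis. t ws b *\<^sub>R letter s b)"
  have L: "(\<lambda>z. L z \<bullet> e) \<in> separated" for e
  proof -
    have "(\<lambda>z. L z \<bullet> e) = (\<lambda>z. \<Sum>i\<in>params. (\<lambda>(ws, s). (t ws (fst i) * (component H 1 (snd i) \<bullet> e)) * s i) z)"
      by (auto simp: L_def letter_def fun_eq_iff inner_sum_left sum.cartesian_product' sum_distrib_left mult_ac)
    also have "\<dots> \<in> separated"
      by (intro function_algebra_sum[OF function_algebra_separated finite_params] separatedI polyfun_coord)
    finally show ?thesis .
  qed
  show ?case
  proof (intro exI[of _ "\<lambda>z. L z \<star> T z"] conjI ballI allI impI)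
    show "(\<lambda>z. (L z \<star> T z) \<bullet> e) \<in> separated" if "e \<in> Basis" for e
      by (rule H.mult_coordinates_closed[OF function_algebra_separated L T that])
    fix ws :: "(real \<times> 'a) list" and s assume ws: "length ws \<le> Suc m \<and> set ws \<subseteq> UNIV \<times> G.hbasis"
    show "L (ws, s) \<star> T (ws, s) = H.wprod (letter s) ws"
    proof (cases ws)
      case Nil
      then show ?thesis using F(2)[of "[]"] by (simp add: L_def T_def t_def)
    next
      case (Cons w vs)
      obtain x b where w: "w = (x, b)" by (cases w)
      have "L (ws, s) = (\<Sum>b'\<in>G.hbasis. if b = b' then x *\<^sub>R letter s b' else 0)"
        unfolding L_def by (simp, rule sum.cong) (auto simp: t_def Cons w)
      then have "L (ws, s) = x *\<^sub>R letter s b" using ws G.hbasis(1) by (simp add: Cons w)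
      moreover have "T (ws, s) = H.wprod (letter s) vs" using ws F(2)[of vs s] by (simp add: T_def Cons)
      ultimately show ?thesis by (simp add: Cons w)
    qed
  qed
qed

text \<open>The infinitely many equations "every relator of the source is a relator of the target" reduce to finitely
  many, since the coefficient vectors of the relators span a finite-dimensional space.  The Lojasiewicz
  inequality then moves an approximate solution to an exact one.\<close>

lemma approximate_relations:
  "\<exists>q. \<forall>d s. 0 < d \<and> d \<le> 1/2 \<and> (\<forall>i\<in>params. \<bar>s i\<bar> \<le> B) \<and>
      (\<forall>ws\<in>relators m. norm (H.wprod (letter s) ws) \<le> d ^ q) \<longrightarrow>
    (\<exists>s'. (\<forall>ws\<in>relators m. H.wprod (letter s') ws = 0) \<and> (\<forall>i\<in>params. \<bar>s i - s' i\<bar> \<le> d))"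
proof -
  obtain F where F: "\<forall>e\<in>Basis. (\<lambda>z. F z \<bullet> e) \<in> separated"
    "\<And>ws s. length ws \<le> m \<and> set ws \<subseteq> UNIV \<times> G.hbasis \<Longrightarrow> F (ws, s) = H.wprod (letter s) ws"
    using wprod_separated[of m] by blast
  have rel: "F (ws, s) = H.wprod (letter s) ws" if "ws \<in> relators m" for ws s
    using that by (intro F(2)) (auto simp: relators_def words_def)
  have "\<forall>e\<in>Basis. \<exists>R0. finite R0 \<and> R0 \<subseteq> relators m \<and> (\<forall>ws\<in>R0. (\<lambda>s. F (ws, s) \<bullet> e) \<in> polyfun params) \<and>
      (\<forall>s. (\<forall>ws\<in>R0. F (ws, s) \<bullet> e = 0) \<longrightarrow> (\<forall>ws\<in>relators m. F (ws, s) \<bullet> e = 0))"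
  proof
    fix e :: 'b assume "e \<in> Basis"
    then have "(\<lambda>z. F z \<bullet> e) \<in> separated" using F(1) by blast
    obtain K :: nat and c Q where Fe0: "(\<forall>k. Q k \<in> polyfun params) \<and> (\<forall>ws s. F (ws, s) \<bullet> e = (\<Sum>k<K. c k ws * Q k s))"
      using separatedD[OF \<open>(\<lambda>z. F z \<bullet> e) \<in> separated\<close>] by blast
    note Fe = Fe0[THEN conjunct1, THEN spec] Fe0[THEN conjunct2, THEN spec, THEN spec]
    obtain R0 where R0: "finite R0" "R0 \<subseteq> relators m"
      "\<forall>w\<in>relators m. \<exists>a. \<forall>k<K. c k w = (\<Sum>v\<in>R0. a v * c k v)"
      using finite_spanning_subfamily[of "relators m" K c] by blast
    have "(\<lambda>s. F (ws, s) \<bullet> e) \<in> polyfun params" for ws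
      unfolding Fe(2) using Fe(1) by (intro function_algebra_sum[OF function_algebra_polyfun]
          function_algebra_cmult[OF function_algebra_polyfun]) auto
    moreover have "F (ws, s) \<bullet> e = 0" if "\<forall>v\<in>R0. F (v, s) \<bullet> e = 0" and ws: "ws \<in> relators m" for s ws
    proof -
      obtain a where a: "\<forall>k<K. c k ws = (\<Sum>v\<in>R0. a v * c k v)" using R0(3) ws by blast
      have "F (ws, s) \<bullet> e = (\<Sum>k<K. \<Sum>v\<in>R0. a v * (c k v * Q k s))"
        unfolding Fe(2) using a by (simp add: sum_distrib_right mult.assoc)
      also have "\<dots> = (\<Sum>v\<in>R0. a v * (F (v, s) \<bullet> e))"
        unfolding Fe(2) by (subst sum.swap) (simp add: sum_distrib_left)
      finally show ?thesis using that(1) by simp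
    qed
    ultimately show "\<exists>R0. finite R0 \<and> R0 \<subseteq> relators m \<and> (\<forall>ws\<in>R0. (\<lambda>s. F (ws, s) \<bullet> e) \<in> polyfun params) \<and>
      (\<forall>s. (\<forall>ws\<in>R0. F (ws, s) \<bullet> e = 0) \<longrightarrow> (\<forall>ws\<in>relators m. F (ws, s) \<bullet> e = 0))"
      using R0(1,2) by (intro exI[of _ R0]) blast
  qed
  from bchoice[OF this] obtain R0 where R0: "\<forall>e\<in>Basis. finite (R0 e) \<and> R0 e \<subseteq> relators m \<and>
      (\<forall>ws\<in>R0 e. (\<lambda>s. F (ws, s) \<bullet> e) \<in> polyfun params) \<and>
      (\<forall>s. (\<forall>ws\<in>R0 e. F (ws, s) \<bullet> e = 0) \<longrightarrow> (\<forall>ws\<in>relators m. F (ws, s) \<bullet> e = 0))" by blast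
  define PP where "PP = (\<Union>e\<in>Basis. (\<lambda>ws s. F (ws, s) \<bullet> e) ` R0 e)"
  have "finite PP" "PP \<subseteq> polyfun params" using R0 by (auto simp: PP_def)
  from lojasiewicz[OF finite_params this, of B] obtain q where
    q: "\<And>d s. 0 < d \<and> d \<le> 1/2 \<and> (\<forall>i\<in>params. \<bar>s i\<bar> \<le> B) \<and> (\<forall>P\<in>PP. \<bar>P s\<bar> \<le> d ^ q) \<Longrightarrow>
      (\<exists>s'. (\<forall>P\<in>PP. P s' = 0) \<and> (\<forall>i\<in>params. \<bar>s i - s' i\<bar> \<le> d))" by blast
  have "\<exists>s'. (\<forall>ws\<in>relators m. H.wprod (letter s') ws = 0) \<and> (\<forall>i\<in>params. \<bar>s i - s' i\<bar> \<le> d)"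
    if s: "0 < d" "d \<le> 1/2" "\<forall>i\<in>params. \<bar>s i\<bar> \<le> B"
      "\<forall>ws\<in>relators m. norm (H.wprod (letter s) ws) \<le> d ^ q" for d s
  proof -
    have "\<bar>F (ws, s) \<bullet> e\<bar> \<le> d ^ q" if "e \<in> Basis" "ws \<in> R0 e" for e ws
    proof -
      have "ws \<in> relators m" using R0 that by blast
      then have "norm (F (ws, s)) \<le> d ^ q" using s(4) rel[of ws s] by simp
      with Basis_le_norm[OF that(1)] show ?thesis by (rule order_trans)
    qed
    then have "\<forall>P\<in>PP. \<bar>P s\<bar> \<le> d ^ q" by (auto simp: PP_def)
    then have "\<exists>s'. (\<forall>P\<in>PP. P s' = 0) \<and> (\<forall>i\<in>params. \<bar>s i - s' i\<bar> \<le> d)"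
      by (intro q conjI s)
    then obtain s' where s': "\<forall>P\<in>PP. P s' = 0" "\<forall>i\<in>params. \<bar>s i - s' i\<bar> \<le> d" by (elim exE conjE)
    have "H.wprod (letter s') ws = 0" if ws: "ws \<in> relators m" for ws
    proof -
      have "F (ws, s') \<bullet> e = 0" if e: "e \<in> Basis" for e
      proof -
        have "\<forall>v\<in>R0 e. F (v, s') \<bullet> e = 0" using s'(1) e by (auto simp: PP_def)
        then show ?thesis using R0 e ws by blast
      qed
      then have "F (ws, s') = 0" by (simp add: euclidean_eq_iff[where 'a = 'b])
      then show ?thesis using rel[OF ws] by simp
    qed
    then show ?thesis using s'(2) by blast
  qed
  then show ?thesis by blast
qed

text \<open>If words of length \<open>n\<close> reach every point, then the multiplication table consists of relators of length \<open>3 n\<close>: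
  words for \<open>x\<close> and for \<open>y\<close>, followed by the inverse of a word for their product.\<close>

lemma exact_relations_hom:
  assumes W: "\<And>x. W x \<in> words G.hbasis n (C * G.hnorm x)" "\<And>x. gword (W x) = x" and C: "0 \<le> C"
    and rel: "\<forall>ws\<in>relators (3 * n). H.wprod (letter s) ws = 0"
  shows "(\<lambda>x. H.wprod (letter s) (W x)) \<in> lipschitz_homs G H N"
proof -
  let ?T = "\<lambda>x. H.wprod (letter s) (W x)"
  \<comment> \<open>the bound one on the exponents of a relator is immaterial, by dilation\<close>
  have rel': "H.wprod (letter s) ws = 0" if ws: "ws \<in> words G.hbasis (3 * n) \<tau>" "gword ws = 0" for ws \<tau>
  proof -
    define c where "c = 1 / (\<bar>\<tau>\<bar> + 1)"
    have c: "c > 0" "c * \<tau> \<le> 1" by (auto simp: c_def field_simps abs_if)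
    have ws': "set ws \<subseteq> UNIV \<times> G.hbasis" using ws(1) by (auto simp: words_def)
    have "word_scale c ws \<in> words G.hbasis (3 * n) 1"
      using word_scale_words[OF ws(1), of c] c words_mono by fastforce
    moreover have "gword (word_scale c ws) = 0" using G.wprod_id_scale[OF ws', of c] ws(2) by simp
    ultimately have "H.wprod (letter s) (word_scale c ws) = 0" using rel by (simp add: relators_def)
    then have "dilation H c (H.wprod (letter s) ws) = 0"
      using H.wprod_scale[of ws "letter s" c] letter_layer by simp
    then have "dilation H (1 / c) (dilation H c (H.wprod (letter s) ws)) = 0" by simp
    then show ?thesis using c by (simp add: H.dilation_dilation)
  qed
  have hom: "?T (x \<cdot> y) = ?T x \<star> ?T y" for x y
  proof -
    define \<tau> where "\<tau> = max (max (C * G.hnorm x) (C * G.hnorm y)) (C * G.hnorm (x \<cdot> y))"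
    have "W x \<in> words G.hbasis n \<tau>" "W y \<in> words G.hbasis n \<tau>" "W (x \<cdot> y) \<in> words G.hbasis n \<tau>"
      by (auto intro!: words_mono[OF W(1)] simp: \<tau>_def)
    then have "W x @ W y @ word_inverse (W (x \<cdot> y)) \<in> words G.hbasis (3 * n) \<tau>"
      using append_words[of "W x" G.hbasis n \<tau> "W y @ word_inverse (W (x \<cdot> y))" "n + n"]
        append_words[of "W y" G.hbasis n \<tau> "word_inverse (W (x \<cdot> y))" n] word_inverse_words[of "W (x \<cdot> y)"]
      by (simp add: numeral_3_eq_3)
    moreover have "gword (W x @ W y @ word_inverse (W (x \<cdot> y))) = 0"
      by (simp add: G.wprod_append G.wprod_inverse W(2) flip: G.mult_assoc)
    ultimately have "H.wprod (letter s) (W x @ W y @ word_inverse (W (x \<cdot> y))) = 0" by (rule rel')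
    then have "(?T x \<star> ?T y) \<star> - ?T (x \<cdot> y) = 0"
      by (simp add: H.wprod_append H.wprod_inverse H.mult_assoc)
    then have "(?T x \<star> ?T y) \<star> - ?T (x \<cdot> y) \<star> ?T (x \<cdot> y) = ?T (x \<cdot> y)" by simp
    then show ?thesis by (simp add: H.mult_assoc)
  qed
  have T0: "?T 0 = 0"
  proof -
    have "?T 0 \<star> ?T 0 = ?T 0" using hom[of 0 0] by simp
    then have "- ?T 0 \<star> (?T 0 \<star> ?T 0) = - ?T 0 \<star> ?T 0" by simp
    then show ?thesis by simp
  qed
  have neg: "?T (- x) = - ?T x" for x
  proof -
    have "?T x \<star> ?T (- x) = 0" using hom[of x "- x"] T0 by simp
    then have "- ?T x \<star> (?T x \<star> ?T (- x)) = - ?T x" by simp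
    then show ?thesis by simp
  qed
  define M where "M = (\<Sum>b\<in>G.hbasis. norm (letter s b))"
  have M: "norm (letter s b) \<le> M" if "b \<in> G.hbasis" for b
    unfolding M_def using that G.hbasis(1) by (intro member_le_sum) auto
  obtain D where D: "\<And>(a :: 'a \<Rightarrow> 'b) ws. ws \<in> words G.hbasis n 1 \<Longrightarrow> (\<And>e. e \<in> G.hbasis \<Longrightarrow> norm (a e) \<le> M) \<Longrightarrow> norm (H.wprod a ws) \<le> D"
    using H.wprod_bounded[of G.hbasis n M] by blast
  obtain D' where D': "D' \<ge> 0" "\<And>x. norm x \<le> D \<Longrightarrow> N x \<le> D'" using H.N_bounded_if_norm[of D] by blast
  have lip: "N (?T x) \<le> D' * (C + 1) * G.hnorm x" for x
  proof (cases "x = 0")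
    case False
    then have h: "G.hnorm x > 0" using G.hnorm_nonneg[of x] G.hnorm_eq_zero[of x] by linarith
    define c where "c = (C + 1) * G.hnorm x"
    have c: "c > 0" using h C by (simp add: c_def)
    have "word_scale (1 / c) (W x) \<in> words G.hbasis n 1"
      using c h C by (intro words_mono[OF word_scale_words[OF W(1)]]) (auto simp: c_def field_simps)
    then have "norm (H.wprod (letter s) (word_scale (1 / c) (W x))) \<le> D" using M by (rule D)
    then have "N (dilation H (1 / c) (?T x)) \<le> D'"
      using D'(2) H.wprod_scale[of "W x" "letter s" "1 / c"] letter_layer by simp
    then show ?thesis using c by (simp add: H.N_dilation c_def field_simps)
  qed (simp add: T0)
  obtain c where c: "c > 0" "\<And>x y. c * G.hdist x y \<le> cc_dist G x y"
    using G.cc_dist_comparable by blast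
  have "hom_dist H N (?T x) (?T y) \<le> (D' * (C + 1) / c) * cc_dist G x y" for x y
  proof -
    have "hom_dist H N (?T x) (?T y) = N (?T (- x \<cdot> y))" by (simp add: H.hom_dist_eq hom neg)
    also have "\<dots> \<le> D' * (C + 1) * G.hdist x y" by (rule lip)
    also have "\<dots> \<le> D' * (C + 1) * (cc_dist G x y / c)"
      using c D'(1) C by (intro mult_left_mono) (auto simp: field_simps)
    finally show ?thesis by simp
  qed
  then show ?thesis
    unfolding lipschitz_homs_def mem_Collect_eq using hom
    by (intro conjI exI[of _ "D' * (C + 1) / c"]) (auto simp: hom_def G.carrier_UNIV H.carrier_UNIV)
qed

end

section \<open>Maps that are straight along horizontal lines are close to homomorphisms\<close>

lemma norm_add3: "norm (a + b + c) \<le> norm a + norm b + norm (c :: 'a::real_normed_vector)"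
  using norm_triangle_ineq[of "a + b" c] norm_triangle_ineq[of a b] by linarith

context carnot_group
begin

text \<open>Conjugation is continuous and fixes the unit; as it is polynomial, the modulus of continuity is a power.\<close>

lemma conjugation_small:
  "\<exists>q\<ge>1. \<forall>d u v. 0 < d \<and> d \<le> 1/2 \<and> norm v \<le> B \<and> hnorm u \<le> d ^ q \<longrightarrow> hnorm (- v \<otimes> (u \<otimes> v)) \<le> d"
proof -
  define B1 where "B1 = max B 1"
  obtain L where L: "L \<ge> 0" "\<And>x y x' y'. norm x \<le> B1 \<and> norm y \<le> B1 \<and> norm x' \<le> B1 \<and> norm y' \<le> B1 \<Longrightarrow>
     norm (x \<otimes> y - x' \<otimes> y') \<le> L * (norm (x - x') + norm (y - y'))"
    using mult_lipschitz[of B1] by blast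
  define B2 where "B2 = B1 + L"
  obtain L' where L': "L' \<ge> 0" "\<And>x y x' y'. norm x \<le> B2 \<and> norm y \<le> B2 \<and> norm x' \<le> B2 \<and> norm y' \<le> B2 \<Longrightarrow>
     norm (x \<otimes> y - x' \<otimes> y') \<le> L' * (norm (x - x') + norm (y - y'))"
    using mult_lipschitz[of B2] by blast
  obtain q1 where q1: "q1 \<ge> 1" "\<And>d x. 0 < d \<and> d \<le> 1/2 \<and> norm x \<le> d ^ q1 \<Longrightarrow> hnorm x \<le> d"
    using hnorm_small_if_norm by blast
  obtain q2 where q2: "q2 \<ge> 1" "\<And>d x. 0 < d \<and> d \<le> 1/2 \<and> hnorm x \<le> d ^ q2 \<Longrightarrow> norm x \<le> d"
    using norm_small_if_hnorm by blast
  obtain q3 where q3: "q3 \<ge> q1" "\<And>d. 0 < d \<and> d \<le> 1/2 \<Longrightarrow> (L' * L) * d ^ q3 \<le> d ^ q1"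
    using absorb_constant[of q1 "L' * L"] by blast
  have "hnorm (- v \<otimes> (u \<otimes> v)) \<le> d"
    if d: "0 < d" "d \<le> 1/2" and v: "norm v \<le> B" and u: "hnorm u \<le> d ^ (q3 * q2)" for d u v
  proof -
    have q31: "q3 \<ge> 1" using q1 q3 by linarith
    note d3 = power_small_range[OF d q31]
    have nu: "norm u \<le> d ^ q3" using q2(2)[of "d ^ q3" u] d3 u by (simp add: power_mult)
    have 1: "norm (u \<otimes> v - 0 \<otimes> v) \<le> L * (norm (u - 0) + norm (v - v))"
      using nu d3 v by (intro L(2)) (auto simp: B1_def)
    then have 2: "norm (u \<otimes> v - v) \<le> L * norm u" by simp
    also have "\<dots> \<le> L * 1" using nu d3 L(1) by (intro mult_left_mono) auto
    finally have "norm (u \<otimes> v) \<le> B2"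
      using norm_triangle_sub[of "u \<otimes> v" v] v by (simp add: B2_def B1_def)
    moreover have "norm v \<le> B2" using v L(1) by (simp add: B2_def B1_def)
    ultimately have "norm (- v \<otimes> (u \<otimes> v) - - v \<otimes> v) \<le> L' * (norm (- v - - v) + norm (u \<otimes> v - v))"
      by (intro L'(2)) simp
    then have "norm (- v \<otimes> (u \<otimes> v)) \<le> L' * norm (u \<otimes> v - v)" by simp
    also have "\<dots> \<le> L' * (L * d ^ q3)"
      using 2 nu L(1) L'(1) by (intro mult_left_mono) (auto intro: order_trans[OF _ mult_left_mono])
    also have "\<dots> \<le> d ^ q1" using q3(2) d by (simp add: mult.assoc)
    finally show ?thesis using q1(2) d by blast
  qed
  then show ?thesis using q1 q2 q3 by (intro exI[of _ "q3 * q2"]) auto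
qed

end

locale carnot_target = carnot_pair +
  assumes horizontal_le: "norm (component H 1 x - component H 1 y) \<le> N (- x \<star> y)"
begin

abbreviation hcomp :: "'b \<Rightarrow> 'b" where "hcomp \<equiv> component H 1"

text \<open>Lipschitz above the scale \<open>\<kappa>\<close>, with no control below it beyond the bound at that scale.\<close>

definition coarse_lip :: "real \<Rightarrow> real \<Rightarrow> ('a \<Rightarrow> 'b) \<Rightarrow> bool" where
  "coarse_lip C \<kappa> F \<longleftrightarrow> F 0 = 0 \<and>
     (\<forall>x y. N (- F x \<star> F y) \<le> C * max (G.hdist x y) \<kappa>)"

text \<open>The midpoint property at all dyadic scales up to \<open>2 ^ k\<close> gives the horizontal component a slope along the ray from \<open>x\<close>.
  Horizontality of the increment is wanted for the first step only, which is the one to be computed.\<close>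

definition straight :: "nat \<Rightarrow> real \<Rightarrow> ('a \<Rightarrow> 'b) \<Rightarrow> 'a \<Rightarrow> 'a \<Rightarrow> bool" where
  "straight k \<theta> F x v \<longleftrightarrow>
     nonhorizontality H N (- F x \<star> F (x \<cdot> v)) \<le> \<theta> \<and>
     (\<forall>i<k. norm ((1 / 2) *\<^sub>R (hcomp (F x) + hcomp (F (x \<cdot> (2 ^ Suc i *\<^sub>R v)))) - hcomp (F (x \<cdot> (2 ^ i *\<^sub>R v))))
        \<le> 2 ^ i * \<theta>)"

definition grid_vectors :: "nat \<Rightarrow> 'a set" where
  "grid_vectors n = {(of_int l / real n) *\<^sub>R b | l b. l \<in> {- int n..int n} \<and> b \<in> G.hbasis}"

text \<open>The defect is controlled in measure only, so straight points are merely \<open>\<kappa>\<close>-dense.\<close>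

definition straight_nearby :: "nat \<Rightarrow> nat \<Rightarrow> real \<Rightarrow> real \<Rightarrow> real \<Rightarrow> ('a \<Rightarrow> 'b) \<Rightarrow> bool" where
  "straight_nearby n k \<theta> \<kappa> \<rho> F \<longleftrightarrow>
     (\<forall>x. G.hnorm x \<le> \<rho> \<longrightarrow> (\<exists>x'. G.hdist x x' \<le> \<kappa> \<and> (\<forall>v\<in>grid_vectors n. straight k \<theta> F x' v)))"

lemma grid_vectors_bound:
  obtains M where "M \<ge> 1" "\<And>n v. v \<in> grid_vectors n \<Longrightarrow> v \<in> layer G 1 \<and> norm v \<le> M \<and> G.hnorm v \<le> M"
proof -
  define M where "M = 1 + (\<Sum>b\<in>G.hbasis. norm b)"
  have "v \<in> layer G 1 \<and> norm v \<le> M \<and> G.hnorm v \<le> M" if v0: "v \<in> grid_vectors n" for n v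
  proof -
    obtain l b where v: "v = (of_int l / real n) *\<^sub>R b" "l \<in> {- int n..int n}" "b \<in> G.hbasis"
      using v0 unfolding grid_vectors_def by blast
    then have b: "b \<in> layer G 1" using G.hbasis(2) by blast
    then have vl: "v \<in> layer G 1" unfolding v by (rule subspace_scale[OF G.layer_subspace])
    have "\<bar>real_of_int l\<bar> \<le> real n" using v(2) by auto
    then have "\<bar>of_int l / real n\<bar> \<le> 1" by (cases "n = 0") (simp_all add: abs_divide divide_le_eq)
    then have "norm v \<le> 1 * norm b" unfolding v norm_scaleR by (intro mult_right_mono) auto
    also have "\<dots> \<le> (\<Sum>b\<in>G.hbasis. norm b)" using v(3) G.hbasis(1) by (auto intro: member_le_sum)
    finally show ?thesis using vl by (auto simp: M_def G.hnorm_layer1)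
  qed
  moreover have "M \<ge> 1" by (simp add: M_def sum_nonneg)
  ultimately show thesis using that by blast
qed

text \<open>Each midpoint estimate compares the difference quotients at two consecutive dyadic scales; add them up.\<close>

lemma straight_slope:
  assumes "straight k \<theta> F x v"
  shows "norm ((hcomp (F (x \<cdot> v)) - hcomp (F x)) - (1 / 2 ^ k) *\<^sub>R (hcomp (F (x \<cdot> (2 ^ k *\<^sub>R v))) - hcomp (F x)))
    \<le> real k * \<theta>"
proof -
  define f where "f i = hcomp (F (x \<cdot> (2 ^ i *\<^sub>R v))) - hcomp (F x)" for i :: nat
  have "norm (f 0 - (1 / 2 ^ j) *\<^sub>R f j) \<le> real j * \<theta>" if "j \<le> k" for j
    using that
  proof (induction j)
    case (Suc j)
    have mid: "norm ((1 / 2) *\<^sub>R f (Suc j) - f j) \<le> 2 ^ j * \<theta>"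
    proof -
      have "(1 / 2) *\<^sub>R f (Suc j) - f j =
          (1 / 2) *\<^sub>R (hcomp (F x) + hcomp (F (x \<cdot> (2 ^ Suc j *\<^sub>R v)))) - hcomp (F (x \<cdot> (2 ^ j *\<^sub>R v)))"
        using scaleR_half_double[of "hcomp (F x)"]
        by (simp add: f_def scaleR_add_right scaleR_diff_right algebra_simps)
      then show ?thesis using assms Suc.prems by (simp add: straight_def)
    qed
    have "(1 / 2 ^ j) *\<^sub>R f j - (1 / 2 ^ Suc j) *\<^sub>R f (Suc j) = - (1 / 2 ^ j) *\<^sub>R ((1 / 2) *\<^sub>R f (Suc j) - f j)"
      by (simp add: scaleR_diff_right field_simps)
    then have "norm ((1 / 2 ^ j) *\<^sub>R f j - (1 / 2 ^ Suc j) *\<^sub>R f (Suc j)) \<le> 1 / 2 ^ j * (2 ^ j * \<theta>)"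
      using mid by (simp add: divide_le_eq mult.commute)
    then have "norm ((1 / 2 ^ j) *\<^sub>R f j - (1 / 2 ^ Suc j) *\<^sub>R f (Suc j)) \<le> \<theta>" by simp
    then have "norm ((f 0 - (1 / 2 ^ j) *\<^sub>R f j) + ((1 / 2 ^ j) *\<^sub>R f j - (1 / 2 ^ Suc j) *\<^sub>R f (Suc j))) \<le> real j * \<theta> + \<theta>"
      using Suc by (intro order_trans[OF norm_triangle_ineq] add_mono) auto
    then show ?case by (simp add: algebra_simps)
  qed simp
  from this[of k] show ?thesis by (simp add: f_def)
qed

text \<open>Slopes at different points agree: the two rays stay much closer to each other than their length.  Here
  the group structure enters; the gain comes from conjugating a small element.\<close>

lemma slope_compare:
  assumes F: "coarse_lip C \<kappa> F" and C: "0 \<le> C" and \<kappa>: "0 \<le> \<kappa>"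
    and sx: "straight k \<theta> F x v" and sy: "straight k \<theta> F y v" and v: "v \<in> layer G 1"
  shows "norm ((hcomp (F (x \<cdot> v)) - hcomp (F x)) - (hcomp (F (y \<cdot> v)) - hcomp (F y)))
    \<le> 2 * (real k * \<theta>) + C * (G.hnorm (- v \<cdot> (dilation G (1 / 2 ^ k) (- x \<cdot> y) \<cdot> v))
         + (1 / 2 ^ k) * G.hdist x y + 2 * \<kappa>)"
proof -
  define R :: real where "R = 2 ^ k"
  have R: "1 \<le> R" "0 < R" by (simp_all add: R_def)
  define z where "z = - x \<cdot> y"
  define w where "w = - v \<cdot> (dilation G (1 / R) z \<cdot> v)"
  define fx fy where "fx = hcomp (F (x \<cdot> (R *\<^sub>R v))) - hcomp (F x)"
    and "fy = hcomp (F (y \<cdot> (R *\<^sub>R v))) - hcomp (F y)"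
  have lip: "norm (hcomp (F a) - hcomp (F b)) \<le> C * (G.hdist a b + \<kappa>)" for a b
  proof -
    have "norm (hcomp (F a) - hcomp (F b)) \<le> C * max (G.hdist a b) \<kappa>"
      using horizontal_le F unfolding coarse_lip_def by (meson order_trans)
    also have "\<dots> \<le> C * (G.hdist a b + \<kappa>)"
      using C \<kappa> G.hnorm_nonneg by (intro mult_left_mono) auto
    finally show ?thesis .
  qed
  have dv: "dilation G R v = R *\<^sub>R v" using G.dilation_layer[OF v, of R] by simp
  have "- (x \<cdot> (R *\<^sub>R v)) \<cdot> (y \<cdot> (R *\<^sub>R v)) = dilation G R w"
    using R by (simp add: w_def z_def G.dilation_mult G.dilation_neg G.dilation_dilation dv G.neg_mult G.mult_assoc)
  then have "G.hnorm (- (x \<cdot> (R *\<^sub>R v)) \<cdot> (y \<cdot> (R *\<^sub>R v))) = R * G.hnorm w"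
    using R by (simp add: G.hnorm_dilation)
  with lip have 1: "norm (hcomp (F (x \<cdot> (R *\<^sub>R v))) - hcomp (F (y \<cdot> (R *\<^sub>R v)))) \<le> C * (R * G.hnorm w + \<kappa>)"
    by metis
  have "norm (fx - fy) \<le> norm (hcomp (F (x \<cdot> (R *\<^sub>R v))) - hcomp (F (y \<cdot> (R *\<^sub>R v)))) + norm (hcomp (F x) - hcomp (F y))"
    unfolding fx_def fy_def by (rule order_trans[OF _ norm_triangle_ineq4]) (simp add: algebra_simps)
  also have "\<dots> \<le> C * (R * G.hnorm w + \<kappa>) + C * (G.hnorm z + \<kappa>)"
    using 1 lip[of x y] by (simp add: z_def)
  finally have "norm (fx - fy) \<le> C * (R * G.hnorm w + G.hnorm z + 2 * \<kappa>)" by (simp add: algebra_simps)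
  then have "1 / R * norm (fx - fy) \<le> 1 / R * (C * (R * G.hnorm w + G.hnorm z + 2 * \<kappa>))"
    using R by (intro mult_left_mono) auto
  also have "\<dots> = C * (G.hnorm w + 1 / R * G.hnorm z + 1 / R * (2 * \<kappa>))" using R by (simp add: field_simps)
  also have "\<dots> \<le> C * (G.hnorm w + 1 / R * G.hnorm z + 1 * (2 * \<kappa>))"
    using C \<kappa> R by (intro mult_left_mono add_left_mono mult_right_mono) auto
  finally have 2: "norm ((1 / R) *\<^sub>R fx - (1 / R) *\<^sub>R fy) \<le> C * (G.hnorm w + 1 / R * G.hnorm z + 2 * \<kappa>)"
    using R by (simp flip: scaleR_diff_right)
  define ax ay where "ax = hcomp (F (x \<cdot> v)) - hcomp (F x)" and "ay = hcomp (F (y \<cdot> v)) - hcomp (F y)"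
  have 3: "norm (ax - (1 / R) *\<^sub>R fx) \<le> real k * \<theta>" "norm (ay - (1 / R) *\<^sub>R fy) \<le> real k * \<theta>"
    using straight_slope[OF sx] straight_slope[OF sy] by (simp_all add: ax_def ay_def fx_def fy_def R_def)
  have "ax - ay = (ax - (1 / R) *\<^sub>R fx) + ((1 / R) *\<^sub>R fx - (1 / R) *\<^sub>R fy) - (ay - (1 / R) *\<^sub>R fy)" by simp
  then have "norm (ax - ay) \<le> norm (ax - (1 / R) *\<^sub>R fx) + norm ((1 / R) *\<^sub>R fx - (1 / R) *\<^sub>R fy) + norm (ay - (1 / R) *\<^sub>R fy)"
    by (metis norm_triangle_ineq norm_triangle_ineq4 order_trans add_right_mono)
  with 2 3 show ?thesis by (simp add: ax_def ay_def w_def z_def R_def)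
qed

text \<open>As slopes agree, the horizontal part of the increment along \<open>v\<close> is nearly the same at all points; as the increment
  is nearly horizontal, it is determined by this part.\<close>

lemma one_step:
  assumes C: "1 \<le> C" and \<rho>: "1 \<le> \<rho>"
  shows "\<exists>q\<ge>1. \<exists>C2\<ge>1. \<forall>d n k \<theta> \<kappa> \<kappa>' F.
     0 < d \<and> d \<le> 1/2 \<and> 0 \<le> \<kappa> \<and> \<kappa> \<le> d ^ q \<and> \<kappa>' \<le> d ^ q \<and> 1 / 2 ^ k \<le> d ^ q \<and>
     real k * \<theta> \<le> d ^ q \<and> \<theta> \<le> d ^ q \<and> coarse_lip C \<kappa> F \<and> straight_nearby n k \<theta> \<kappa>' \<rho> F \<longrightarrow>
     (\<exists>s. \<forall>v\<in>grid_vectors n. s v \<in> layer H 1 \<and> norm (s v) \<le> C2 \<and>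
        (\<forall>x. G.hnorm x \<le> \<rho> \<longrightarrow> norm (F x) \<le> C2 \<and> norm (F (x \<cdot> v) - F x \<star> s v) \<le> d))"
proof -
  obtain M where M: "M \<ge> 1" "\<And>n v. v \<in> grid_vectors n \<Longrightarrow> v \<in> layer G 1 \<and> norm v \<le> M \<and> G.hnorm v \<le> M"
    using grid_vectors_bound by blast
  obtain D where D: "D \<ge> 1" "\<And>x y. G.hnorm (x \<cdot> y) \<le> D * (G.hnorm x + G.hnorm y)"
    using G.hnorm_quasi_triangle by blast
  define r where "r = D * (\<rho> + 1)"
  have "1 * (\<rho> + 1) \<le> D * (\<rho> + 1)" using D(1) \<rho> by (intro mult_right_mono) auto
  then have r: "\<rho> + 1 \<le> r" by (simp only: r_def mult_1)
  then have r2: "2 \<le> r" using \<rho> by linarith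
  define r' where "r' = D * (r + M)"
  have "1 * (r + M) \<le> D * (r + M)" using D(1) r2 M(1) by (intro mult_right_mono) auto
  then have "r + M \<le> r'" by (simp only: r'_def mult_1)
  then have r': "r \<le> r'" "M \<le> r'" "1 \<le> r'" using r2 M(1) by linarith+
  obtain B where B: "B \<ge> 0" "\<And>y. N y \<le> C * r' \<Longrightarrow> norm y \<le> B" using H.norm_bounded_if_N[of "C * r'"] by blast
  define C2 where "C2 = max (max B 1) (C * M)"
  obtain L where L: "L \<ge> 0" "\<And>x y x' y'. norm x \<le> C2 \<and> norm y \<le> C2 \<and> norm x' \<le> C2 \<and> norm y' \<le> C2 \<Longrightarrow>
     norm (x \<star> y - x' \<star> y') \<le> L * (norm (x - x') + norm (y - y'))"
    using H.mult_lipschitz[of C2] by blast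
  obtain qc where qc: "qc \<ge> 1" "\<And>d u v. 0 < d \<and> d \<le> 1/2 \<and> norm v \<le> M \<and> G.hnorm u \<le> d ^ qc \<Longrightarrow>
      G.hnorm (- v \<cdot> (u \<cdot> v)) \<le> d"
    using G.conjugation_small[of M] by blast
  obtain qN where qN: "qN \<ge> 1" "\<And>d x y. 0 < d \<and> d \<le> 1/2 \<and> norm x \<le> C2 \<and> N (- x \<star> y) \<le> d ^ qN \<Longrightarrow> norm (x - y) \<le> d"
    using H.norm_dist_small_if_N[of C2] by blast
  define K1 where "K1 = 2 + C * 4"
  have K1: "0 \<le> K1" using C by (simp add: K1_def)
  obtain p where p: "p \<ge> 1" "\<And>d. 0 < d \<and> d \<le> 1/2 \<Longrightarrow> (1 + L * (1 + K1) + L) * d ^ p \<le> d ^ 1"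
    using absorb_constant[of 1 "1 + L * (1 + K1) + L"] by blast
  obtain m where m: "m \<ge> qN" "\<And>d. 0 < d \<and> d \<le> 1/2 \<Longrightarrow> C * d ^ m \<le> d ^ qN"
    using absorb_constant[of qN C] by blast
  \<comment> \<open>\<open>t\<close> leaves room for a conjugation (\<open>qc\<close>), the Lipschitz constant (\<open>m\<close>) and the passage from \<open>N\<close> to the
    Euclidean norm (\<open>qN\<close>); \<open>w\<close> absorbs the constants\<close>
  define t where "t = qc * m + qc + qN + 1"
  obtain w where w: "w \<ge> t" "\<And>d. 0 < d \<and> d \<le> 1/2 \<Longrightarrow> (2 * D * r' + C + 1) * d ^ w \<le> d ^ t"
    using absorb_constant[of t "2 * D * r' + C + 1"] by blast
  have "\<exists>s. \<forall>v\<in>grid_vectors n. s v \<in> layer H 1 \<and> norm (s v) \<le> C2 \<and>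
        (\<forall>x. G.hnorm x \<le> \<rho> \<longrightarrow> norm (F x) \<le> C2 \<and> norm (F (x \<cdot> v) - F x \<star> s v) \<le> d)"
    if d: "0 < d" "d \<le> 1/2" and \<kappa>: "0 \<le> \<kappa>" "\<kappa> \<le> d ^ (p * w)" "\<kappa>' \<le> d ^ (p * w)" and k: "1 / 2 ^ k \<le> d ^ (p * w)"
      and \<theta>: "real k * \<theta> \<le> d ^ (p * w)" "\<theta> \<le> d ^ (p * w)"
      and F: "coarse_lip C \<kappa> F" and S: "straight_nearby n k \<theta> \<kappa>' \<rho> F" for d n k \<theta> \<kappa> \<kappa>' F
  proof -
    define e where "e = d ^ p"
    have e: "0 < e" "e \<le> 1/2" unfolding e_def using power_small_range[OF d p(1)] by auto
    have ew: "d ^ (p * w) = e ^ w" by (simp add: e_def power_mult)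
    have ewt: "(2 * D * r' + C + 1) * e ^ w \<le> e ^ t" using w(2) e by blast
    have pos: "0 < e ^ w" using e by simp
    have coef: "0 \<le> 2 * D * r'" "0 \<le> C" using D(1) r' C by auto
    have small: "a * e ^ w \<le> e ^ j" if "a \<le> 2 * D * r' + C + 1" "j \<le> t" for a j
    proof -
      have "a * e ^ w \<le> (2 * D * r' + C + 1) * e ^ w" using that(1) pos by (intro mult_right_mono) auto
      also have "\<dots> \<le> e ^ t" by (rule ewt)
      also have "\<dots> \<le> e ^ j" by (rule power_small_mono[OF e that(2)])
      finally show ?thesis .
    qed
    have t_ge: "1 \<le> t" "qN \<le> t" "qc \<le> t" "m * qc \<le> t" by (simp_all add: t_def mult.commute)
    have s1: "e ^ w \<le> e ^ j" if "j \<le> t" for j using small[of 1 j] that coef by simp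
    have sC: "C * e ^ w \<le> e ^ qN" using coef t_ge by (intro small) auto
    have lip: "N (- F x \<star> F y) \<le> C * max (G.hdist x y) \<kappa>" for x y
      using F by (simp add: coarse_lip_def)
    have F0: "F 0 = 0" using F by (simp add: coarse_lip_def)
    have \<kappa>1: "\<kappa> \<le> 1" using \<kappa>(2) s1[of 1] t_ge e by (simp add: ew)
    have \<kappa>'1: "\<kappa>' \<le> 1" using \<kappa>(3) s1[of 1] t_ge e by (simp add: ew)
    have FB: "norm (F y) \<le> C2" if "G.hnorm y \<le> r'" for y
    proof -
      have "N (F y) \<le> C * max (G.hnorm y) \<kappa>" using lip[of 0 y] by (simp add: F0)
      also have "\<dots> \<le> C * r'" using that \<kappa>1 r' C by (intro mult_left_mono) auto
      finally show ?thesis using B(2) by (auto simp: C2_def le_max_iff_disj)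
    qed
    obtain x0 where x0: "G.hdist 0 x0 \<le> \<kappa>'" "\<And>v. v \<in> grid_vectors n \<Longrightarrow> straight k \<theta> F x0 v"
      using S \<rho> unfolding straight_nearby_def by (metis G.hnorm_zero order_trans zero_le_one)
    have hx0: "G.hnorm x0 \<le> r" using x0(1) \<kappa>'1 r2 by simp
    define s where "s v = hcomp (F (x0 \<cdot> v)) - hcomp (F x0)" for v
    have sl: "s v \<in> layer H 1" for v
      unfolding s_def by (intro subspace_diff[OF H.layer_subspace] H.component_in_layer)
    have incr: "norm (hcomp (F (x \<cdot> v)) - hcomp (F x)) \<le> C * M" if v: "v \<in> grid_vectors n" for x v
    proof -
      have "norm (hcomp (F (x \<cdot> v)) - hcomp (F x)) \<le> N (- F x \<star> F (x \<cdot> v))"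
        using horizontal_le[of "F x" "F (x \<cdot> v)"] by (simp add: norm_minus_commute)
      also have "\<dots> \<le> C * max (G.hnorm v) \<kappa>" using lip[of x "x \<cdot> v"] by simp
      also have "\<dots> \<le> C * M" using M[OF ] v \<kappa>1 C by (intro mult_left_mono) (auto intro: order_trans)
      finally show ?thesis .
    qed
    have sC2: "norm (s v) \<le> C2" if "v \<in> grid_vectors n" for v
      using incr[OF that, of x0] by (auto simp: s_def C2_def)
    have main: "norm (F (x \<cdot> v) - F x \<star> s v) \<le> d" if v: "v \<in> grid_vectors n" and x: "G.hnorm x \<le> \<rho>" for v x
    proof -
      have vv: "v \<in> layer G 1" "norm v \<le> M" "G.hnorm v \<le> M" using M(2)[OF v] by auto
      obtain x' where x': "G.hdist x x' \<le> \<kappa>'" "straight k \<theta> F x' v"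
        using S x v unfolding straight_nearby_def by blast
      have "G.hnorm x' \<le> D * (G.hnorm x + G.hdist x x')" using D(2)[of x "- x \<cdot> x'"] by simp
      also have "\<dots> \<le> r" unfolding r_def using x x'(1) \<kappa>'1 D(1) by (intro mult_left_mono add_mono) auto
      finally have hx': "G.hnorm x' \<le> r" .
      have step: "G.hnorm (a \<cdot> v) \<le> r'" if "G.hnorm a \<le> r" for a
      proof -
        have "G.hnorm (a \<cdot> v) \<le> D * (G.hnorm a + G.hnorm v)" by (rule D(2))
        also have "\<dots> \<le> r'" unfolding r'_def using that vv D(1) by (intro mult_left_mono add_mono) auto
        finally show ?thesis .
      qed
      have hx: "G.hnorm x \<le> r" using x r by linarith
      \<comment> \<open>\<open>x0\<close> is a fixed straight point near the origin, with which all others are compared\<close>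
      define z where "z = - x' \<cdot> x0"
      have "G.hnorm z \<le> D * (G.hnorm x' + G.hnorm x0)" using D(2)[of "- x'" x0] by (simp add: z_def)
      also have "\<dots> \<le> D * (r' + r')" using hx' hx0 r' D(1) by (intro mult_left_mono add_mono) auto
      finally have hz: "G.hnorm z \<le> 2 * D * r'" by simp
      have "(1 / 2 ^ k) * G.hnorm z \<le> e ^ w * (2 * D * r')"
        using k hz pos G.hnorm_nonneg[of z] by (intro mult_mono) (auto simp: ew)
      then have z1: "(1 / 2 ^ k) * G.hnorm z \<le> e ^ j" if "j \<le> t" for j
        using small[of "2 * D * r'" j] that coef by (simp add: mult.commute)
      have "G.hnorm (dilation G (1 / 2 ^ k) z) \<le> e ^ qc" using z1[of qc] t_ge by (simp add: G.hnorm_dilation)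
      then have conj: "G.hnorm (- v \<cdot> (dilation G (1 / 2 ^ k) z \<cdot> v)) \<le> e"
        using qc(2) e vv by blast
      have "norm ((hcomp (F (x' \<cdot> v)) - hcomp (F x')) - s v) \<le> 2 * (real k * \<theta>) +
          C * (G.hnorm (- v \<cdot> (dilation G (1 / 2 ^ k) z \<cdot> v)) + (1 / 2 ^ k) * G.hnorm z + 2 * \<kappa>)"
        unfolding s_def z_def using slope_compare[OF F _ \<kappa>(1) x'(2) x0(2)[OF v] vv(1)] C by simp
      also have "\<dots> \<le> 2 * e + C * (e + e + 2 * e)"
        using conj z1[of 1] t_ge \<theta>(1) \<kappa>(2) s1[of 1] C
        by (intro add_mono mult_left_mono) (auto simp: ew)
      also have "\<dots> = K1 * e" by (simp add: K1_def algebra_simps)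
      finally have slope: "norm ((hcomp (F (x' \<cdot> v)) - hcomp (F x')) - s v) \<le> K1 * e" .
      define y where "y = - F x' \<star> F (x' \<cdot> v)"
      have hy: "hcomp y = hcomp (F (x' \<cdot> v)) - hcomp (F x')"
        using H.component1_mult[of "- F x'" "F (x' \<cdot> v)"] by (simp add: y_def H.component_neg)
      have "N y \<le> C * max (G.hnorm v) \<kappa>" using lip[of x' "x' \<cdot> v"] by (simp add: y_def)
      also have "\<dots> \<le> C * r'" using vv \<kappa>1 r' C by (intro mult_left_mono) auto
      finally have yB: "norm y \<le> C2" using B(2) by (auto simp: C2_def le_max_iff_disj)
      have yh: "norm (hcomp y) \<le> C2" using incr[OF v, of x'] unfolding hy C2_def by linarith
      have "N (- hcomp y \<star> y) \<le> \<theta>"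
        using x'(2) by (simp add: straight_def nonhorizontality_def H.hom_dist_eq y_def)
      also have "\<dots> \<le> e ^ qN" using \<theta>(2) s1[of qN] t_ge by (simp add: ew)
      finally have "norm (hcomp y - y) \<le> e"
        using qN(2) e yh by blast
      then have "norm (y - s v) \<le> e + K1 * e"
        using slope norm_triangle_ineq4[of "hcomp y - s v" "hcomp y - y"] unfolding hy[symmetric] by simp
      then have "L * (norm (F x' - F x') + norm (y - s v)) \<le> L * (e + K1 * e)"
        using L(1) by (intro mult_left_mono) auto
      moreover have "norm (F x' \<star> y - F x' \<star> s v) \<le> L * (norm (F x' - F x') + norm (y - s v))"
        using FB[of x'] hx' r' yB sC2[OF v] by (intro L(2)) auto
      ultimately have 1: "norm (F (x' \<cdot> v) - F x' \<star> s v) \<le> L * (1 + K1) * e"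
        by (simp add: y_def algebra_simps)
      \<comment> \<open>\<open>x'\<close> is straight, but \<open>x\<close> is only near to it; \<open>F\<close> is Lipschitz above the scale \<open>\<kappa>\<close>\<close>
      have C\<kappa>: "C * \<kappa> \<le> e ^ qN"
        using mult_left_mono[OF \<kappa>(2), of C] coef sC by (simp add: ew)
      have "N (- F x \<star> F x') \<le> C * max (G.hdist x x') \<kappa>" by (rule lip)
      also have "\<dots> \<le> C * e ^ w" using x'(1) \<kappa> C by (intro mult_left_mono) (auto simp: ew)
      also have "\<dots> \<le> e ^ qN" by (rule sC)
      finally have 2: "norm (F x - F x') \<le> e" using qN(2) e FB[of x] hx r' by auto
      have "G.hdist x x' \<le> (e ^ m) ^ qc"
        using x'(1) \<kappa>(3) s1[OF t_ge(4)] unfolding ew power_mult[symmetric] by linarith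
      then have "G.hnorm (- v \<cdot> ((- x \<cdot> x') \<cdot> v)) \<le> e ^ m"
        using power_small_range[OF e, of m] m(1) qN(1) vv by (intro qc(2)) auto
      then have "G.hnorm (- (x \<cdot> v) \<cdot> (x' \<cdot> v)) \<le> e ^ m" by (simp add: G.neg_mult G.mult_assoc)
      then have "C * max (G.hnorm (- (x \<cdot> v) \<cdot> (x' \<cdot> v))) \<kappa> \<le> e ^ qN"
        using C\<kappa> order_trans[OF mult_left_mono[OF _ coef(2)] m(2)[OF conjI[OF e]]] by (simp add: max_def)
      with lip have "N (- F (x \<cdot> v) \<star> F (x' \<cdot> v)) \<le> e ^ qN" by (rule order_trans)
      then have 3: "norm (F (x \<cdot> v) - F (x' \<cdot> v)) \<le> e"
        using qN(2) e FB[OF step[OF hx]] by blast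
      have 4: "norm (F x' \<star> s v - F x \<star> s v) \<le> L * e"
      proof -
        have "norm (F x' \<star> s v - F x \<star> s v) \<le> L * (norm (F x' - F x) + norm (s v - s v))"
          using FB[of x'] FB[of x] hx hx' r' sC2[OF v] by (intro L(2)) auto
        also have "\<dots> \<le> L * e" using 2 L(1) by (intro mult_left_mono) (auto simp: norm_minus_commute)
        finally show ?thesis .
      qed
      have "F (x \<cdot> v) - F x \<star> s v = (F (x \<cdot> v) - F (x' \<cdot> v)) +
          (F (x' \<cdot> v) - F x' \<star> s v) + (F x' \<star> s v - F x \<star> s v)" by simp
      then have "norm (F (x \<cdot> v) - F x \<star> s v) \<le> norm (F (x \<cdot> v) - F (x' \<cdot> v)) +
          norm (F (x' \<cdot> v) - F x' \<star> s v) + norm (F x' \<star> s v - F x \<star> s v)"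
        by (simp only: norm_add3)
      also have "\<dots> \<le> (1 + L * (1 + K1) + L) * e" using 1 3 4 by (simp add: algebra_simps)
      also have "\<dots> \<le> d" using p(2)[of d] d by (simp add: e_def)
      finally show ?thesis .
    qed
    show ?thesis
    proof (intro exI[of _ s] ballI conjI allI impI)
      fix x assume "G.hnorm x \<le> \<rho>"
      then show "norm (F x) \<le> C2" using r r' by (intro FB) linarith
    qed (use sl sC2 main in auto)
  qed
  moreover have "1 \<le> p * w" using p(1) w(1) by (simp add: t_def)
  moreover have "1 \<le> C2" by (simp add: C2_def)
  ultimately show ?thesis by (intro exI[of _ "p * w"] conjI exI[of _ C2]) blast+
qed

lemma grid_vectorsI: "l \<in> {- int n..int n} \<Longrightarrow> b \<in> G.hbasis \<Longrightarrow> (of_int l / real n) *\<^sub>R b \<in> grid_vectors n"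
  unfolding grid_vectors_def by blast

text \<open>The steps along multiples of one basis vector are nearly proportional, because a long step can also be
  performed as a sequence of short ones.\<close>

lemma slopes_linear:
  assumes n: "1 \<le> n" and b: "b \<in> G.hbasis" and K: "\<And>y. norm (hcomp y) \<le> K * norm y" "0 \<le> K"
    and grid: "\<And>v. v \<in> grid_vectors n \<Longrightarrow> G.hnorm v \<le> \<rho>"
    and s: "\<And>v. v \<in> grid_vectors n \<Longrightarrow> s v \<in> layer H 1"
    and step: "\<And>v x. v \<in> grid_vectors n \<Longrightarrow> G.hnorm x \<le> \<rho> \<Longrightarrow> norm (F (x \<cdot> v) - F x \<star> s v) \<le> d"
    and l: "l \<in> {- int n..int n}"
  shows "norm (s ((of_int l / real n) *\<^sub>R b) - of_int l *\<^sub>R s ((1 / real n) *\<^sub>R b)) \<le> 2 * real n * (K * d)"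
proof -
  define g where "g l = (of_int l / real n) *\<^sub>R b" for l :: int
  define f where "f l = hcomp (F (g l))" for l
  define s1 where "s1 = s ((1 / real n) *\<^sub>R b)"
  have g: "g l \<in> grid_vectors n" if "l \<in> {- int n..int n}" for l
    unfolding g_def using that b by (rule grid_vectorsI)
  have g1: "(1 / real n) *\<^sub>R b = g 1" by (simp add: g_def)
  have incr: "norm (hcomp (F (x \<cdot> v)) - hcomp (F x) - s v) \<le> K * d"
    if v: "v \<in> grid_vectors n" and x: "G.hnorm x \<le> \<rho>" for x v
  proof -
    have "hcomp (s v) = s v" using s[OF v] by (simp add: H.component_layer)
    then have "hcomp (F (x \<cdot> v)) - hcomp (F x) - s v = hcomp (F (x \<cdot> v) - F x \<star> s v)"
      unfolding H.component_diff H.component1_mult by simp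
    also have "norm \<dots> \<le> K * d" using K(1) step[OF v x] K(2) by (meson mult_left_mono order_trans)
    finally show ?thesis .
  qed
  have Kd: "0 \<le> K * d" using incr[OF g[of 0], of 0] grid[OF g[of 0]] norm_ge_zero order_trans
    by (metis G.hnorm_zero atLeastAtMost_iff g_def neg_le_0_iff_le of_int_0 of_nat_0_le_iff scaleR_zero_left div_0)
  have run: "norm (f (l + int m) - f l - real m *\<^sub>R s1) \<le> real m * (K * d)"
    if "- int n \<le> l" "l + int m \<le> int n" for l m
    using that
  proof (induction m)
    case (Suc m)
    have "g (l + int m) \<cdot> g 1 = g (l + int (Suc m))"
      using n by (simp add: g_def G.mult_multiples add_divide_distrib)
    moreover have "g 1 \<in> grid_vectors n" "g (l + int m) \<in> grid_vectors n" using n Suc.prems by (auto intro!: g)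
    ultimately have "norm (f (l + int (Suc m)) - f (l + int m) - s1) \<le> K * d"
      using incr[of "g 1" "g (l + int m)"] grid by (simp add: f_def s1_def g1)
    moreover have "norm (f (l + int m) - f l - real m *\<^sub>R s1) \<le> real m * (K * d)"
      using Suc by simp
    ultimately have "norm ((f (l + int (Suc m)) - f (l + int m) - s1) + (f (l + int m) - f l - real m *\<^sub>R s1))
        \<le> K * d + real m * (K * d)" by (intro order_trans[OF norm_triangle_ineq] add_mono)
    then show ?case by (simp add: algebra_simps)
  qed simp
  have f0: "norm (f l - f 0 - s (g l)) \<le> K * d"
    using incr[OF g[OF l], of 0] grid[OF g[of 0]] by (simp add: f_def g_def)
  have "norm (f l - f 0 - of_int l *\<^sub>R s1) \<le> real n * (K * d)"
  proof (cases "0 \<le> l")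
    case True
    have "norm (f l - f 0 - of_int l *\<^sub>R s1) \<le> real (nat l) * (K * d)"
      using run[of 0 "nat l"] True l by simp
    also have "\<dots> \<le> real n * (K * d)" using True l Kd by (intro mult_right_mono) auto
    finally show ?thesis .
  next
    case False
    have "norm (f 0 - f l - real (nat (- l)) *\<^sub>R s1) \<le> real (nat (- l)) * (K * d)"
      using run[of l "nat (- l)"] False l by simp
    also have "\<dots> \<le> real n * (K * d)" using False l Kd by (intro mult_right_mono) auto
    also have "f 0 - f l - real (nat (- l)) *\<^sub>R s1 = - (f l - f 0 - of_int l *\<^sub>R s1)" using False by simp
    finally show ?thesis by (simp only: norm_minus_cancel)
  qed
  with f0 have "norm ((f l - f 0 - of_int l *\<^sub>R s1) - (f l - f 0 - s (g l))) \<le> real n * (K * d) + K * d"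
    using norm_triangle_ineq4[of "f l - f 0 - of_int l *\<^sub>R s1" "f l - f 0 - s (g l)"] by linarith
  also have "\<dots> \<le> 2 * real n * (K * d)" using n Kd mult_right_mono[of 1 "real n" "K * d"] by (simp add: algebra_simps)
  finally show ?thesis by (simp add: g_def s1_def)
qed

text \<open>The error of one step is multiplied by the Lipschitz constant of the product in each later step; as the length
  of the words is bounded, this is harmless.\<close>

lemma grid_word_chain:
  assumes n: "1 \<le> n"
    and L: "\<And>x y x' y'. norm x \<le> B \<and> norm y \<le> B \<and> norm x' \<le> B \<and> norm y' \<le> B \<Longrightarrow>
      norm (x \<star> y - x' \<star> y') \<le> L * (norm (x - x') + norm (y - y'))" "0 \<le> L"
    and F0: "F 0 = 0" and d: "0 \<le> d"
    and step: "\<And>l b x. l \<in> {- int n..int n} \<Longrightarrow> b \<in> G.hbasis \<Longrightarrow> G.hnorm x \<le> \<rho> \<Longrightarrow>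
      norm (F (x \<cdot> ((of_int l / real n) *\<^sub>R b)) - F x \<star> ((of_int l / real n) *\<^sub>R a b)) \<le> d"
    and FB: "\<And>x. G.hnorm x \<le> \<rho> \<Longrightarrow> norm (F x) \<le> B" and aB: "\<And>b. b \<in> G.hbasis \<Longrightarrow> norm (a b) \<le> B"
    and wB: "\<And>ws. ws \<in> words G.hbasis m 1 \<Longrightarrow> norm (H.wprod a ws) \<le> B"
    and w\<rho>: "\<And>ws. ws \<in> words G.hbasis m 1 \<Longrightarrow> G.hnorm (gword ws) \<le> \<rho>"
    and ws: "ws \<in> grid_words n G.hbasis m"
  shows "norm (F (gword ws) - H.wprod a ws) \<le> (2 + L) ^ m * d"
proof -
  have "norm (F (gword ws) - H.wprod a ws) \<le> (2 + L) ^ length ws * d"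
    if "ws \<in> grid_words n G.hbasis m" for ws
    using that
  proof (induction ws rule: rev_induct)
    case (snoc w ws)
    obtain t b where w: "w = (t, b)" by (cases w)
    have "(t, b) \<in> (\<lambda>l. of_int l / real n) ` {- int n..int n} \<times> G.hbasis"
      using snoc.prems unfolding grid_words_def w by simp
    then obtain l where l: "t = of_int l / real n" "l \<in> {- int n..int n}" and b: "b \<in> G.hbasis" by blast
    have ws: "ws \<in> grid_words n G.hbasis m" using snoc.prems by (auto simp: grid_words_def)
    then have ws1: "ws \<in> words G.hbasis m 1" using grid_words_subset[OF n] by blast
    let ?x = "gword ws" and ?y = "H.wprod a ws"
    have "\<bar>t\<bar> \<le> 1" using l n by (simp add: abs_le_iff divide_le_eq le_divide_eq)
    then have tB: "norm (t *\<^sub>R a b) \<le> B"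
      using mult_mono[of "\<bar>t\<bar>" 1 "norm (a b)" B] aB[OF b] by simp
    have "norm (F ?x \<star> (t *\<^sub>R a b) - ?y \<star> (t *\<^sub>R a b)) \<le> L * (norm (F ?x - ?y) + norm (t *\<^sub>R a b - t *\<^sub>R a b))"
      using FB[OF w\<rho>[OF ws1]] wB[OF ws1] tB by (intro L(1)) simp
    also have "\<dots> \<le> L * ((2 + L) ^ length ws * d)" using snoc.IH[OF ws] L(2) by (intro mult_left_mono) auto
    finally have 1: "norm (F ?x \<star> (t *\<^sub>R a b) - ?y \<star> (t *\<^sub>R a b)) \<le> L * ((2 + L) ^ length ws * d)" .
    have 2: "norm (F (?x \<cdot> (t *\<^sub>R b)) - F ?x \<star> (t *\<^sub>R a b)) \<le> d"
      using step[OF l(2) b w\<rho>[OF ws1]] by (simp add: l(1))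
    have "1 * d \<le> (2 + L) ^ length ws * d" using L(2) d by (intro mult_right_mono one_le_power) auto
    then have "d + L * ((2 + L) ^ length ws * d) \<le> (2 + L) ^ length (ws @ [w]) * d"
      using L(2) d by (simp add: algebra_simps)
    then have "norm ((F (?x \<cdot> (t *\<^sub>R b)) - F ?x \<star> (t *\<^sub>R a b)) + (F ?x \<star> (t *\<^sub>R a b) - ?y \<star> (t *\<^sub>R a b)))
        \<le> (2 + L) ^ length (ws @ [w]) * d"
      using order_trans[OF norm_triangle_ineq add_mono[OF 2 1]] by linarith
    then show ?case by (simp add: w G.wprod_append H.wprod_append)
  qed (use F0 d in simp)
  from this[OF ws] have "norm (F (gword ws) - H.wprod a ws) \<le> (2 + L) ^ length ws * d" .
  also have "\<dots> \<le> (2 + L) ^ m * d"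
    using L(2) d ws by (intro mult_right_mono power_increasing) (auto simp: grid_words_def)
  finally show ?thesis .
qed

text \<open>The increments along basis vectors define an assignment of the letters.  It nearly respects every relator,
  since a relator returns to the origin; moving it to an exact assignment gives the homomorphism.\<close>

theorem rigidity:
  assumes C: "1 \<le> C"
  shows "\<exists>\<rho>0>0. \<exists>\<rho>\<ge>1. \<exists>p\<ge>1. \<exists>q\<ge>1. \<forall>d n k \<theta> \<kappa> \<kappa>' F.
     0 < d \<and> d \<le> 1/2 \<and> 1 \<le> real n * d ^ p \<and> real n * d ^ (p + 1) \<le> 1 \<and>
     0 \<le> \<kappa> \<and> \<kappa> \<le> d ^ q \<and> \<kappa>' \<le> d ^ q \<and> 1 / 2 ^ k \<le> d ^ q \<and> real k * \<theta> \<le> d ^ q \<and> \<theta> \<le> d ^ q \<and>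
     coarse_lip C \<kappa> F \<and> straight_nearby n k \<theta> \<kappa>' \<rho> F \<longrightarrow>
     (\<exists>T\<in>lipschitz_homs G H N. \<forall>x. G.hnorm x \<le> \<rho>0 \<longrightarrow> N (- T x \<star> F x) \<le> d)"
proof -
  obtain n0 CW where CW: "0 \<le> CW" "\<And>x. \<exists>ws\<in>words G.hbasis n0 (CW * G.hnorm x). gword ws = x"
    using G.horizontal_words_reach by blast
  define m where "m = 3 * n0"
  obtain A where A: "A \<ge> 0" "\<And>\<tau> ws. \<tau> \<ge> 0 \<Longrightarrow> ws \<in> words G.hbasis m \<tau> \<Longrightarrow> G.hnorm (gword ws) \<le> A * \<tau>"
    using G.hnorm_wprod_bound[of m] by blast
  obtain M where M: "M \<ge> 1" "\<And>n v. v \<in> grid_vectors n \<Longrightarrow> v \<in> layer G 1 \<and> norm v \<le> M \<and> G.hnorm v \<le> M"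
    using grid_vectors_bound by blast
  have Mb: "norm b \<le> M" if "b \<in> G.hbasis" for b
    using M(2)[OF grid_vectorsI[of 1 1 b]] that by simp
  define \<rho> where "\<rho> = max A M"
  have \<rho>: "1 \<le> \<rho>" using M(1) by (simp add: \<rho>_def)
  obtain q1 C2 where q1: "q1 \<ge> 1" and C2: "C2 \<ge> 1" and one: "\<And>d n k \<theta> \<kappa> \<kappa>' F.
     0 < d \<and> d \<le> 1/2 \<and> 0 \<le> \<kappa> \<and> \<kappa> \<le> d ^ q1 \<and> \<kappa>' \<le> d ^ q1 \<and> 1 / 2 ^ k \<le> d ^ q1 \<and>
     real k * \<theta> \<le> d ^ q1 \<and> \<theta> \<le> d ^ q1 \<and> coarse_lip C \<kappa> F \<and> straight_nearby n k \<theta> \<kappa>' \<rho> F \<Longrightarrow>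
     (\<exists>s. \<forall>v\<in>grid_vectors n. s v \<in> layer H 1 \<and> norm (s v) \<le> C2 \<and>
        (\<forall>x. G.hnorm x \<le> \<rho> \<longrightarrow> norm (F x) \<le> C2 \<and> norm (F (x \<cdot> v) - F x \<star> s v) \<le> d))"
    using one_step[OF C \<rho>] by blast
  obtain K where K: "K \<ge> 0" "\<And>y. norm (hcomp y) \<le> K * norm y" using H.component_bound by blast
  obtain C3 where C3: "C3 \<ge> 1" and wlip: "\<And>(a :: 'a \<Rightarrow> 'b) a' ws ws' \<eta>.
     ws \<in> words G.hbasis m 1 \<and> ws' \<in> words G.hbasis m 1 \<and> nearby_words \<eta> ws ws' \<and> 0 \<le> \<eta> \<and>
     (\<forall>e\<in>G.hbasis. norm (a e) \<le> C2 + 1 \<and> norm (a' e) \<le> C2 + 1 \<and> norm (a e - a' e) \<le> \<eta>) \<Longrightarrow>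
     norm (H.wprod a ws) \<le> C3 \<and> norm (H.wprod a' ws') \<le> C3 \<and> norm (H.wprod a ws - H.wprod a' ws') \<le> C3 * \<eta>"
    using H.wprod_lipschitz[of G.hbasis m "C2 + 1"] by blast
  obtain CG where CG: "CG \<ge> 1" and glip: "\<And>a a' ws ws' \<eta>.
     ws \<in> words G.hbasis m 1 \<and> ws' \<in> words G.hbasis m 1 \<and> nearby_words \<eta> ws ws' \<and> 0 \<le> \<eta> \<and>
     (\<forall>e\<in>G.hbasis. norm (a e) \<le> M \<and> norm (a' e) \<le> M \<and> norm (a e - a' e) \<le> \<eta>) \<Longrightarrow>
     norm (G.wprod a ws) \<le> CG \<and> norm (G.wprod a' ws') \<le> CG \<and> norm (G.wprod a ws - G.wprod a' ws') \<le> CG * \<eta>"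
    using G.wprod_lipschitz[of G.hbasis m M] by blast
  have nearby_refl: "nearby_words \<eta> ws ws" if "0 \<le> \<eta>" for \<eta> and ws :: "(real \<times> 'a) list"
    using that by (auto simp: nearby_words_def list_all2_same)
  define B where "B = max C3 (C2 + 1)"
  obtain L where L: "L \<ge> 0" "\<And>x y x' y'. norm x \<le> B \<and> norm y \<le> B \<and> norm x' \<le> B \<and> norm y' \<le> B \<Longrightarrow>
     norm (x \<star> y - x' \<star> y') \<le> L * (norm (x - x') + norm (y - y'))"
    using H.mult_lipschitz[of B] by blast
  obtain CL where CL: "CL \<ge> 1" and llip: "\<And>s s' \<eta> b. b \<in> G.hbasis \<and> (\<forall>i\<in>params. \<bar>s i - s' i\<bar> \<le> \<eta>) \<Longrightarrow>
      norm (letter s b - letter s' b) \<le> CL * \<eta>"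
    using letter_lipschitz by blast
  obtain qA where approx: "\<And>d s. 0 < d \<and> d \<le> 1/2 \<and> (\<forall>i\<in>params. \<bar>s i\<bar> \<le> C2 + 1) \<and>
      (\<forall>ws\<in>relators m. norm (H.wprod (letter s) ws) \<le> d ^ qA) \<Longrightarrow>
    (\<exists>s'. (\<forall>ws\<in>relators m. H.wprod (letter s') ws = 0) \<and> (\<forall>i\<in>params. \<bar>s i - s' i\<bar> \<le> d))"
    using approximate_relations[of "C2 + 1" m] by blast
  obtain qF where qF: "qF \<ge> 1" "\<And>d x y. 0 < d \<and> d \<le> 1/2 \<and> norm x \<le> B \<and> norm y \<le> B \<and> norm (x - y) \<le> d ^ qF \<Longrightarrow>
     N (- x \<star> y) \<le> d" using H.N_dist_small_if_norm[of B] by blast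
  obtain qE where qE: "qE \<ge> 1" "\<And>d x y. 0 < d \<and> d \<le> 1/2 \<and> norm x \<le> CG \<and> norm y \<le> CG \<and> norm (x - y) \<le> d ^ qE \<Longrightarrow>
     G.hdist x y \<le> d"
    using normed_carnot_group.N_dist_small_if_norm[OF G.normed_hnorm, of CG] by blast
  obtain qN where qN: "qN \<ge> 1" "\<And>d x y. 0 < d \<and> d \<le> 1/2 \<and> norm x \<le> B \<and> N (- x \<star> y) \<le> d ^ qN \<Longrightarrow> norm (x - y) \<le> d"
    using H.norm_dist_small_if_N[of B] by blast
  obtain r2 where r2: "r2 \<ge> qF" "\<And>d. 0 < d \<and> d \<le> 1/2 \<Longrightarrow> (2 * C3 * CL) * d ^ r2 \<le> d ^ qF"
    using absorb_constant[of qF "2 * C3 * CL"] by blast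
  obtain r where r: "r \<ge> r2 * qA + qF" "\<And>d. 0 < d \<and> d \<le> 1/2 \<Longrightarrow> (2 * (C3 + 2)) * d ^ r \<le> d ^ (r2 * qA + qF)"
    using absorb_constant[of "r2 * qA + qF" "2 * (C3 + 2)"] by blast
  obtain j where j: "j \<ge> qN" "\<And>d. 0 < d \<and> d \<le> 1/2 \<Longrightarrow> C * d ^ j \<le> d ^ qN"
    using absorb_constant[of qN C] by blast
  obtain p where p: "p \<ge> r * (j * qE)" "\<And>d. 0 < d \<and> d \<le> 1/2 \<Longrightarrow> CG * d ^ p \<le> d ^ (r * (j * qE))"
    using absorb_constant[of "r * (j * qE)" CG] by blast
  define Ku where "Ku = (2 + L) ^ m * (1 + L * (2 * K)) + 4 * K"
  obtain u' where u': "u' \<ge> r" "\<And>d. 0 < d \<and> d \<le> 1/2 \<Longrightarrow> Ku * d ^ u' \<le> d ^ r"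
    using absorb_constant[of r Ku] by blast
  \<comment> \<open>the exponents, from the last step backwards: \<open>r2\<close> for the exact assignment, \<open>r\<close> for the words that almost are
    relations, \<open>p\<close> for the fineness of the grid, \<open>u\<close> for single steps, which are repeated up to \<open>n \<le> 1 / d ^ (p + 1)\<close> times\<close>
  define u where "u = p + 1 + u'"
  define q where "q = u * q1 + r * j"
  define \<rho>0 where "\<rho>0 = 1 / (CW + 1)"
  have r1: "r \<ge> 1" using r(1) qF(1) by linarith
  have j1: "j \<ge> 1" using j(1) qN(1) by linarith
  have rj: "r \<le> p" using p(1) r1 j1 qE(1)
    by (metis dual_order.trans mult_le_mono mult.right_neutral order_refl nat_mult_1_right)
  have "\<exists>T\<in>lipschitz_homs G H N. \<forall>x. G.hnorm x \<le> \<rho>0 \<longrightarrow> N (- T x \<star> F x) \<le> d"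
    if d: "0 < d" "d \<le> 1/2" and n: "1 \<le> real n * d ^ p" "real n * d ^ (p + 1) \<le> 1"
      and \<kappa>: "0 \<le> \<kappa>" "\<kappa> \<le> d ^ q" "\<kappa>' \<le> d ^ q" and k: "1 / 2 ^ k \<le> d ^ q"
      and \<theta>: "real k * \<theta> \<le> d ^ q" "\<theta> \<le> d ^ q"
      and F: "coarse_lip C \<kappa> F" and S: "straight_nearby n k \<theta> \<kappa>' \<rho> F" for d n k \<theta> \<kappa> \<kappa>' F
  proof -
    have n1: "1 \<le> n" using n(1) by (cases n) auto
    have lip: "N (- F x \<star> F y) \<le> C * max (G.hdist x y) \<kappa>" and F0: "F 0 = 0" for x y
      using F by (simp_all add: coarse_lip_def)
    have u1: "1 \<le> u" by (simp add: u_def)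
    note du = power_small_range[OF d u1]
    have dq: "d ^ q \<le> (d ^ u) ^ q1"
      unfolding power_mult[symmetric] by (rule power_small_mono[OF d]) (simp add: q_def)
    have "\<exists>s. \<forall>v\<in>grid_vectors n. s v \<in> layer H 1 \<and> norm (s v) \<le> C2 \<and>
        (\<forall>x. G.hnorm x \<le> \<rho> \<longrightarrow> norm (F x) \<le> C2 \<and> norm (F (x \<cdot> v) - F x \<star> s v) \<le> d ^ u)"
      by (rule one[of "d ^ u" \<kappa> \<kappa>' k \<theta> F n])
        (intro conjI du F S \<kappa>(1) order_trans[OF \<kappa>(2) dq] order_trans[OF \<kappa>(3) dq] order_trans[OF k dq]
          order_trans[OF \<theta>(1) dq] order_trans[OF \<theta>(2) dq])
    then obtain s where s: "\<forall>v\<in>grid_vectors n. s v \<in> layer H 1 \<and> norm (s v) \<le> C2 \<and>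
        (\<forall>x. G.hnorm x \<le> \<rho> \<longrightarrow> norm (F x) \<le> C2 \<and> norm (F (x \<cdot> v) - F x \<star> s v) \<le> d ^ u)" by blast
    have FB: "norm (F x) \<le> C2" if "G.hnorm x \<le> \<rho>" for x
    proof (cases "G.hbasis = {}")
      case True
      then have "x = 0" using CW(2)[of x] by (auto simp: words_def)
      then show ?thesis using F0 C2 by simp
    next
      case False
      then show ?thesis using s that grid_vectorsI[of 0 n] by fastforce
    qed
    define a where "a b = real n *\<^sub>R s ((1 / real n) *\<^sub>R b)" for b
    have nu: "real n * d ^ u \<le> d ^ u'"
    proof -
      have "real n * d ^ u = (real n * d ^ (p + 1)) * d ^ u'" by (simp only: u_def power_add mult.assoc)
      also have "\<dots> \<le> 1 * d ^ u'" using n(2) d by (intro mult_right_mono) auto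
      finally show ?thesis by simp
    qed
    have du': "0 < d ^ u'" using d by simp
    have slope: "norm (s ((of_int l / real n) *\<^sub>R b) - (of_int l / real n) *\<^sub>R a b) \<le> 2 * K * (real n * d ^ u)"
      if "l \<in> {- int n..int n}" "b \<in> G.hbasis" for l b
    proof -
      have "norm (s ((of_int l / real n) *\<^sub>R b) - of_int l *\<^sub>R s ((1 / real n) *\<^sub>R b)) \<le> 2 * real n * (K * d ^ u)"
        using s M(2) by (intro slopes_linear[OF n1 that(2) K(2,1) _ _ _ that(1), where \<rho> = \<rho>]) (auto simp: \<rho>_def le_max_iff_disj)
      then show ?thesis using n1 by (simp add: a_def algebra_simps)
    qed
    have K4: "4 * K * (real n * d ^ u) \<le> 1"
    proof -
      have "4 * K * (real n * d ^ u) \<le> 4 * K * d ^ u'" using nu K(1) by (intro mult_left_mono) auto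
      also have "\<dots> \<le> Ku * d ^ u'" using L(1) K(1) du' by (intro mult_right_mono) (auto simp: Ku_def)
      also have "\<dots> \<le> d ^ r" using u'(2) d by blast
      also have "\<dots> \<le> 1" using power_small_range[OF d r1] by linarith
      finally show ?thesis .
    qed
    have aB: "norm (a b) \<le> C2 + 1/2" and al: "a b \<in> layer H 1" if b: "b \<in> G.hbasis" for b
    proof -
      have "norm (s b - a b) \<le> 2 * K * (real n * d ^ u)" using slope[of "int n" b] b n1 by simp
      also have "\<dots> \<le> 1/2" using K4 by simp
      finally have "norm (s b - a b) \<le> 1/2" .
      moreover have "norm (s b) \<le> C2" using s grid_vectorsI[of "int n" n b] b n1 by simp
      ultimately show "norm (a b) \<le> C2 + 1/2" using norm_triangle_sub[of "a b" "s b"] by (simp add: norm_minus_commute)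
      have "(1 / real n) *\<^sub>R b \<in> grid_vectors n" using grid_vectorsI[of 1 n b] b n1 by simp
      then show "a b \<in> layer H 1" unfolding a_def using s by (intro subspace_scale[OF H.layer_subspace]) blast
    qed
    define e where "e = d ^ r"
    have e: "0 < e" "e \<le> 1/2" unfolding e_def using power_small_range[OF d r1] by auto
    have wB: "norm (H.wprod a ws) \<le> C3" if "ws \<in> words G.hbasis m 1" for ws
      using wlip[of ws ws 0 a a] that nearby_refl[of 0 ws] aB by force
    have step: "norm (F (x \<cdot> ((of_int l / real n) *\<^sub>R b)) - F x \<star> ((of_int l / real n) *\<^sub>R a b)) \<le> (1 + L * (2 * K)) * (real n * d ^ u)"
      if l: "l \<in> {- int n..int n}" and b: "b \<in> G.hbasis" and x: "G.hnorm x \<le> \<rho>" for l b x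
    proof -
      define v w where "v = (of_int l / real n) *\<^sub>R b" and "w = (of_int l / real n) *\<^sub>R a b"
      have v: "v \<in> grid_vectors n" unfolding v_def using l b by (rule grid_vectorsI)
      have sw: "norm (s v - w) \<le> 2 * K * (real n * d ^ u)" using slope[OF l b] by (simp add: v_def w_def)
      have svB: "norm (s v) \<le> C2" using s v by blast
      then have "norm w \<le> C2 + 1"
        using sw K4 norm_triangle_sub[of w "s v"] by (simp add: norm_minus_commute)
      then have "norm (F x \<star> s v - F x \<star> w) \<le> L * (norm (F x - F x) + norm (s v - w))"
        using FB[OF x] svB by (intro L(2)) (auto simp: B_def)
      also have "\<dots> \<le> L * (2 * K * (real n * d ^ u))" using sw L(1) by (intro mult_left_mono) auto
      finally have 1: "norm (F x \<star> s v - F x \<star> w) \<le> L * (2 * K * (real n * d ^ u))" .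
      have "norm (F (x \<cdot> v) - F x \<star> s v) \<le> d ^ u" using s v x by blast
      also have "\<dots> \<le> real n * d ^ u" using n1 du mult_right_mono[of 1 "real n" "d ^ u"] by simp
      finally have "norm ((F (x \<cdot> v) - F x \<star> s v) + (F x \<star> s v - F x \<star> w)) \<le>
          real n * d ^ u + L * (2 * K * (real n * d ^ u))"
        using 1 by (intro order_trans[OF norm_triangle_ineq] add_mono)
      then show ?thesis by (simp add: v_def w_def algebra_simps)
    qed
    have chain: "norm (F (gword ws) - H.wprod a ws) \<le> e" if "ws \<in> grid_words n G.hbasis m" for ws
    proof -
      have "norm (F (gword ws) - H.wprod a ws) \<le> (2 + L) ^ m * ((1 + L * (2 * K)) * (real n * d ^ u))"
      proof (rule grid_word_chain[OF n1 L(2,1) F0 _ step _ _ _ _ that])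
        show "0 \<le> (1 + L * (2 * K)) * (real n * d ^ u)" using L(1) K(1) d by simp
        show "norm (F x) \<le> B" if "G.hnorm x \<le> \<rho>" for x using FB[OF that] by (simp add: B_def)
        show "norm (a b) \<le> B" if "b \<in> G.hbasis" for b using aB[OF that] by (simp add: B_def)
        show "norm (H.wprod a ws) \<le> B" if "ws \<in> words G.hbasis m 1" for ws using wB[OF that] by (simp add: B_def)
        show "G.hnorm (gword ws) \<le> \<rho>" if "ws \<in> words G.hbasis m 1" for ws using A(2)[OF _ that] by (simp add: \<rho>_def)
      qed auto
      also have "\<dots> = ((2 + L) ^ m * (1 + L * (2 * K))) * (real n * d ^ u)" by simp
      also have "\<dots> \<le> Ku * d ^ u'" using nu L(1) K(1) d by (intro mult_mono) (auto simp: Ku_def)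
      also have "\<dots> \<le> e" using u'(2) d by (simp add: e_def)
      finally show ?thesis .
    qed
    \<comment> \<open>rounding an exponent moves the endpoint of a word by at most a multiple of \<open>d ^ p\<close>, and \<open>F\<close> is Lipschitz\<close>
    have inv_n: "1 / real n \<le> d ^ p" using n(1) n1 by (simp add: field_simps)
    have inv_e: "1 / real n \<le> e" using inv_n power_small_mono[OF d rj] by (simp add: e_def)
    have close: "norm (F x - F y) \<le> e"
      if "norm x \<le> CG" "norm y \<le> CG" "norm (x - y) \<le> CG * (1 / real n)" "G.hnorm x \<le> \<rho>" for x y
    proof -
      have "norm (x - y) \<le> CG * d ^ p" using that(3) inv_n CG by (meson mult_left_mono order_trans zero_le_one)
      also have "\<dots> \<le> (e ^ j) ^ qE" using p(2)[of d] d by (simp add: e_def mult.assoc flip: power_mult)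
      finally have "G.hdist x y \<le> e ^ j"
        using qE(2) power_small_range[OF e j1] that(1,2) by blast
      moreover have "\<kappa> \<le> e ^ j"
        using \<kappa>(2) power_small_mono[OF d, of "r * j" q] by (simp add: q_def e_def flip: power_mult)
      ultimately have "C * max (G.hdist x y) \<kappa> \<le> C * e ^ j" using C by (intro mult_left_mono) auto
      also have "\<dots> \<le> e ^ qN" using j(2) e by blast
      finally have "N (- F x \<star> F y) \<le> e ^ qN" using lip order_trans by blast
      moreover have "norm (F x) \<le> B" using FB[OF that(4)] by (simp add: B_def)
      ultimately show ?thesis using qN(2) e by blast
    qed
    have round: "norm (F (gword ws) - H.wprod a ws) \<le> (C3 + 2) * e" if ws: "ws \<in> words G.hbasis m 1" for ws
    proof -
      obtain ws' where ws': "ws' \<in> grid_words n G.hbasis m" "nearby_words (1 / real n) ws ws'"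
        using round_to_grid[OF n1 ws] by blast
      have ws1: "ws' \<in> words G.hbasis m 1" using ws'(1) grid_words_subset[OF n1] by blast
      have "norm (gword ws) \<le> CG \<and> norm (gword ws') \<le> CG \<and> norm (gword ws - gword ws') \<le> CG * (1 / real n)"
        using ws ws1 ws'(2) Mb by (intro glip) auto
      then have 1: "norm (F (gword ws) - F (gword ws')) \<le> e"
        using A(2)[OF _ ws] by (intro close) (auto simp: \<rho>_def)
      have "norm (H.wprod a ws' - H.wprod a ws) \<le> C3 * (1 / real n)"
        using wlip[of ws ws' "1 / real n" a a] ws ws1 ws'(2) aB by (force simp: norm_minus_commute)
      also have "\<dots> \<le> C3 * e" using inv_e C3 by (intro mult_left_mono) auto
      finally have 2: "norm (H.wprod a ws' - H.wprod a ws) \<le> C3 * e" .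
      have "norm ((F (gword ws) - F (gword ws')) + (F (gword ws') - H.wprod a ws') + (H.wprod a ws' - H.wprod a ws))
          \<le> e + e + C3 * e"
        using 1 2 chain[OF ws'(1)] by (intro order_trans[OF norm_add3] add_mono)
      then show ?thesis by (simp add: algebra_simps)
    qed
    \<comment> \<open>the assignment \<open>a\<close> almost kills every relator, since \<open>F\<close> vanishes at the end of a closed word\<close>
    define \<sigma> where "\<sigma> = (\<lambda>(b, e). a b \<bullet> e)"
    have letter_\<sigma>: "letter \<sigma> b = a b" if "b \<in> G.hbasis" for b
      unfolding \<sigma>_def by (rule letter_coordinates[where a = a, OF al[OF that]])
    have wprod_\<sigma>: "H.wprod (letter \<sigma>) ws = H.wprod a ws" if "set ws \<subseteq> UNIV \<times> G.hbasis" for ws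
      using that by (induction ws) (auto simp: letter_\<sigma>)
    define d2 where "d2 = d ^ r2"
    have d2: "0 < d2" "d2 \<le> 1/2" unfolding d2_def using power_small_range[OF d, of r2] r2(1) qF(1) by auto
    have Ce: "2 * ((C3 + 2) * e) \<le> d ^ (r2 * qA + qF)" using r(2)[of d] d by (simp add: e_def algebra_simps)
    have "\<exists>\<sigma>'. (\<forall>ws\<in>relators m. H.wprod (letter \<sigma>') ws = 0) \<and> (\<forall>i\<in>params. \<bar>\<sigma> i - \<sigma>' i\<bar> \<le> d2)"
    proof (intro approx conjI ballI d2)
      fix i assume "i \<in> params"
      then show "\<bar>\<sigma> i\<bar> \<le> C2 + 1"
        using aB[of "fst i"] Basis_le_norm[of "snd i" "a (fst i)"] by (auto simp: \<sigma>_def split: prod.splits)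
    next
      fix ws assume "ws \<in> relators m"
      then have ws: "ws \<in> words G.hbasis m 1" "gword ws = 0" by (auto simp: relators_def)
      have "norm (H.wprod a ws) \<le> (C3 + 2) * e" using round[OF ws(1)] by (simp add: ws(2) F0)
      also have "\<dots> \<le> d ^ (r2 * qA + qF)" using Ce C3 e by (auto intro: order_trans[rotated])
      also have "\<dots> \<le> d2 ^ qA" unfolding d2_def power_mult[symmetric] by (rule power_small_mono[OF d]) simp
      finally have "norm (H.wprod a ws) \<le> d2 ^ qA" .
      moreover have "set ws \<subseteq> UNIV \<times> G.hbasis" using ws(1) by (fastforce simp: words_def)
      ultimately show "norm (H.wprod (letter \<sigma>) ws) \<le> d2 ^ qA" by (simp only: wprod_\<sigma>)
    qed
    then obtain \<sigma>' where \<sigma>': "\<forall>ws\<in>relators m. H.wprod (letter \<sigma>') ws = 0" "\<forall>i\<in>params. \<bar>\<sigma> i - \<sigma>' i\<bar> \<le> d2" by blast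
    have CLd: "C3 * (CL * d2) \<le> d ^ qF / 2" using r2(2)[of d] d by (simp add: d2_def)
    have dF: "d ^ qF \<le> 1/2" using power_small_range[OF d qF(1)] by simp
    have "1 * (CL * d2) \<le> C3 * (CL * d2)" using C3 CL d2 by (intro mult_right_mono) auto
    then have CLd1: "CL * d2 \<le> 1/2" using CLd dF by linarith
    have near: "norm (a b - letter \<sigma>' b) \<le> CL * d2" if b: "b \<in> G.hbasis" for b
      using llip[of b \<sigma> \<sigma>' d2] b \<sigma>'(2) by (simp add: letter_\<sigma>[OF b])
    have lB: "norm (letter \<sigma>' b) \<le> C2 + 1" if b: "b \<in> G.hbasis" for b
      using near[OF b] CLd1 aB[OF b] norm_triangle_sub[of "letter \<sigma>' b" "a b"] by (simp add: norm_minus_commute)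
    obtain W where W: "\<And>x. W x \<in> words G.hbasis n0 (CW * G.hnorm x)" "\<And>x. gword (W x) = x"
      using CW(2) by metis
    define T where "T x = H.wprod (letter \<sigma>') (W x)" for x
    have "T \<in> lipschitz_homs G H N"
      unfolding T_def[abs_def] using \<sigma>'(1) by (intro exact_relations_hom[OF W CW(1)]) (simp add: m_def)
    moreover have "N (- T x \<star> F x) \<le> d" if x: "G.hnorm x \<le> \<rho>0" for x
    proof -
      have "CW * G.hnorm x \<le> (CW + 1) * \<rho>0" using x CW(1) G.hnorm_nonneg[of x] by (intro mult_mono) auto
      also have "\<dots> = 1" using CW(1) by (simp add: \<rho>0_def)
      finally have Wx: "W x \<in> words G.hbasis m 1" by (intro words_mono[OF W(1)]) (simp_all add: m_def)
      have lip2: "norm (H.wprod (letter \<sigma>') (W x)) \<le> C3 \<and> norm (H.wprod a (W x)) \<le> C3 \<and>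
          norm (H.wprod (letter \<sigma>') (W x) - H.wprod a (W x)) \<le> C3 * (CL * d2)"
        using Wx nearby_refl[of "CL * d2" "W x"] lB aB near CL d2
        by (intro wlip) (force simp: norm_minus_commute)
      have Fx: "norm (F x - H.wprod a (W x)) \<le> (C3 + 2) * e" using round[OF Wx] by (simp add: W(2))
      have hx: "G.hnorm x \<le> \<rho>" using A(2)[OF _ Wx] by (simp add: W(2) \<rho>_def)
      have "norm (T x - F x) \<le> norm (T x - H.wprod a (W x)) + norm (F x - H.wprod a (W x))"
        using norm_triangle_ineq4[of "T x - H.wprod a (W x)" "F x - H.wprod a (W x)"] by simp
      also have "\<dots> \<le> C3 * (CL * d2) + (C3 + 2) * e" using lip2 Fx by (simp add: T_def)
      also have "\<dots> \<le> d ^ qF / 2 + d ^ qF / 2"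
      proof (rule add_mono[OF CLd])
        have "d ^ (r2 * qA + qF) \<le> d ^ qF" by (rule power_small_mono[OF d]) simp
        then show "(C3 + 2) * e \<le> d ^ qF / 2" using Ce by linarith
      qed
      finally have "norm (T x - F x) \<le> d ^ qF" by simp
      moreover have "norm (T x) \<le> B" "norm (F x) \<le> B" using lip2 FB[OF hx] by (auto simp: B_def T_def)
      ultimately show ?thesis using qF(2) d by blast
    qed
    ultimately show ?thesis by blast
  qed
  moreover have "0 < \<rho>0" using CW(1) by (simp add: \<rho>0_def)
  moreover have "1 \<le> p" using rj r1 by simp
  moreover have "1 \<le> q" using q1 by (simp add: q_def u_def)
  ultimately show ?thesis using \<rho> by blast
qed

end

section \<open>Telescoping the convexity inequality over dyadic scales\<close>

locale convex_target = carnot_target +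
  fixes K p :: real
  assumes K: "0 < K" and p: "1 < p"
    and convexity: "(N (- x \<star> y) powr p + N (- y \<star> z) powr p) / 2
        \<ge> (N (- x \<star> z) / 2) powr p
          + 1 / K * (norm ((1 / 2) *\<^sub>R (component H 1 x + component H 1 z) - component H 1 y) powr p
              + nonhorizontality H N (- x \<star> z) powr p)"
begin

text \<open>The two sides of the convexity inequality along a horizontal line: the \<open>p\<close>-th power of an increment, and the gain.\<close>

definition spread :: "('a \<Rightarrow> 'b) \<Rightarrow> 'a \<Rightarrow> 'a \<Rightarrow> real" where
  "spread f w x = N (- f x \<star> f (x \<cdot> w)) powr p"

definition defect :: "('a \<Rightarrow> 'b) \<Rightarrow> 'a \<Rightarrow> 'a \<Rightarrow> real" where
  "defect f w x =
     norm ((1 / 2) *\<^sub>R (hcomp (f x) + hcomp (f (x \<cdot> (2 *\<^sub>R w)))) - hcomp (f (x \<cdot> w))) powr p +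
     nonhorizontality H N (- f x \<star> f (x \<cdot> (2 *\<^sub>R w))) powr p"

lemma spread_nonneg: "0 \<le> spread f w x" and defect_nonneg: "0 \<le> defect f w x"
  by (simp_all add: spread_def defect_def)

lemma defect_le_spread:
  "spread f (2 *\<^sub>R w) x / 2 powr p + defect f w x / K \<le> (spread f w x + spread f w (x \<cdot> w)) / 2"
proof -
  have "x \<cdot> w \<cdot> w = x \<cdot> (2 *\<^sub>R w)"
    using G.mult_multiples[of 1 w 1] by (simp add: G.mult_assoc)
  then show ?thesis
    using convexity[of "f x" "f (x \<cdot> (2 *\<^sub>R w))" "f (x \<cdot> w)"] H.N_nonneg
    by (simp add: spread_def defect_def powr_divide)
qed

lemma nonhorizontality_nonneg: "0 \<le> nonhorizontality H N y"
  by (simp add: nonhorizontality_def H.hom_dist_eq H.N_nonneg)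

lemma borel_measurable_spread [measurable]:
  assumes [measurable]: "f \<in> borel_measurable borel"
  shows "spread f w \<in> borel_measurable borel"
proof -
  have [measurable]: "(\<lambda>x. f (x \<cdot> w)) \<in> borel_measurable borel"
    by (rule measurable_compose[OF G.borel_measurable_translations(2)]) simp
  have "(\<lambda>x. N (- f x \<star> f (x \<cdot> w))) \<in> borel_measurable borel"
    by (rule borel_measurable_continuous_Pair[where H = "\<lambda>x y. N (- x \<star> y)"])
      (auto intro!: continuous_intros)
  then show ?thesis unfolding spread_def[abs_def] by measurable
qed

lemma borel_measurable_defect [measurable]:
  assumes [measurable]: "f \<in> borel_measurable borel"
  shows "defect f w \<in> borel_measurable borel"
proof -
  have [measurable]: "(\<lambda>x. f (x \<cdot> w)) \<in> borel_measurable borel" for w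
    by (rule measurable_compose[OF G.borel_measurable_translations(2)]) simp
  have [measurable]: "hcomp \<in> borel_measurable borel"
    by (intro borel_measurable_continuous_onI continuous_intros)
  have [measurable]: "(\<lambda>x. nonhorizontality H N (- f x \<star> f (x \<cdot> (2 *\<^sub>R w)))) \<in> borel_measurable borel"
    unfolding nonhorizontality_def H.hom_dist_eq
    by (rule borel_measurable_continuous_Pair[where H = "\<lambda>x y. N (- hcomp (- x \<star> y) \<star> (- x \<star> y))"])
      (auto intro!: continuous_intros)
  show ?thesis unfolding defect_def[abs_def] by measurable
qed

text \<open>The one-step inequality is integrated over \<open>U\<close>; right translations preserve the measure, and
  \<open>U\<close> together with its translate is the region for the next smaller scale.  Taking the union of the two
  instead of adding their contributions keeps the constant equal to one at every scale.\<close>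

lemma telescoping_defect:
  assumes f [measurable]: "f \<in> borel_measurable borel" and U: "U \<in> sets borel"
    and W [measurable]: "W \<in> sets borel" and UW: "\<And>x l. x \<in> U \<Longrightarrow> l < 2 ^ m \<Longrightarrow> x \<cdot> (real l *\<^sub>R u) \<in> W"
  shows "(\<integral>\<^sup>+x\<in>U. ennreal (spread f (2 ^ m *\<^sub>R u) x / (2 ^ m) powr p) \<partial>lborel) +
      (\<Sum>i<m. \<integral>\<^sup>+x\<in>U. ennreal (defect f (2 ^ i *\<^sub>R u) x / (2 ^ i) powr p / K) \<partial>lborel)
    \<le> (\<integral>\<^sup>+x\<in>W. ennreal (spread f u x) \<partial>lborel)"
  using U UW
proof (induction m arbitrary: U)
  case 0
  have "U \<subseteq> W"
  proof
    fix x assume "x \<in> U"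
    then show "x \<in> W" using "0.prems"(2)[of x 0] by simp
  qed
  then show ?case by (auto intro!: nn_integral_mono split: split_indicator)
next
  case (Suc m)
  note [measurable] = Suc.prems(1)
  define w where "w = (2 ^ m :: real) *\<^sub>R u"
  define U' where "U' = {x. x \<cdot> (- w) \<in> U}"
  define V where "V = U \<union> U'"
  define D where "D i = (\<lambda>x. spread f (2 ^ i *\<^sub>R u) x / (2 ^ i) powr p)" for i :: nat
  define E where "E i = (\<lambda>x. defect f (2 ^ i *\<^sub>R u) x / (2 ^ i) powr p / K)" for i :: nat
  have [measurable]: "D i \<in> borel_measurable borel" "E i \<in> borel_measurable borel" for i
    unfolding D_def E_def by measurable
  have D0: "0 \<le> D i x" and E0: "0 \<le> E i x" for i x
    using K by (simp_all add: D_def E_def spread_nonneg defect_nonneg)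
  have [measurable]: "U' \<in> sets borel"
    using measurable_sets[OF G.borel_measurable_translations(2), of U "- w"] by (simp add: U'_def vimage_def)
  have V [measurable]: "V \<in> sets borel" by (simp add: V_def)
  have step: "D (Suc m) x + E m x \<le> (D m x + D m (x \<cdot> w)) / 2" for x
  proof -
    have "(spread f (2 *\<^sub>R w) x / 2 powr p + defect f w x / K) / (2 ^ m) powr p
        \<le> ((spread f w x + spread f w (x \<cdot> w)) / 2) / (2 ^ m) powr p"
      using defect_le_spread by (intro divide_right_mono) auto
    then show ?thesis by (simp add: D_def E_def w_def powr_mult field_simps)
  qed
  have "(\<integral>\<^sup>+x\<in>U. D (Suc m) x \<partial>lborel) + (\<integral>\<^sup>+x\<in>U. E m x \<partial>lborel) = (\<integral>\<^sup>+x\<in>U. (D (Suc m) x + E m x) \<partial>lborel)"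
    by (subst nn_integral_add[symmetric]) (auto intro!: nn_integral_cong split: split_indicator simp: D0 E0)
  also have "\<dots> \<le> (\<integral>\<^sup>+x\<in>U. (D m x + D m (x \<cdot> w)) / 2 \<partial>lborel)"
    using step by (auto intro!: nn_integral_mono ennreal_leI split: split_indicator)
  also have "\<dots> = (\<integral>\<^sup>+x. (ennreal (D m x / 2) * indicator U x + ennreal (D m (x \<cdot> w) / 2) * indicator U' (x \<cdot> w)) \<partial>lborel)"
    by (auto intro!: nn_integral_cong split: split_indicator simp: D0 add_divide_distrib U'_def G.mult_assoc
        simp flip: ennreal_plus)
  also have "\<dots> = (\<integral>\<^sup>+x\<in>U. D m x / 2 \<partial>lborel) + (\<integral>\<^sup>+x. ennreal (D m (x \<cdot> w) / 2) * indicator U' (x \<cdot> w) \<partial>lborel)"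
    by (rule nn_integral_add)
      (simp_all add: measurable_compose[OF G.borel_measurable_translations(2)[of w],
          of "\<lambda>x. ennreal (D m x / 2) * indicator U' x"])
  also have "(\<integral>\<^sup>+x. ennreal (D m (x \<cdot> w) / 2) * indicator U' (x \<cdot> w) \<partial>lborel) = (\<integral>\<^sup>+x\<in>U'. D m x / 2 \<partial>lborel)"
    by (rule G.nn_integral_right_translation[of "\<lambda>x. ennreal (D m x / 2) * indicator U' x"]) simp
  also have "(\<integral>\<^sup>+x\<in>U. D m x / 2 \<partial>lborel) + (\<integral>\<^sup>+x\<in>U'. D m x / 2 \<partial>lborel)
      = (\<integral>\<^sup>+x. (ennreal (D m x / 2) * indicator U x + ennreal (D m x / 2) * indicator U' x) \<partial>lborel)"
    by (subst nn_integral_add) auto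
  also have "\<dots> \<le> (\<integral>\<^sup>+x\<in>V. D m x \<partial>lborel)"
    by (auto intro!: nn_integral_mono ennreal_leI split: split_indicator simp: V_def D0 simp flip: ennreal_plus)
  finally have 1: "(\<integral>\<^sup>+x\<in>U. D (Suc m) x \<partial>lborel) + (\<integral>\<^sup>+x\<in>U. E m x \<partial>lborel) \<le> (\<integral>\<^sup>+x\<in>V. D m x \<partial>lborel)" .
  have 2: "(\<Sum>i<m. \<integral>\<^sup>+x\<in>U. E i x \<partial>lborel) \<le> (\<Sum>i<m. \<integral>\<^sup>+x\<in>V. E i x \<partial>lborel)"
    by (intro sum_mono nn_integral_mono) (auto split: split_indicator simp: V_def)
  have "x \<cdot> (real l *\<^sub>R u) \<in> W" if "x \<in> V" "l < 2 ^ m" for x l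
  proof (cases "x \<in> U")
    case True
    then show ?thesis using Suc.prems(2)[of x l] that by simp
  next
    case False
    then have U: "x \<cdot> (- w) \<in> U" using that by (simp add: V_def U'_def)
    have "(x \<cdot> (- w)) \<cdot> (real (2 ^ m + l) *\<^sub>R u) = x \<cdot> (real l *\<^sub>R u)"
      using G.mult_multiples[of "- (2 ^ m)" u "real (2 ^ m + l)"] by (simp add: G.mult_assoc w_def)
    then show ?thesis using Suc.prems(2)[OF U, of "2 ^ m + l"] that by simp
  qed
  then have "(\<integral>\<^sup>+x\<in>V. D m x \<partial>lborel) + (\<Sum>i<m. \<integral>\<^sup>+x\<in>V. E i x \<partial>lborel) \<le> (\<integral>\<^sup>+x\<in>W. ennreal (spread f u x) \<partial>lborel)"
    using Suc.IH[OF V] by (simp add: D_def E_def)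
  then have "(\<integral>\<^sup>+x\<in>U. D (Suc m) x \<partial>lborel) + (\<Sum>i<Suc m. \<integral>\<^sup>+x\<in>U. E i x \<partial>lborel) \<le> (\<integral>\<^sup>+x\<in>W. ennreal (spread f u x) \<partial>lborel)"
    using order_trans[OF add_mono[OF 1 2]] by (simp add: ac_simps)
  then show ?case by (simp only: D_def E_def)
qed

text \<open>The weight \<open>r powr p\<close> makes the defect invariant under dilations of source and target.\<close>

definition grid_defect :: "nat \<Rightarrow> ('a \<Rightarrow> 'b) \<Rightarrow> real \<Rightarrow> 'a \<Rightarrow> real" where
  "grid_defect n f r x = (\<Sum>v\<in>grid_vectors n. defect f (r *\<^sub>R v) x / r powr p)"

lemma finite_grid_vectors: "finite (grid_vectors n)"
proof -
  have "grid_vectors n = (\<lambda>(l, b). (of_int l / real n) *\<^sub>R b) ` ({- int n..int n} \<times> G.hbasis)"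
    by (force simp: grid_vectors_def)
  then show ?thesis using G.hbasis(1) by simp
qed

lemma card_grid_vectors: "card (grid_vectors n) \<le> (2 * n + 1) * card G.hbasis"
proof -
  have "grid_vectors n = (\<lambda>(l, b). (of_int l / real n) *\<^sub>R b) ` ({- int n..int n} \<times> G.hbasis)"
    by (force simp: grid_vectors_def)
  then have "card (grid_vectors n) \<le> card ({- int n..int n} \<times> G.hbasis)"
    by (simp only:) (intro card_image_le finite_cartesian_product G.hbasis(1) finite_atLeastAtMost_int)
  moreover have "card {- int n..int n} = 2 * n + 1" by simp
  ultimately show ?thesis by (simp only: card_cartesian_product)
qed

lemma borel_measurable_grid_defect [measurable]:
  "f \<in> borel_measurable borel \<Longrightarrow> grid_defect n f r \<in> borel_measurable borel"
  unfolding grid_defect_def[abs_def]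
  by (intro borel_measurable_sum borel_measurable_divide borel_measurable_defect borel_measurable_const)

text \<open>The right-hand side of the telescoped inequality is the spread at the smallest scale, where the Lipschitz
  bound applies; it is independent of the number of scales.\<close>

lemma total_grid_defect:
  assumes C: "0 \<le> C"
  shows "\<exists>A\<ge>0. \<forall>n f r U W m. 0 < r \<and> f \<in> borel_measurable borel \<and>
      (\<forall>x y. N (- f x \<star> f y) \<le> C * max (G.hdist x y) r) \<and>
      U \<in> sets borel \<and> W \<in> sets borel \<and>
      (\<forall>x\<in>U. \<forall>v\<in>grid_vectors n. \<forall>l<2 ^ m. x \<cdot> ((real l * r) *\<^sub>R v) \<in> W) \<longrightarrow>
    (\<Sum>i<m. \<integral>\<^sup>+x\<in>U. ennreal (grid_defect n f (2 ^ i * r) x) \<partial>lborel)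
      \<le> ennreal (A * real (card (grid_vectors n))) * emeasure lborel W"
proof -
  obtain M where M: "M \<ge> 1" "\<And>n v. v \<in> grid_vectors n \<Longrightarrow> v \<in> layer G 1 \<and> norm v \<le> M \<and> G.hnorm v \<le> M"
    using grid_vectors_bound by blast
  define A where "A = K * (C * M) powr p"
  have "(\<Sum>i<m. \<integral>\<^sup>+x\<in>U. ennreal (grid_defect n f (2 ^ i * r) x) \<partial>lborel)
      \<le> ennreal (A * real (card (grid_vectors n))) * emeasure lborel W"
    if r: "0 < r" and f [measurable]: "f \<in> borel_measurable borel"
      and lip: "\<forall>x y. N (- f x \<star> f y) \<le> C * max (G.hdist x y) r"
      and U [measurable]: "U \<in> sets borel" and W [measurable]: "W \<in> sets borel"
      and UW: "\<forall>x\<in>U. \<forall>v\<in>grid_vectors n. \<forall>l<2 ^ m. x \<cdot> ((real l * r) *\<^sub>R v) \<in> W" for n f r U W m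
  proof -
    have one: "(\<Sum>i<m. \<integral>\<^sup>+x\<in>U. ennreal (defect f ((2 ^ i * r) *\<^sub>R v) x / (2 ^ i * r) powr p) \<partial>lborel)
        \<le> ennreal A * emeasure lborel W" if v: "v \<in> grid_vectors n" for v
    proof -
      have hv: "G.hnorm (r *\<^sub>R v) \<le> M * r"
        using G.hnorm_dilation[of r v] G.dilation_layer[of v 1 r] M(2)[OF v] r by (simp add: mult.commute)
      have sp: "spread f (r *\<^sub>R v) x / r powr p \<le> (C * M) powr p" for x
      proof -
        have "N (- f x \<star> f (x \<cdot> (r *\<^sub>R v))) \<le> C * max (G.hnorm (r *\<^sub>R v)) r"
          using lip[rule_format, of x "x \<cdot> (r *\<^sub>R v)"] by simp
        also have "\<dots> \<le> C * (M * r)" using hv M(1) r C mult_right_mono[of 1 M r] by (intro mult_left_mono) auto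
        finally have "spread f (r *\<^sub>R v) x \<le> (C * M * r) powr p"
          unfolding spread_def using p H.N_nonneg by (intro powr_mono2) (auto simp: mult.assoc)
        then show ?thesis using r C M(1) by (simp add: powr_mult divide_le_eq)
      qed
      have "(\<Sum>i<m. \<integral>\<^sup>+x\<in>U. ennreal (defect f ((2 ^ i * r) *\<^sub>R v) x / (2 ^ i * r) powr p) \<partial>lborel)
          = (\<Sum>i<m. ennreal (K / r powr p) * (\<integral>\<^sup>+x\<in>U. ennreal (defect f (2 ^ i *\<^sub>R (r *\<^sub>R v)) x / (2 ^ i) powr p / K) \<partial>lborel))"
        using r K by (intro sum.cong refl, subst nn_integral_cmult[symmetric])
          (auto intro!: nn_integral_cong split: split_indicator simp: powr_mult defect_nonneg simp flip: ennreal_mult)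
      also have "\<dots> = ennreal (K / r powr p) * (\<Sum>i<m. \<integral>\<^sup>+x\<in>U. ennreal (defect f (2 ^ i *\<^sub>R (r *\<^sub>R v)) x / (2 ^ i) powr p / K) \<partial>lborel)"
        by (simp add: sum_distrib_left)
      also have "\<dots> \<le> ennreal (K / r powr p) * (\<integral>\<^sup>+x\<in>W. ennreal (spread f (r *\<^sub>R v) x) \<partial>lborel)"
      proof (intro mult_left_mono order_trans[OF _ telescoping_defect[OF f U W, of m "r *\<^sub>R v"]])
        show "x \<cdot> (real l *\<^sub>R r *\<^sub>R v) \<in> W" if "x \<in> U" "l < 2 ^ m" for x l
          using UW v that by simp
      qed auto
      also have "\<dots> = (\<integral>\<^sup>+x\<in>W. ennreal (K * (spread f (r *\<^sub>R v) x / r powr p)) \<partial>lborel)"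
        using r K by (subst nn_integral_cmult[symmetric])
          (auto intro!: nn_integral_cong split: split_indicator simp: spread_nonneg simp flip: ennreal_mult)
      also have "\<dots> \<le> (\<integral>\<^sup>+x\<in>W. ennreal A \<partial>lborel)"
        unfolding A_def using K by (intro nn_integral_mono mult_right_mono ennreal_leI mult_left_mono sp) auto
      also have "\<dots> = ennreal A * emeasure lborel W" by (simp add: nn_integral_cmult_indicator)
      finally show ?thesis .
    qed
    have "(\<Sum>i<m. \<integral>\<^sup>+x\<in>U. ennreal (grid_defect n f (2 ^ i * r) x) \<partial>lborel)
        = (\<Sum>i<m. \<Sum>v\<in>grid_vectors n. \<integral>\<^sup>+x\<in>U. ennreal (defect f ((2 ^ i * r) *\<^sub>R v) x / (2 ^ i * r) powr p) \<partial>lborel)"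
      unfolding grid_defect_def
      by (intro sum.cong refl, subst nn_integral_sum[symmetric])
        (auto simp: sum_distrib_right defect_nonneg simp flip: sum_ennreal)
    also have "\<dots> = (\<Sum>v\<in>grid_vectors n. \<Sum>i<m. \<integral>\<^sup>+x\<in>U. ennreal (defect f ((2 ^ i * r) *\<^sub>R v) x / (2 ^ i * r) powr p) \<partial>lborel)"
      by (rule sum.swap)
    also have "\<dots> \<le> (\<Sum>v\<in>grid_vectors n. ennreal A * emeasure lborel W)" by (intro sum_mono one)
    also have "\<dots> = ennreal (A * real (card (grid_vectors n))) * emeasure lborel W"
      using K by (simp add: A_def ennreal_mult ac_simps ennreal_of_nat_eq_real_of_nat)
    finally show ?thesis .
  qed
  moreover have "0 \<le> A" using K by (simp add: A_def)
  ultimately show ?thesis by blast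
qed

end

text \<open>A map that is Lipschitz at large distances need not be measurable.  Rounding the argument to a countable dense
  set makes it so, at the cost of an error that is invisible above the scale \<open>r\<close>.\<close>

lemma (in carnot_group) measurable_rounding:
  fixes h :: "'a \<Rightarrow> 'c::topological_space"
  assumes r: "0 < r"
  obtains f where "f \<in> borel_measurable borel" "\<And>x. \<exists>y. hdist x y \<le> r \<and> f x = h y"
proof -
  obtain D :: "'a set" where D: "countable D" "\<And>X. open X \<Longrightarrow> X \<noteq> {} \<Longrightarrow> \<exists>d\<in>D. d \<in> X"
    using countable_dense_exists by blast
  have ne: "D \<noteq> {}" using D(2)[of UNIV] by auto
  define q where "q = from_nat_into D"
  have ex: "\<exists>n. x \<in> hball (q n) r" for x
  proof -
    have "x \<in> hball x r" using r by (simp add: hball_def)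
    then obtain d where d: "d \<in> D" "d \<in> hball x r" using D(2)[OF open_hball, of x r] by blast
    obtain n where "q n = d" using d(1) from_nat_into_surj[OF D(1)] unfolding q_def by blast
    moreover have "hdist d x = hdist x d" using hnorm_neg[of "- x \<otimes> d"] by (simp add: neg_mult del: hnorm_neg)
    ultimately show ?thesis using d(2) by (intro exI[of _ n]) (simp add: hball_def)
  qed
  define g where "g x = (LEAST n. x \<in> hball (q n) r)" for x
  have [measurable]: "g \<in> borel \<rightarrow>\<^sub>M count_space UNIV"
    unfolding g_def[abs_def] by (rule measurable_Least) simp
  have "(\<lambda>x. h (q (g x))) \<in> borel_measurable borel"
    by (rule measurable_compose[of g _ "count_space UNIV"]) simp_all
  moreover have "\<exists>y. hdist x y \<le> r \<and> h (q (g x)) = h y" for x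
  proof -
    have "x \<in> hball (q (g x)) r" unfolding g_def using ex by (rule LeastI_ex)
    moreover have "hnorm (- x \<otimes> q (g x)) = hnorm (- q (g x) \<otimes> x)"
      using hnorm_neg[of "- x \<otimes> q (g x)"] by (simp add: neg_mult del: hnorm_neg)
    ultimately show ?thesis by (intro exI[of _ "q (g x)"]) (simp add: hball_def)
  qed
  ultimately show ?thesis using that by blast
qed

context convex_target
begin

text \<open>The map \<open>f\<close> seen from \<open>z\<close> at scale \<open>\<rho>\<close>.\<close>

definition rescale :: "('a \<Rightarrow> 'b) \<Rightarrow> 'a \<Rightarrow> real \<Rightarrow> 'a \<Rightarrow> 'b" where
  "rescale f z \<rho> y = dilation H (1 / \<rho>) (- f z \<star> f (z \<cdot> dilation G \<rho> y))"

lemma rescale_increment: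
  "- rescale f z \<rho> x \<star> rescale f z \<rho> y
    = dilation H (1 / \<rho>) (- f (z \<cdot> dilation G \<rho> x) \<star> f (z \<cdot> dilation G \<rho> y))"
  by (simp add: rescale_def H.dilation_mult H.neg_mult H.mult_assoc H.dilation_neg)

lemma coarse_lip_rescale:
  assumes lip: "\<And>x y. N (- f x \<star> f y) \<le> C * max (G.hdist x y) r" and \<rho>: "0 < \<rho>"
  shows "coarse_lip C (r / \<rho>) (rescale f z \<rho>)"
proof -
  have "N (- rescale f z \<rho> x \<star> rescale f z \<rho> y) \<le> C * max (G.hdist x y) (r / \<rho>)" for x y
  proof -
    let ?x = "z \<cdot> dilation G \<rho> x" and ?y = "z \<cdot> dilation G \<rho> y"
    have "- ?x \<cdot> ?y = dilation G \<rho> (- x \<cdot> y)"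
      by (simp add: G.neg_mult G.mult_assoc G.dilation_mult G.dilation_neg)
    then have "N (- f ?x \<star> f ?y) \<le> C * max (\<rho> * G.hdist x y) r"
      using lip[of ?x ?y] \<rho> by (simp add: G.hnorm_dilation)
    also have "\<dots> = C * (\<rho> * max (G.hdist x y) (r / \<rho>))"
      using \<rho> by (simp add: max_mult_distrib_left)
    finally show ?thesis using \<rho> by (simp add: rescale_increment H.N_dilation field_simps)
  qed
  then show ?thesis by (simp add: coarse_lip_def rescale_def)
qed

lemma nonhorizontality_dilation:
  assumes "0 \<le> c"
  shows "nonhorizontality H N (dilation H c x) = c * nonhorizontality H N x"
proof -
  have "component H 1 (dilation H c x) = dilation H c (component H 1 x)"
    using H.dilation_layer[OF H.component_in_layer, of c 1 x] by (simp add: H.component_dilation)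
  then have "- component H 1 (dilation H c x) \<star> dilation H c x = dilation H c (- component H 1 x \<star> x)"
    by (simp only: H.dilation_mult H.dilation_neg)
  then show ?thesis using assms by (simp add: nonhorizontality_def H.hom_dist_eq H.N_dilation)
qed

lemma defect_smallD:
  assumes "defect f w x \<le> t powr p" "0 \<le> t"
  shows "norm ((1 / 2) *\<^sub>R (hcomp (f x) + hcomp (f (x \<cdot> (2 *\<^sub>R w)))) - hcomp (f (x \<cdot> w))) \<le> t"
    and "nonhorizontality H N (- f x \<star> f (x \<cdot> (2 *\<^sub>R w))) \<le> t"
proof -
  have le: "a \<le> t" if "a powr p \<le> t powr p" for a
    using that p assms(2) powr_less_mono2[of p t a] by linarith
  note a = assms(1)[unfolded defect_def]
  show "norm ((1 / 2) *\<^sub>R (hcomp (f x) + hcomp (f (x \<cdot> (2 *\<^sub>R w)))) - hcomp (f (x \<cdot> w))) \<le> t"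
    by (rule le, rule order_trans[OF _ a]) simp
  show "nonhorizontality H N (- f x \<star> f (x \<cdot> (2 *\<^sub>R w))) \<le> t"
    by (rule le, rule order_trans[OF _ a]) simp
qed

text \<open>The scale \<open>\<rho> / 2\<close> enters because the defect of a vector controls the horizontality of the increment along its
  double.\<close>

lemma straight_rescale:
  assumes \<rho>: "0 < \<rho>" and \<theta>: "0 \<le> \<theta>" and v: "v \<in> layer G 1"
    and small: "\<And>i. i \<le> k \<Longrightarrow> defect f ((2 ^ i * (\<rho> / 2)) *\<^sub>R v) (z \<cdot> dilation G \<rho> y) \<le> (2 ^ i * (\<rho> / 2) * \<theta>) powr p"
  shows "straight k \<theta> (rescale f z \<rho>) y v"
proof -
  let ?x = "z \<cdot> dilation G \<rho> y"
  have shift: "z \<cdot> dilation G \<rho> (y \<cdot> (t *\<^sub>R v)) = ?x \<cdot> ((t * \<rho>) *\<^sub>R v)" for t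
    using G.dilation_layer[OF v, of \<rho>] by (simp add: G.dilation_mult G.dilation_scaleR G.mult_assoc)
  have hc: "hcomp (rescale f z \<rho> x) = (1 / \<rho>) *\<^sub>R (hcomp (f (z \<cdot> dilation G \<rho> x)) - hcomp (f z))" for x
    unfolding rescale_def H.component_dilation H.component1_mult H.component_neg by (simp add: algebra_simps)
  have "nonhorizontality H N (- f ?x \<star> f (?x \<cdot> (2 *\<^sub>R ((2 ^ 0 * (\<rho> / 2)) *\<^sub>R v)))) \<le> 2 ^ 0 * (\<rho> / 2) * \<theta>"
    using \<rho> \<theta> by (intro defect_smallD(2)[OF small]) auto
  then have "nonhorizontality H N (- f ?x \<star> f (?x \<cdot> (\<rho> *\<^sub>R v))) \<le> \<rho> * \<theta> / 2" by simp
  then have "1 / \<rho> * nonhorizontality H N (- f ?x \<star> f (?x \<cdot> (\<rho> *\<^sub>R v))) \<le> \<theta>"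
    using \<rho> nonhorizontality_nonneg[of "- f ?x \<star> f (?x \<cdot> (\<rho> *\<^sub>R v))"]
    by (simp add: divide_le_eq mult.commute)
  then have 1: "nonhorizontality H N (- rescale f z \<rho> y \<star> rescale f z \<rho> (y \<cdot> v)) \<le> \<theta>"
    using shift[of 1] \<rho> by (simp add: rescale_increment nonhorizontality_dilation)
  have "norm ((1 / 2) *\<^sub>R (hcomp (rescale f z \<rho> y) + hcomp (rescale f z \<rho> (y \<cdot> (2 ^ Suc i *\<^sub>R v))))
      - hcomp (rescale f z \<rho> (y \<cdot> (2 ^ i *\<^sub>R v)))) \<le> 2 ^ i * \<theta>" if "i < k" for i
  proof -
    define a where "a = hcomp (f ?x)"
    define b where "b = hcomp (f (?x \<cdot> ((2 ^ Suc i * \<rho>) *\<^sub>R v)))"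
    define c where "c = hcomp (f (?x \<cdot> ((2 ^ i * \<rho>) *\<^sub>R v)))"
    define e where "e = hcomp (f z)"
    let ?w = "(2 ^ Suc i * (\<rho> / 2)) *\<^sub>R v"
    have "norm ((1 / 2) *\<^sub>R (hcomp (f ?x) + hcomp (f (?x \<cdot> (2 *\<^sub>R ?w)))) - hcomp (f (?x \<cdot> ?w))) \<le> 2 ^ Suc i * (\<rho> / 2) * \<theta>"
      using \<rho> \<theta> that by (intro defect_smallD(1)[OF small]) auto
    moreover have "2 *\<^sub>R ?w = (2 ^ Suc i * \<rho>) *\<^sub>R v" "?w = (2 ^ i * \<rho>) *\<^sub>R v" by simp_all
    ultimately have "norm ((1 / 2) *\<^sub>R (a + b) - c) \<le> \<rho> * (2 ^ i * \<theta>)"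
      unfolding a_def b_def c_def by (simp only:) (simp add: algebra_simps)
    then have "1 / \<rho> * norm ((1 / 2) *\<^sub>R (a + b) - c) \<le> 2 ^ i * \<theta>" using \<rho> by (simp add: field_simps)
    moreover have "norm ((1 / \<rho>) *\<^sub>R ((1 / 2) *\<^sub>R (a + b) - c)) = 1 / \<rho> * norm ((1 / 2) *\<^sub>R (a + b) - c)"
      using \<rho> by simp
    moreover have "(1 / \<rho>) *\<^sub>R ((1 / 2) *\<^sub>R (a + b) - c)
        = (1 / 2) *\<^sub>R ((1 / \<rho>) *\<^sub>R (a - e) + (1 / \<rho>) *\<^sub>R (b - e)) - (1 / \<rho>) *\<^sub>R (c - e)"
    proof -
      have "(1 / 2) *\<^sub>R ((1 / \<rho>) *\<^sub>R (a - e) + (1 / \<rho>) *\<^sub>R (b - e)) - (1 / \<rho>) *\<^sub>R (c - e)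
          = (1 / \<rho>) *\<^sub>R ((1 / 2) *\<^sub>R ((a - e) + (b - e)) - (c - e))"
        by (simp add: scaleR_add_right scaleR_diff_right mult.commute)
      also have "(1 / 2) *\<^sub>R ((a - e) + (b - e)) - (c - e) = (1 / 2) *\<^sub>R (a + b) - c"
        using scaleR_left_distrib[of "1/2" "1/2" e] by (simp add: scaleR_add_right scaleR_diff_right algebra_simps)
      finally show ?thesis by simp
    qed
    ultimately have "norm ((1 / 2) *\<^sub>R ((1 / \<rho>) *\<^sub>R (a - e) + (1 / \<rho>) *\<^sub>R (b - e)) - (1 / \<rho>) *\<^sub>R (c - e)) \<le> 2 ^ i * \<theta>"
      by metis
    then show ?thesis by (simp only: hc shift a_def b_def c_def e_def)
  qed
  then show ?thesis using 1 by (simp only: straight_def) simp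
qed

lemma hom_mult_neg: "T \<in> hom G H \<Longrightarrow> T (x \<cdot> y) = T x \<star> T y" "T \<in> hom G H \<Longrightarrow> T (- x) = - T x"
proof -
  assume T: "T \<in> hom G H"
  show m: "T (x \<cdot> y) = T x \<star> T y" for x y
    using hom_mult[OF T] by (simp add: G.carrier_UNIV)
  have "T 0 = - T 0 \<star> (T 0 \<star> T 0)" by simp
  also have "\<dots> = 0" using m[of 0 0] by simp
  finally have 0: "T 0 = 0" .
  have "T (- x) = - T x \<star> (T x \<star> T (- x))" by simp
  also have "\<dots> = - T x" using m[of x "- x"] 0 by simp
  finally show "T (- x) = - T x" .
qed

text \<open>Dilations are homomorphisms; this undoes the normalisation of scales.\<close>

lemma rescaled_hom:
  assumes T: "T \<in> lipschitz_homs G H N" and a: "0 \<le> a" and b: "0 \<le> b"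
  shows "(\<lambda>x. dilation H a (T (dilation G b x))) \<in> lipschitz_homs G H N"
proof -
  obtain c C where c: "c > 0" "C > 0" "\<And>x y. c * G.hdist x y \<le> cc_dist G x y \<and> cc_dist G x y \<le> C * G.hdist x y"
    using G.cc_dist_comparable by blast
  obtain L where hom: "T \<in> hom G H" and L: "\<And>x y. hom_dist H N (T x) (T y) \<le> L * cc_dist G x y"
    using T by (auto simp: lipschitz_homs_def)
  let ?S = "\<lambda>x. dilation H a (T (dilation G b x))"
  have "hom_dist H N (?S x) (?S y) \<le> (a * \<bar>L\<bar> * C * b / c) * cc_dist G x y" for x y
  proof -
    have "- ?S x \<star> ?S y = dilation H a (- T (dilation G b x) \<star> T (dilation G b y))"
      by (simp add: H.dilation_mult H.dilation_neg)
    then have "hom_dist H N (?S x) (?S y) = a * hom_dist H N (T (dilation G b x)) (T (dilation G b y))"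
      using a by (simp add: H.hom_dist_eq H.N_dilation)
    also have "\<dots> \<le> a * (\<bar>L\<bar> * (C * G.hnorm (- dilation G b x \<cdot> dilation G b y)))"
    proof (rule mult_left_mono[OF _ a])
      have "0 \<le> cc_dist G (dilation G b x) (dilation G b y)"
        using c(3)[of "dilation G b x" "dilation G b y"] c(1) G.hnorm_nonneg
        by (meson dual_order.trans less_imp_le mult_nonneg_nonneg)
      then have "L * cc_dist G (dilation G b x) (dilation G b y) \<le> \<bar>L\<bar> * cc_dist G (dilation G b x) (dilation G b y)"
        by (intro mult_right_mono) auto
      also have "\<dots> \<le> \<bar>L\<bar> * (C * G.hnorm (- dilation G b x \<cdot> dilation G b y))"
        using c(3) by (intro mult_left_mono) auto
      finally show "hom_dist H N (T (dilation G b x)) (T (dilation G b y)) \<le> \<bar>L\<bar> * (C * G.hnorm (- dilation G b x \<cdot> dilation G b y))"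
        using L order_trans by blast
    qed
    also have "- dilation G b x \<cdot> dilation G b y = dilation G b (- x \<cdot> y)"
      by (simp add: G.dilation_mult G.dilation_neg)
    also have "a * (\<bar>L\<bar> * (C * G.hnorm (dilation G b (- x \<cdot> y)))) = (a * \<bar>L\<bar> * C * b) * G.hdist x y"
      using b by (simp add: G.hnorm_dilation)
    also have "\<dots> \<le> (a * \<bar>L\<bar> * C * b) * (cc_dist G x y / c)"
      using c a b by (intro mult_left_mono) (auto simp: field_simps)
    finally show ?thesis by simp
  qed
  moreover have "?S \<in> hom G H"
    by (intro homI) (simp_all add: G.carrier_UNIV H.carrier_UNIV G.dilation_mult H.dilation_mult hom_mult_neg(1)[OF hom])
  ultimately show ?thesis unfolding lipschitz_homs_def by (intro CollectI conjI exI allI)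
qed

text \<open>If \<open>f\<close> is not close to an affine map near \<open>z\<close>, some point near \<open>z\<close> has no straight point in its vicinity; the
  defect is then large on a whole small ball.\<close>

theorem approximable_or_large_defect:
  assumes C: "1 \<le> C"
  shows "\<exists>\<rho>0>0. \<exists>R\<ge>1. \<exists>a\<ge>1. \<exists>q\<ge>1. \<forall>d n k \<theta> \<kappa> r \<rho> f z.
     0 < d \<and> d \<le> 1/2 \<and> 1 \<le> real n * d ^ a \<and> real n * d ^ (a + 1) \<le> 1 \<and> 0 < \<rho> \<and>
     0 \<le> r \<and> r \<le> d ^ q * \<rho> \<and> 0 < \<kappa> \<and> \<kappa> \<le> d ^ q \<and> 1 / 2 ^ k \<le> d ^ q \<and> real k * \<theta> \<le> d ^ q \<and> 0 < \<theta> \<and> \<theta> \<le> d ^ q \<and>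
     f \<in> borel_measurable borel \<and> (\<forall>x y. N (- f x \<star> f y) \<le> C * max (G.hdist x y) r) \<longrightarrow>
     (\<exists>T\<in>lipschitz_homs G H N. \<exists>g. \<forall>x. G.hdist z x \<le> \<rho>0 * \<rho> \<longrightarrow> N (- f x \<star> (g \<star> T x)) \<le> d * \<rho>) \<or>
     ennreal (\<theta> powr p * G.volume (\<kappa> * \<rho>))
       \<le> (\<Sum>i<Suc k. \<integral>\<^sup>+x\<in>G.hball z (R * \<rho>). ennreal (grid_defect n f (2 ^ i * (\<rho> / 2)) x) \<partial>lborel)"
proof -
  obtain \<rho>0 \<rho>1 a q where *: "\<rho>0 > 0" "\<rho>1 \<ge> 1" "a \<ge> 1" "q \<ge> 1" and rig: "\<And>d n k \<theta> \<kappa> \<kappa>' F.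
     0 < d \<and> d \<le> 1/2 \<and> 1 \<le> real n * d ^ a \<and> real n * d ^ (a + 1) \<le> 1 \<and>
     0 \<le> \<kappa> \<and> \<kappa> \<le> d ^ q \<and> \<kappa>' \<le> d ^ q \<and> 1 / 2 ^ k \<le> d ^ q \<and> real k * \<theta> \<le> d ^ q \<and> \<theta> \<le> d ^ q \<and>
     coarse_lip C \<kappa> F \<and> straight_nearby n k \<theta> \<kappa>' \<rho>1 F \<Longrightarrow>
     (\<exists>T\<in>lipschitz_homs G H N. \<forall>x. G.hnorm x \<le> \<rho>0 \<longrightarrow> N (- T x \<star> F x) \<le> d)"
    using rigidity[OF C] by blast
  obtain CQ where CQ: "CQ \<ge> 1" "\<And>x y. G.hnorm (x \<cdot> y) \<le> CQ * (G.hnorm x + G.hnorm y)"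
    using G.hnorm_quasi_triangle by blast
  obtain M where M: "M \<ge> 1" "\<And>n v. v \<in> grid_vectors n \<Longrightarrow> v \<in> layer G 1 \<and> norm v \<le> M \<and> G.hnorm v \<le> M"
    using grid_vectors_bound by blast
  define R where "R = CQ * (\<rho>1 + 2)"
  have R1: "1 \<le> R" using mult_mono[of 1 CQ 1 "\<rho>1 + 2"] CQ(1) *(2) by (simp add: R_def)
  have main: "(\<exists>T\<in>lipschitz_homs G H N. \<exists>g. \<forall>x. G.hdist z x \<le> \<rho>0 * \<rho> \<longrightarrow> N (- f x \<star> (g \<star> T x)) \<le> d * \<rho>)"
    if d: "0 < d" "d \<le> 1/2" and n: "1 \<le> real n * d ^ a" "real n * d ^ (a + 1) \<le> 1" and \<rho>: "0 < \<rho>"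
      and r: "0 \<le> r" "r \<le> d ^ q * \<rho>" and \<kappa>: "0 < \<kappa>" "\<kappa> \<le> d ^ q" and k: "1 / 2 ^ k \<le> d ^ q"
      and \<theta>: "real k * \<theta> \<le> d ^ q" "0 < \<theta>" "\<theta> \<le> d ^ q"
      and f [measurable]: "f \<in> borel_measurable borel"
      and lip: "\<forall>x y. N (- f x \<star> f y) \<le> C * max (G.hdist x y) r"
      and small: "\<not> ennreal (\<theta> powr p * G.volume (\<kappa> * \<rho>))
       \<le> (\<Sum>i<Suc k. \<integral>\<^sup>+x\<in>G.hball z (R * \<rho>). ennreal (grid_defect n f (2 ^ i * (\<rho> / 2)) x) \<partial>lborel)"
    for d n k \<theta> \<kappa> r \<rho> f z
  proof -
    define F where "F = rescale f z \<rho>"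
    have cl: "coarse_lip C (r / \<rho>) F" unfolding F_def using lip \<rho> by (intro coarse_lip_rescale) auto
    have sn: "straight_nearby n k \<theta> \<kappa> \<rho>1 F"
      unfolding straight_nearby_def
    proof (intro allI impI)
      fix y assume y: "G.hnorm y \<le> \<rho>1"
      let ?x = "z \<cdot> dilation G \<rho> y"
      have sub: "G.hball ?x (\<kappa> * \<rho>) \<subseteq> G.hball z (R * \<rho>)"
      proof
        fix x assume x: "x \<in> G.hball ?x (\<kappa> * \<rho>)"
        have "- z \<cdot> x = dilation G \<rho> y \<cdot> (- ?x \<cdot> x)" by (simp add: G.neg_mult G.mult_assoc)
        then have "G.hdist z x \<le> CQ * (\<rho> * G.hnorm y + G.hdist ?x x)"
          using CQ(2)[of "dilation G \<rho> y" "- ?x \<cdot> x"] \<rho> by (simp add: G.hnorm_dilation)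
        also have "\<dots> \<le> CQ * (\<rho> * \<rho>1 + \<kappa> * \<rho>)"
          using x y \<rho> CQ(1) by (intro mult_left_mono add_mono) (auto simp: G.hball_def)
        also have "\<dots> < CQ * (\<rho> * \<rho>1 + 2 * \<rho>)"
          using \<kappa>(2) power_small_range[OF d *(4)] \<rho> CQ(1) by (intro mult_strict_left_mono add_strict_left_mono mult_strict_right_mono) auto
        also have "\<dots> = R * \<rho>" by (simp add: R_def algebra_simps)
        finally show "x \<in> G.hball z (R * \<rho>)" by (simp add: G.hball_def)
      qed
      define B where "B = G.hball ?x (\<kappa> * \<rho>)"
      have [measurable]: "B \<in> sets borel" by (simp add: B_def)
      have "\<exists>x\<in>B. \<forall>i\<le>k. grid_defect n f (2 ^ i * (\<rho> / 2)) x \<le> \<theta> powr p"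
      proof (rule ccontr)
        assume neg: "\<not> ?thesis"
        have "ennreal (\<theta> powr p * G.volume (\<kappa> * \<rho>)) = (\<integral>\<^sup>+x\<in>B. ennreal (\<theta> powr p) \<partial>lborel)"
          by (simp add: nn_integral_cmult_indicator B_def G.emeasure_hball ennreal_mult G.volume_nonneg)
        also have "\<dots> \<le> (\<integral>\<^sup>+x. (\<Sum>i<Suc k. ennreal (grid_defect n f (2 ^ i * (\<rho> / 2)) x) * indicator B x) \<partial>lborel)"
        proof (rule nn_integral_mono)
          fix x
          show "ennreal (\<theta> powr p) * indicator B x \<le> (\<Sum>i<Suc k. ennreal (grid_defect n f (2 ^ i * (\<rho> / 2)) x) * indicator B x)"
          proof (cases "x \<in> B")
            case True
            then obtain i where i: "i \<le> k" "\<theta> powr p < grid_defect n f (2 ^ i * (\<rho> / 2)) x"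
              using neg by (meson not_le)
            then have "ennreal (\<theta> powr p) * indicator B x \<le> ennreal (grid_defect n f (2 ^ i * (\<rho> / 2)) x) * indicator B x"
              by (intro mult_right_mono ennreal_leI) auto
            also have "\<dots> \<le> (\<Sum>i<Suc k. ennreal (grid_defect n f (2 ^ i * (\<rho> / 2)) x) * indicator B x)"
              using i(1) by (intro member_le_sum) auto
            finally show ?thesis .
          qed simp
        qed
        also have "\<dots> = (\<Sum>i<Suc k. \<integral>\<^sup>+x\<in>B. ennreal (grid_defect n f (2 ^ i * (\<rho> / 2)) x) \<partial>lborel)"
          by (rule nn_integral_sum) measurable
        also have "\<dots> \<le> (\<Sum>i<Suc k. \<integral>\<^sup>+x\<in>G.hball z (R * \<rho>). ennreal (grid_defect n f (2 ^ i * (\<rho> / 2)) x) \<partial>lborel)"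
          using sub by (intro sum_mono nn_integral_mono mult_left_mono) (auto simp: B_def split: split_indicator)
        finally show False using small by simp
      qed
      then obtain x' where x': "x' \<in> B" "\<And>i. i \<le> k \<Longrightarrow> grid_defect n f (2 ^ i * (\<rho> / 2)) x' \<le> \<theta> powr p" by blast
      define y' where "y' = dilation G (1 / \<rho>) (- z \<cdot> x')"
      have y'x: "z \<cdot> dilation G \<rho> y' = x'" using \<rho> by (simp add: y'_def G.dilation_dilation)
      have "straight k \<theta> F y' v" if v: "v \<in> grid_vectors n" for v
        unfolding F_def
      proof (rule straight_rescale[OF \<rho>])
        fix i assume i: "i \<le> k"
        define s where "s = 2 ^ i * (\<rho> / 2)"
        have s: "0 < s" using \<rho> by (simp add: s_def)
        have "defect f (s *\<^sub>R v) x' / s powr p \<le> grid_defect n f s x'"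
          unfolding grid_defect_def using v by (intro member_le_sum) (auto simp: finite_grid_vectors defect_nonneg)
        also have "\<dots> \<le> \<theta> powr p" using x'(2)[OF i] by (simp add: s_def)
        finally show "defect f ((2 ^ i * (\<rho> / 2)) *\<^sub>R v) (z \<cdot> dilation G \<rho> y') \<le> (2 ^ i * (\<rho> / 2) * \<theta>) powr p"
          using s \<theta> unfolding y'x s_def[symmetric] by (simp add: powr_mult field_simps)
      qed (use \<theta> M(2)[OF v] in auto)
      moreover have "- y \<cdot> y' = dilation G (1 / \<rho>) (- ?x \<cdot> x')"
        using \<rho> by (simp add: y'_def G.dilation_mult G.dilation_neg G.neg_mult G.mult_assoc G.dilation_dilation)
      then have "G.hdist y y' \<le> \<kappa>"
        using x'(1) \<rho> by (simp add: G.hnorm_dilation B_def G.hball_def field_simps)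
      ultimately show "\<exists>x'. G.hdist y x' \<le> \<kappa> \<and> (\<forall>v\<in>grid_vectors n. straight k \<theta> F x' v)" by blast
    qed
    have r': "0 \<le> r / \<rho>" "r / \<rho> \<le> d ^ q" using r \<rho> by (auto simp: field_simps)
    obtain T where T: "T \<in> lipschitz_homs G H N" "\<And>x. G.hnorm x \<le> \<rho>0 \<Longrightarrow> N (- T x \<star> F x) \<le> d"
      using rig[of d n "r / \<rho>" \<kappa> k \<theta> F] d n r' \<kappa> k \<theta> cl sn by blast
    define S where "S x = dilation H \<rho> (T (dilation G (1 / \<rho>) x))" for x
    have S: "S \<in> lipschitz_homs G H N"
      unfolding S_def[abs_def] using \<rho> by (intro rescaled_hom[OF T(1)]) auto
    then have Sh: "S \<in> hom G H" by (simp add: lipschitz_homs_def)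
    have "N (- f x \<star> ((f z \<star> S (- z)) \<star> S x)) \<le> d * \<rho>" if x: "G.hdist z x \<le> \<rho>0 * \<rho>" for x
    proof -
      define y where "y = dilation G (1 / \<rho>) (- z \<cdot> x)"
      have y: "G.hnorm y \<le> \<rho>0" using x \<rho> by (simp add: y_def G.hnorm_dilation field_simps)
      have Fy: "dilation H \<rho> (F y) = - f z \<star> f x"
        using \<rho> by (simp add: F_def rescale_def y_def G.dilation_dilation H.dilation_dilation)
      have "- f x \<star> ((f z \<star> S (- z)) \<star> S x) = - (- f z \<star> f x) \<star> S (- z \<cdot> x)"
        by (simp add: hom_mult_neg(1)[OF Sh] H.neg_mult H.mult_assoc)
      also have "\<dots> = - dilation H \<rho> (F y) \<star> dilation H \<rho> (T y)" by (simp only: Fy S_def y_def[symmetric])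
      also have "\<dots> = dilation H \<rho> (- F y \<star> T y)" by (simp add: H.dilation_mult H.dilation_neg)
      also have "N \<dots> = \<rho> * N (- (- T y \<star> F y))" using \<rho> by (simp add: H.N_dilation H.neg_mult)
      also have "\<dots> \<le> d * \<rho>" using T(2)[OF y] \<rho> by (simp add: H.N_neg del: H.neg_mult)
      finally show ?thesis .
    qed
    then show ?thesis using S by blast
  qed
  show ?thesis
    by (intro exI[of _ \<rho>0] exI[of _ R] exI[of _ a] exI[of _ q] conjI allI impI *(1,3,4) R1; elim conjE)
      (rule disjCI, rule main)
qed

end

section \<open>Christ cubes\<close>

locale carnot_cubes = carnot_group G + christ_cubes G \<Delta>
  for G :: "'a::euclidean_space carnot" (structure) and \<Delta> :: "('a, 'i) cube_system"
begin

lemma cube_length_pos: "0 < cube_length \<Delta> k"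
  using cube_ratio by (simp add: cube_length_def)

lemma cube_length_add: "cube_length \<Delta> (j + int k) = cube_length \<Delta> j * cube_ratio \<Delta> ^ k"
  using cube_ratio by (simp add: cube_length_def power_int_add)

text \<open>Homogeneous balls are open and their volumes are known, so they replace the Carnot--Caratheodory balls.\<close>

lemma cubes_comparable_balls:
  obtains a b where "0 < a" "0 < b"
    "\<And>\<omega> k. \<omega> \<in> cube_index \<Delta> k \<Longrightarrow> hball (cube_centre \<Delta> k \<omega>) (a * cube_length \<Delta> k) \<subseteq> cube \<Delta> k \<omega>"
    "\<And>\<omega> k. \<omega> \<in> cube_index \<Delta> k \<Longrightarrow> cube \<Delta> k \<omega> \<subseteq> hball (cube_centre \<Delta> k \<omega>) (b * cube_length \<Delta> k)"
proof -
  obtain c C where c: "c > 0" "C > 0" "\<And>x y. c * hdist x y \<le> cc_dist G x y \<and> cc_dist G x y \<le> C * hdist x y"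
    using cc_dist_comparable by blast
  define a b where "a = inner_const \<Delta> / C" and "b = outer_const \<Delta> / c + 1"
  have ab: "0 < a" "0 < b" using c inner_const_pos outer_const_pos by (simp_all add: a_def b_def add_pos_pos)
  have in_cube: "hball (cube_centre \<Delta> k \<omega>) (a * cube_length \<Delta> k) \<subseteq> cube \<Delta> k \<omega>" if \<omega>: "\<omega> \<in> cube_index \<Delta> k" for \<omega> k
  proof (rule order_trans[OF subsetI cube_inner_ball[OF \<omega>]])
    fix x assume "x \<in> hball (cube_centre \<Delta> k \<omega>) (a * cube_length \<Delta> k)"
    then have "C * hnorm (- cube_centre \<Delta> k \<omega> \<otimes> x) < inner_const \<Delta> * cube_length \<Delta> k"
      using c(2) by (simp add: hball_def a_def field_simps)
    then show "x \<in> cc_ball G (cube_centre \<Delta> k \<omega>) (inner_const \<Delta> * cube_length \<Delta> k)"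
      using c(3)[of "cube_centre \<Delta> k \<omega>" x] by (simp add: cc_ball_def)
  qed
  moreover have "cube \<Delta> k \<omega> \<subseteq> hball (cube_centre \<Delta> k \<omega>) (b * cube_length \<Delta> k)" if \<omega>: "\<omega> \<in> cube_index \<Delta> k" for \<omega> k
  proof
    fix x assume x: "x \<in> cube \<Delta> k \<omega>"
    have "cube_centre \<Delta> k \<omega> \<in> hball (cube_centre \<Delta> k \<omega>) (a * cube_length \<Delta> k)"
      using ab cube_length_pos by (simp add: hball_def)
    then have "cc_dist G (cube_centre \<Delta> k \<omega>) x \<le> outer_const \<Delta> * cube_length \<Delta> k"
      using in_cube[OF \<omega>] cube_diameter[OF \<omega> _ x] by blast
    then have "c * hnorm (- cube_centre \<Delta> k \<omega> \<otimes> x) \<le> outer_const \<Delta> * cube_length \<Delta> k"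
      using c(3)[of "cube_centre \<Delta> k \<omega>" x] by linarith
    then have "hnorm (- cube_centre \<Delta> k \<omega> \<otimes> x) \<le> outer_const \<Delta> / c * cube_length \<Delta> k"
      using c(1) by (simp add: field_simps)
    also have "\<dots> < b * cube_length \<Delta> k" using cube_length_pos[of k] by (simp add: b_def algebra_simps)
    finally show "x \<in> hball (cube_centre \<Delta> k \<omega>) (b * cube_length \<Delta> k)" by (simp add: hball_def)
  qed
  ultimately show ?thesis using that ab by blast
qed

text \<open>Two cubes of a generation that meet are equal as sets; a cube of the next generation inside them has
  one ancestor only, hence the indices agree as well.\<close>

lemma cubes_disjoint:
  assumes \<omega>: "\<omega> \<in> cube_index \<Delta> k" and \<omega>': "\<omega>' \<in> cube_index \<Delta> k" and ne: "\<omega> \<noteq> \<omega>'"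
  shows "cube \<Delta> k \<omega> \<inter> cube \<Delta> k \<omega>' = {}"
proof (rule ccontr)
  assume "\<not> ?thesis"
  then have eq: "cube \<Delta> k \<omega> = cube \<Delta> k \<omega>'"
    using cube_nested[OF order_refl \<omega> \<omega>'] cube_nested[OF order_refl \<omega>' \<omega>] by blast
  obtain a b where a: "0 < a" "hball (cube_centre \<Delta> k \<omega>) (a * cube_length \<Delta> k) \<subseteq> cube \<Delta> k \<omega>"
    using cubes_comparable_balls \<omega> by metis
  have "cube_centre \<Delta> k \<omega> \<in> hball (cube_centre \<Delta> k \<omega>) (a * cube_length \<Delta> k)"
    using a(1) cube_length_pos by (simp add: hball_def)
  then have "\<not> negligible (hball (cube_centre \<Delta> k \<omega>) (a * cube_length \<Delta> k))"
    using open_not_negligible[OF open_hball] by blast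
  then have "\<not> cube \<Delta> k \<omega> \<subseteq> UNIV - (\<Union>\<alpha> \<in> cube_index \<Delta> (k + 1). cube \<Delta> (k + 1) \<alpha>)"
    using a(2) negligible_subset[OF cube_cover[of "k + 1"]] order_trans by metis
  then obtain \<alpha> where \<alpha>: "\<alpha> \<in> cube_index \<Delta> (k + 1)" "cube \<Delta> (k + 1) \<alpha> \<inter> cube \<Delta> k \<omega> \<noteq> {}" by blast
  then have "cube \<Delta> (k + 1) \<alpha> \<subseteq> cube \<Delta> k \<omega>" using cube_nested[of k "k + 1" \<alpha> \<omega>] \<omega> by simp
  then show False using cube_ancestor[of k "k + 1" \<alpha>] \<alpha>(1) \<omega> \<omega>' eq ne by (metis less_add_one)
qed

text \<open>Only balls inside the cubes are integrated over, which avoids any regularity question for the cubes.\<close>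

lemma sum_over_inner_balls:
  assumes g [measurable]: "g \<in> borel_measurable borel" and I: "finite I" "I \<subseteq> cube_index \<Delta> k"
    and B: "\<And>\<omega>. \<omega> \<in> I \<Longrightarrow> B \<omega> \<in> sets borel \<and> B \<omega> \<subseteq> cube \<Delta> k \<omega> \<and> B \<omega> \<subseteq> U" and U: "U \<in> sets borel"
  shows "(\<Sum>\<omega>\<in>I. \<integral>\<^sup>+x\<in>B \<omega>. g x \<partial>lborel) \<le> (\<integral>\<^sup>+x\<in>U. g x \<partial>lborel)"
proof -
  have "disjoint_family_on B I"
    unfolding disjoint_family_on_def
  proof (intro ballI impI)
    fix \<omega> \<omega>' assume "\<omega> \<in> I" "\<omega>' \<in> I" "\<omega> \<noteq> \<omega>'"
    then show "B \<omega> \<inter> B \<omega>' = {}" using cubes_disjoint[of \<omega> k \<omega>'] B I(2) by blast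
  qed
  then have ind: "(\<Sum>\<omega>\<in>I. indicator (B \<omega>) x :: ennreal) = indicator (\<Union>\<omega>\<in>I. B \<omega>) x" for x
    by (rule indicator_UN_disjoint[OF I(1), symmetric])
  have "(\<Sum>\<omega>\<in>I. \<integral>\<^sup>+x\<in>B \<omega>. g x \<partial>lborel) = (\<integral>\<^sup>+x. (\<Sum>\<omega>\<in>I. g x * indicator (B \<omega>) x) \<partial>lborel)"
  proof (rule nn_integral_sum[symmetric])
    fix \<omega> assume "\<omega> \<in> I"
    then have [measurable]: "B \<omega> \<in> sets borel" using B by blast
    show "(\<lambda>x. g x * indicator (B \<omega>) x) \<in> borel_measurable lborel" by measurable
  qed
  also have "\<dots> = (\<integral>\<^sup>+x. g x * indicator (\<Union>\<omega>\<in>I. B \<omega>) x \<partial>lborel)"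
    by (simp add: ind flip: sum_distrib_left)
  also have "\<dots> \<le> (\<integral>\<^sup>+x\<in>U. g x \<partial>lborel)"
    using B by (intro nn_integral_mono mult_left_mono) (auto split: split_indicator)
  finally show ?thesis .
qed

end

section \<open>Choice of scales and constants\<close>

lemma dyadic_power_between:
  fixes x :: real
  assumes "0 < x" "x \<le> 1"
  obtains k :: nat where "1 / 2 ^ k \<le> x" "2 ^ k * x \<le> 2"
proof -
  define k where "k = (LEAST k :: nat. 1 / 2 ^ k \<le> x)"
  have "\<exists>k :: nat. 1 / 2 ^ k \<le> x"
    using real_arch_pow_inv[OF assms(1), of "1/2"] by (auto simp: power_one_over intro: less_imp_le)
  then have k: "1 / 2 ^ k \<le> x" unfolding k_def by (rule LeastI_ex)
  have "2 ^ k * x \<le> 2"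
  proof (cases k)
    case (Suc i)
    then have "\<not> 1 / 2 ^ i \<le> x" using not_less_Least[of i "\<lambda>k. 1 / 2 ^ k \<le> x"] by (simp add: k_def)
    then show ?thesis using Suc by (simp add: field_simps)
  qed (use assms in simp)
  with k show ?thesis using that by blast
qed

lemma grid_fineness:
  fixes x :: real
  assumes "0 < x" "x \<le> 1/2"
  obtains n :: nat where "1 \<le> real n * x ^ a" "real n * x ^ (a + 1) \<le> 1"
proof
  have xa: "0 < x ^ a" "x ^ a \<le> 1" using assms by (auto intro: power_le_one)
  have "1 / x ^ a \<le> real (nat \<lceil>1 / x ^ a\<rceil>)" by (simp add: of_nat_ceiling)
  then have "1 / x ^ a * x ^ a \<le> real (nat \<lceil>1 / x ^ a\<rceil>) * x ^ a" using xa by (intro mult_right_mono) auto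
  then show "1 \<le> real (nat \<lceil>1 / x ^ a\<rceil>) * x ^ a" using xa assms(1) by simp
  have "real (nat \<lceil>1 / x ^ a\<rceil>) = of_int \<lceil>1 / x ^ a\<rceil>"
    using order.strict_trans[OF _ divide_pos_pos[OF zero_less_one xa(1)], of "-1"] by (intro of_nat_nat) simp
  also have "\<dots> \<le> 1 / x ^ a + 1" using ceiling_correct[of "1 / x ^ a"] by linarith
  finally have "real (nat \<lceil>1 / x ^ a\<rceil>) * x ^ (a + 1) \<le> (1 / x ^ a + 1) * x ^ (a + 1)"
    using assms by (intro mult_right_mono) auto
  also have "\<dots> = x + x * x ^ a" using xa by (simp add: field_simps)
  also have "\<dots> \<le> 1/2 + 1/2 * 1" using assms xa by (intro add_mono mult_mono) auto
  finally show "real (nat \<lceil>1 / x ^ a\<rceil>) * x ^ (a + 1) \<le> 1" by simp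
qed

text \<open>The generations shrink by \<open>\<tau>\<close> instead of \<open>1 / 2\<close>, so they are rounded to dyadic scales.  After \<open>q\<close> generations the size has at least
  halved, hence the rounded scale has changed; this bounds how often a scale is counted.\<close>

lemma dyadic_scales:
  fixes \<tau> \<psi> t :: real
  assumes \<tau>: "0 < \<tau>" "\<tau> < 1" and q: "\<tau> ^ q \<le> 1/2" and t: "0 < t" and \<psi>: "0 < \<psi>" and m: "\<psi> \<le> t * \<tau> ^ m"
  obtains e :: "nat \<Rightarrow> nat" where
    "\<And>k. k \<le> m \<Longrightarrow> 2 ^ e k * \<psi> \<le> t * \<tau> ^ k \<and> t * \<tau> ^ k < 2 * (2 ^ e k * \<psi>)"
    "\<And>(X :: nat \<Rightarrow> ennreal) l. (\<Sum>k\<le>m. \<Sum>i<l. X (e k + i)) \<le> ennreal (real l * real q) * (\<Sum>i<e 0 + l. X i)"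
proof -
  define e where "e k = (LEAST i. t * \<tau> ^ k < 2 * (2 ^ i * \<psi>))" for k
  have up: "t * \<tau> ^ k < 2 * (2 ^ e k * \<psi>)" for k
  proof -
    obtain i where "t * \<tau> ^ k / \<psi> < 2 ^ i" using real_arch_pow[of 2] by auto
    then have "t * \<tau> ^ k < 2 ^ i * \<psi>" using \<psi> by (simp add: field_simps)
    also have "\<dots> < 2 * (2 ^ i * \<psi>)" using \<psi> by simp
    finally have "\<exists>i. t * \<tau> ^ k < 2 * (2 ^ i * \<psi>)" by blast
    then show ?thesis unfolding e_def by (rule LeastI_ex)
  qed
  have lo: "2 ^ e k * \<psi> \<le> t * \<tau> ^ k" if k: "k \<le> m" for k
  proof (cases "e k")
    case 0
    have "t * \<tau> ^ m \<le> t * \<tau> ^ k" using t \<tau> k by (intro mult_left_mono power_decreasing) auto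
    then show ?thesis using m 0 by simp
  next
    case (Suc i)
    then show ?thesis using not_less_Least[of i "\<lambda>i. t * \<tau> ^ k < 2 * (2 ^ i * \<psi>)"] by (simp add: e_def mult.assoc)
  qed
  have anti: "e k \<le> e 0" for k
    unfolding e_def[of k]
  proof (rule Least_le)
    have "t * \<tau> ^ k \<le> t * \<tau> ^ 0" using t \<tau> by (intro mult_left_mono power_decreasing) auto
    then show "t * \<tau> ^ k < 2 * (2 ^ e 0 * \<psi>)" using up[of 0] by linarith
  qed
  have fibre: "card {k \<in> {..m}. e k = v} \<le> q" for v
  proof (cases "{k \<in> {..m}. e k = v} = {}")
    case False
    define k0 where "k0 = Min {k \<in> {..m}. e k = v}"
    have k0: "k0 \<in> {k \<in> {..m}. e k = v}" unfolding k0_def using False by (intro Min_in) auto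
    have "{k \<in> {..m}. e k = v} \<subseteq> {k0..<k0 + q}"
    proof
      fix k assume k: "k \<in> {k \<in> {..m}. e k = v}"
      have "k0 \<le> k" unfolding k0_def using k by (intro Min_le) auto
      moreover have "k < k0 + q"
      proof (rule ccontr)
        assume "\<not> ?thesis"
        then have "t * \<tau> ^ k \<le> t * \<tau> ^ (k0 + q)" using t \<tau> by (intro mult_left_mono power_decreasing) auto
        also have "\<dots> = t * \<tau> ^ k0 * \<tau> ^ q" by (simp add: power_add)
        also have "\<dots> \<le> t * \<tau> ^ k0 * (1/2)" using t \<tau> q by (intro mult_left_mono) auto
        also have "\<dots> < 2 ^ e k0 * \<psi>" using up[of k0] by simp
        also have "\<dots> \<le> t * \<tau> ^ k" using lo[of k] k k0 by simp
        finally show False by simp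
      qed
      ultimately show "k \<in> {k0..<k0 + q}" by simp
    qed
    then show ?thesis using card_mono[of "{k0..<k0 + q}"] by fastforce
  next
    case True
    then show ?thesis by (simp only: card.empty)
  qed
  have "(\<Sum>k\<le>m. \<Sum>i<l. X (e k + i)) \<le> ennreal (real l * real q) * (\<Sum>i<e 0 + l. X i)" for X :: "nat \<Rightarrow> ennreal" and l
  proof -
    have one: "(\<Sum>k\<le>m. X (e k + i)) \<le> of_nat q * (\<Sum>i<e 0 + l. X i)" if i: "i < l" for i
    proof -
      have "(\<Sum>k\<le>m. X (e k + i)) = (\<Sum>v\<in>e ` {..m}. \<Sum>k\<in>{k \<in> {..m}. e k = v}. X (e k + i))"
        by (rule sum.image_gen) simp
      also have "\<dots> = (\<Sum>v\<in>e ` {..m}. of_nat (card {k \<in> {..m}. e k = v}) * X (v + i))"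
        by (intro sum.cong refl) simp
      also have "\<dots> \<le> (\<Sum>v\<in>e ` {..m}. of_nat q * X (v + i))"
        using fibre by (intro sum_mono mult_right_mono) auto
      also have "\<dots> \<le> (\<Sum>v\<le>e 0. of_nat q * X (v + i))" using anti by (intro sum_mono2) auto
      also have "\<dots> = of_nat q * (\<Sum>v\<in>(\<lambda>v. v + i) ` {..e 0}. X v)"
        by (simp add: sum_distrib_left sum.reindex)
      also have "\<dots> \<le> of_nat q * (\<Sum>i<e 0 + l. X i)" using i by (intro mult_left_mono sum_mono2) auto
      finally show ?thesis .
    qed
    have "(\<Sum>k\<le>m. \<Sum>i<l. X (e k + i)) = (\<Sum>i<l. \<Sum>k\<le>m. X (e k + i))" by (rule sum.swap)
    also have "\<dots> \<le> (\<Sum>i<l. of_nat q * (\<Sum>i<e 0 + l. X i))" using one by (intro sum_mono) auto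
    also have "\<dots> = ennreal (real l * real q) * (\<Sum>i<e 0 + l. X i)"
      by (simp add: ennreal_mult ennreal_of_nat_eq_real_of_nat mult.assoc)
    finally show ?thesis .
  qed
  with lo up show ?thesis using that by blast
qed

text \<open>For \<open>x = 1 / \<epsilon> \<ge> 2\<close> the factor \<open>x ^ c \<ge> 2 ^ c\<close> absorbs the constant, and \<open>exp y \<ge> y\<close>.\<close>

lemma exp_dominates_power:
  fixes A :: real
  shows "\<exists>\<alpha>0>0. \<forall>\<alpha>\<ge>\<alpha>0. \<forall>\<epsilon>\<in>{0<..<1/2}. A * (1 / \<epsilon>) ^ b \<le> exp (\<epsilon> powr (- \<alpha>))"
proof -
  obtain c :: nat where c: "A < 2 ^ c" using real_arch_pow[of 2 A] by auto
  have "A * (1 / \<epsilon>) ^ b \<le> exp (\<epsilon> powr (- \<alpha>))" if \<alpha>: "real (b + c + 1) \<le> \<alpha>" and \<epsilon>: "0 < \<epsilon>" "\<epsilon> < 1/2" for \<alpha> \<epsilon> :: real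
  proof -
    have x: "2 \<le> 1 / \<epsilon>" using \<epsilon> by (simp add: field_simps)
    have "A * (1 / \<epsilon>) ^ b \<le> (1 / \<epsilon>) ^ c * (1 / \<epsilon>) ^ b"
      using c power_mono[OF x, of c] \<epsilon> by (intro mult_right_mono) auto
    also have "\<dots> = (1 / \<epsilon>) ^ (c + b)" by (simp only: power_add)
    also have "\<dots> \<le> (1 / \<epsilon>) ^ (b + c + 1)" using x by (intro power_increasing) auto
    also have "\<dots> = (1 / \<epsilon>) powr real (b + c + 1)" using \<epsilon> by (subst powr_realpow) auto
    also have "\<dots> \<le> (1 / \<epsilon>) powr \<alpha>" using \<alpha> x by (intro powr_mono) auto
    also have "\<dots> = \<epsilon> powr (- \<alpha>)" using \<epsilon> by (simp add: powr_divide powr_minus_divide)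
    also have "\<dots> \<le> exp (\<epsilon> powr (- \<alpha>))" using exp_ge_add_one_self[of "\<epsilon> powr (- \<alpha>)"] by linarith
    finally show ?thesis .
  qed
  then show ?thesis by (intro exI[of _ "real (b + c + 1)"]) auto
qed

section \<open>Summation over the cubes\<close>

locale cube_setting = convex_target G H N K p + carnot_cubes G \<Delta>
  for G :: "'a::euclidean_space carnot" and H :: "'b::euclidean_space carnot" and N K p
    and \<Delta> :: "('a, 'i) cube_system"
begin

text \<open>Points that are rounded by at most \<open>\<psi>\<close> change distances above the scale \<open>\<psi>\<close> by a factor only.\<close>

lemma rounded_map:
  assumes C: "0 \<le> C"
  shows "\<exists>C'\<ge>1. \<forall>h \<psi>. 0 < \<psi> \<and> (\<forall>x y. N (- h x \<star> h y) \<le> C * max (G.hdist x y) \<psi>) \<longrightarrow>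
    (\<exists>f\<in>borel_measurable borel. (\<forall>x. N (- h x \<star> f x) \<le> C' * \<psi>) \<and>
       (\<forall>x y. N (- f x \<star> f y) \<le> C' * max (G.hdist x y) \<psi>))"
proof -
  obtain Q where Q: "Q \<ge> 1" "\<And>x y. G.hnorm (x \<cdot> y) \<le> Q * (G.hnorm x + G.hnorm y)"
    using G.hnorm_quasi_triangle by blast
  define C' where "C' = max 1 (C * (3 * Q * Q))"
  have C': "1 \<le> C'" "C * (3 * Q * Q) \<le> C'" by (simp_all add: C'_def)
  have "C * 1 \<le> C * (3 * Q * Q)" using C Q(1) mult_mono[of 1 Q 1 Q] by (intro mult_left_mono) auto
  then have C'2: "C \<le> C'" using C' by simp
  have "\<exists>f\<in>borel_measurable borel. (\<forall>x. N (- h x \<star> f x) \<le> C' * \<psi>) \<and>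
       (\<forall>x y. N (- f x \<star> f y) \<le> C' * max (G.hdist x y) \<psi>)"
    if \<psi>: "0 < \<psi>" and lip: "\<And>x y. N (- h x \<star> h y) \<le> C * max (G.hdist x y) \<psi>" for h \<psi>
  proof -
    obtain f where f: "f \<in> borel_measurable borel" "\<And>x. \<exists>y. G.hdist x y \<le> \<psi> \<and> f x = h y"
      using G.measurable_rounding[OF \<psi>] by blast
    have "N (- h x \<star> f x) \<le> C' * \<psi>" for x
    proof -
      obtain y where y: "G.hdist x y \<le> \<psi>" "f x = h y" using f(2) by blast
      then have "N (- h x \<star> f x) \<le> C * \<psi>" using lip[of x y] by (simp add: max_absorb2)
      also have "\<dots> \<le> C' * \<psi>" using C'2 \<psi> by (intro mult_right_mono) auto
      finally show ?thesis .
    qed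
    moreover have "N (- f x \<star> f x') \<le> C' * max (G.hdist x x') \<psi>" for x x'
    proof -
      define D where "D = max (G.hdist x x') \<psi>"
      have D: "G.hdist x x' \<le> D" "\<psi> \<le> D" "0 < D" using \<psi> by (auto simp: D_def)
      obtain y where y: "G.hdist x y \<le> \<psi>" "f x = h y" using f(2) by blast
      obtain y' where y': "G.hdist x' y' \<le> \<psi>" "f x' = h y'" using f(2) by blast
      have yx: "G.hdist y x \<le> \<psi>"
        using y(1) G.hnorm_neg[of "- x \<cdot> y"] by (simp add: G.neg_mult del: G.hnorm_neg)
      have "- y \<cdot> y' = (- y \<cdot> x) \<cdot> ((- x \<cdot> x') \<cdot> (- x' \<cdot> y'))"
        by (simp add: G.mult_assoc)
      then have "G.hdist y y' \<le> Q * (G.hdist y x + G.hnorm ((- x \<cdot> x') \<cdot> (- x' \<cdot> y')))"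
        using Q(2) by simp
      also have "\<dots> \<le> Q * (D + Q * (D + D))"
      proof (intro mult_left_mono add_mono)
        show "G.hdist y x \<le> D" using yx D by simp
        have "G.hnorm ((- x \<cdot> x') \<cdot> (- x' \<cdot> y')) \<le> Q * (G.hdist x x' + G.hdist x' y')"
          by (rule Q(2))
        also have "\<dots> \<le> Q * (D + D)" using y'(1) D Q(1) by (intro mult_left_mono add_mono) auto
        finally show "G.hnorm ((- x \<cdot> x') \<cdot> (- x' \<cdot> y')) \<le> Q * (D + D)" .
      qed (use Q(1) in auto)
      also have "\<dots> \<le> Q * (Q * D + Q * (D + D))"
        using Q(1) D mult_right_mono[of 1 Q D] by (intro mult_left_mono add_mono) auto
      also have "\<dots> = (3 * Q * Q) * D" by (simp add: algebra_simps)
      finally have 1: "G.hdist y y' \<le> (3 * Q * Q) * D" .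
      have "1 * D \<le> (3 * Q * Q) * D" using Q(1) D mult_mono[of 1 Q 1 Q] by (intro mult_right_mono) auto
      then have "max (G.hdist y y') \<psi> \<le> (3 * Q * Q) * D" using 1 D by linarith
      then have "C * max (G.hdist y y') \<psi> \<le> C * ((3 * Q * Q) * D)" using C by (intro mult_left_mono)
      also have "\<dots> \<le> C' * D" using C'(2) D by (simp add: mult.assoc[symmetric] mult_right_mono)
      finally show ?thesis using lip[of y y'] y(2) y'(2) by (simp add: D_def)
    qed
    ultimately show ?thesis using f(1) by blast
  qed
  then show ?thesis using C'(1) by blast
qed

text \<open>The accuracy is \<open>d = cd \<epsilon>\<close>, and \<open>\<psi>\<close> is so much smaller than all the cubes that it is below \<open>d ^ q\<close> times the scale \<open>\<rho>\<close> used
  for a cube.  That scale is the dyadic one next to \<open>\<mu> d ^ q\<close> times the length of the cube; the factor \<open>d ^ q\<close> leaves room for the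
  scales up to \<open>2 ^ k' \<rho>\<close>, with \<open>2 ^ k'\<close> about \<open>1 / d ^ q\<close>, which the rigidity theorem inspects.  A bad cube \<open>Q\<close> then
  carries the defect \<open>Y |Q|\<close>, where \<open>Y\<close> is a power of \<open>d\<close>.\<close>

theorem sum_of_deviating_cubes:
  assumes C: "0 \<le> C"
  shows "\<exists>\<alpha>>0. \<exists>\<beta>>0. \<exists>\<zeta>>0. \<forall>\<epsilon>\<in>{0<..<1/2}. \<forall>m h j. \<forall>\<sigma>\<in>cube_index \<Delta> j. \<forall>\<psi> bad.
     \<psi> = exp (- (\<epsilon> powr (- \<alpha>))) * (cube_ratio \<Delta> ^ m * cube_length \<Delta> j) \<longrightarrow>
     (\<forall>x y. N (- h x \<star> h y) \<le> C * max (G.hdist x y) \<psi>) \<longrightarrow>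
     (\<forall>k\<le>m. finite (bad k) \<and> bad k \<subseteq> subcubes \<Delta> j \<sigma> k \<and>
        (\<forall>\<omega>\<in>bad k. \<forall>T\<in>lipschitz_homs G H N. \<forall>g. \<exists>x\<in>cube_ball G \<Delta> (\<zeta> * \<epsilon> powr \<beta>) (j + int k) \<omega>.
           \<epsilon> * (\<zeta> * \<epsilon> powr \<beta> * inner_const \<Delta> * cube_length \<Delta> (j + int k)) < N (- h x \<star> (g \<star> T x)))) \<longrightarrow>
     (\<Sum>k\<le>m. \<Sum>\<omega>\<in>bad k. measure lebesgue (cube \<Delta> (j + int k) \<omega>))
       \<le> exp (\<epsilon> powr (- \<alpha>)) * measure lebesgue (cube \<Delta> j \<sigma>)"
proof -
  let ?\<tau> = "cube_ratio \<Delta>"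
  have \<tau>: "0 < ?\<tau>" "?\<tau> < 1" using cube_ratio by auto
  obtain c CC where c: "c > 0" "CC > 0" "\<And>x y. c * G.hdist x y \<le> cc_dist G x y \<and> cc_dist G x y \<le> CC * G.hdist x y"
    using G.cc_dist_comparable by blast
  obtain QH where QH: "QH \<ge> 1" "\<And>x y. N (x \<star> y) \<le> QH * (N x + N y)" using H.N_quasi_triangle by blast
  obtain QG where QG: "QG \<ge> 1" "\<And>x y. G.hnorm (x \<cdot> y) \<le> QG * (G.hnorm x + G.hnorm y)"
    using G.hnorm_quasi_triangle by blast
  obtain M where M: "M \<ge> 1" "\<And>n v. v \<in> grid_vectors n \<Longrightarrow> v \<in> layer G 1 \<and> norm v \<le> M \<and> G.hnorm v \<le> M"
    using grid_vectors_bound by blast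
  obtain ci co where ci: "0 < ci" and co: "0 < co"
    and inner: "\<And>\<omega> k. \<omega> \<in> cube_index \<Delta> k \<Longrightarrow> G.hball (cube_centre \<Delta> k \<omega>) (ci * cube_length \<Delta> k) \<subseteq> cube \<Delta> k \<omega>"
    and outer: "\<And>\<omega> k. \<omega> \<in> cube_index \<Delta> k \<Longrightarrow> cube \<Delta> k \<omega> \<subseteq> G.hball (cube_centre \<Delta> k \<omega>) (co * cube_length \<Delta> k)"
    using cubes_comparable_balls by metis
  obtain C1 where C1: "C1 \<ge> 1" and rounded: "\<And>h \<psi>. 0 < \<psi> \<and> (\<forall>x y. N (- h x \<star> h y) \<le> C * max (G.hdist x y) \<psi>) \<Longrightarrow>
    (\<exists>f\<in>borel_measurable borel. (\<forall>x. N (- h x \<star> f x) \<le> C1 * \<psi>) \<and>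
       (\<forall>x y. N (- f x \<star> f y) \<le> C1 * max (G.hdist x y) \<psi>))"
    using rounded_map[OF C] by blast
  obtain \<rho>0 R a q where \<rho>0: "\<rho>0 > 0" and R: "R \<ge> 1" and a: "a \<ge> 1" and q: "q \<ge> 1" and alt: "\<forall>d n k \<theta> \<kappa> r \<rho> f z.
     0 < d \<and> d \<le> 1/2 \<and> 1 \<le> real n * d ^ a \<and> real n * d ^ (a + 1) \<le> 1 \<and> 0 < \<rho> \<and>
     0 \<le> r \<and> r \<le> d ^ q * \<rho> \<and> 0 < \<kappa> \<and> \<kappa> \<le> d ^ q \<and> 1 / 2 ^ k \<le> d ^ q \<and> real k * \<theta> \<le> d ^ q \<and> 0 < \<theta> \<and> \<theta> \<le> d ^ q \<and>
     f \<in> borel_measurable borel \<and> (\<forall>x y. N (- f x \<star> f y) \<le> C1 * max (G.hdist x y) r) \<longrightarrow>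
     (\<exists>T\<in>lipschitz_homs G H N. \<exists>g. \<forall>x. G.hdist z x \<le> \<rho>0 * \<rho> \<longrightarrow> N (- f x \<star> (g \<star> T x)) \<le> d * \<rho>) \<or>
     ennreal (\<theta> powr p * G.volume (\<kappa> * \<rho>))
       \<le> (\<Sum>i<Suc k. \<integral>\<^sup>+x\<in>G.hball z (R * \<rho>). ennreal (grid_defect n f (2 ^ i * (\<rho> / 2)) x) \<partial>lborel)"
    using approximable_or_large_defect[OF C1] by (elim exE conjE) (rule that)
  obtain A where A: "A \<ge> 0" and total: "\<forall>n f r U W m. 0 < r \<and> f \<in> borel_measurable borel \<and>
      (\<forall>x y. N (- f x \<star> f y) \<le> C1 * max (G.hdist x y) r) \<and>
      U \<in> sets borel \<and> W \<in> sets borel \<and>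
      (\<forall>x\<in>U. \<forall>v\<in>grid_vectors n. \<forall>l<2 ^ m. x \<cdot> ((real l * r) *\<^sub>R v) \<in> W) \<longrightarrow>
    (\<Sum>i<m. \<integral>\<^sup>+x\<in>U. ennreal (grid_defect n f (2 ^ i * r) x) \<partial>lborel)
      \<le> ennreal (A * real (card (grid_vectors n))) * emeasure lborel W"
    using total_grid_defect[OF order_trans[OF zero_le_one C1]] by (elim exE conjE) (rule that)
  obtain q0 where q0: "?\<tau> ^ q0 \<le> 1/2" using real_arch_pow_inv[of "1/2" ?\<tau>] \<tau> by (auto intro: less_imp_le)
  \<comment> \<open>the ball \<open>\<eta> B\<^sub>Q\<close> has to lie inside the region of approximation at scale \<open>\<rho>\<close>, and \<open>R \<rho>\<close> inside the cube\<close>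
  define \<mu> where "\<mu> = min 1 (ci / R)"
  have \<mu>: "0 < \<mu>" "R * \<mu> \<le> ci" "\<mu> \<le> 1" using ci R by (auto simp: \<mu>_def min_def field_simps)
  define cd where "cd = min 1 (c * \<rho>0 / (2 * (QH * (C1 + 1))))"
  have cd: "0 < cd" "cd \<le> 1" "2 * (QH * (C1 + 1)) * cd \<le> c * \<rho>0"
  proof -
    define D where "D = 2 * (QH * (C1 + 1))"
    have D: "0 < D" using QH(1) C1 by (simp add: D_def)
    have cd_D: "cd = min 1 (c * \<rho>0 / D)" by (simp add: cd_def D_def)
    have "D * cd \<le> D * (c * \<rho>0 / D)" unfolding cd_D using D by (intro mult_left_mono) auto
    then show "2 * (QH * (C1 + 1)) * cd \<le> c * \<rho>0" using D by (simp flip: D_def)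
    show "0 < cd" "cd \<le> 1" using D c(1) \<rho>0 by (simp_all add: cd_D)
  qed
  define \<zeta> where "\<zeta> = \<mu> * c * \<rho>0 / (2 * inner_const \<Delta>) * cd ^ q"
  have \<zeta>: "0 < \<zeta>" using \<mu> c \<rho>0 cd inner_const_pos by (simp add: \<zeta>_def)
  obtain b where b: "b \<ge> 2 * q" "\<And>d. 0 < d \<and> d \<le> 1/2 \<Longrightarrow> (2 * co / \<mu>) * d ^ b \<le> d ^ (2 * q)"
    using absorb_constant[of "2 * q" "2 * co / \<mu>"] by blast
  obtain qv where qv: "\<And>d \<rho>. 0 < d \<and> d \<le> 1/2 \<and> 0 < \<rho> \<Longrightarrow> d ^ qv * G.volume \<rho> \<le> G.volume (d * \<rho>)"
    using G.volume_scale_down by blast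
  define C4 where "C4 = QG * (co + 2 * M)"
  obtain Dv where Dv: "Dv \<ge> 1" "\<And>\<rho>. \<rho> > 0 \<Longrightarrow> G.volume (C4 / ci * \<rho>) \<le> Dv * G.volume \<rho>"
    using G.volume_scale_up by blast
  obtain np where np: "p \<le> real np" using real_arch_simple by blast
  define ex where "ex = q + (a + 1) + (2 * q + 1) * np + b * qv"
  define cb where "cb = real (card G.hbasis)"
  define A1 where "A1 = 2 * real q0 * (A * (3 * cb)) * Dv"
  have cb0: "0 \<le> cb" by (simp add: cb_def)
  have A1: "0 \<le> A1" using A Dv(1) by (simp add: A1_def cb_def)
  obtain \<alpha>1 where \<alpha>1: "\<alpha>1 > 0" "\<And>\<alpha> \<epsilon>. \<alpha>1 \<le> \<alpha> \<Longrightarrow> \<epsilon> \<in> {0<..<1/2} \<Longrightarrow> A1 * (1 / cd) ^ ex * (1 / \<epsilon>) ^ ex \<le> exp (\<epsilon> powr (- \<alpha>))"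
    using exp_dominates_power[of "A1 * (1 / cd) ^ ex" ex] by blast
  obtain \<alpha>2 where \<alpha>2: "\<alpha>2 > 0" "\<And>\<alpha> \<epsilon>. \<alpha>2 \<le> \<alpha> \<Longrightarrow> \<epsilon> \<in> {0<..<1/2} \<Longrightarrow> 2 / \<mu> * (1 / cd) ^ (2 * q) * (1 / \<epsilon>) ^ (2 * q) \<le> exp (\<epsilon> powr (- \<alpha>))"
    using exp_dominates_power[of "2 / \<mu> * (1 / cd) ^ (2 * q)" "2 * q"] by blast
  define \<alpha> where "\<alpha> = max \<alpha>1 \<alpha>2"
  have "(\<Sum>k\<le>m. \<Sum>\<omega>\<in>bad k. measure lebesgue (cube \<Delta> (j + int k) \<omega>))
       \<le> exp (\<epsilon> powr (- \<alpha>)) * measure lebesgue (cube \<Delta> j \<sigma>)"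
    if \<epsilon>: "\<epsilon> \<in> {0<..<1/2}" and \<sigma>: "\<sigma> \<in> cube_index \<Delta> j"
      and \<psi>_def: "\<psi> = exp (- (\<epsilon> powr (- \<alpha>))) * (?\<tau> ^ m * cube_length \<Delta> j)"
      and lip: "\<forall>x y. N (- h x \<star> h y) \<le> C * max (G.hdist x y) \<psi>"
      and bad: "\<forall>k\<le>m. finite (bad k) \<and> bad k \<subseteq> subcubes \<Delta> j \<sigma> k \<and>
        (\<forall>\<omega>\<in>bad k. \<forall>T\<in>lipschitz_homs G H N. \<forall>g. \<exists>x\<in>cube_ball G \<Delta> (\<zeta> * \<epsilon> powr real q) (j + int k) \<omega>.
           \<epsilon> * (\<zeta> * \<epsilon> powr real q * inner_const \<Delta> * cube_length \<Delta> (j + int k)) < N (- h x \<star> (g \<star> T x)))"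
    for \<epsilon> m h j \<sigma> \<psi> bad
  proof -
    define len where "len k = cube_length \<Delta> (j + int k)" for k
    have len: "len k = cube_length \<Delta> j * ?\<tau> ^ k" "0 < len k" for k
      by (simp_all add: len_def cube_length_add cube_length_pos \<tau>)
    have len0: "0 < cube_length \<Delta> j" by (rule cube_length_pos)
    define d where "d = cd * \<epsilon>"
    have "cd * \<epsilon> \<le> 1 * (1/2)" using cd \<epsilon> by (intro mult_mono) auto
    then have d: "0 < d" "d \<le> 1/2" using cd \<epsilon> by (auto simp: d_def)
    have inv_d: "(1 / cd) ^ i * (1 / \<epsilon>) ^ i = 1 / d ^ i" for i by (simp add: d_def power_mult_distrib power_one_over)
    define t where "t = \<mu> * d ^ q * cube_length \<Delta> j"
    have t: "0 < t" using \<mu> d len0 by (simp add: t_def)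
    have tk: "t * ?\<tau> ^ k = \<mu> * d ^ q * len k" for k by (simp add: t_def len(1))
    have \<eta>: "\<zeta> * \<epsilon> powr real q * inner_const \<Delta> * len k = t * ?\<tau> ^ k * (c * \<rho>0) / 2" for k
      using inner_const_pos \<epsilon> by (simp add: \<zeta>_def tk d_def powr_realpow power_mult_distrib)
    have \<psi>: "0 < \<psi>" using \<tau> len0 by (simp add: \<psi>_def)
    have \<psi>small: "\<psi> \<le> \<mu> * d ^ (2 * q) / 2 * len k" if k: "k \<le> m" for k
    proof -
      have "2 / \<mu> * (1 / d ^ (2 * q)) \<le> exp (\<epsilon> powr (- \<alpha>))"
        using \<alpha>2(2)[OF max.cobounded2[of _ \<alpha>1] \<epsilon>] unfolding mult.assoc inv_d \<alpha>_def by (simp only: max.commute)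
      then have e: "exp (- (\<epsilon> powr (- \<alpha>))) \<le> \<mu> * d ^ (2 * q) / 2"
        using \<mu> d by (simp add: exp_minus field_simps)
      have "?\<tau> ^ m * cube_length \<Delta> j \<le> len k"
        unfolding len(1) using \<tau> len0 k by (simp add: mult.commute mult_left_mono power_decreasing)
      then show ?thesis unfolding \<psi>_def using e \<tau> len0 \<mu> d by (intro mult_mono) auto
    qed
    obtain f where f [measurable]: "f \<in> borel_measurable borel" and hf: "\<And>x. N (- h x \<star> f x) \<le> C1 * \<psi>"
      and lipf: "\<forall>x y. N (- f x \<star> f y) \<le> C1 * max (G.hdist x y) \<psi>"
      using rounded[of \<psi> h] \<psi> lip by blast
    have dd: "d ^ (2 * q) = d ^ q * d ^ q" by (simp add: mult_2 power_add)
    have dq: "0 < d ^ q" "d ^ q \<le> 1/2" using power_small_range[OF d q] by auto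
    obtain k' :: nat where k': "1 / 2 ^ k' \<le> d ^ q" "2 ^ k' * d ^ q \<le> 2"
      using dyadic_power_between[of "d ^ q"] dq by auto
    obtain n :: nat where n: "1 \<le> real n * d ^ a" "real n * d ^ (a + 1) \<le> 1"
      using grid_fineness[OF d] by blast
    define \<theta> where "\<theta> = d ^ (2 * q + 1)"
    have \<theta>: "0 < \<theta>" "\<theta> \<le> d ^ q" using d power_small_mono[OF d, of q "2 * q + 1"] by (auto simp: \<theta>_def)
    have k'\<theta>: "real k' * \<theta> \<le> d ^ q"
    proof -
      have "real k' * \<theta> \<le> 2 ^ k' * \<theta>" using \<theta> less_imp_le[OF of_nat_less_two_power[of k', where 'a = real]] by (intro mult_right_mono) auto
      also have "\<dots> = (2 ^ k' * d ^ q) * (d ^ q * d)" by (simp add: \<theta>_def power_add mult_2)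
      also have "\<dots> \<le> 2 * (d ^ q * d)" using k'(2) dq d by (intro mult_right_mono) auto
      also have "\<dots> \<le> d ^ q" using dq d by simp
      finally show ?thesis .
    qed
    have "2 * \<psi> \<le> t * ?\<tau> ^ m"
    proof -
      have "2 * \<psi> \<le> \<mu> * d ^ (2 * q) * len m" using \<psi>small[of m] by simp
      also have "\<dots> \<le> t * ?\<tau> ^ m"
        unfolding tk using power_small_mono[OF d, of q "2 * q"] \<mu> len(2)[of m] by (intro mult_right_mono mult_left_mono) auto
      finally show ?thesis .
    qed
    then obtain e where e: "\<And>k. k \<le> m \<Longrightarrow> 2 ^ e k * (2 * \<psi>) \<le> t * ?\<tau> ^ k \<and> t * ?\<tau> ^ k < 2 * (2 ^ e k * (2 * \<psi>))"
      and e_count: "\<And>(X :: nat \<Rightarrow> ennreal) l. (\<Sum>k\<le>m. \<Sum>i<l. X (e k + i)) \<le> ennreal (real l * real q0) * (\<Sum>i<e 0 + l. X i)"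
      by (rule dyadic_scales[OF \<tau> q0 t mult_pos_pos[OF zero_less_numeral \<psi>]]) (rule that)
    define \<rho> where "\<rho> k = 2 ^ e k * (2 * \<psi>)" for k
    have \<rho>: "\<rho> k \<le> t * ?\<tau> ^ k" "t * ?\<tau> ^ k < 2 * \<rho> k" if "k \<le> m" for k using e[OF that] by (auto simp: \<rho>_def)
    have \<rho>pos: "0 < \<rho> k" for k using \<psi> by (simp add: \<rho>_def)
    define X where "X = (\<lambda>i. \<integral>\<^sup>+x\<in>G.hball (cube_centre \<Delta> j \<sigma>) (co * cube_length \<Delta> j). ennreal (grid_defect n f (2 ^ i * \<psi>) x) \<partial>lborel)"
    define Y where "Y = \<theta> powr p * (d ^ b) ^ qv"
    have Y: "0 < Y" using \<theta> d by (simp add: Y_def)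
    \<comment> \<open>were the rounded map \<open>f\<close> close to an affine map at scale \<open>\<rho> k\<close>, then so would be \<open>h\<close>, and \<open>\<omega>\<close> would not be bad\<close>
    have energy: "ennreal (Y * measure lebesgue (cube \<Delta> (j + int k) \<omega>))
        \<le> (\<Sum>i<Suc k'. \<integral>\<^sup>+x\<in>G.hball (cube_centre \<Delta> (j + int k) \<omega>) (R * \<rho> k). ennreal (grid_defect n f (2 ^ (e k + i) * \<psi>) x) \<partial>lborel)"
      if k: "k \<le> m" and \<omega>: "\<omega> \<in> bad k" for k \<omega>
    proof -
      let ?z = "cube_centre \<Delta> (j + int k) \<omega>"
      have \<omega>i: "\<omega> \<in> cube_index \<Delta> (j + int k)" using bad k \<omega> by (auto simp: subcubes_def)
      have r: "\<psi> \<le> d ^ q * \<rho> k"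
      proof -
        have "\<psi> \<le> d ^ q * (\<mu> * d ^ q * len k / 2)" using \<psi>small[OF k] unfolding dd by (simp add: mult_ac)
        also have "\<dots> \<le> d ^ q * \<rho> k" using \<rho>(2)[OF k] dq unfolding tk by (intro mult_left_mono) auto
        finally show ?thesis .
      qed
      have "\<not> (\<exists>T\<in>lipschitz_homs G H N. \<exists>g. \<forall>x. G.hdist ?z x \<le> \<rho>0 * \<rho> k \<longrightarrow> N (- f x \<star> (g \<star> T x)) \<le> d * \<rho> k)"
        (is "\<not> ?near")
      proof
        assume ?near
        then obtain T g where T: "T \<in> lipschitz_homs G H N"
          and near: "\<And>x. G.hdist ?z x \<le> \<rho>0 * \<rho> k \<Longrightarrow> N (- f x \<star> (g \<star> T x)) \<le> d * \<rho> k" by blast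
        obtain x where x: "x \<in> cube_ball G \<Delta> (\<zeta> * \<epsilon> powr real q) (j + int k) \<omega>"
          and far: "\<epsilon> * (t * ?\<tau> ^ k * (c * \<rho>0) / 2) < N (- h x \<star> (g \<star> T x))"
          using bad k \<omega> T unfolding \<eta>[symmetric] len_def by meson
        have "cc_dist G ?z x < t * ?\<tau> ^ k * (c * \<rho>0) / 2"
          using x \<eta>[of k] by (simp add: cube_ball_def cc_ball_def len_def mult.assoc)
        also have "\<dots> \<le> (2 * \<rho> k) * (c * \<rho>0) / 2" using \<rho>(2)[OF k] c \<rho>0 by (intro divide_right_mono mult_right_mono) auto
        finally have "c * G.hdist ?z x \<le> c * (\<rho>0 * \<rho> k)" using c(3)[of ?z x] by (simp add: mult_ac)
        then have "G.hdist ?z x \<le> \<rho>0 * \<rho> k" using c(1) by simp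
        then have 1: "N (- f x \<star> (g \<star> T x)) \<le> d * \<rho> k" by (rule near)
        have "C1 * \<psi> \<le> C1 * (d ^ q * \<rho> k)" using r C1 by (intro mult_left_mono) auto
        also have "\<dots> \<le> C1 * (d * \<rho> k)"
          using power_small_mono[OF d q] C1 \<rho>pos[of k] by (intro mult_left_mono mult_right_mono) auto
        finally have 2: "N (- h x \<star> f x) \<le> C1 * (d * \<rho> k)" using hf order_trans by blast
        have "N (- h x \<star> (g \<star> T x)) = N ((- h x \<star> f x) \<star> (- f x \<star> (g \<star> T x)))"
          by (simp add: H.mult_assoc)
        also have "\<dots> \<le> QH * (N (- h x \<star> f x) + N (- f x \<star> (g \<star> T x)))" by (rule QH(2))
        also have "\<dots> \<le> QH * (C1 * (d * \<rho> k) + d * \<rho> k)" using 1 2 QH(1) by (intro mult_left_mono add_mono) auto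
        also have "\<dots> = (2 * (QH * (C1 + 1)) * cd) * (\<epsilon> * \<rho> k / 2)" by (simp add: d_def algebra_simps)
        also have "\<dots> \<le> (c * \<rho>0) * (\<epsilon> * (t * ?\<tau> ^ k) / 2)"
          using \<rho>(1)[OF k] \<rho>pos[of k] \<epsilon> c(1) \<rho>0 by (intro mult_mono[OF cd(3)]) auto
        finally show False using far by (simp add: mult_ac)
      qed
      moreover have "?near \<or> ennreal (\<theta> powr p * G.volume (d ^ q * \<rho> k))
          \<le> (\<Sum>i<Suc k'. \<integral>\<^sup>+x\<in>G.hball ?z (R * \<rho> k). ennreal (grid_defect n f (2 ^ i * (\<rho> k / 2)) x) \<partial>lborel)"
        by (rule alt[rule_format, of d n "\<rho> k" \<psi> "d ^ q" k' \<theta> f ?z]) (intro conjI d n \<rho>pos less_imp_le[OF \<psi>] r dq(1) order_refl k'(1) k'\<theta> \<theta> f lipf)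
      ultimately have "ennreal (\<theta> powr p * G.volume (d ^ q * \<rho> k))
          \<le> (\<Sum>i<Suc k'. \<integral>\<^sup>+x\<in>G.hball ?z (R * \<rho> k). ennreal (grid_defect n f (2 ^ i * (\<rho> k / 2)) x) \<partial>lborel)"
        by (simp only: simp_thms)
      moreover have "2 ^ i * (\<rho> k / 2) = 2 ^ (e k + i) * \<psi>" for i by (simp add: \<rho>_def power_add)
      moreover have "Y * measure lebesgue (cube \<Delta> (j + int k) \<omega>) \<le> \<theta> powr p * G.volume (d ^ q * \<rho> k)"
      proof -
        have "measure lebesgue (cube \<Delta> (j + int k) \<omega>) \<le> G.volume (co * len k)"
        proof -
          have "emeasure lebesgue (cube \<Delta> (j + int k) \<omega>) \<le> emeasure lebesgue (G.hball ?z (co * len k))"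
            using outer[OF \<omega>i] unfolding len_def by (intro emeasure_mono) auto
          also have "\<dots> = ennreal (G.volume (co * len k))" by (simp add: G.emeasure_hball)
          finally show ?thesis by (simp add: measure_def enn2real_leI G.volume_nonneg)
        qed
        then have "(d ^ b) ^ qv * measure lebesgue (cube \<Delta> (j + int k) \<omega>) \<le> (d ^ b) ^ qv * G.volume (co * len k)"
          using d by (intro mult_left_mono) auto
        also have "\<dots> \<le> G.volume (d ^ b * (co * len k))"
          using power_small_range[OF d, of b] b(1) q co len(2)[of k] by (intro qv) auto
        also have "\<dots> \<le> G.volume (d ^ q * \<rho> k)"
        proof (rule G.volume_mono)
          have "2 * co * d ^ b \<le> \<mu> * d ^ (2 * q)" using b(2)[of d] d \<mu> by (simp add: field_simps)
          then have "2 * co * d ^ b * len k \<le> \<mu> * d ^ (2 * q) * len k" using len(2)[of k] by (intro mult_right_mono) auto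
          also have "\<dots> = d ^ q * (t * ?\<tau> ^ k)" unfolding dd tk by (simp add: mult_ac)
          also have "\<dots> \<le> d ^ q * (2 * \<rho> k)" using \<rho>(2)[OF k] dq by (intro mult_left_mono) auto
          finally show "d ^ b * (co * len k) \<le> d ^ q * \<rho> k" by (simp add: mult_ac)
        qed
        finally show ?thesis unfolding Y_def using \<theta> by (simp add: mult.assoc mult_left_mono)
      qed
      ultimately show ?thesis by (simp only:) (rule order_trans[OF ennreal_leI])
    qed
    have generation: "ennreal Y * ennreal (\<Sum>\<omega>\<in>bad k. measure lebesgue (cube \<Delta> (j + int k) \<omega>)) \<le> (\<Sum>i<Suc k'. X (e k + i))"
      if k: "k \<le> m" for k
    proof -
      have bk: "finite (bad k)" "bad k \<subseteq> subcubes \<Delta> j \<sigma> k" using bad k by auto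
      have "ennreal Y * ennreal (\<Sum>\<omega>\<in>bad k. measure lebesgue (cube \<Delta> (j + int k) \<omega>))
          = (\<Sum>\<omega>\<in>bad k. ennreal (Y * measure lebesgue (cube \<Delta> (j + int k) \<omega>)))"
        using Y by (simp add: ennreal_mult'[symmetric] sum_distrib_left flip: sum_ennreal)
      also have "\<dots> \<le> (\<Sum>\<omega>\<in>bad k. \<Sum>i<Suc k'. \<integral>\<^sup>+x\<in>G.hball (cube_centre \<Delta> (j + int k) \<omega>) (R * \<rho> k). ennreal (grid_defect n f (2 ^ (e k + i) * \<psi>) x) \<partial>lborel)"
        by (intro sum_mono energy k)
      also have "\<dots> = (\<Sum>i<Suc k'. \<Sum>\<omega>\<in>bad k. \<integral>\<^sup>+x\<in>G.hball (cube_centre \<Delta> (j + int k) \<omega>) (R * \<rho> k). ennreal (grid_defect n f (2 ^ (e k + i) * \<psi>) x) \<partial>lborel)"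
        by (rule sum.swap)
      also have "\<dots> \<le> (\<Sum>i<Suc k'. X (e k + i))"
        unfolding X_def
      proof (intro sum_mono sum_over_inner_balls bk(1))
        show "bad k \<subseteq> cube_index \<Delta> (j + int k)" using bk by (auto simp: subcubes_def)
      next
        fix \<omega> assume "\<omega> \<in> bad k"
        then have \<omega>: "\<omega> \<in> cube_index \<Delta> (j + int k)" "cube \<Delta> (j + int k) \<omega> \<subseteq> cube \<Delta> j \<sigma>" using bk by (auto simp: subcubes_def)
        have "R * \<rho> k \<le> R * (\<mu> * 1 * len k)"
          using \<rho>(1)[OF k] R \<mu> dq len(2)[of k] unfolding tk
          by (intro mult_left_mono order_trans[OF \<rho>(1)[OF k, unfolded tk]] mult_right_mono) auto
        also have "\<dots> \<le> ci * len k" using mult_right_mono[OF \<mu>(2), of "len k"] len(2)[of k] by (simp add: mult.assoc)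
        finally have "G.hball (cube_centre \<Delta> (j + int k) \<omega>) (R * \<rho> k) \<subseteq> cube \<Delta> (j + int k) \<omega>"
          using G.hball_mono inner[OF \<omega>(1)] unfolding len_def by blast
        then show "G.hball (cube_centre \<Delta> (j + int k) \<omega>) (R * \<rho> k) \<in> sets borel \<and>
            G.hball (cube_centre \<Delta> (j + int k) \<omega>) (R * \<rho> k) \<subseteq> cube \<Delta> (j + int k) \<omega> \<and>
            G.hball (cube_centre \<Delta> (j + int k) \<omega>) (R * \<rho> k) \<subseteq> G.hball (cube_centre \<Delta> j \<sigma>) (co * cube_length \<Delta> j)"
          using \<omega>(2) outer[OF \<sigma>] by (simp add: G.borel_hball)
      qed simp_all
      finally show ?thesis .
    qed
    \<comment> \<open>horizontal translations by the largest scale in use still move the cube by a multiple of its size only\<close>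
    have "(\<Sum>i<e 0 + Suc k'. X i) \<le> ennreal (A * real (card (grid_vectors n))) * emeasure lborel (G.hball (cube_centre \<Delta> j \<sigma>) (C4 * cube_length \<Delta> j))"
      unfolding X_def
    proof (rule total[rule_format], intro conjI \<psi> f lipf G.borel_hball ballI allI impI)
      fix x v and l :: nat
      assume x: "x \<in> G.hball (cube_centre \<Delta> j \<sigma>) (co * cube_length \<Delta> j)" and v: "v \<in> grid_vectors n" and l: "l < 2 ^ (e 0 + Suc k')"
      let ?z = "cube_centre \<Delta> j \<sigma>"
      have "real l \<le> 2 ^ (e 0 + Suc k')" using l by (metis less_imp_le of_nat_le_numeral_power_cancel_iff of_nat_numeral)
      then have "real l * \<psi> \<le> 2 ^ k' * \<rho> 0"
        using mult_right_mono[of "real l" "2 ^ (e 0 + Suc k')" \<psi>] \<psi> by (simp add: \<rho>_def power_add mult_ac)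
      also have "\<dots> \<le> 2 ^ k' * (\<mu> * d ^ q * cube_length \<Delta> j)" using \<rho>(1)[of 0] by (simp add: t_def)
      also have "\<dots> = (2 ^ k' * d ^ q) * (\<mu> * cube_length \<Delta> j)" by simp
      also have "\<dots> \<le> 2 * (1 * cube_length \<Delta> j)" using k'(2) \<mu> len0 dq by (intro mult_mono) auto
      finally have l\<psi>: "real l * \<psi> \<le> 2 * cube_length \<Delta> j" by simp
      have "G.hnorm ((real l * \<psi>) *\<^sub>R v) = (real l * \<psi>) * G.hnorm v"
        using G.dilation_layer[of v 1 "real l * \<psi>"] G.hnorm_dilation[of "real l * \<psi>" v] M(2)[OF v] \<psi> by simp
      also have "\<dots> \<le> 2 * cube_length \<Delta> j * M" using l\<psi> M(2)[OF v] len0 G.hnorm_nonneg[of v] by (intro mult_mono[OF l\<psi>]) auto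
      finally have 1: "G.hnorm ((real l * \<psi>) *\<^sub>R v) \<le> 2 * cube_length \<Delta> j * M" .
      have "G.hnorm (- ?z \<cdot> (x \<cdot> ((real l * \<psi>) *\<^sub>R v))) \<le> QG * (G.hdist ?z x + G.hnorm ((real l * \<psi>) *\<^sub>R v))"
        using QG(2)[of "- ?z \<cdot> x"] by (simp add: G.mult_assoc)
      also have "\<dots> < QG * (co * cube_length \<Delta> j + 2 * cube_length \<Delta> j * M)"
        using x 1 QG(1) by (intro mult_strict_left_mono add_less_le_mono) (auto simp: G.hball_def)
      finally show "x \<cdot> ((real l * \<psi>) *\<^sub>R v) \<in> G.hball ?z (C4 * cube_length \<Delta> j)"
        by (simp add: G.hball_def C4_def algebra_simps)
    qed
    also have "emeasure lborel (G.hball (cube_centre \<Delta> j \<sigma>) (C4 * cube_length \<Delta> j)) \<le> ennreal (Dv * measure lebesgue (cube \<Delta> j \<sigma>))"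
    proof -
      have fin: "emeasure lebesgue (cube \<Delta> j \<sigma>) < \<infinity>"
      proof -
        have "emeasure lebesgue (cube \<Delta> j \<sigma>) \<le> emeasure lebesgue (G.hball (cube_centre \<Delta> j \<sigma>) (co * cube_length \<Delta> j))"
          using outer[OF \<sigma>] by (intro emeasure_mono) auto
        also have "\<dots> < \<infinity>" by (simp add: G.emeasure_hball)
        finally show ?thesis .
      qed
      have "ennreal (G.volume (ci * cube_length \<Delta> j)) = emeasure lebesgue (G.hball (cube_centre \<Delta> j \<sigma>) (ci * cube_length \<Delta> j))"
        by (simp add: G.emeasure_hball)
      also have "\<dots> \<le> emeasure lebesgue (cube \<Delta> j \<sigma>)" using inner[OF \<sigma>] cube_measurable[OF \<sigma>] by (intro emeasure_mono) auto
      finally have v: "G.volume (ci * cube_length \<Delta> j) \<le> measure lebesgue (cube \<Delta> j \<sigma>)"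
        using fin by (simp add: emeasure_eq_ennreal_measure)
      have "G.volume (C4 * cube_length \<Delta> j) \<le> Dv * G.volume (ci * cube_length \<Delta> j)"
        using Dv(2)[of "ci * cube_length \<Delta> j"] ci len0 by simp
      also have "\<dots> \<le> Dv * measure lebesgue (cube \<Delta> j \<sigma>)" using v Dv(1) by (intro mult_left_mono) auto
      finally show ?thesis by (simp add: G.emeasure_hball ennreal_leI)
    qed
    finally have Xsum: "(\<Sum>i<e 0 + Suc k'. X i) \<le> ennreal (A * real (card (grid_vectors n)) * (Dv * measure lebesgue (cube \<Delta> j \<sigma>)))"
      using A Dv(1) by (simp add: ennreal_mult mult_left_mono)
    define V where "V = (\<Sum>k\<le>m. \<Sum>\<omega>\<in>bad k. measure lebesgue (cube \<Delta> (j + int k) \<omega>))"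
    define B where "B = real (Suc k') * real q0 * (A * real (card (grid_vectors n)) * (Dv * measure lebesgue (cube \<Delta> j \<sigma>)))"
    have "ennreal (Y * V) = (\<Sum>k\<le>m. ennreal Y * ennreal (\<Sum>\<omega>\<in>bad k. measure lebesgue (cube \<Delta> (j + int k) \<omega>)))"
      using Y by (simp add: V_def sum_distrib_left sum_nonneg ennreal_mult'[symmetric] flip: sum_ennreal)
    also have "\<dots> \<le> (\<Sum>k\<le>m. \<Sum>i<Suc k'. X (e k + i))" using generation by (intro sum_mono) auto
    also have "\<dots> \<le> ennreal (real (Suc k') * real q0) * (\<Sum>i<e 0 + Suc k'. X i)" by (rule e_count)
    also have "\<dots> \<le> ennreal (real (Suc k') * real q0) * ennreal (A * real (card (grid_vectors n)) * (Dv * measure lebesgue (cube \<Delta> j \<sigma>)))"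
      by (intro mult_left_mono Xsum) simp
    also have "\<dots> = ennreal B" unfolding B_def by (intro ennreal_mult[symmetric]) (use A Dv(1) in auto)
    finally have YV: "Y * V \<le> B" using A Dv(1) by (simp add: B_def)
    \<comment> \<open>all losses are powers of \<open>1 / d\<close>\<close>
    have 1: "d ^ q * real (Suc k') \<le> 2"
    proof -
      have "real (Suc k') \<le> 2 ^ k'" using less_exp[of k'] by (metis Suc_leI of_nat_le_iff of_nat_numeral of_nat_power)
      then have "d ^ q * real (Suc k') \<le> d ^ q * 2 ^ k'" using dq by (intro mult_left_mono) auto
      then show ?thesis using k'(2) by (simp add: mult.commute)
    qed
    have 2: "d ^ (a + 1) * real (card (grid_vectors n)) \<le> 3 * cb"
    proof -
      have n1: "1 \<le> n" using n(1) by (cases n) auto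
      have "real (card (grid_vectors n)) \<le> real ((2 * n + 1) * card G.hbasis)" using card_grid_vectors by (simp only: of_nat_le_iff)
      also have "\<dots> \<le> (3 * real n) * cb" unfolding cb_def of_nat_mult using n1 by (intro mult_right_mono) auto
      finally have "d ^ (a + 1) * real (card (grid_vectors n)) \<le> d ^ (a + 1) * ((3 * real n) * cb)" using d by (intro mult_left_mono) auto
      also have "\<dots> = (real n * d ^ (a + 1)) * (3 * cb)" by (simp add: mult_ac)
      also have "\<dots> \<le> 1 * (3 * cb)" using n(2) cb0 by (intro mult_right_mono) auto
      finally show ?thesis by simp
    qed
    have "(d ^ q * real (Suc k')) * (d ^ (a + 1) * real (card (grid_vectors n))) \<le> 2 * (3 * cb)"
      using d by (intro mult_mono[OF 1 2]) auto
    then have "((d ^ q * real (Suc k')) * (d ^ (a + 1) * real (card (grid_vectors n)))) * (real q0 * A * (Dv * measure lebesgue (cube \<Delta> j \<sigma>)))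
        \<le> (2 * (3 * cb)) * (real q0 * A * (Dv * measure lebesgue (cube \<Delta> j \<sigma>)))"
      using A Dv(1) by (intro mult_right_mono) auto
    then have dB: "d ^ q * d ^ (a + 1) * B \<le> A1 * measure lebesgue (cube \<Delta> j \<sigma>)" by (simp only: B_def A1_def mult_ac)
    have V0: "0 \<le> V" by (simp add: V_def sum_nonneg)
    have "d ^ ((2 * q + 1) * np) \<le> \<theta> powr p"
    proof -
      have "d ^ ((2 * q + 1) * np) = \<theta> ^ np" by (simp only: \<theta>_def power_mult)
      also have "\<dots> = \<theta> powr real np" using \<theta>(1) by (simp add: powr_realpow)
      also have "\<dots> \<le> \<theta> powr p" using np \<theta> dq by (intro powr_mono') auto
      finally show ?thesis .
    qed
    then have "d ^ ((2 * q + 1) * np) * (d ^ b) ^ qv \<le> Y" unfolding Y_def using d by (intro mult_right_mono) auto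
    then have "d ^ q * d ^ (a + 1) * (d ^ ((2 * q + 1) * np) * (d ^ b) ^ qv * V) \<le> d ^ q * d ^ (a + 1) * (Y * V)"
      using V0 d by (intro mult_left_mono mult_right_mono) auto
    also have "\<dots> \<le> d ^ q * d ^ (a + 1) * B" using YV d by (intro mult_left_mono) auto
    finally have "d ^ ex * V \<le> A1 * measure lebesgue (cube \<Delta> j \<sigma>)"
      using dB by (simp add: ex_def power_add mult_ac flip: power_mult)
    then have "V \<le> A1 * (1 / d ^ ex) * measure lebesgue (cube \<Delta> j \<sigma>)" using d by (simp add: field_simps)
    also have "\<dots> \<le> exp (\<epsilon> powr (- \<alpha>)) * measure lebesgue (cube \<Delta> j \<sigma>)"
      using \<alpha>1(2)[OF _ \<epsilon>, of \<alpha>] by (intro mult_right_mono) (simp_all add: \<alpha>_def mult.assoc inv_d)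
    finally show ?thesis by (simp only: V_def)
  qed
  moreover have "0 < \<alpha>" using \<alpha>1(1) by (simp add: \<alpha>_def)
  ultimately show ?thesis using \<zeta> q
    by (intro exI[of _ \<alpha>] exI[of _ "real q"] exI[of _ \<zeta>] conjI ballI allI impI) auto
qed

lemma deviation_le:
  assumes \<eta>: "0 < \<eta>" and T: "T \<in> lipschitz_homs G H N"
    and near: "\<And>x. x \<in> cube_ball G \<Delta> \<eta> k \<omega> \<Longrightarrow> N (- h x \<star> (g \<star> T x)) \<le> s * (\<eta> * inner_const \<Delta> * cube_length \<Delta> k)"
  shows "carnot_deviation G H N \<Delta> h k \<omega> \<eta> \<le> ereal s"
proof -
  define a where "a = \<eta> * inner_const \<Delta> * cube_length \<Delta> k"
  have a: "0 < a" using \<eta> inner_const_pos cube_length_pos by (simp add: a_def)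
  have "(INF (T, g) \<in> lipschitz_homs G H N \<times> carrier H.
      SUP x \<in> cube_ball G \<Delta> \<eta> k \<omega>. ereal (hom_dist H N (h x) (g \<star> T x))) \<le> ereal (s * a)"
    using T near by (intro INF_lower2[of "(T, g)"]) (auto intro!: SUP_least simp: H.carrier_UNIV H.hom_dist_eq a_def)
  then have "carnot_deviation G H N \<Delta> h k \<omega> \<eta> \<le> ereal (1 / a) * ereal (s * a)"
    unfolding carnot_deviation_def a_def[symmetric] using a by (intro ereal_mult_left_mono) auto
  also have "\<dots> = ereal s" using a by simp
  finally show ?thesis .
qed

text \<open>The distance is unbounded, so the supremum that defines the constant is over a nonempty set and is not negative.\<close>

lemma lipschitz_constant:
  assumes h: "lipschitz_large_dist G H N \<psi> h" and \<psi>: "0 \<le> \<psi>"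
  obtains L where "0 \<le> L" "lip_at G H N h \<psi> = ereal L"
    "\<And>x y. N (- h x \<star> h y) \<le> L * max (cc_dist G x y) \<psi>"
proof -
  obtain c C where c: "c > 0" "C > 0" "\<And>x y. c * G.hdist x y \<le> cc_dist G x y \<and> cc_dist G x y \<le> C * G.hdist x y"
    using G.cc_dist_comparable by blast
  have ratio: "ereal (N (- h x \<star> h y) / cc_dist G x y) \<le> lip_at G H N h \<psi>" if "\<psi> < cc_dist G x y" for x y
    unfolding lip_at_def using that by (intro SUP_upper2[of "(x, y)"]) (auto simp: H.hom_dist_eq)
  have "\<exists>v \<in> layer G (step G). v \<noteq> 0"
    using G.layer_top subspace_0[OF G.layer_subspace, of "step G"] by blast
  then obtain v where "v \<noteq> (0 :: 'a)" by blast
  define w where "w = c * G.hnorm v"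
  have w: "0 < w" unfolding w_def using \<open>v \<noteq> 0\<close> c(1) G.hnorm_nonneg[of v] G.hnorm_eq_zero[of v] by (simp add: less_le)
  define u where "u = (\<psi> + 1) / w"
  have u: "0 \<le> u" using w \<psi> by (simp add: u_def)
  have "\<psi> < u * w" using w by (simp add: u_def)
  also have "\<dots> = c * G.hnorm (- 0 \<cdot> dilation G u v)" using u by (simp add: w_def G.hnorm_dilation)
  also have "\<dots> \<le> cc_dist G 0 (dilation G u v)" using c(3) by blast
  finally have far: "\<psi> < cc_dist G 0 (dilation G u v)" .
  have "0 \<le> ereal (N (- h 0 \<star> h (dilation G u v)) / cc_dist G 0 (dilation G u v))"
    using far \<psi> H.N_nonneg by simp
  also have "\<dots> \<le> lip_at G H N h \<psi>" by (rule ratio[OF far])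
  finally have "0 \<le> lip_at G H N h \<psi>" .
  moreover have "lip_at G H N h \<psi> < \<infinity>" using h by (simp add: lipschitz_large_dist_def)
  ultimately obtain L where L: "lip_at G H N h \<psi> = ereal L" "0 \<le> L" by (cases "lip_at G H N h \<psi>") auto
  have "N (- h x \<star> h y) \<le> L * max (cc_dist G x y) \<psi>" for x y
  proof (cases "\<psi> < cc_dist G x y")
    case True
    then show ?thesis using ratio[OF True] L \<psi> by (simp add: divide_le_eq)
  next
    case False
    then have "ereal (N (- h x \<star> h y)) \<le> (SUP (x, y) \<in> {(x, y). cc_dist G x y \<le> \<psi>}. ereal (hom_dist H N (h x) (h y)))"
      by (intro SUP_upper2[of "(x, y)"]) (auto simp: H.hom_dist_eq)
    also have "\<dots> \<le> lip_at G H N h \<psi> * ereal \<psi>" using h by (simp add: lipschitz_large_dist_def)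
    also have "\<dots> = ereal (L * \<psi>)" by (simp add: L(1))
    finally show ?thesis using False by (simp add: max_absorb2)
  qed
  with L show ?thesis using that by blast
qed

text \<open>Dilating the target by \<open>1 / L\<close> reduces to the Lipschitz constant one.  The scale \<open>\<psi>\<close> is enlarged to the largest value that
  the hypothesis on the length of \<open>S\<close> permits, so that it is positive even if the given one is zero.\<close>

theorem sum_of_deviating_subcubes:
  "\<exists>\<alpha> > 0. \<exists>\<beta> > 0. \<exists>\<zeta> > 0.
    \<forall>\<epsilon> \<in> {0<..<1/2}. \<forall>m :: nat. \<forall>\<psi> \<ge> 0. \<forall>h :: 'a \<Rightarrow> 'b. \<forall>j. \<forall>\<sigma> \<in> cube_index \<Delta> j.
      lipschitz_large_dist G H N \<psi> h \<longrightarrow>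
      cube_length \<Delta> j \<ge> exp (\<epsilon> powr (- \<alpha>)) * cube_ratio \<Delta> powi (- int m) * \<psi> \<longrightarrow>
      (\<Sum>k = 0..m. \<Sum>\<omega> | \<omega> \<in> subcubes \<Delta> j \<sigma> k \<and>
          carnot_deviation G H N \<Delta> h (j + int k) \<omega> (\<zeta> * \<epsilon> powr \<beta>) > ereal \<epsilon> * lip_at G H N h \<psi>.
        measure lebesgue (cube \<Delta> (j + int k) \<omega>))
      \<le> exp (\<epsilon> powr (- \<alpha>)) * measure lebesgue (cube \<Delta> j \<sigma>)"
proof -
  obtain c C where c: "c > 0" "C > 0" "\<And>x y. c * G.hdist x y \<le> cc_dist G x y \<and> cc_dist G x y \<le> C * G.hdist x y"
    using G.cc_dist_comparable by blast
  define C1 where "C1 = max C 1"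
  have C1: "0 \<le> C1" "1 \<le> C1" "C \<le> C1" by (auto simp: C1_def)
  obtain \<alpha> \<beta> \<zeta> where pos: "\<alpha> > 0" "\<beta> > 0" "\<zeta> > 0" and main: "\<forall>\<epsilon>\<in>{0<..<1/2}. \<forall>m h j. \<forall>\<sigma>\<in>cube_index \<Delta> j. \<forall>\<psi> bad.
     \<psi> = exp (- (\<epsilon> powr (- \<alpha>))) * (cube_ratio \<Delta> ^ m * cube_length \<Delta> j) \<longrightarrow>
     (\<forall>x y. N (- h x \<star> h y) \<le> C1 * max (G.hdist x y) \<psi>) \<longrightarrow>
     (\<forall>k\<le>m. finite (bad k) \<and> bad k \<subseteq> subcubes \<Delta> j \<sigma> k \<and>
        (\<forall>\<omega>\<in>bad k. \<forall>T\<in>lipschitz_homs G H N. \<forall>g. \<exists>x\<in>cube_ball G \<Delta> (\<zeta> * \<epsilon> powr \<beta>) (j + int k) \<omega>.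
           \<epsilon> * (\<zeta> * \<epsilon> powr \<beta> * inner_const \<Delta> * cube_length \<Delta> (j + int k)) < N (- h x \<star> (g \<star> T x)))) \<longrightarrow>
     (\<Sum>k\<le>m. \<Sum>\<omega>\<in>bad k. measure lebesgue (cube \<Delta> (j + int k) \<omega>))
       \<le> exp (\<epsilon> powr (- \<alpha>)) * measure lebesgue (cube \<Delta> j \<sigma>)"
    using sum_of_deviating_cubes[OF C1(1)] by (elim exE conjE) (rule that)
  have "(\<Sum>k = 0..m. \<Sum>\<omega> | \<omega> \<in> subcubes \<Delta> j \<sigma> k \<and>
          carnot_deviation G H N \<Delta> h (j + int k) \<omega> (\<zeta> * \<epsilon> powr \<beta>) > ereal \<epsilon> * lip_at G H N h \<psi>.
        measure lebesgue (cube \<Delta> (j + int k) \<omega>))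
      \<le> exp (\<epsilon> powr (- \<alpha>)) * measure lebesgue (cube \<Delta> j \<sigma>)"
    if \<epsilon>: "\<epsilon> \<in> {0<..<1/2}" and \<psi>: "0 \<le> \<psi>" and \<sigma>: "\<sigma> \<in> cube_index \<Delta> j"
      and h: "lipschitz_large_dist G H N \<psi> h"
      and large: "cube_length \<Delta> j \<ge> exp (\<epsilon> powr (- \<alpha>)) * cube_ratio \<Delta> powi (- int m) * \<psi>" for \<epsilon> m \<psi> h j \<sigma>
  proof -
    obtain L where L: "0 \<le> L" "lip_at G H N h \<psi> = ereal L" and lip: "\<And>x y. N (- h x \<star> h y) \<le> L * max (cc_dist G x y) \<psi>"
      using lipschitz_constant[OF h \<psi>] by blast
    define \<eta> where "\<eta> = \<zeta> * \<epsilon> powr \<beta>"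
    have \<eta>: "0 < \<eta>" using pos \<epsilon> by (simp add: \<eta>_def)
    define A where "A k = {\<omega>. \<omega> \<in> subcubes \<Delta> j \<sigma> k \<and> carnot_deviation G H N \<Delta> h (j + int k) \<omega> \<eta> > ereal (\<epsilon> * L)}" for k
    have "(\<Sum>k\<le>m. \<Sum>\<omega>\<in>A k. measure lebesgue (cube \<Delta> (j + int k) \<omega>))
      \<le> exp (\<epsilon> powr (- \<alpha>)) * measure lebesgue (cube \<Delta> j \<sigma>)"
    proof (cases "L = 0")
      case True
      \<comment> \<open>the map is constant\<close>
      have "(\<lambda>x. 0) \<in> lipschitz_homs G H N"
        unfolding lipschitz_homs_def by (auto intro!: homI exI[of _ 0] simp: H.carrier_UNIV H.hom_dist_eq)
      then have "carnot_deviation G H N \<Delta> h (j + int k) \<omega> \<eta> \<le> ereal 0" for k \<omega>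
        using lip[of _ 0] True by (intro deviation_le[OF \<eta>, where g = "h 0"]) auto
      then have "A k = {}" for k using True by (auto simp: A_def not_less)
      then show ?thesis by simp
    next
      case False
      then have L0: "0 < L" using L by simp
      define h' where "h' x = dilation H (1 / L) (h x)" for x
      define \<psi>' where "\<psi>' = exp (- (\<epsilon> powr (- \<alpha>))) * (cube_ratio \<Delta> ^ m * cube_length \<Delta> j)"
      have "\<psi> \<le> \<psi>'"
        using large cube_ratio by (simp add: \<psi>'_def exp_minus power_int_minus field_simps)
      have lip': "N (- h' x \<star> h' y) \<le> C1 * max (G.hdist x y) \<psi>'" for x y
      proof -
        have "- h' x \<star> h' y = dilation H (1 / L) (- h x \<star> h y)"
          by (simp add: h'_def H.dilation_mult H.dilation_neg)
        then have "N (- h' x \<star> h' y) \<le> max (cc_dist G x y) \<psi>"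
          using lip[of x y] L0 by (simp add: H.N_dilation field_simps)
        also have "\<dots> \<le> C1 * max (G.hdist x y) \<psi>'"
        proof (rule max.boundedI)
          have "cc_dist G x y \<le> C * G.hdist x y" using c(3) by blast
          also have "\<dots> \<le> C1 * max (G.hdist x y) \<psi>'" using C1 G.hnorm_nonneg by (intro mult_mono) auto
          finally show "cc_dist G x y \<le> C1 * max (G.hdist x y) \<psi>'" .
          have "1 * \<psi> \<le> C1 * max (G.hdist x y) \<psi>'" using C1 \<open>\<psi> \<le> \<psi>'\<close> \<psi> by (intro mult_mono) auto
          then show "\<psi> \<le> C1 * max (G.hdist x y) \<psi>'" by simp
        qed
        finally show ?thesis .
      qed
      \<comment> \<open>a sum over an infinite family is zero by convention\<close>
      define bad where "bad k = (if finite (A k) then A k else {})" for k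
      have far: "\<exists>x\<in>cube_ball G \<Delta> \<eta> (j + int k) \<omega>. \<epsilon> * (\<eta> * inner_const \<Delta> * cube_length \<Delta> (j + int k)) < N (- h' x \<star> (g \<star> T x))"
        if \<omega>: "\<omega> \<in> bad k" and T: "T \<in> lipschitz_homs G H N" for k \<omega> T g
      proof (rule ccontr)
        assume "\<not> ?thesis"
        then have near: "N (- h' x \<star> (g \<star> T x)) \<le> \<epsilon> * (\<eta> * inner_const \<Delta> * cube_length \<Delta> (j + int k))"
          if "x \<in> cube_ball G \<Delta> \<eta> (j + int k) \<omega>" for x using that by force
        have "carnot_deviation G H N \<Delta> h (j + int k) \<omega> \<eta> \<le> ereal (\<epsilon> * L)"
        proof (rule deviation_le[OF \<eta>, where g = "dilation H L g"])
          show "(\<lambda>x. dilation H L (T x)) \<in> lipschitz_homs G H N"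
            using rescaled_hom[OF T, of L 1] L by simp
          fix x assume x: "x \<in> cube_ball G \<Delta> \<eta> (j + int k) \<omega>"
          have "h x = dilation H L (h' x)" using L0 by (simp add: h'_def H.dilation_dilation)
          then have "- h x \<star> (dilation H L g \<star> dilation H L (T x)) = dilation H L (- h' x \<star> (g \<star> T x))"
            by (simp only: H.dilation_mult H.dilation_neg)
          then show "N (- h x \<star> (dilation H L g \<star> dilation H L (T x))) \<le> \<epsilon> * L * (\<eta> * inner_const \<Delta> * cube_length \<Delta> (j + int k))"
            using mult_left_mono[OF near[OF x] L(1)] L by (simp add: H.N_dilation mult_ac)
        qed
        then show False using \<omega> by (auto simp: bad_def A_def split: if_splits)
      qed
      have eq: "sum g (A k) = sum g (bad k)" for k and g :: "'i \<Rightarrow> real"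
        by (cases "finite (A k)") (simp_all add: bad_def)
      have "(\<Sum>k\<le>m. \<Sum>\<omega>\<in>A k. measure lebesgue (cube \<Delta> (j + int k) \<omega>)) = (\<Sum>k\<le>m. \<Sum>\<omega>\<in>bad k. measure lebesgue (cube \<Delta> (j + int k) \<omega>))"
        by (simp only: eq)
      also have "\<dots> \<le> exp (\<epsilon> powr (- \<alpha>)) * measure lebesgue (cube \<Delta> j \<sigma>)"
      proof (rule main[rule_format, OF \<epsilon> \<sigma> \<psi>'_def])
        show "N (- h' x \<star> h' y) \<le> C1 * max (G.hdist x y) \<psi>'" for x y by (rule lip')
        show "finite (bad k) \<and> bad k \<subseteq> subcubes \<Delta> j \<sigma> k \<and>
          (\<forall>\<omega>\<in>bad k. \<forall>T\<in>lipschitz_homs G H N. \<forall>g. \<exists>x\<in>cube_ball G \<Delta> (\<zeta> * \<epsilon> powr \<beta>) (j + int k) \<omega>.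
           \<epsilon> * (\<zeta> * \<epsilon> powr \<beta> * inner_const \<Delta> * cube_length \<Delta> (j + int k)) < N (- h' x \<star> (g \<star> T x)))" for k
          unfolding \<eta>_def[symmetric]
        proof (intro conjI ballI allI far)
          show "finite (bad k)" by (simp add: bad_def)
          show "bad k \<subseteq> subcubes \<Delta> j \<sigma> k" by (auto simp: bad_def A_def)
        qed
      qed
      finally show ?thesis .
    qed
    then show ?thesis by (simp add: A_def L(2) \<eta>_def atLeast0AtMost)
  qed
  then show ?thesis using pos
    by (intro exI[of _ \<alpha>] exI[of _ \<beta>] exI[of _ \<zeta>] conjI ballI allI impI)
qed

end

theorem theorem6p1:
  fixes G :: "'a::euclidean_space carnot" and H :: "'b::euclidean_space carnot"
    and \<Delta> :: "('a, 'i) cube_system" and N :: "'b \<Rightarrow> real" and K p :: real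
  assumes "carnot_group G" and "christ_cubes G \<Delta>"
    and "carnot_group H" and "homogeneous_norm H N"
    and "\<And>x y. norm (component H 1 x - component H 1 y) \<le> hom_dist H N x y"
    and "K > 0" and "p > 1"
    and "\<And>x y z.
      (hom_dist H N x y powr p + hom_dist H N y z powr p) / 2
        \<ge> (hom_dist H N x z / 2) powr p
          + 1 / K * (norm ((1 / 2) *\<^sub>R (component H 1 x + component H 1 z) - component H 1 y) powr p
              + nonhorizontality H N (inv\<^bsub>H\<^esub> x \<otimes>\<^bsub>H\<^esub> z) powr p)"
  shows "\<exists>\<alpha> > 0. \<exists>\<beta> > 0. \<exists>\<zeta> > 0.
    \<forall>\<epsilon> \<in> {0<..<1/2}. \<forall>m :: nat. \<forall>\<psi> \<ge> 0. \<forall>h :: 'a \<Rightarrow> 'b. \<forall>j. \<forall>\<sigma> \<in> cube_index \<Delta> j.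
      lipschitz_large_dist G H N \<psi> h \<longrightarrow>
      cube_length \<Delta> j \<ge> exp (\<epsilon> powr (- \<alpha>)) * cube_ratio \<Delta> powi (- int m) * \<psi> \<longrightarrow>
      (\<Sum>k = 0..m. \<Sum>\<omega> | \<omega> \<in> subcubes \<Delta> j \<sigma> k \<and>
          carnot_deviation G H N \<Delta> h (j + int k) \<omega> (\<zeta> * \<epsilon> powr \<beta>) > ereal \<epsilon> * lip_at G H N h \<psi>.
        measure lebesgue (cube \<Delta> (j + int k) \<omega>))
      \<le> exp (\<epsilon> powr (- \<alpha>)) * measure lebesgue (cube \<Delta> j \<sigma>)"
proof -
  interpret H: normed_carnot_group H N
    using assms(3,4) by (intro normed_carnot_group.intro normed_carnot_group_axioms.intro)
  have "cube_setting G H N K p \<Delta>"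
  proof (intro cube_setting.intro convex_target.intro carnot_target.intro carnot_pair.intro carnot_cubes.intro
      convex_target_axioms.intro carnot_target_axioms.intro)
    show "norm (component H 1 x - component H 1 y) \<le> N (- x \<otimes>\<^bsub>H\<^esub> y)" for x y
      using assms(5)[of x y] by (simp only: H.hom_dist_eq)
    show "(N (- x \<otimes>\<^bsub>H\<^esub> y) powr p + N (- y \<otimes>\<^bsub>H\<^esub> z) powr p) / 2
        \<ge> (N (- x \<otimes>\<^bsub>H\<^esub> z) / 2) powr p
          + 1 / K * (norm ((1 / 2) *\<^sub>R (component H 1 x + component H 1 z) - component H 1 y) powr p
              + nonhorizontality H N (- x \<otimes>\<^bsub>H\<^esub> z) powr p)" for x y z
      using assms(8)[where x = x and y = y and z = z] by (simp only: H.hom_dist_eq H.inv_eq_neg)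
  qed (rule assms H.normed_carnot_group_axioms)+
  then show ?thesis by (rule cube_setting.sum_of_deviating_subcubes)
qed

end
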